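(* Let $K$ be a commutative ring with unit, let $A$ be a commutative unital $K$-algebra of zero characteristic containing $K$ as a subring, and let $\mathfrak{D}$ be a differentially closed smooth subcategory of the category of $A$-modules. Then for all sequences of positive integers $\tau,\sigma\in\mathbf{N}_+^\infty$ with $\tau\ge\sigma$ (i.e. $\tau_i\ge\sigma_i$ for all $i\ge 1$), the canonical epimorphism of higher de Rham complexes $$\mathbf{dR}_\tau^{\mathfrak{D}}\longrightarrow\mathbf{dR}_\sigma^{\mathfrak{D}}$$ is a quasi-isomorphism; so $H^n_\sigma\simeq H^n_\tau$ for all $n\ge 0$, where $H^n_\sigma$ denotes the $n$-th cohomology $K$-module of $\mathbf{dR}_\sigma^{\mathfrak{D}}$.
   Context: **Differential operators.** For $A$-modules $P,Q$, $a\in A$ and $\Phi\in Hom_K(P,Q)$ put $(\delta_a\Phi)(p)=\Phi(ap)-a\Phi(p)$. A differential operator (DO) of order $\le k$ is $\Delta\in Hom_K(P,Q)$ with $\delta_{a_0}\circ\cdots\circ\delta_{a_k}(\Delta)=0$ for all $a_0,\dots,a_k\in A$. $\mathrm{Diff}_k(P,Q)$ is the set of these with $A$-module structure $(a\Delta)(p)=a\Delta(p)$; $\mathrm{Diff}_k^+(P,Q)$ is the same set with $(a^+\Delta)(p)=\Delta(ap)$. Put $\mathrm{Diff}_kQ=\mathrm{Diff}_k(A,Q)$, $\mathrm{Diff}^+_kQ=\mathrm{Diff}^+_k(A,Q)$. For a finite sequence $\sigma=(\sigma_1,\dots,\sigma_n)$ of positive integers, $\mathrm{Diff}^+_{\sigma}Q=\mathrm{Diff}^+_{\sigma_1}(\cdots(\mathrm{Diff}^+_{\sigma_n}Q)\cdots)$,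 and $\mathrm{Diff}^+_\emptyset Q=Q$. **Functors $\mathrm{D}_\sigma$, $\mathcal{P}_\sigma$.** $\mathrm{D}_\emptyset(Q)=Q$; for $n\ge1$, $\mathrm{D}_{(\sigma_1,\dots,\sigma_n)}(Q)$ is the set of $\Delta\in\mathrm{Diff}_{\sigma_1}(A,\mathrm{Diff}^+_{(\sigma_2,\dots,\sigma_n)}Q)$ with $\Delta(1)=0$ and $\Delta(a)\in \mathrm{D}_{(\sigma_2,\dots,\sigma_n)}(Q)$ for all $a\in A$, with module structure $(a\Delta)(b)=a\cdot\Delta(b)$ (product in $\mathrm{D}_{(\sigma_2,\dots,\sigma_n)}(Q)$). For an $A$-module $P$, $\mathcal{P}^\bullet_{\sigma}[P](Q)$ is the set of $\Delta\in\mathrm{Diff}_{\sigma_1}(P,\mathrm{Diff}^+_{(\sigma_2,\dots,\sigma_n)}Q)$ with $\Delta(p)\in \mathrm{D}_{(\sigma_2,\dots,\sigma_n)}(Q)$ for all $p$, with $(a\Delta)(p)=a\cdot\Delta(p)$ (product in $\mathrm{D}_{(\sigma_2,\dots,\sigma_n)}(Q)$); $\mathcal{P}^+_\sigma[P](Q)$ is the same set with $(a^+\Delta)(p)=\Delta(ap)$. $\mathcal{P}^\bullet_\sigma=\mathcal{P}^\bullet_\sigma[A]$, $\mathcal{P}^+_\sigma=\mathcal{P}^+_\sigma[A]$. All are functors of $Q$ (apply homomorphisms to the final values). **Bimodule versions.** An $A$-bimodule $(Q,Q^+)$ is a $K$-module with two commuting $A$-module structures $Q$ (written $a$) and $Q^+$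 (written $a^+$); a biad $(Q,Q^+;S)$ is a bimodule with an $A$-submodule $S\subset Q$. $\mathrm{Diff}_k(P,S\subset Q^+)$ is the set of DOs $P\to Q^+$ of order $\le k$ with image in $S$; as $\mathrm{Diff}^\bullet_k(P,S\subset Q^+)$ it has structure $(a^\bullet\Delta)(p)=a\Delta(p)$ (product in $Q$), as $\mathrm{Diff}^+_k(P,S\subset Q^+)$ it has $(a^+\Delta)(p)=\Delta(ap)$; $\mathrm{D}_{(k)}(S\subset Q^+)=\{\Delta\in \mathrm{Diff}^\bullet_k(A,S\subset Q^+):\Delta(1)=0\}$. **Differentially closed, smooth.** A functor $T:\mathfrak{D}\to\mathfrak{D}$ on a full subcategory $\mathfrak{D}$ of $A$-modules is strictly representable in $\mathfrak{D}$ by $\tau\in Ob(\mathfrak{D})$ if $T\simeq Hom_A(\tau,\cdot)$ as functors $\mathfrak{D}\to\mathfrak{D}$. A full abelian subcategory $\mathfrak{D}$ of $A$-modules is differentially closed if: (a) all the functors above ($\mathrm{Diff}_k(P,\cdot)$, $\mathrm{Diff}^+_k(P,\cdot)$, $\mathrm{D}_\sigma$, $\mathcal{P}^\bullet_\sigma[P]$, $\mathcal{P}^+_\sigma[P]$, and their versions for bimodules and biads, including the cases $S=Q$), applied to modules, bimodules or biads all of whose components lie in $\mathfrak{D}$, have values (components) in $\mathfrak{D}$; (b) for all finite sequences $\sigma$ of positive integers of length $\geq 1$ and all $P\in Ob(\mathfrak{D})$, the functors $\mathrm{D}_\sigma$, $\mathcal{P}^\bullet_\sigma$, $\mathcal{P}^\bullet_\sigma[P]$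 restricted to $\mathfrak{D}$ are strictly representable in $\mathfrak{D}$; (c) $A\in Ob(\mathfrak{D})$; (d) $\mathfrak{D}$ is closed under $\otimes_A$; (e) $\mathfrak{D}$ is closed under $A$-submodules. Let $\mathbf{\Lambda}_{\mathfrak{D}}^\sigma$ denote the representing object of $\mathrm{D}_\sigma$ in $\mathfrak{D}$, with $\mathbf{\Lambda}^\emptyset_{\mathfrak{D}}=A$. $\mathfrak{D}$ is smooth if it is differentially closed and $\mathbf{\Lambda}^{(1)}_{\mathfrak{D}}$ is a projective $A$-module of finite type. **Higher de Rham complexes.** $\mathbf{N}_+^\infty$ is the set of infinite sequences of positive integers; $\sigma(n)=(\sigma_1,\dots,\sigma_n)$. For $\sigma\in\mathbf{N}_+^\infty$, $n\ge 0$, $k=\sigma_{n+1}$, one has natural maps $Hom_A(\mathbf{\Lambda}_{\mathfrak{D}}^{\sigma(n+1)},Q)\simeq \mathrm{D}_{\sigma(n+1)}(Q)\hookrightarrow \mathrm{D}_{\sigma(n)}(\mathrm{Diff}_k^+Q)\simeq Hom_A(\mathbf{\Lambda}^{\sigma(n)}_{\mathfrak{D}},\mathrm{Diff}^+_kQ)\simeq\mathrm{Diff}_k(\mathbf{\Lambda}^{\sigma(n)}_{\mathfrak{D}},Q)$, the last being $f\mapsto(\omega\mapsto f(\omega)(1))$ (for $n=0$, it is the inclusion $\mathrm{D}_{(k)}(Q)\subset\mathrm{Diff}_k(A,Q)$). The higher de Rham differential $d_{\sigma(n+1)}:\mathbf{\Lambda}_{\mathfrak{D}}^{\sigma(n)}\to\mathbf{\Lambda}_{\mathfrak{D}}^{\sigma(n+1)}$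 is the image of the identity for $Q=\mathbf{\Lambda}_{\mathfrak{D}}^{\sigma(n+1)}$. The complex $\mathbf{dR}^{\mathfrak{D}}_\sigma$ is $0\to A\to\mathbf{\Lambda}_{\mathfrak{D}}^{\sigma(1)}\to\mathbf{\Lambda}_{\mathfrak{D}}^{\sigma(2)}\to\cdots$ with these differentials ($A$ in degree $0$), a complex of $K$-modules. If $\tau\ge\sigma$, the inclusions $\mathrm{D}_{\sigma(n)}\hookrightarrow\mathrm{D}_{\tau(n)}$ induce epimorphisms $\mathbf{\Lambda}_{\mathfrak{D}}^{\tau(n)}\to\mathbf{\Lambda}_{\mathfrak{D}}^{\sigma(n)}$ commuting with the differentials; this is the canonical morphism $\mathbf{dR}^{\mathfrak{D}}_\tau\to\mathbf{dR}^{\mathfrak{D}}_\sigma$.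
   Formalization: "Zero characteristic" is taken to mean that A contains the rational numbers (every positive integer is invertible in A); with only Z contained in A the claim fails, e.g. for K = Z, A = Z[x], all modules, τ = (2,1,1,…), σ = (1,1,1,…). *)

theory Defs
  imports "HOL-Algebra.Module" "HOL-Algebra.Subrings" "HOL-Algebra.AbelCoset"
begin

text \<open>
  Conventions.  The ring \<open>A\<close> and its subring \<open>K\<close> are explicit arguments, \<open>K\<close> being given
  by its underlying set; every \<open>A\<close>-module is a \<open>K\<close>-module by restriction.  Maps
  between modules are extensional functions on the carrier, so that sets of maps are again carriers
  of modules.  The ring fields \<open>mult\<close> and \<open>one\<close> of module records play no role and are left
  unspecified.
\<close>


section \<open>Modules\<close>

text \<open>Maps linear over the set of scalars \<open>K\<close>: this is $Hom_K$, and $Hom_A$ for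
  \<open>K = carrier A\<close>.\<close>

definition lin_maps ::
  "'a set \<Rightarrow> ('a, 'p) module \<Rightarrow> ('a, 'q) module \<Rightarrow> ('p \<Rightarrow> 'q) set" where
  "lin_maps K P Q = {f \<in> carrier P \<rightarrow>\<^sub>E carrier Q.
     (\<forall>x\<in>carrier P. \<forall>y\<in>carrier P. f (x \<oplus>\<^bsub>P\<^esub> y) = f x \<oplus>\<^bsub>Q\<^esub> f y) \<and>
     (\<forall>c\<in>K. \<forall>x\<in>carrier P. f (c \<odot>\<^bsub>P\<^esub> x) = c \<odot>\<^bsub>Q\<^esub> f x)}"

definition mod_hom ::
  "('a, 'z) ring_scheme \<Rightarrow> ('a, 'p) module \<Rightarrow> ('a, 'q) module \<Rightarrow> ('p \<Rightarrow> 'q) set" where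
  "mod_hom R P Q = lin_maps (carrier R) P Q"

definition mod_iso ::
  "('a, 'z) ring_scheme \<Rightarrow> ('a, 'p) module \<Rightarrow> ('a, 'q) module \<Rightarrow> ('p \<Rightarrow> 'q) set" where
  "mod_iso R P Q = {f \<in> mod_hom R P Q. module R P \<and> module R Q \<and> bij_betw f (carrier P) (carrier Q)}"

definition isomorphic_modules ::
  "('a, 'z) ring_scheme \<Rightarrow> ('a, 'p) module \<Rightarrow> ('a, 'q) module \<Rightarrow> bool" where
  "isomorphic_modules R P Q \<longleftrightarrow> mod_iso R P Q \<noteq> {}"

definition regular_module :: "('a, 'z) ring_scheme \<Rightarrow> ('a, 'a) module" where
  "regular_module A = \<lparr>carrier = carrier A, mult = mult A, one = one A, zero = zero A, add = add A,
     smult = mult A\<rparr>"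

definition scalars :: "'a set \<Rightarrow> ('a, 'z) ring_scheme \<Rightarrow> ('a, 'z) ring_scheme" where
  "scalars K A = A\<lparr>carrier := K\<rparr>"

text \<open>A set \<open>S\<close> of maps \<open>P \<rightarrow> Q\<close> with pointwise addition and a given action of scalars.\<close>

definition map_module ::
  "('a, 'p) module \<Rightarrow> ('a, 'q) module \<Rightarrow> ('p \<Rightarrow> 'q) set \<Rightarrow> ('a \<Rightarrow> ('p \<Rightarrow> 'q) \<Rightarrow> ('p \<Rightarrow> 'q))
     \<Rightarrow> ('a, 'p \<Rightarrow> 'q) module" where
  "map_module P Q S act = \<lparr>carrier = S, mult = undefined, one = undefined,
     zero = (\<lambda>p\<in>carrier P. \<zero>\<^bsub>Q\<^esub>),
     add = (\<lambda>f g. \<lambda>p\<in>carrier P. f p \<oplus>\<^bsub>Q\<^esub> g p),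
     smult = act\<rparr>"

definition Hom ::
  "('a, 'z) ring_scheme \<Rightarrow> ('a, 'p) module \<Rightarrow> ('a, 'q) module \<Rightarrow> ('a, 'p \<Rightarrow> 'q) module" where
  "Hom A P Q = map_module P Q (mod_hom A P Q) (\<lambda>a f. \<lambda>p\<in>carrier P. a \<odot>\<^bsub>Q\<^esub> f p)"

text \<open>Transport of a module structure along an injection \<open>h\<close> with left inverse \<open>g\<close>.\<close>

definition transport_module ::
  "('p \<Rightarrow> 'q) \<Rightarrow> ('q \<Rightarrow> 'p) \<Rightarrow> ('a, 'p) module \<Rightarrow> ('a, 'q) module" where
  "transport_module h g M = \<lparr>carrier = h ` carrier M, mult = undefined, one = undefined,
     zero = h \<zero>\<^bsub>M\<^esub>, add = (\<lambda>x y. h (g x \<oplus>\<^bsub>M\<^esub> g y)), smult = (\<lambda>a x. h (a \<odot>\<^bsub>M\<^esub> g x))\<rparr>"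

definition quot_module :: "('a, 'm) module \<Rightarrow> 'm set \<Rightarrow> ('a, 'm set) module" where
  "quot_module M S = \<lparr>carrier = a_rcosets\<^bsub>M\<^esub> S, mult = undefined, one = undefined,
     zero = S, add = set_add M, smult = (\<lambda>a X. \<Union>x\<in>X. S +>\<^bsub>M\<^esub> (a \<odot>\<^bsub>M\<^esub> x))\<rparr>"

definition direct_sum :: "('a, 'm) module \<Rightarrow> ('a, 'n) module \<Rightarrow> ('a, 'm \<times> 'n) module" where
  "direct_sum M N = \<lparr>carrier = carrier M \<times> carrier N, mult = undefined, one = undefined,
     zero = (\<zero>\<^bsub>M\<^esub>, \<zero>\<^bsub>N\<^esub>),
     add = (\<lambda>(x, y) (x', y'). (x \<oplus>\<^bsub>M\<^esub> x', y \<oplus>\<^bsub>N\<^esub> y')),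
     smult = (\<lambda>a (x, y). (a \<odot>\<^bsub>M\<^esub> x, a \<odot>\<^bsub>N\<^esub> y))\<rparr>"

definition hom_kernel :: "('a, 'm) module \<Rightarrow> ('a, 'n) module \<Rightarrow> ('m \<Rightarrow> 'n) \<Rightarrow> 'm set" where
  "hom_kernel M N f = {x \<in> carrier M. f x = \<zero>\<^bsub>N\<^esub>}"

definition span_module :: "('a, 'z) ring_scheme \<Rightarrow> ('a, 'm) module \<Rightarrow> 'm set \<Rightarrow> 'm set" where
  "span_module A M B = \<Inter> {S. submodule S A M \<and> B \<subseteq> S}"

definition finite_type :: "('a, 'z) ring_scheme \<Rightarrow> ('a, 'm) module \<Rightarrow> bool" where
  "finite_type A M \<longleftrightarrow> module A M \<and> (\<exists>B. finite B \<and> B \<subseteq> carrier M \<and> span_module A M B = carrier M)"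

text \<open>The lifting property.  A definition can only quantify over test modules of fixed types; these
  are large enough to include the surjection onto \<open>P\<close> from the free module on the carrier
  of \<open>P\<close>, hence the property implies lifting along all surjections.\<close>

definition projective_module :: "('a, 'z) ring_scheme \<Rightarrow> ('a, 'p) module \<Rightarrow> bool" where
  "projective_module A P \<longleftrightarrow> module A P \<and>
     (\<forall>(M :: ('a, 'p \<Rightarrow> 'a) module) (N :: ('a, 'p) module). \<forall>g \<in> mod_hom A M N. \<forall>f \<in> mod_hom A P N.
        module A M \<longrightarrow> module A N \<longrightarrow> g ` carrier M = carrier N \<longrightarrow>
        (\<exists>h \<in> mod_hom A P M. \<forall>x\<in>carrier P. g (h x) = f x))"

definition free_module :: "('a, 'z) ring_scheme \<Rightarrow> 'x set \<Rightarrow> ('a, 'x \<Rightarrow> 'a) module" where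
  "free_module A X = \<lparr>carrier = {f \<in> X \<rightarrow>\<^sub>E carrier A. finite {x \<in> X. f x \<noteq> \<zero>\<^bsub>A\<^esub>}},
     mult = undefined, one = undefined,
     zero = (\<lambda>x\<in>X. \<zero>\<^bsub>A\<^esub>),
     add = (\<lambda>f g. \<lambda>x\<in>X. f x \<oplus>\<^bsub>A\<^esub> g x),
     smult = (\<lambda>a f. \<lambda>x\<in>X. a \<otimes>\<^bsub>A\<^esub> f x)\<rparr>"

definition free_gen :: "('a, 'z) ring_scheme \<Rightarrow> 'x set \<Rightarrow> 'x \<Rightarrow> 'x \<Rightarrow> 'a" where
  "free_gen A X x = (\<lambda>y\<in>X. if y = x then \<one>\<^bsub>A\<^esub> else \<zero>\<^bsub>A\<^esub>)"

definition tensor_relations ::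
  "('a, 'z) ring_scheme \<Rightarrow> ('a, 'm) module \<Rightarrow> ('a, 'n) module \<Rightarrow> ('m \<times> 'n \<Rightarrow> 'a) set" where
  "tensor_relations A M N =
    (let X = carrier M \<times> carrier N; F = free_module A X; e = free_gen A X in
      {e (m \<oplus>\<^bsub>M\<^esub> m', n) \<ominus>\<^bsub>F\<^esub> (e (m, n) \<oplus>\<^bsub>F\<^esub> e (m', n)) | m m' n.
         m \<in> carrier M \<and> m' \<in> carrier M \<and> n \<in> carrier N} \<union>
      {e (m, n \<oplus>\<^bsub>N\<^esub> n') \<ominus>\<^bsub>F\<^esub> (e (m, n) \<oplus>\<^bsub>F\<^esub> e (m, n')) | m n n'.
         m \<in> carrier M \<and> n \<in> carrier N \<and> n' \<in> carrier N} \<union>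
      {e (a \<odot>\<^bsub>M\<^esub> m, n) \<ominus>\<^bsub>F\<^esub> a \<odot>\<^bsub>F\<^esub> e (m, n) | a m n.
         a \<in> carrier A \<and> m \<in> carrier M \<and> n \<in> carrier N} \<union>
      {e (m, a \<odot>\<^bsub>N\<^esub> n) \<ominus>\<^bsub>F\<^esub> a \<odot>\<^bsub>F\<^esub> e (m, n) | a m n.
         a \<in> carrier A \<and> m \<in> carrier M \<and> n \<in> carrier N})"

definition tensor_module ::
  "('a, 'z) ring_scheme \<Rightarrow> ('a, 'm) module \<Rightarrow> ('a, 'n) module
     \<Rightarrow> ('a, ('m \<times> 'n \<Rightarrow> 'a) set) module" where
  "tensor_module A M N =
    (let F = free_module A (carrier M \<times> carrier N)
     in quot_module F (span_module A F (tensor_relations A M N)))"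

text \<open>``Zero characteristic'' means that \<open>A\<close> contains the rational numbers.  Injectivity of
  the map from the integers alone is not enough for quasi-isomorphisms: for the
  polynomial ring in one variable over the integers, the canonical morphism from the complex of
  $(2,1,1,\dots)$ to that of $(1,1,1,\dots)$ is not surjective on $H^1$.\<close>

definition zero_characteristic :: "('a, 'z) ring_scheme \<Rightarrow> bool" where
  "zero_characteristic A \<longleftrightarrow> \<one>\<^bsub>A\<^esub> \<noteq> \<zero>\<^bsub>A\<^esub> \<and> (\<forall>n::nat. 0 < n \<longrightarrow> [n] \<cdot>\<^bsub>A\<^esub> \<one>\<^bsub>A\<^esub> \<in> Units A)"


section \<open>Differential operators\<close>

definition delta ::
  "('a, 'p) module \<Rightarrow> ('a, 'q) module \<Rightarrow> 'a \<Rightarrow> ('p \<Rightarrow> 'q) \<Rightarrow> 'p \<Rightarrow> 'q" where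
  "delta P Q a \<Phi> = (\<lambda>p\<in>carrier P. \<Phi> (a \<odot>\<^bsub>P\<^esub> p) \<ominus>\<^bsub>Q\<^esub> a \<odot>\<^bsub>Q\<^esub> \<Phi> p)"

definition diff_ops ::
  "'a set \<Rightarrow> ('a, 'z) ring_scheme \<Rightarrow> nat \<Rightarrow> ('a, 'p) module \<Rightarrow> ('a, 'q) module \<Rightarrow> ('p \<Rightarrow> 'q) set" where
  "diff_ops K A k P Q = {\<Delta> \<in> lin_maps K P Q.
     \<forall>as. length as = Suc k \<and> set as \<subseteq> carrier A \<longrightarrow>
       (\<forall>p\<in>carrier P. foldr (delta P Q) as \<Delta> p = \<zero>\<^bsub>Q\<^esub>)}"

text \<open>An $A$-bimodule $(Q, Q^+)$ is a pair of module structures on the same underlying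
  \<open>K\<close>-module.\<close>

definition bimodule ::
  "'a set \<Rightarrow> ('a, 'z) ring_scheme \<Rightarrow> ('a, 'q) module \<Rightarrow> ('a, 'q) module \<Rightarrow> bool" where
  "bimodule K A Q Qp \<longleftrightarrow> module A Q \<and> module A Qp \<and>
     carrier Qp = carrier Q \<and> zero Qp = zero Q \<and> add Qp = add Q \<and>
     (\<forall>c\<in>K. \<forall>q\<in>carrier Q. c \<odot>\<^bsub>Qp\<^esub> q = c \<odot>\<^bsub>Q\<^esub> q) \<and>
     (\<forall>a\<in>carrier A. \<forall>b\<in>carrier A. \<forall>q\<in>carrier Q. a \<odot>\<^bsub>Q\<^esub> (b \<odot>\<^bsub>Qp\<^esub> q) = b \<odot>\<^bsub>Qp\<^esub> (a \<odot>\<^bsub>Q\<^esub> q))"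

text \<open>In the next three definitions \<open>S\<close> is the module $S \subset Q$ with the module
  structure of $Q$, and \<open>Qp\<close> is $Q^+$; the rest of $Q$ does not matter.\<close>

definition Diff_dot ::
  "'a set \<Rightarrow> ('a, 'z) ring_scheme \<Rightarrow> nat \<Rightarrow> ('a, 'p) module \<Rightarrow> ('a, 'q) module \<Rightarrow> ('a, 'q) module
     \<Rightarrow> ('a, 'p \<Rightarrow> 'q) module" where
  "Diff_dot K A k P S Qp =
     map_module P S {\<Delta> \<in> diff_ops K A k P Qp. \<Delta> ` carrier P \<subseteq> carrier S}
       (\<lambda>a \<Delta>. \<lambda>p\<in>carrier P. a \<odot>\<^bsub>S\<^esub> \<Delta> p)"

definition Diff_plus ::
  "'a set \<Rightarrow> ('a, 'z) ring_scheme \<Rightarrow> nat \<Rightarrow> ('a, 'p) module \<Rightarrow> ('a, 'q) module \<Rightarrow> ('a, 'q) module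
     \<Rightarrow> ('a, 'p \<Rightarrow> 'q) module" where
  "Diff_plus K A k P S Qp =
     map_module P S {\<Delta> \<in> diff_ops K A k P Qp. \<Delta> ` carrier P \<subseteq> carrier S}
       (\<lambda>a \<Delta>. \<lambda>p\<in>carrier P. \<Delta> (a \<odot>\<^bsub>P\<^esub> p))"

definition Der_dot ::
  "'a set \<Rightarrow> ('a, 'z) ring_scheme \<Rightarrow> nat \<Rightarrow> ('a, 'q) module \<Rightarrow> ('a, 'q) module
     \<Rightarrow> ('a, 'a \<Rightarrow> 'q) module" where
  "Der_dot K A k S Qp =
     (let DS = Diff_dot K A k (regular_module A) S Qp
      in DS\<lparr>carrier := {\<Delta> \<in> carrier DS. \<Delta> \<one>\<^bsub>A\<^esub> = \<zero>\<^bsub>S\<^esub>}\<rparr>)"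

abbreviation "Diffp K A k P Q \<equiv> Diff_plus K A k P Q Q"


section \<open>Iterated functors\<close>

text \<open>Elements of iterated function modules $\mathrm{Diff}^+_{\sigma_1}(\cdots(\mathrm{Diff}^+_{\sigma_n}Q)\cdots)$
  are functions of type \<open>'a \<Rightarrow> \<dots> \<Rightarrow> 'a \<Rightarrow> 'q\<close> with \<open>n\<close> arguments; the
  following datatype collects these types for all \<open>n\<close>.\<close>

datatype ('a, 'q) iter = Base (un_Base: 'q) | Fn (un_Fn: "'a \<Rightarrow> ('a, 'q) iter")

definition Base_module :: "('a, 'q) module \<Rightarrow> ('a, ('a, 'q) iter) module" where
  "Base_module = transport_module Base un_Base"

definition Fn_module :: "('a, 'a \<Rightarrow> ('a, 'q) iter) module \<Rightarrow> ('a, ('a, 'q) iter) module" where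
  "Fn_module = transport_module Fn un_Fn"

primrec Diffp_seq ::
  "'a set \<Rightarrow> ('a, 'z) ring_scheme \<Rightarrow> nat list \<Rightarrow> ('a, 'q) module \<Rightarrow> ('a, ('a, 'q) iter) module" where
  "Diffp_seq K A [] Qp = Base_module Qp"
| "Diffp_seq K A (k # \<sigma>) Qp = Fn_module (Diffp K A k (regular_module A) (Diffp_seq K A \<sigma> Qp))"

text \<open>$\mathrm{D}_\sigma(S \subset Q^+)$; the functor $\mathrm{D}_\sigma(Q)$ is the case
  $S = Q = Q^+$.\<close>

primrec D_seq ::
  "'a set \<Rightarrow> ('a, 'z) ring_scheme \<Rightarrow> nat list \<Rightarrow> ('a, 'q) module \<Rightarrow> ('a, 'q) module
     \<Rightarrow> ('a, ('a, 'q) iter) module" where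
  "D_seq K A [] S Qp = Base_module S"
| "D_seq K A (k # \<sigma>) S Qp = Fn_module (Der_dot K A k (D_seq K A \<sigma> S Qp) (Diffp_seq K A \<sigma> Qp))"

text \<open>$\mathcal{P}^\bullet_{(k,\sigma)}[P]$ and $\mathcal{P}^+_{(k,\sigma)}[P]$, with the same
  convention.\<close>

definition P_dot ::
  "'a set \<Rightarrow> ('a, 'z) ring_scheme \<Rightarrow> nat \<Rightarrow> nat list \<Rightarrow> ('a, 'p) module \<Rightarrow> ('a, 'q) module
     \<Rightarrow> ('a, 'q) module \<Rightarrow> ('a, 'p \<Rightarrow> ('a, 'q) iter) module" where
  "P_dot K A k \<sigma> P S Qp = Diff_dot K A k P (D_seq K A \<sigma> S Qp) (Diffp_seq K A \<sigma> Qp)"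

definition P_plus ::
  "'a set \<Rightarrow> ('a, 'z) ring_scheme \<Rightarrow> nat \<Rightarrow> nat list \<Rightarrow> ('a, 'p) module \<Rightarrow> ('a, 'q) module
     \<Rightarrow> ('a, 'q) module \<Rightarrow> ('a, 'p \<Rightarrow> ('a, 'q) iter) module" where
  "P_plus K A k \<sigma> P S Qp = Diff_plus K A k P (D_seq K A \<sigma> S Qp) (Diffp_seq K A \<sigma> Qp)"

abbreviation "DD K A \<sigma> Q \<equiv> D_seq K A \<sigma> Q Q"

text \<open>Functoriality in \<open>Q\<close>: apply \<open>f\<close> to the final values.\<close>

primrec iter_map ::
  "('a, 'z) ring_scheme \<Rightarrow> ('q \<Rightarrow> 'r) \<Rightarrow> ('a, 'q) iter \<Rightarrow> ('a, 'r) iter" where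
  "iter_map A f (Base q) = Base (f q)"
| "iter_map A f (Fn g) = Fn (\<lambda>a\<in>carrier A. iter_map A f (g a))"

definition P_map ::
  "('a, 'z) ring_scheme \<Rightarrow> ('a, 'p) module \<Rightarrow> ('q \<Rightarrow> 'r)
     \<Rightarrow> ('p \<Rightarrow> ('a, 'q) iter) \<Rightarrow> 'p \<Rightarrow> ('a, 'r) iter" where
  "P_map A P f \<Delta> = (\<lambda>p\<in>carrier P. iter_map A f (\<Delta> p))"

text \<open>The inclusion $\mathrm{D}_{(\sigma,k)}(Q) \hookrightarrow \mathrm{D}_\sigma(\mathrm{Diff}^+_kQ)$,
  where $\sigma$ has length \<open>n\<close>, only re-brackets the innermost function.\<close>

primrec iter_split ::
  "('a, 'z) ring_scheme \<Rightarrow> nat \<Rightarrow> ('a, 'q) iter \<Rightarrow> ('a, 'a \<Rightarrow> 'q) iter" where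
  "iter_split A 0 x = Base (\<lambda>a\<in>carrier A. un_Base (un_Fn x a))"
| "iter_split A (Suc n) x = Fn (\<lambda>a\<in>carrier A. iter_split A n (un_Fn x a))"


section \<open>Differentially closed and smooth subcategories\<close>

text \<open>A full subcategory is given by its set \<open>\<DD>\<close> of objects.  In HOL the carriers of these are
  subsets of one type \<open>'m\<close>, which plays the role of a universe.  A module over any other type
  counts as lying in the subcategory if it is isomorphic to an object.\<close>

definition in_cat :: "('a, 'z) ring_scheme \<Rightarrow> ('a, 'm) module set \<Rightarrow> ('a, 'n) module \<Rightarrow> bool" where
  "in_cat A \<DD> M \<longleftrightarrow> (\<exists>X\<in>\<DD>. isomorphic_modules A M X)"

definition full_abelian_subcategory ::
  "('a, 'z) ring_scheme \<Rightarrow> ('a, 'm) module set \<Rightarrow> bool" where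
  "full_abelian_subcategory A \<DD> \<longleftrightarrow>
     (\<forall>M\<in>\<DD>. module A M) \<and>
     (\<exists>Z\<in>\<DD>. carrier Z = {\<zero>\<^bsub>Z\<^esub>}) \<and>
     (\<forall>M\<in>\<DD>. \<forall>N\<in>\<DD>. in_cat A \<DD> (direct_sum M N)) \<and>
     (\<forall>M\<in>\<DD>. \<forall>N\<in>\<DD>. \<forall>f \<in> mod_hom A M N.
        in_cat A \<DD> (M\<lparr>carrier := hom_kernel M N f\<rparr>) \<and>
        in_cat A \<DD> (quot_module N (f ` carrier M)))"

text \<open>\<open>\<eta>\<close> is an isomorphism $Hom_A(\tau,\cdot) \simeq T$ of functors on \<open>\<DD>\<close>, where
  \<open>T\<close> is given by its action \<open>Tob\<close> on objects and \<open>Tmap\<close> on morphisms.\<close>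

definition strict_representation ::
  "('a, 'z) ring_scheme \<Rightarrow> ('a, 'm) module set \<Rightarrow> (('a, 'm) module \<Rightarrow> ('a, 't) module)
     \<Rightarrow> (('m \<Rightarrow> 'm) \<Rightarrow> 't \<Rightarrow> 't) \<Rightarrow> ('a, 'm) module
     \<Rightarrow> (('a, 'm) module \<Rightarrow> ('m \<Rightarrow> 'm) \<Rightarrow> 't) \<Rightarrow> bool" where
  "strict_representation A \<DD> Tob Tmap \<tau> \<eta> \<longleftrightarrow>
     \<tau> \<in> \<DD> \<and>
     (\<forall>Q\<in>\<DD>. \<eta> Q \<in> mod_iso A (Hom A \<tau> Q) (Tob Q)) \<and>
     (\<forall>Q\<in>\<DD>. \<forall>Q'\<in>\<DD>. \<forall>f \<in> mod_hom A Q Q'. \<forall>h \<in> mod_hom A \<tau> Q.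
        \<eta> Q' (compose (carrier \<tau>) f h) = Tmap f (\<eta> Q h))"

definition strictly_representable ::
  "('a, 'z) ring_scheme \<Rightarrow> ('a, 'm) module set \<Rightarrow> (('a, 'm) module \<Rightarrow> ('a, 't) module)
     \<Rightarrow> (('m \<Rightarrow> 'm) \<Rightarrow> 't \<Rightarrow> 't) \<Rightarrow> bool" where
  "strictly_representable A \<DD> Tob Tmap \<longleftrightarrow> (\<exists>\<tau> \<eta>. strict_representation A \<DD> Tob Tmap \<tau> \<eta>)"

abbreviation pos_seq :: "nat list \<Rightarrow> bool" where
  "pos_seq \<sigma> \<equiv> (\<forall>k \<in> set \<sigma>. 0 < k)"

text \<open>All functors of differential calculus have values in \<open>\<DD>\<close> when applied to $S \subset Q^+$.\<close>

definition calculus_closed ::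
  "'a set \<Rightarrow> ('a, 'z) ring_scheme \<Rightarrow> ('a, 'm) module set \<Rightarrow> ('a, 'm) module \<Rightarrow> ('a, 'm) module
     \<Rightarrow> bool" where
  "calculus_closed K A \<DD> S Qp \<longleftrightarrow>
     (\<forall>P\<in>\<DD>. \<forall>k. in_cat A \<DD> (Diff_dot K A k P S Qp) \<and> in_cat A \<DD> (Diff_plus K A k P S Qp)) \<and>
     (\<forall>\<sigma>. pos_seq \<sigma> \<longrightarrow> in_cat A \<DD> (D_seq K A \<sigma> S Qp)) \<and>
     (\<forall>P\<in>\<DD>. \<forall>k \<sigma>. pos_seq (k # \<sigma>) \<longrightarrow>
        in_cat A \<DD> (P_dot K A k \<sigma> P S Qp) \<and> in_cat A \<DD> (P_plus K A k \<sigma> P S Qp))"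

definition differentially_closed ::
  "'a set \<Rightarrow> ('a, 'z) ring_scheme \<Rightarrow> ('a, 'a) module set \<Rightarrow> bool" where
  "differentially_closed K A \<DD> \<longleftrightarrow>
     full_abelian_subcategory A \<DD> \<and>
     (\<forall>Q\<in>\<DD>. calculus_closed K A \<DD> Q Q) \<and>
     (\<forall>Q Qp S. bimodule K A Q Qp \<and> submodule S A Q \<and>
        in_cat A \<DD> Q \<and> in_cat A \<DD> Qp \<and> in_cat A \<DD> (Q\<lparr>carrier := S\<rparr>) \<longrightarrow>
        calculus_closed K A \<DD> (Q\<lparr>carrier := S\<rparr>) Qp) \<and>
     (\<forall>\<sigma>. \<sigma> \<noteq> [] \<and> pos_seq \<sigma> \<longrightarrow> strictly_representable A \<DD> (DD K A \<sigma>) (iter_map A)) \<and>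
     (\<forall>k \<sigma>. pos_seq (k # \<sigma>) \<longrightarrow>
        strictly_representable A \<DD> (\<lambda>Q. P_dot K A k \<sigma> (regular_module A) Q Q)
          (P_map A (regular_module A)) \<and>
        (\<forall>P\<in>\<DD>. strictly_representable A \<DD> (\<lambda>Q. P_dot K A k \<sigma> P Q Q) (P_map A P))) \<and>
     regular_module A \<in> \<DD> \<and>
     (\<forall>M\<in>\<DD>. \<forall>N\<in>\<DD>. in_cat A \<DD> (tensor_module A M N)) \<and>
     (\<forall>M\<in>\<DD>. \<forall>S. submodule S A M \<longrightarrow> in_cat A \<DD> (M\<lparr>carrier := S\<rparr>))"

definition smooth_subcategory ::
  "'a set \<Rightarrow> ('a, 'z) ring_scheme \<Rightarrow> ('a, 'a) module set \<Rightarrow> bool" where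
  "smooth_subcategory K A \<DD> \<longleftrightarrow> differentially_closed K A \<DD> \<and>
     (\<exists>\<Lambda> \<eta>. strict_representation A \<DD> (DD K A [1]) (iter_map A) \<Lambda> \<eta> \<and>
        projective_module A \<Lambda> \<and> finite_type A \<Lambda>)"


section \<open>Cochain complexes\<close>

text \<open>Complexes in degrees \<open>\<ge> 0\<close>, extended by zero.\<close>

record ('a, 'm) cochains =
  deg :: "nat \<Rightarrow> ('a, 'm) module"
  differential :: "nat \<Rightarrow> 'm \<Rightarrow> 'm"

definition cochain_complex :: "('a, 'z) ring_scheme \<Rightarrow> ('a, 'm) cochains \<Rightarrow> bool" where
  "cochain_complex R C \<longleftrightarrow>
     (\<forall>n. module R (deg C n) \<and> differential C n \<in> mod_hom R (deg C n) (deg C (Suc n)) \<and>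
        (\<forall>x\<in>carrier (deg C n).
           differential C (Suc n) (differential C n x) = \<zero>\<^bsub>deg C (Suc (Suc n))\<^esub>))"

definition cochain_map ::
  "('a, 'z) ring_scheme \<Rightarrow> ('a, 'm) cochains \<Rightarrow> ('a, 'n) cochains \<Rightarrow> (nat \<Rightarrow> 'm \<Rightarrow> 'n) \<Rightarrow> bool" where
  "cochain_map R C C' f \<longleftrightarrow> cochain_complex R C \<and> cochain_complex R C' \<and>
     (\<forall>n. f n \<in> mod_hom R (deg C n) (deg C' n) \<and>
        (\<forall>x\<in>carrier (deg C n). f (Suc n) (differential C n x) = differential C' n (f n x)))"

definition cochain_epi ::
  "('a, 'z) ring_scheme \<Rightarrow> ('a, 'm) cochains \<Rightarrow> ('a, 'n) cochains \<Rightarrow> (nat \<Rightarrow> 'm \<Rightarrow> 'n) \<Rightarrow> bool" where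
  "cochain_epi R C C' f \<longleftrightarrow> cochain_map R C C' f \<and>
     (\<forall>n. f n ` carrier (deg C n) = carrier (deg C' n))"

definition cocycles :: "('a, 'm) cochains \<Rightarrow> nat \<Rightarrow> 'm set" where
  "cocycles C n = {x \<in> carrier (deg C n). differential C n x = \<zero>\<^bsub>deg C (Suc n)\<^esub>}"

definition coboundaries :: "('a, 'm) cochains \<Rightarrow> nat \<Rightarrow> 'm set" where
  "coboundaries C n =
     (case n of 0 \<Rightarrow> {\<zero>\<^bsub>deg C 0\<^esub>} | Suc m \<Rightarrow> differential C m ` carrier (deg C m))"

definition cohomology :: "('a, 'm) cochains \<Rightarrow> nat \<Rightarrow> ('a, 'm set) module" where
  "cohomology C n = quot_module ((deg C n)\<lparr>carrier := cocycles C n\<rparr>) (coboundaries C n)"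

definition cohomology_map ::
  "('a, 'm) cochains \<Rightarrow> ('a, 'n) cochains \<Rightarrow> (nat \<Rightarrow> 'm \<Rightarrow> 'n) \<Rightarrow> nat \<Rightarrow> 'm set \<Rightarrow> 'n set" where
  "cohomology_map C C' f n =
     (\<lambda>X\<in>carrier (cohomology C n). \<Union>x\<in>X. coboundaries C' n +>\<^bsub>deg C' n\<^esub> f n x)"

definition quasi_isomorphism ::
  "('a, 'z) ring_scheme \<Rightarrow> ('a, 'm) cochains \<Rightarrow> ('a, 'n) cochains \<Rightarrow> (nat \<Rightarrow> 'm \<Rightarrow> 'n) \<Rightarrow> bool" where
  "quasi_isomorphism R C C' f \<longleftrightarrow> cochain_map R C C' f \<and>
     (\<forall>n. cohomology_map C C' f n \<in> mod_iso R (cohomology C n) (cohomology C' n))"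


section \<open>Higher de Rham complexes\<close>

text \<open>A choice of representing objects \<open>\<Lambda> \<sigma>\<close> of the functors $\mathrm{D}_\sigma$, together with
  representations \<open>\<eta> \<sigma>\<close>.  For the empty sequence these are \<open>A\<close> and the
  canonical $Hom_A(A,Q) \simeq Q$.\<close>

definition form_system ::
  "'a set \<Rightarrow> ('a, 'z) ring_scheme \<Rightarrow> ('a, 'a) module set \<Rightarrow> (nat list \<Rightarrow> ('a, 'a) module)
     \<Rightarrow> (nat list \<Rightarrow> ('a, 'a) module \<Rightarrow> ('a \<Rightarrow> 'a) \<Rightarrow> ('a, 'a) iter) \<Rightarrow> bool" where
  "form_system K A \<DD> \<Lambda> \<eta> \<longleftrightarrow>
     \<Lambda> [] = regular_module A \<and> (\<forall>Q h. \<eta> [] Q h = Base (h \<one>\<^bsub>A\<^esub>)) \<and>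
     (\<forall>\<sigma>. \<sigma> \<noteq> [] \<and> pos_seq \<sigma> \<longrightarrow>
        strict_representation A \<DD> (DD K A \<sigma>) (iter_map A) (\<Lambda> \<sigma>) (\<eta> \<sigma>))"

text \<open>The element of $\mathrm{D}_\sigma(\Lambda^\sigma)$ corresponding to the identity of
  $\Lambda^\sigma$.\<close>

definition universal_element ::
  "(nat list \<Rightarrow> ('a, 'm) module) \<Rightarrow> (nat list \<Rightarrow> ('a, 'm) module \<Rightarrow> ('m \<Rightarrow> 'm) \<Rightarrow> ('a, 'm) iter)
     \<Rightarrow> nat list \<Rightarrow> ('a, 'm) iter" where
  "universal_element \<Lambda> \<eta> \<sigma> = \<eta> \<sigma> (\<Lambda> \<sigma>) (\<lambda>\<omega>\<in>carrier (\<Lambda> \<sigma>). \<omega>)"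

text \<open>The isomorphism $Hom_A(\Lambda^\sigma,Q) \simeq \mathrm{D}_\sigma(Q)$, written so that it makes
  sense for all \<open>Q\<close> isomorphic to an object of \<open>\<DD>\<close>, in particular for
  $\mathrm{Diff}^+_kQ$: by naturality $h$ goes to $\mathrm{D}_\sigma(h)$ of the universal element.\<close>

definition hom_to_D ::
  "('a, 'z) ring_scheme \<Rightarrow> (nat list \<Rightarrow> ('a, 'm) module)
     \<Rightarrow> (nat list \<Rightarrow> ('a, 'm) module \<Rightarrow> ('m \<Rightarrow> 'm) \<Rightarrow> ('a, 'm) iter)
     \<Rightarrow> nat list \<Rightarrow> ('m \<Rightarrow> 'q) \<Rightarrow> ('a, 'q) iter" where
  "hom_to_D A \<Lambda> \<eta> \<sigma> h = iter_map A h (universal_element \<Lambda> \<eta> \<sigma>)"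

definition deRham_differential ::
  "'a set \<Rightarrow> ('a, 'z) ring_scheme \<Rightarrow> (nat list \<Rightarrow> ('a, 'm) module)
     \<Rightarrow> (nat list \<Rightarrow> ('a, 'm) module \<Rightarrow> ('m \<Rightarrow> 'm) \<Rightarrow> ('a, 'm) iter)
     \<Rightarrow> nat list \<Rightarrow> nat \<Rightarrow> 'm \<Rightarrow> 'm" where
  "deRham_differential K A \<Lambda> \<eta> \<sigma> k =
     (let Q = \<Lambda> (\<sigma> @ [k]);
          f = (THE f. f \<in> mod_hom A (\<Lambda> \<sigma>) (Diffp K A k (regular_module A) Q) \<and>
                 hom_to_D A \<Lambda> \<eta> \<sigma> f =
                   iter_split A (length \<sigma>) (universal_element \<Lambda> \<eta> (\<sigma> @ [k])))
      in (\<lambda>\<omega>\<in>carrier (\<Lambda> \<sigma>). f \<omega> \<one>\<^bsub>A\<^esub>))"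

definition initial_seq :: "(nat \<Rightarrow> nat) \<Rightarrow> nat \<Rightarrow> nat list" where
  "initial_seq \<sigma> n = map \<sigma> [0..<n]"

definition dR ::
  "'a set \<Rightarrow> ('a, 'z) ring_scheme \<Rightarrow> (nat list \<Rightarrow> ('a, 'm) module)
     \<Rightarrow> (nat list \<Rightarrow> ('a, 'm) module \<Rightarrow> ('m \<Rightarrow> 'm) \<Rightarrow> ('a, 'm) iter)
     \<Rightarrow> (nat \<Rightarrow> nat) \<Rightarrow> ('a, 'm) cochains" where
  "dR K A \<Lambda> \<eta> \<sigma> = \<lparr>deg = (\<lambda>n. \<Lambda> (initial_seq \<sigma> n)),
     differential = (\<lambda>n. deRham_differential K A \<Lambda> \<eta> (initial_seq \<sigma> n) (\<sigma> n))\<rparr>"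

text \<open>The homomorphism $\Lambda^{\tau(n)} \to \Lambda^{\sigma(n)}$ inducing the inclusion
  $\mathrm{D}_{\sigma(n)} \hookrightarrow \mathrm{D}_{\tau(n)}$.\<close>

definition dR_canonical ::
  "('a, 'z) ring_scheme \<Rightarrow> (nat list \<Rightarrow> ('a, 'm) module)
     \<Rightarrow> (nat list \<Rightarrow> ('a, 'm) module \<Rightarrow> ('m \<Rightarrow> 'm) \<Rightarrow> ('a, 'm) iter)
     \<Rightarrow> (nat \<Rightarrow> nat) \<Rightarrow> (nat \<Rightarrow> nat) \<Rightarrow> nat \<Rightarrow> 'm \<Rightarrow> 'm" where
  "dR_canonical A \<Lambda> \<eta> \<tau> \<sigma> n =
     (THE c. c \<in> mod_hom A (\<Lambda> (initial_seq \<tau> n)) (\<Lambda> (initial_seq \<sigma> n)) \<and>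
        \<eta> (initial_seq \<tau> n) (\<Lambda> (initial_seq \<sigma> n)) c = universal_element \<Lambda> \<eta> (initial_seq \<sigma> n))"

end

(*
  A form of type s is a sum of words a_1 ... a_n c, standing for c u(a_1, ..., a_n) with u the
  universal element of D_s, and the differential appends 1 to the words.  Let C(r, s) be the quotient
  of the sums of words which represents the iterated operators of type s that vanish when an entry at
  a position >= r equals 1, so that C(0, s) is the de Rham complex of s.  Inserting 1 at position r
  gives, for r >= 1, exact sequences

    0 -> C(r, (.., k + l, ..)) -> C(r + 1, (.., k, l, ..)) -> C(r, (.., k, l, ..)) -> 0

  with k and l at the positions r - 1 and r.  Injectivity on the left means that an operator of order
  k + l is obtained by evaluation at 1 from an operator of order k with values in operators of order l;
  it follows from the exactness of Spencer complexes in characteristic zero.  The complexes C(r, s)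
  with r >= 1 are acyclic.  This is proved by descending induction on r: the connecting homomorphism
  merges k and l, and multiplying the neighbouring entries k and L is a homotopy which shows that
  C(r, (.., k, L, ..)) -> C(r, (.., k, l, ..)) is zero on cohomology for L >= k + l.  For r = 0 the
  sequences read

    0 -> C(0, (s_2, s_3, ..)) -> C(1, s) -> C(0, s) -> 0,

  so the cohomology in degree n only depends on the shifted sequence.  After n + 1 shifts the sequences
  sigma(n + 1) and tau(n + 1), continued by 1's, have become equal.
*)

theory Submission
  imports Defs
begin

section \<open>Differential operators of finite order\<close>

text \<open>Three obstacles shape the proof. A generating family of differentials and a splitting of
  its free cover give derivations \<open>dd x\<close> with da equal to the sum of the
  \<open>dd x a\<close> times dx; this relation passes to all modules of iterated operators and
  replaces coordinates throughout. Secondly, D_s(Q) is in general no submodule of Diff^+_s Q, so the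
  homotopies for Spencer complexes do not act on operators with values in it. It is a syzygy
  instead: D_(m,s) is the kernel of evaluation at 1 on the operators of order at most m with values
  in D_s, which do form a module, and exactness is passed along this sequence. Rational numbers
  enter as inverses of degrees of symbols, of forms, or of both together. Thirdly, the functors
  behind C(r, s) are not assumed representable for general r. Formal sums of words modulo equality
  under all tests in \<open>\<DD>\<close> take the place of representing objects, and exactness in
  the middle needs one universal test, built from the product of all of them.\<close>

lemma (in abelian_group) cancel_add_neg:
  assumes "x \<in> carrier G"
  shows "x \<oplus> \<ominus> x = \<zero>"
    "y \<in> carrier G \<Longrightarrow> x \<oplus> (\<ominus> x \<oplus> y) = y"
    "y \<in> carrier G \<Longrightarrow> x \<oplus> (y \<oplus> \<ominus> x) = y"
    "\<lbrakk>y \<in> carrier G; z \<in> carrier G\<rbrakk> \<Longrightarrow> x \<oplus> (y \<oplus> (\<ominus> x \<oplus> z)) = y \<oplus> z"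
    "\<lbrakk>y \<in> carrier G; z \<in> carrier G\<rbrakk> \<Longrightarrow> x \<oplus> (y \<oplus> (z \<oplus> \<ominus> x)) = y \<oplus> z"
    "\<lbrakk>y \<in> carrier G; z \<in> carrier G; u \<in> carrier G\<rbrakk> \<Longrightarrow> x \<oplus> (y \<oplus> (z \<oplus> (\<ominus> x \<oplus> u))) = y \<oplus> (z \<oplus> u)"
    "\<lbrakk>y \<in> carrier G; z \<in> carrier G; u \<in> carrier G\<rbrakk> \<Longrightarrow> x \<oplus> (y \<oplus> (z \<oplus> (u \<oplus> \<ominus> x))) = y \<oplus> (z \<oplus> u)"
    "\<lbrakk>y \<in> carrier G; z \<in> carrier G; u \<in> carrier G; v \<in> carrier G\<rbrakk> \<Longrightarrow> x \<oplus> (y \<oplus> (z \<oplus> (u \<oplus> (\<ominus> x \<oplus> v)))) = y \<oplus> (z \<oplus> (u \<oplus> v))"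
    "\<lbrakk>y \<in> carrier G; z \<in> carrier G; u \<in> carrier G; v \<in> carrier G\<rbrakk> \<Longrightarrow> x \<oplus> (y \<oplus> (z \<oplus> (u \<oplus> (v \<oplus> \<ominus> x)))) = y \<oplus> (z \<oplus> (u \<oplus> v))"
  using assms by (simp_all add: a_lcomm[of x] r_neg r_neg1 r_neg2 l_neg)

lemma (in abelian_group) cancel_neg_add:
  assumes "x \<in> carrier G"
  shows "\<ominus> x \<oplus> x = \<zero>"
    "y \<in> carrier G \<Longrightarrow> \<ominus> x \<oplus> (x \<oplus> y) = y"
    "y \<in> carrier G \<Longrightarrow> \<ominus> x \<oplus> (y \<oplus> x) = y"
    "\<lbrakk>y \<in> carrier G; z \<in> carrier G\<rbrakk> \<Longrightarrow> \<ominus> x \<oplus> (y \<oplus> (x \<oplus> z)) = y \<oplus> z"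
    "\<lbrakk>y \<in> carrier G; z \<in> carrier G\<rbrakk> \<Longrightarrow> \<ominus> x \<oplus> (y \<oplus> (z \<oplus> x)) = y \<oplus> z"
    "\<lbrakk>y \<in> carrier G; z \<in> carrier G; u \<in> carrier G\<rbrakk> \<Longrightarrow> \<ominus> x \<oplus> (y \<oplus> (z \<oplus> (x \<oplus> u))) = y \<oplus> (z \<oplus> u)"
    "\<lbrakk>y \<in> carrier G; z \<in> carrier G; u \<in> carrier G\<rbrakk> \<Longrightarrow> \<ominus> x \<oplus> (y \<oplus> (z \<oplus> (u \<oplus> x))) = y \<oplus> (z \<oplus> u)"
    "\<lbrakk>y \<in> carrier G; z \<in> carrier G; u \<in> carrier G; v \<in> carrier G\<rbrakk> \<Longrightarrow> \<ominus> x \<oplus> (y \<oplus> (z \<oplus> (u \<oplus> (x \<oplus> v)))) = y \<oplus> (z \<oplus> (u \<oplus> v))"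
    "\<lbrakk>y \<in> carrier G; z \<in> carrier G; u \<in> carrier G; v \<in> carrier G\<rbrakk> \<Longrightarrow> \<ominus> x \<oplus> (y \<oplus> (z \<oplus> (u \<oplus> (v \<oplus> x)))) = y \<oplus> (z \<oplus> (u \<oplus> v))"
  using cancel_add_neg[of "\<ominus> x"] assms by simp_all

text \<open>Sorting a sum by associativity and commutativity need not bring x next to its negative;
  these rules cancel the pair across up to four other summands.\<close>

lemmas (in abelian_group) cancel_simps = cancel_add_neg cancel_neg_add

lemmas (in module) normal_form = smult_r_distr smult_l_distr smult_l_minus smult_r_minus
  smult_assoc1[symmetric] M.a_ac R.m_ac R.l_minus R.r_minus M.minus_add M.minus_minus M.cancel_simps

section \<open>Finite sums over lists\<close>

primrec lsum :: "('a, 'w, 'y) module_scheme \<Rightarrow> ('x \<Rightarrow> 'w) \<Rightarrow> 'x list \<Rightarrow> 'w" where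
  "lsum W f [] = \<zero>\<^bsub>W\<^esub>"
| "lsum W f (x # xs) = f x \<oplus>\<^bsub>W\<^esub> lsum W f xs"

context module
begin

lemma lsum_closed [simp, intro]:
  "(\<And>x. x \<in> set xs \<Longrightarrow> f x \<in> carrier M) \<Longrightarrow> lsum M f xs \<in> carrier M"
  by (induction xs) auto

lemma lsum_add:
  assumes "\<And>x. x \<in> set xs \<Longrightarrow> f x \<in> carrier M" "\<And>x. x \<in> set xs \<Longrightarrow> g x \<in> carrier M"
  shows "lsum M (\<lambda>x. f x \<oplus>\<^bsub>M\<^esub> g x) xs = lsum M f xs \<oplus>\<^bsub>M\<^esub> lsum M g xs"
  using assms by (induction xs) (simp_all add: M.a_ac)

lemma lsum_smult:
  assumes "\<And>x. x \<in> set xs \<Longrightarrow> f x \<in> carrier M" "c \<in> carrier R"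
  shows "c \<odot>\<^bsub>M\<^esub> lsum M f xs = lsum M (\<lambda>x. c \<odot>\<^bsub>M\<^esub> f x) xs"
  using assms by (induction xs) (simp_all add: smult_r_distr)

lemma lsum_zero [simp]: "lsum M (\<lambda>x. \<zero>\<^bsub>M\<^esub>) xs = \<zero>\<^bsub>M\<^esub>"
  by (induction xs) simp_all

lemma lsum_append:
  assumes "\<And>x. x \<in> set (xs @ ys) \<Longrightarrow> f x \<in> carrier M"
  shows "lsum M f (xs @ ys) = lsum M f xs \<oplus>\<^bsub>M\<^esub> lsum M f ys"
  using assms by (induction xs) (simp_all add: M.a_ac)

lemma lsum_swap:
  assumes "\<And>x y. x \<in> set xs \<Longrightarrow> y \<in> set ys \<Longrightarrow> f x y \<in> carrier M"
  shows "lsum M (\<lambda>x. lsum M (f x) ys) xs = lsum M (\<lambda>y. lsum M (\<lambda>x. f x y) xs) ys"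
  using assms by (induction xs) (simp_all add: lsum_add)

end

lemma lsum_cong:
  "xs = ys \<Longrightarrow> (\<And>x. x \<in> set ys \<Longrightarrow> f x = g x) \<Longrightarrow> lsum W f xs = lsum W g ys"
  by (induction xs arbitrary: ys) auto

lemma lsum_hom:
  assumes "h \<zero>\<^bsub>V\<^esub> = \<zero>\<^bsub>W\<^esub>" "\<And>x y. x \<in> carrier V \<Longrightarrow> y \<in> carrier V \<Longrightarrow> h (x \<oplus>\<^bsub>V\<^esub> y) = h x \<oplus>\<^bsub>W\<^esub> h y"
    "module A V" "\<And>x. x \<in> set xs \<Longrightarrow> f x \<in> carrier V"
  shows "h (lsum V f xs) = lsum W (\<lambda>x. h (f x)) xs"
proof -
  interpret V: module A V by fact
  show ?thesis using assms(4) by (induction xs) (simp_all add: assms)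
qed

lemma lsum_carrier_update [simp]: "lsum (W\<lparr>carrier := C\<rparr>) = lsum W"
proof (intro ext)
  show "lsum (W\<lparr>carrier := C\<rparr>) f xs = lsum W f xs" for f xs by (induction xs) simp_all
qed

lemma lsum_map: "lsum W f (map g xs) = lsum W (\<lambda>x. f (g x)) xs"
  by (induction xs) simp_all

section \<open>Operators on the ring with values in a module, and their order\<close>

locale diffcalc = R?: cring A for A :: "('u, 'z) ring_scheme" (structure) +
  fixes K :: "'u set"
  assumes subring_K: "subring K A"
begin

lemma K_carrier: "c \<in> K \<Longrightarrow> c \<in> carrier A"
  using subring_K subringE(1) by fast

definition derivation :: "('u, 'w) module \<Rightarrow> ('u \<Rightarrow> 'w) \<Rightarrow> bool" where
  "derivation W X \<longleftrightarrow> X \<in> carrier A \<rightarrow> carrier W \<and>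
     (\<forall>a\<in>carrier A. \<forall>b\<in>carrier A. X (a \<oplus> b) = X a \<oplus>\<^bsub>W\<^esub> X b) \<and>
     (\<forall>a\<in>carrier A. \<forall>b\<in>carrier A. X (a \<otimes> b) = a \<odot>\<^bsub>W\<^esub> X b \<oplus>\<^bsub>W\<^esub> b \<odot>\<^bsub>W\<^esub> X a) \<and>
     (\<forall>c\<in>K. X c = \<zero>\<^bsub>W\<^esub>)"

definition Klin :: "('u, 'w) module \<Rightarrow> ('u \<Rightarrow> 'w) \<Rightarrow> bool" where
  "Klin W D \<longleftrightarrow> D \<in> carrier A \<rightarrow> carrier W \<and>
     (\<forall>a\<in>carrier A. \<forall>b\<in>carrier A. D (a \<oplus> b) = D a \<oplus>\<^bsub>W\<^esub> D b) \<and>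
     (\<forall>c\<in>K. \<forall>a\<in>carrier A. D (c \<otimes> a) = c \<odot>\<^bsub>W\<^esub> D a)"

text \<open>Subtraction is written with the scalar \<open>\<ominus> a\<close> and not with the
  inverse of \<open>W\<close>: the latter is a description over the carrier, whereas
  \<open>dl\<close> has to stay the same when the carrier is cut down to a submodule. In contrast to
  \<open>delta\<close> the result is not restricted, so equality of operators is always meant on the
  carrier.\<close>

definition dl :: "('u, 'w) module \<Rightarrow> 'u \<Rightarrow> ('u \<Rightarrow> 'w) \<Rightarrow> 'u \<Rightarrow> 'w" where
  "dl W a D = (\<lambda>p. D (a \<otimes> p) \<oplus>\<^bsub>W\<^esub> (\<ominus> a) \<odot>\<^bsub>W\<^esub> D p)"

text \<open>\<open>ord W n D\<close> says that \<open>D\<close> has order strictly below \<open>n\<close>, so that the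
  zero map is the only one of order \<open>< 0\<close>.\<close>

primrec ord :: "('u, 'w) module \<Rightarrow> nat \<Rightarrow> ('u \<Rightarrow> 'w) \<Rightarrow> bool" where
  "ord W 0 D \<longleftrightarrow> (\<forall>p\<in>carrier A. D p = \<zero>\<^bsub>W\<^esub>)"
| "ord W (Suc n) D \<longleftrightarrow> (\<forall>a\<in>carrier A. ord W n (dl W a D))"

definition DO :: "('u, 'w) module \<Rightarrow> nat \<Rightarrow> ('u \<Rightarrow> 'w) \<Rightarrow> bool" where
  "DO W n D \<longleftrightarrow> Klin W D \<and> ord W n D"

lemma ord_cong: "(\<And>p. p \<in> carrier A \<Longrightarrow> D p = E p) \<Longrightarrow> ord W n D = ord W n E"
proof (induction n arbitrary: D E)
  case (Suc n)
  have "ord W n (dl W a D) = ord W n (dl W a E)" if "a \<in> carrier A" for a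
    using that Suc.prems by (intro Suc.IH) (simp add: dl_def)
  then show ?case by simp
qed simp

lemma Klin_cong: "(\<And>p. p \<in> carrier A \<Longrightarrow> D p = E p) \<Longrightarrow> Klin W D = Klin W E"
  by (simp add: Klin_def Pi_def K_carrier)

lemma DO_cong: "(\<And>p. p \<in> carrier A \<Longrightarrow> D p = E p) \<Longrightarrow> DO W n D = DO W n E"
  unfolding DO_def using ord_cong Klin_cong by blast

lemma dl_carrier_update [simp]: "dl (W\<lparr>carrier := C\<rparr>) = dl W"
  by (simp add: dl_def fun_eq_iff)

lemma ord_carrier_update [simp]: "ord (W\<lparr>carrier := C\<rparr>) n D = ord W n D"
  by (induction n arbitrary: D) simp_all

lemma Klin_carrier_update:
  "C \<subseteq> carrier W \<Longrightarrow> Klin (W\<lparr>carrier := C\<rparr>) D \<longleftrightarrow> Klin W D \<and> D \<in> carrier A \<rightarrow> C"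
  by (auto simp: Klin_def Pi_def)

text \<open>The order does not see the carrier, so an operator into a submodule is an operator into
  the ambient module with values there. This allows passing freely between the two.\<close>

lemma DO_carrier_update:
  "C \<subseteq> carrier W \<Longrightarrow> DO (W\<lparr>carrier := C\<rparr>) n D \<longleftrightarrow> DO W n D \<and> D \<in> carrier A \<rightarrow> C"
  by (auto simp: DO_def Klin_carrier_update)

end

locale diffmod = diffcalc A K + module A W
  for A :: "('u, 'z) ring_scheme" (structure) and K and W :: "('u, 'w) module"
begin

lemma DO_maps: "DO W n D \<Longrightarrow> D \<in> carrier A \<rightarrow> carrier W"
  by (simp add: Klin_def DO_def)

lemma DO_closed: "DO W n D \<Longrightarrow> a \<in> carrier A \<Longrightarrow> D a \<in> carrier W"
  using DO_maps by fast

lemma dl_maps: "D \<in> carrier A \<rightarrow> carrier W \<Longrightarrow> a \<in> carrier A \<Longrightarrow> dl W a D \<in> carrier A \<rightarrow> carrier W"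
  by (auto simp: dl_def Pi_def)

lemma ord_zero: "ord W n (\<lambda>p. \<zero>\<^bsub>W\<^esub>)"
proof (induction n)
  case (Suc n)
  have "ord W n (dl W a (\<lambda>p. \<zero>\<^bsub>W\<^esub>))" if "a \<in> carrier A" for a
    using Suc that by (subst ord_cong[of _ "\<lambda>p. \<zero>\<^bsub>W\<^esub>"]) (simp_all add: dl_def)
  then show ?case by simp
qed simp

lemma ord_add:
  assumes "ord W n D" "ord W n E" "D \<in> carrier A \<rightarrow> carrier W" "E \<in> carrier A \<rightarrow> carrier W"
  shows "ord W n (\<lambda>p. D p \<oplus>\<^bsub>W\<^esub> E p)"
  using assms
proof (induction n arbitrary: D E)
  case (Suc n)
  have "ord W n (dl W a (\<lambda>p. D p \<oplus>\<^bsub>W\<^esub> E p))" if a: "a \<in> carrier A" for a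
  proof (subst ord_cong)
    show "dl W a (\<lambda>p. D p \<oplus>\<^bsub>W\<^esub> E p) p = dl W a D p \<oplus>\<^bsub>W\<^esub> dl W a E p" if "p \<in> carrier A" for p
      using Suc.prems that a by (simp add: dl_def Pi_def normal_form)
    show "ord W n (\<lambda>p. dl W a D p \<oplus>\<^bsub>W\<^esub> dl W a E p)"
      using Suc.prems a dl_maps by (intro Suc.IH) auto
  qed
  then show ?case by simp
qed simp

lemma ord_smult:
  assumes "ord W n D" "D \<in> carrier A \<rightarrow> carrier W" "c \<in> carrier A"
  shows "ord W n (\<lambda>p. c \<odot>\<^bsub>W\<^esub> D p)"
  using assms
proof (induction n arbitrary: D)
  case (Suc n)
  have "ord W n (dl W a (\<lambda>p. c \<odot>\<^bsub>W\<^esub> D p))" if a: "a \<in> carrier A" for a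
  proof (subst ord_cong)
    show "dl W a (\<lambda>p. c \<odot>\<^bsub>W\<^esub> D p) p = c \<odot>\<^bsub>W\<^esub> dl W a D p" if "p \<in> carrier A" for p
      using Suc.prems that a by (simp add: dl_def Pi_def normal_form)
    show "ord W n (\<lambda>p. c \<odot>\<^bsub>W\<^esub> dl W a D p)"
      using Suc.prems a dl_maps by (intro Suc.IH) auto
  qed
  then show ?case by simp
qed simp

lemma ord_plus:
  assumes "ord W n D" "b \<in> carrier A"
  shows "ord W n (\<lambda>p. D (b \<otimes> p))"
  using assms
proof (induction n arbitrary: D)
  case (Suc n)
  have "ord W n (dl W a (\<lambda>p. D (b \<otimes> p)))" if a: "a \<in> carrier A" for a
  proof (subst ord_cong)
    show "dl W a (\<lambda>p. D (b \<otimes> p)) p = dl W a D (b \<otimes> p)" if "p \<in> carrier A" for p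
      using Suc.prems that a by (simp add: dl_def m_ac)
    show "ord W n (\<lambda>p. dl W a D (b \<otimes> p))"
      using Suc.prems a by (intro Suc.IH) auto
  qed
  then show ?case by simp
qed simp

lemma ord_Suc:
  assumes "ord W n D" "D \<in> carrier A \<rightarrow> carrier W" shows "ord W (Suc n) D"
  using assms
proof (induction n arbitrary: D)
  case 0 then show ?case by (simp add: dl_def)
next
  case (Suc n)
  have "ord W (Suc n) (dl W a D)" if "a \<in> carrier A" for a
    using Suc.prems dl_maps that by (intro Suc.IH) auto
  then show ?case by simp
qed

lemma ord_mono:
  assumes "ord W n D" "D \<in> carrier A \<rightarrow> carrier W" "n \<le> m"
  shows "ord W m D"
  using assms(3,1,2) by (induction m rule: dec_induct) (auto intro: ord_Suc simp del: ord.simps)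

lemma DO_mono: "DO W n D \<Longrightarrow> n \<le> m \<Longrightarrow> DO W m D"
  using ord_mono by (auto simp: DO_def Klin_def)

lemma DO_zero: "DO W n (\<lambda>p. \<zero>\<^bsub>W\<^esub>)"
  using ord_zero by (auto simp: DO_def Klin_def K_carrier)

lemma DO_add: "DO W n D \<Longrightarrow> DO W n E \<Longrightarrow> DO W n (\<lambda>p. D p \<oplus>\<^bsub>W\<^esub> E p)"
  unfolding DO_def using ord_add[of n D E]
  by (auto simp: Klin_def Pi_def M.a_ac smult_r_distr K_carrier)

lemma DO_smult: "DO W n D \<Longrightarrow> c \<in> carrier A \<Longrightarrow> DO W n (\<lambda>p. c \<odot>\<^bsub>W\<^esub> D p)"
  unfolding DO_def using ord_smult[of n D c]
  by (auto simp: Klin_def Pi_def smult_r_distr K_carrier smult_assoc1[symmetric] m_comm)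

lemma DO_plus: "DO W n D \<Longrightarrow> b \<in> carrier A \<Longrightarrow> DO W n (\<lambda>p. D (b \<otimes> p))"
  unfolding DO_def using ord_plus[of n D b]
  by (auto simp: Klin_def Pi_def r_distr K_carrier m_lcomm)

lemma DO_lsum: "(\<And>x. x \<in> set xs \<Longrightarrow> DO W n (D x)) \<Longrightarrow> DO W n (\<lambda>p. lsum W (\<lambda>x. D x p) xs)"
  by (induction xs) (auto intro!: DO_zero DO_add)

lemma DO_dl: "DO W (Suc n) D \<Longrightarrow> a \<in> carrier A \<Longrightarrow> DO W n (dl W a D)"
proof -
  assume D: "DO W (Suc n) D" and a: "a \<in> carrier A"
  \<comment> \<open>This order is one too large; only the \<open>K\<close>-linearity is taken from
    it.\<close>
  have "DO W (Suc n) (dl W a D)"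
    unfolding dl_def using D a by (intro DO_add DO_plus DO_smult) auto
  then show ?thesis using D a by (simp add: DO_def)
qed

lemma DO_0: "DO W 0 D \<Longrightarrow> p \<in> carrier A \<Longrightarrow> D p = \<zero>\<^bsub>W\<^esub>"
  by (simp add: DO_def)

lemma ord_1:
  assumes "ord W (Suc 0) D" "D \<in> carrier A \<rightarrow> carrier W" "p \<in> carrier A"
  shows "D p = p \<odot>\<^bsub>W\<^esub> D \<one>"
proof -
  have "dl W p D \<one> = \<zero>\<^bsub>W\<^esub>" using assms by simp
  moreover have "D \<one> \<in> carrier W" "D p \<in> carrier W" using assms by auto
  ultimately show ?thesis
    using assms by (simp add: dl_def smult_l_minus M.r_neg M.minus_equality M.minus_minus)
      (metis M.add.inv_equality M.minus_minus M.add.inv_closed smult_closed)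
qed

lemma DO_1I: "w \<in> carrier W \<Longrightarrow> DO W (Suc 0) (\<lambda>p. p \<odot>\<^bsub>W\<^esub> w)"
  by (auto simp: DO_def Klin_def K_carrier dl_def normal_form)

lemma DO_sum_decomp:
  assumes "\<And>p. p \<in> carrier A \<Longrightarrow> D p = E p \<oplus>\<^bsub>W\<^esub> F p" "DO W n E" "DO W n F"
  shows "DO W n D"
  using DO_add[OF assms(2,3)] DO_cong[of D "\<lambda>p. E p \<oplus>\<^bsub>W\<^esub> F p"] assms(1) by blast

end

section \<open>Coordinates\<close>

context diffcalc
begin

text \<open>\<open>pder W \<Phi>\<close>: the operator \<open>\<Phi> b\<close> is a derivation in \<open>b\<close> for the action of the ring on the
  arguments of operators.\<close>

definition pder :: "('u, 'w) module \<Rightarrow> ('u \<Rightarrow> 'u \<Rightarrow> 'w) \<Rightarrow> bool" where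
  "pder W \<Phi> \<longleftrightarrow>
     (\<forall>b\<in>carrier A. \<forall>c\<in>carrier A. \<forall>a\<in>carrier A. \<Phi> (b \<oplus> c) a = \<Phi> b a \<oplus>\<^bsub>W\<^esub> \<Phi> c a) \<and>
     (\<forall>b\<in>carrier A. \<forall>c\<in>carrier A. \<forall>a\<in>carrier A. \<Phi> (b \<otimes> c) a = \<Phi> b (c \<otimes> a) \<oplus>\<^bsub>W\<^esub> \<Phi> c (b \<otimes> a)) \<and>
     (\<forall>c\<in>K. \<forall>a\<in>carrier A. \<Phi> c a = \<zero>\<^bsub>W\<^esub>)"

lemma pder_cong:
  "(\<And>b a. b \<in> carrier A \<Longrightarrow> a \<in> carrier A \<Longrightarrow> \<Phi> b a = \<Psi> b a) \<Longrightarrow> pder W \<Phi> = pder W \<Psi>"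
  by (simp add: pder_def K_carrier)

lemma pderD:
  assumes "pder W \<Phi>" "b \<in> carrier A" "c \<in> carrier A" "a \<in> carrier A"
  shows "\<Phi> (b \<oplus> c) a = \<Phi> b a \<oplus>\<^bsub>W\<^esub> \<Phi> c a" "\<Phi> (b \<otimes> c) a = \<Phi> b (c \<otimes> a) \<oplus>\<^bsub>W\<^esub> \<Phi> c (b \<otimes> a)"
  using assms by (auto simp: pder_def)

lemma pder_K: "pder W \<Phi> \<Longrightarrow> c \<in> K \<Longrightarrow> a \<in> carrier A \<Longrightarrow> \<Phi> c a = \<zero>\<^bsub>W\<^esub>"
  by (auto simp: pder_def)

lemma pder_carrier_update [simp]: "pder (W\<lparr>carrier := C\<rparr>) = pder W"
  by (simp add: pder_def fun_eq_iff)

lemma derivationD: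
  assumes "derivation W X"
  shows "X \<in> carrier A \<rightarrow> carrier W" "a \<in> carrier A \<Longrightarrow> X a \<in> carrier W"
    "a \<in> carrier A \<Longrightarrow> b \<in> carrier A \<Longrightarrow> X (a \<oplus> b) = X a \<oplus>\<^bsub>W\<^esub> X b"
    "a \<in> carrier A \<Longrightarrow> b \<in> carrier A \<Longrightarrow> X (a \<otimes> b) = a \<odot>\<^bsub>W\<^esub> X b \<oplus>\<^bsub>W\<^esub> b \<odot>\<^bsub>W\<^esub> X a"
    "c \<in> K \<Longrightarrow> X c = \<zero>\<^bsub>W\<^esub>"
  using assms by (auto simp: derivation_def)

end

lemma regular_module_simps [simp]:
  "carrier (regular_module A) = carrier A" "add (regular_module A) = add A"
  "smult (regular_module A) = mult A" "zero (regular_module A) = zero A"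
  by (simp_all add: regular_module_def)

lemma (in cring) module_regular: "module A (regular_module A)" if "A = R" for A
proof -
  have "abelian_group (regular_module R)"
    by (rule abelian_groupI) (auto simp: a_ac l_neg dest: a_inv_closed intro!: bexI[where x = "\<ominus> _"])
  then show ?thesis using that
    by (intro moduleI) (simp_all add: is_cring l_distr r_distr m_assoc)
qed

lemma (in cring) lsum_regular_closed [simp]:
  "(\<And>x. x \<in> set xs \<Longrightarrow> f x \<in> carrier R) \<Longrightarrow> lsum (regular_module R) f xs \<in> carrier R"
  by (induction xs) auto

lemma (in module) neg_one_smult: "x \<in> carrier M \<Longrightarrow> (\<ominus> \<one>) \<odot>\<^bsub>M\<^esub> x = \<ominus>\<^bsub>M\<^esub> x"
  by (simp add: smult_l_minus)

lemma (in module) add_neg_eq_zero: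
  "x \<in> carrier M \<Longrightarrow> y \<in> carrier M \<Longrightarrow> x \<oplus>\<^bsub>M\<^esub> (\<ominus> \<one>) \<odot>\<^bsub>M\<^esub> y = \<zero>\<^bsub>M\<^esub> \<longleftrightarrow> x = y"
  by (metis neg_one_smult M.add.inv_closed M.minus_equality M.minus_minus M.r_neg)

context diffmod
begin

lemma Klin_zero: "Klin W D \<Longrightarrow> D \<zero> = \<zero>\<^bsub>W\<^esub>"
proof -
  assume D: "Klin W D"
  have "D (\<zero> \<oplus> \<zero>) = D \<zero> \<oplus>\<^bsub>W\<^esub> D \<zero>" "D \<zero> \<in> carrier W"
    using D by (auto simp: Klin_def Pi_def simp del: R.l_zero R.r_zero)
  then have "D \<zero> \<oplus>\<^bsub>W\<^esub> D \<zero> = D \<zero>" "D \<zero> \<in> carrier W" by simp_all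
  then show ?thesis by (simp add: M.add.l_cancel_one')
qed

lemma pder_add:
  assumes "pder W \<Phi>" "pder W \<Psi>"
    "\<And>b a. b \<in> carrier A \<Longrightarrow> a \<in> carrier A \<Longrightarrow> \<Phi> b a \<in> carrier W"
    "\<And>b a. b \<in> carrier A \<Longrightarrow> a \<in> carrier A \<Longrightarrow> \<Psi> b a \<in> carrier W"
  shows "pder W (\<lambda>b a. \<Phi> b a \<oplus>\<^bsub>W\<^esub> \<Psi> b a)"
  using assms by (simp add: pder_def M.a_ac)

lemma pder_zero: "pder W (\<lambda>b a. \<zero>\<^bsub>W\<^esub>)"
  by (simp add: pder_def)

lemma pder_lsum:
  assumes "\<And>x. x \<in> set xs \<Longrightarrow> pder W (\<Phi> x)"
    "\<And>x b a. x \<in> set xs \<Longrightarrow> b \<in> carrier A \<Longrightarrow> a \<in> carrier A \<Longrightarrow> \<Phi> x b a \<in> carrier W"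
  shows "pder W (\<lambda>b a. lsum W (\<lambda>x. \<Phi> x b a) xs)"
  using assms by (induction xs) (auto intro!: pder_add pder_zero)

lemma pder_smult:
  assumes "pder W \<Phi>" "c \<in> carrier A"
    "\<And>b a. b \<in> carrier A \<Longrightarrow> a \<in> carrier A \<Longrightarrow> \<Phi> b a \<in> carrier W"
  shows "pder W (\<lambda>b a. c \<odot>\<^bsub>W\<^esub> \<Phi> b a)"
  using assms by (simp add: pder_def smult_r_distr)

lemma pder_dl:
  assumes "pder W \<Phi>" "y \<in> carrier A"
    "\<And>b a. b \<in> carrier A \<Longrightarrow> a \<in> carrier A \<Longrightarrow> \<Phi> b a \<in> carrier W"
  shows "pder W (\<lambda>b. dl W y (\<Phi> b))"
proof -
  note cl = assms(3) and y = assms(2)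
  have "dl W y (\<Phi> (b \<oplus> c)) a = dl W y (\<Phi> b) a \<oplus>\<^bsub>W\<^esub> dl W y (\<Phi> c) a"
    if "b \<in> carrier A" "c \<in> carrier A" "a \<in> carrier A" for b c a
    using that y cl by (simp add: dl_def pderD(1)[OF assms(1)] smult_r_distr M.a_ac)
  moreover have "dl W y (\<Phi> (b \<otimes> c)) a = dl W y (\<Phi> b) (c \<otimes> a) \<oplus>\<^bsub>W\<^esub> dl W y (\<Phi> c) (b \<otimes> a)"
    if "b \<in> carrier A" "c \<in> carrier A" "a \<in> carrier A" for b c a
  proof -
    have "c \<otimes> (y \<otimes> a) = y \<otimes> (c \<otimes> a)" "b \<otimes> (y \<otimes> a) = y \<otimes> (b \<otimes> a)"
      using that y by (simp_all add: m_lcomm)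
    then show ?thesis
      using that y cl by (simp add: dl_def pderD(2)[OF assms(1)] smult_r_distr M.a_ac)
  qed
  ultimately show ?thesis using y by (simp add: pder_def dl_def pder_K[OF assms(1)])
qed

text \<open>The basic source of \<open>pder\<close> families: composition with multiplication by
  \<open>X b\<close> turns the product rule of \<open>X\<close> into the product rule for the action
  on arguments.\<close>

lemma pder_comp:
  assumes "Klin W D" "derivation (regular_module A) X"
  shows "pder W (\<lambda>b a. D (X b \<otimes> a))"
proof -
  note X = derivationD[OF assms(2), simplified]
  have D: "D (a \<oplus> b) = D a \<oplus>\<^bsub>W\<^esub> D b" if "a \<in> carrier A" "b \<in> carrier A" for a b
    using assms(1) that by (simp add: Klin_def)
  have "X (b \<otimes> c) \<otimes> a = X b \<otimes> (c \<otimes> a) \<oplus> X c \<otimes> (b \<otimes> a)"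
    if "b \<in> carrier A" "c \<in> carrier A" "a \<in> carrier A" for a b c
  proof -
    have "b \<otimes> X c \<otimes> a = X c \<otimes> (b \<otimes> a)" "c \<otimes> X b \<otimes> a = X b \<otimes> (c \<otimes> a)"
      using that X(2) by (simp_all add: m_ac)
    then show ?thesis using that X(2) by (simp add: X(4) R.l_distr R.a_comm)
  qed
  then show ?thesis using X by (simp add: pder_def R.l_distr D Klin_zero[OF assms(1)])
qed

text \<open>On operators of order < 1 the actions on arguments and on values agree, so a
  \<open>pder\<close> family of such operators is an ordinary derivation into
  \<open>W\<close>.\<close>

lemma derivation_at_one:
  assumes "pder W \<Phi>" "\<And>b. b \<in> carrier A \<Longrightarrow> ord W (Suc 0) (\<Phi> b)"
    "\<And>b. b \<in> carrier A \<Longrightarrow> \<Phi> b \<in> carrier A \<rightarrow> carrier W"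
  shows "derivation W (\<lambda>b. \<Phi> b \<one>)"
proof -
  have *: "\<Phi> b a = a \<odot>\<^bsub>W\<^esub> \<Phi> b \<one>" if "a \<in> carrier A" "b \<in> carrier A" for a b
    using that by (intro ord_1[of "\<Phi> b" a] assms(2,3))
  have "\<Phi> (a \<otimes> b) \<one> = a \<odot>\<^bsub>W\<^esub> \<Phi> b \<one> \<oplus>\<^bsub>W\<^esub> b \<odot>\<^bsub>W\<^esub> \<Phi> a \<one>"
    if a: "a \<in> carrier A" "b \<in> carrier A" for a b
  proof -
    have "\<Phi> a \<one> \<in> carrier W" "\<Phi> b \<one> \<in> carrier W"
      using funcset_mem[OF assms(3)[OF a(1)]] funcset_mem[OF assms(3)[OF a(2)]] by auto
    moreover have "\<Phi> (a \<otimes> b) \<one> = \<Phi> a b \<oplus>\<^bsub>W\<^esub> \<Phi> b a"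
      using a by (simp add: pderD(2)[OF assms(1)])
    ultimately show ?thesis using *[of b a] *[of a b] a by (simp add: M.a_comm)
  qed
  moreover have "\<Phi> b \<one> \<in> carrier W" if "b \<in> carrier A" for b
    using funcset_mem[OF assms(3)[OF that]] by simp
  ultimately show ?thesis using assms(1) by (simp add: derivation_def pderD(1)[OF assms(1)] pder_K[OF assms(1)])
qed

end

text \<open>Coordinates \<open>xs\<close> with dual derivations \<open>dd\<close>.  A module is good if the relation
  $da = \sum_x \partial_x(a)\,dx$ holds for all derivations into it; no independence of the
  $dx$ is required.\<close>

locale frame = diffcalc A K for A :: "('u, 'z) ring_scheme" (structure) and K +
  fixes xs :: "'u list" and dd :: "'u \<Rightarrow> 'u \<Rightarrow> 'u"
  assumes rational: "\<And>n::nat. 0 < n \<Longrightarrow> [n] \<cdot> \<one> \<in> Units A"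
    and xs: "set xs \<subseteq> carrier A"
    and dd: "\<And>x. x \<in> set xs \<Longrightarrow> derivation (regular_module A) (dd x)"
    and regular_good: "\<And>X a. derivation (regular_module A) X \<Longrightarrow> a \<in> carrier A \<Longrightarrow>
      X a = lsum (regular_module A) (\<lambda>x. dd x a \<otimes> X x) xs"
begin

definition good :: "('u, 'w) module \<Rightarrow> bool" where
  "good W \<longleftrightarrow> (\<forall>X. derivation W X \<longrightarrow> (\<forall>a\<in>carrier A. X a = lsum W (\<lambda>x. dd x a \<odot>\<^bsub>W\<^esub> X x) xs))"

lemma xs_carrier [simp]: "x \<in> set xs \<Longrightarrow> x \<in> carrier A"
  using xs by auto

lemma dd_closed [simp]: "x \<in> set xs \<Longrightarrow> a \<in> carrier A \<Longrightarrow> dd x a \<in> carrier A"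
  using derivationD(2)[OF dd] by simp

lemma dd_mult: "x \<in> set xs \<Longrightarrow> a \<in> carrier A \<Longrightarrow> b \<in> carrier A \<Longrightarrow>
    dd x (a \<otimes> b) = a \<otimes> dd x b \<oplus> b \<otimes> dd x a"
  using derivationD(4)[OF dd] by simp

end

locale framed_module = frame A K xs dd + diffmod A K W
  for A :: "('u, 'z) ring_scheme" (structure) and K xs dd and W :: "('u, 'w) module"

locale good_module = framed_module +
  assumes good: "good W"

context framed_module
begin

text \<open>The frame relation for derivations of the ring itself, carried through \<open>D\<close>.
  For \<open>X = dd y\<close> it says that the matrix with entries \<open>dd y x\<close> fixes the
  coordinate vectors of all differentials, which is the substitute for independence of the
  dx.\<close>

lemma Klin_lsum_frame:
  assumes D: "Klin W D" and "derivation (regular_module A) X" "a \<in> carrier A" "b \<in> carrier A"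
  shows "D (X a \<otimes> b) = lsum W (\<lambda>x. D (X x \<otimes> dd x a \<otimes> b)) xs"
proof -
  note X = derivationD[OF assms(2), simplified]
  interpret R: module A "regular_module A" by (rule module_regular) simp
  have z: "D \<zero> = \<zero>\<^bsub>W\<^esub>" using D by (rule Klin_zero)
  have "X a = lsum (regular_module A) (\<lambda>x. dd x a \<otimes> X x) xs"
    using assms by (intro regular_good)
  then have "D (X a \<otimes> b) = D (b \<otimes> lsum (regular_module A) (\<lambda>x. dd x a \<otimes> X x) xs)"
    using assms X by (simp add: m_comm)
  also have "\<dots> = lsum W (\<lambda>x. D (b \<otimes> (dd x a \<otimes> X x))) xs"
    using assms X D z
    by (subst lsum_hom[where V = "regular_module A" and A = A and h = "\<lambda>c. D (b \<otimes> c)" and W = W])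
      (auto simp: R.module_axioms Klin_def r_distr)
  also have "\<dots> = lsum W (\<lambda>x. D (X x \<otimes> dd x a \<otimes> b)) xs"
    using assms X by (intro lsum_cong) (auto simp: m_ac)
  finally show ?thesis .
qed

end

context good_module
begin

text \<open>The frame relation for derivations into operators of finite order. By induction on the
  order the error of the expansion commutes with multiplication, hence comes from a derivation into
  \<open>W\<close>, to which goodness applies; as expanding twice is the same as expanding once,
  this derivation is zero.\<close>

lemma pder_expand:
  assumes "pder W \<Phi>" "\<And>b. b \<in> carrier A \<Longrightarrow> DO W n (\<Phi> b)" "b \<in> carrier A" "a \<in> carrier A"
  shows "\<Phi> b a = lsum W (\<lambda>x. \<Phi> x (dd x b \<otimes> a)) xs"
  using assms
proof (induction n arbitrary: \<Phi> a b)
  case 0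
  have z: "\<Phi> c d = \<zero>\<^bsub>W\<^esub>" if "c \<in> carrier A" "d \<in> carrier A" for c d
    using that by (intro DO_0[OF 0(2)])
  have "\<Phi> b a = \<zero>\<^bsub>W\<^esub>" using 0(3,4) z by simp
  moreover have "lsum W (\<lambda>x. \<Phi> x (dd x b \<otimes> a)) xs = lsum W (\<lambda>x. \<zero>\<^bsub>W\<^esub>) xs"
    using 0(3,4) z by (intro lsum_cong) auto
  ultimately show ?case by simp
next
  case (Suc n)
  have cl: "\<Phi> b a \<in> carrier W" if "b \<in> carrier A" "a \<in> carrier A" for a b
    using that by (intro DO_closed[OF Suc.prems(2)])
  define H where "H b a = lsum W (\<lambda>x. \<Phi> x (dd x b \<otimes> a)) xs" for b a
  define \<Psi> where "\<Psi> b a = \<Phi> b a \<oplus>\<^bsub>W\<^esub> (\<ominus> \<one>) \<odot>\<^bsub>W\<^esub> H b a" for b a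
  have Hc: "H b a \<in> carrier W" if "b \<in> carrier A" "a \<in> carrier A" for a b
    using cl that by (auto simp: H_def)
  have \<Psi>c: "\<Psi> b a \<in> carrier W" if "b \<in> carrier A" "a \<in> carrier A" for a b
    using cl Hc that by (auto simp: \<Psi>_def)
  have Hp: "pder W H"
    unfolding H_def
  proof (rule pder_lsum)
    show "pder W (\<lambda>b a. \<Phi> x (dd x b \<otimes> a))" if "x \<in> set xs" for x
      using that Suc.prems(2) dd by (intro pder_comp) (auto simp: DO_def)
  qed (use cl in auto)
  have HDO: "DO W (Suc n) (H b)" if "b \<in> carrier A" for b
  proof -
    have "DO W (Suc n) (\<lambda>p. \<Phi> x (dd x b \<otimes> p))" if "x \<in> set xs" for x
      using that \<open>b \<in> carrier A\<close> Suc.prems(2) by (intro DO_plus[of _ "\<Phi> x"]) auto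
    then show ?thesis unfolding H_def by (intro DO_lsum) auto
  qed
  have \<Psi>p: "pder W \<Psi>"
    unfolding \<Psi>_def using Suc.prems(1) Hp cl Hc by (intro pder_add pder_smult) auto
  have \<Psi>DO: "DO W (Suc n) (\<Psi> b)" if "b \<in> carrier A" for b
    unfolding \<Psi>_def using that Suc.prems(2) HDO by (intro DO_add DO_smult) auto
  \<comment> \<open>\<open>dl W y\<close> makes a family of lower order out of
    \<open>\<Phi>\<close>, and the expansion of that family is known by induction.\<close>
  have dl0: "dl W y (\<Psi> b) a = \<zero>\<^bsub>W\<^esub>" if "y \<in> carrier A" "b \<in> carrier A" "a \<in> carrier A" for y b a
  proof -
    have "dl W y (\<Phi> b) a = lsum W (\<lambda>x. dl W y (\<Phi> x) (dd x b \<otimes> a)) xs"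
      using that Suc.prems cl by (intro Suc.IH pder_dl DO_dl) auto
    also have "\<dots> = lsum W (\<lambda>x. \<Phi> x (dd x b \<otimes> (y \<otimes> a)) \<oplus>\<^bsub>W\<^esub> (\<ominus> y) \<odot>\<^bsub>W\<^esub> \<Phi> x (dd x b \<otimes> a)) xs"
      using that by (intro lsum_cong) (auto simp: dl_def m_ac)
    also have "\<dots> = dl W y (H b) a"
      using that cl by (subst lsum_add) (auto simp: dl_def H_def lsum_smult)
    finally have "dl W y (\<Phi> b) a = dl W y (H b) a" .
    moreover have "dl W y (\<Psi> b) a = dl W y (\<Phi> b) a \<oplus>\<^bsub>W\<^esub> (\<ominus> \<one>) \<odot>\<^bsub>W\<^esub> dl W y (H b) a"
      using that cl Hc by (simp add: dl_def \<Psi>_def normal_form)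
    moreover have "dl W y (H b) a \<in> carrier W"
      using that Hc by (simp add: dl_def)
    ultimately show ?thesis by (simp add: neg_one_smult M.r_neg)
  qed
  have \<Psi>1: "ord W (Suc 0) (\<Psi> b)" if "b \<in> carrier A" for b
    using dl0 that by simp
  have lin: "\<Psi> b a = a \<odot>\<^bsub>W\<^esub> \<Psi> b \<one>" if "b \<in> carrier A" "a \<in> carrier A" for a b
    using that \<Psi>1 \<Psi>c by (intro ord_1[of "\<Psi> b" a]) auto
  have der: "derivation W (\<lambda>b. \<Psi> b \<one>)"
    using \<Psi>p \<Psi>1 \<Psi>c by (intro derivation_at_one[of \<Psi>]) auto
  \<comment> \<open>Goodness expresses \<open>\<Psi> b \<one>\<close> by the \<open>\<Psi> x\<close>
    at the coordinates. There \<open>\<Phi>\<close> and its expansion \<open>H\<close> have equal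
    sums, because the frame relation also holds for each \<open>dd y\<close>.\<close>
  have "\<Psi> b \<one> = \<zero>\<^bsub>W\<^esub>" if b: "b \<in> carrier A" for b
  proof -
    have "\<Psi> b \<one> = lsum W (\<lambda>x. dd x b \<odot>\<^bsub>W\<^esub> \<Psi> x \<one>) xs"
      using good[unfolded good_def, rule_format, OF der b] .
    also have "\<dots> = lsum W (\<lambda>x. \<Psi> x (dd x b)) xs"
      using b by (intro lsum_cong) (simp_all add: lin[symmetric])
    also have "\<dots> = lsum W (\<lambda>x. \<Phi> x (dd x b)) xs \<oplus>\<^bsub>W\<^esub> (\<ominus>\<one>) \<odot>\<^bsub>W\<^esub> lsum W (\<lambda>x. H x (dd x b)) xs"
      using b cl Hc unfolding \<Psi>_def by (subst lsum_add) (simp_all add: lsum_smult)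
    also have "lsum W (\<lambda>x. H x (dd x b)) xs = lsum W (\<lambda>x. \<Phi> x (dd x b)) xs"
    proof -
      have "lsum W (\<lambda>x. H x (dd x b)) xs = lsum W (\<lambda>y. lsum W (\<lambda>x. \<Phi> y (dd y x \<otimes> dd x b)) xs) xs"
        unfolding H_def using cl b by (subst lsum_swap) simp_all
      also have "\<dots> = lsum W (\<lambda>y. \<Phi> y (dd y b)) xs"
      proof (intro lsum_cong refl)
        fix y assume y: "y \<in> set xs"
        have "\<Phi> y (dd y b \<otimes> \<one>) = lsum W (\<lambda>x. \<Phi> y (dd y x \<otimes> dd x b \<otimes> \<one>)) xs"
          using Suc.prems(2) y b dd[OF y] by (intro Klin_lsum_frame) (auto simp: DO_def)
        also have "\<dots> = lsum W (\<lambda>x. \<Phi> y (dd y x \<otimes> dd x b)) xs"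
          using y b by (intro lsum_cong) simp_all
        finally show "lsum W (\<lambda>x. \<Phi> y (dd y x \<otimes> dd x b)) xs = \<Phi> y (dd y b)" using y b by simp
      qed
      finally show ?thesis .
    qed
    finally show ?thesis using b cl by (simp add: neg_one_smult M.r_neg)
  qed
  then have "\<Psi> b a = \<zero>\<^bsub>W\<^esub>" using lin[OF Suc.prems(3,4)] Suc.prems(3,4) by simp
  then have "\<Phi> b a \<oplus>\<^bsub>W\<^esub> (\<ominus> \<one>) \<odot>\<^bsub>W\<^esub> H b a = \<zero>\<^bsub>W\<^esub>" by (simp add: \<Psi>_def)
  then show ?case using Suc.prems(3,4) cl Hc unfolding H_def[symmetric]
    by (simp add: add_neg_eq_zero)
qed

end

section \<open>The Euler operator\<close>

context diffmod
begin

lemma dl_closed [simp]: "D \<in> carrier A \<rightarrow> carrier W \<Longrightarrow> a \<in> carrier A \<Longrightarrow> p \<in> carrier A \<Longrightarrow> dl W a D p \<in> carrier W"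
  by (rule funcset_mem[OF dl_maps])

lemma dl_commute:
  assumes "D \<in> carrier A \<rightarrow> carrier W" "y \<in> carrier A" "z \<in> carrier A" "p \<in> carrier A"
  shows "dl W z (dl W y D) p = dl W y (dl W z D) p"
proof -
  have [simp]: "D q \<in> carrier W" if "q \<in> carrier A" for q using assms(1) that by auto
  have "y \<otimes> (z \<otimes> p) = z \<otimes> (y \<otimes> p)" using assms by (simp add: R.m_lcomm)
  then show ?thesis using assms(2-) by (simp add: dl_def smult_r_distr smult_assoc1[symmetric] R.m_comm M.a_ac)
qed

lemma dl_add:
  assumes "D \<in> carrier A \<rightarrow> carrier W" "E \<in> carrier A \<rightarrow> carrier W" "y \<in> carrier A" "p \<in> carrier A"
  shows "dl W y (\<lambda>p. D p \<oplus>\<^bsub>W\<^esub> E p) p = dl W y D p \<oplus>\<^bsub>W\<^esub> dl W y E p"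
proof -
  have [simp]: "D q \<in> carrier W" "E q \<in> carrier W" if "q \<in> carrier A" for q using assms that by auto
  show ?thesis using assms(3-) by (simp add: dl_def smult_r_distr M.a_ac)
qed

lemma dl_smult:
  assumes "D \<in> carrier A \<rightarrow> carrier W" "c \<in> carrier A" "y \<in> carrier A" "p \<in> carrier A"
  shows "dl W y (\<lambda>p. c \<odot>\<^bsub>W\<^esub> D p) p = c \<odot>\<^bsub>W\<^esub> dl W y D p"
proof -
  have [simp]: "D q \<in> carrier W" if "q \<in> carrier A" for q using assms that by auto
  show ?thesis using assms(2-) by (simp add: dl_def smult_r_distr smult_assoc1[symmetric] R.m_comm)
qed

lemma dl_lsum:
  assumes "\<And>x. x \<in> set ys \<Longrightarrow> D x \<in> carrier A \<rightarrow> carrier W" "y \<in> carrier A" "p \<in> carrier A"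
  shows "dl W y (\<lambda>p. lsum W (\<lambda>x. D x p) ys) p = lsum W (\<lambda>x. dl W y (D x) p) ys"
  using assms(1)
proof (induction ys)
  case Nil then show ?case using assms(2,3) by (simp add: dl_def)
next
  case (Cons x ys)
  have "(\<lambda>p. lsum W (\<lambda>x. D x p) ys) \<in> carrier A \<rightarrow> carrier W"
    using Cons.prems by (auto intro!: lsum_closed)
  then have "dl W y (\<lambda>p. D x p \<oplus>\<^bsub>W\<^esub> lsum W (\<lambda>x. D x p) ys) p
      = dl W y (D x) p \<oplus>\<^bsub>W\<^esub> dl W y (\<lambda>p. lsum W (\<lambda>x. D x p) ys) p"
    using Cons.prems assms(2,3) by (intro dl_add) auto
  then show ?case using Cons by simp
qed

lemma dl_plus: "c \<in> carrier A \<Longrightarrow> y \<in> carrier A \<Longrightarrow> p \<in> carrier A \<Longrightarrow>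
    dl W y (\<lambda>p. D (c \<otimes> p)) p = dl W y D (c \<otimes> p)"
  by (simp add: dl_def R.m_lcomm)

lemma dl_expand:
  assumes "D \<in> carrier A \<rightarrow> carrier W" "y \<in> carrier A" "p \<in> carrier A"
  shows "D (y \<otimes> p) = dl W y D p \<oplus>\<^bsub>W\<^esub> y \<odot>\<^bsub>W\<^esub> D p"
proof -
  have "D (y \<otimes> p) \<in> carrier W" "D p \<in> carrier W" using assms by auto
  then show ?thesis using assms(2,3) by (simp add: dl_def smult_l_minus M.a_assoc M.l_neg)
qed

text \<open>By the product rule, \<open>dl W x\<close> of the merged operator is
  \<open>\<Phi> x\<close> plus the merged family of the \<open>dl W x (\<Phi> b)\<close>; the first
  has the right order by hypothesis and the second by induction. This is the order bound for the
  Spencer differential and for composition with a derivation.\<close>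

lemma DO_merge_pder:
  assumes "pder W \<Phi>" "\<And>b. b \<in> carrier A \<Longrightarrow> DO W n (\<Phi> b)"
  shows "DO W (Suc n) (\<lambda>b. \<Phi> b \<one>)"
  using assms
proof (induction n arbitrary: \<Phi>)
  case 0
  have "\<Phi> b p = \<zero>\<^bsub>W\<^esub>" if "b \<in> carrier A" "p \<in> carrier A" for b p
    using DO_0[OF 0(2)] that by blast
  then have "DO W (Suc 0) (\<lambda>b. \<Phi> b \<one>) = DO W (Suc 0) (\<lambda>b. \<zero>\<^bsub>W\<^esub>)"
    by (intro DO_cong) simp
  then show ?case using DO_zero by simp
next
  case (Suc n)
  have cl: "\<Phi> b \<in> carrier A \<rightarrow> carrier W" if "b \<in> carrier A" for b
    by (rule DO_maps[OF Suc.prems(2)[OF that]])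
  have cl': "\<Phi> b a \<in> carrier W" if "b \<in> carrier A" "a \<in> carrier A" for a b
    using cl that by blast
  note pd = pderD[OF Suc.prems(1)]
  have K: "\<Phi> (c \<otimes> a) \<one> = c \<odot>\<^bsub>W\<^esub> \<Phi> a \<one>" if "c \<in> K" "a \<in> carrier A" for a c
  proof -
    have "\<Phi> a (c \<otimes> \<one>) = c \<odot>\<^bsub>W\<^esub> \<Phi> a \<one>"
      using Suc.prems(2)[OF that(2)] that unfolding DO_def Klin_def by (auto simp del: R.r_one)
    then show ?thesis using pd(2)[of c a \<one>] that K_carrier[OF that(1)] pder_K[OF Suc.prems(1) that(1)] cl'
      by simp
  qed
  have "ord W (Suc n) (dl W x (\<lambda>b. \<Phi> b \<one>))" if x: "x \<in> carrier A" for x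
  proof -
    have IH: "DO W (Suc n) (\<lambda>b. dl W x (\<Phi> b) \<one>)"
    proof (rule Suc.IH)
      show "pder W (\<lambda>b. dl W x (\<Phi> b))" using x Suc.prems(1) cl' by (intro pder_dl) auto
      show "DO W n (dl W x (\<Phi> b))" if "b \<in> carrier A" for b using Suc.prems(2) that x by (intro DO_dl) auto
    qed
    have "DO W (Suc n) (dl W x (\<lambda>b. \<Phi> b \<one>))"
    proof (rule DO_sum_decomp)
      show "DO W (Suc n) (\<Phi> x)" using Suc.prems(2) x by blast
      show "DO W (Suc n) (\<lambda>b. dl W x (\<Phi> b) \<one>)" by (rule IH)
      show "dl W x (\<lambda>b. \<Phi> b \<one>) p = \<Phi> x p \<oplus>\<^bsub>W\<^esub> dl W x (\<Phi> p) \<one>" if "p \<in> carrier A" for p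
        using that x pd(2)[of x p \<one>] cl' by (simp add: dl_def M.a_assoc)
    qed
    then show ?thesis by (simp add: DO_def)
  qed
  moreover have "Klin W (\<lambda>b. \<Phi> b \<one>)"
    using cl' K pd(1) by (simp add: Klin_def)
  ultimately show ?case by (simp add: DO_def)
qed

lemma DO_comp_derivation:
  assumes "DO W n D" "derivation (regular_module A) X"
  shows "DO W (Suc n) (\<lambda>p. D (X p))"
proof -
  note X = derivationD[OF assms(2), simplified]
  have "DO W (Suc n) (\<lambda>b. D (X b \<otimes> \<one>))"
  proof (rule DO_merge_pder[where \<Phi> = "\<lambda>b a. D (X b \<otimes> a)"])
    show "pder W (\<lambda>b a. D (X b \<otimes> a))" using assms by (intro pder_comp) (auto simp: DO_def)
    show "DO W n (\<lambda>a. D (X b \<otimes> a))" if "b \<in> carrier A" for b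
      using assms(1) X(2)[OF that] by (rule DO_plus)
  qed
  then show ?thesis by (rule DO_cong[THEN iffD1, rotated]) (simp add: X)
qed

end

section \<open>Symbols in coordinates and the eigenvalues of the Euler operator\<close>

context good_module
begin

text \<open>The defect of the frame relation on symbols: \<open>dl W y D\<close> is a derivation in
  \<open>y\<close> up to lower order only, so its expansion in the coordinates leaves an
  error.\<close>

definition esym :: "('a \<Rightarrow> 'c) \<Rightarrow> 'a \<Rightarrow> 'a \<Rightarrow> 'c" where
  "esym D y p = dl W y D p \<oplus>\<^bsub>W\<^esub> (\<ominus> \<one>) \<odot>\<^bsub>W\<^esub> lsum W (\<lambda>x. dl W x D (dd x y \<otimes> p)) xs"

text \<open>The order drops by two and not merely by one. For \<open>D\<close> of order < 2 the
  values \<open>dl W y D \<one>\<close> form a derivation into \<open>W\<close> and goodness makes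
  the defect zero; in higher order the defect commutes with \<open>dl W z\<close>.\<close>

lemma DO_esym:
  assumes "DO W (Suc (Suc n)) D" "y \<in> carrier A"
  shows "DO W n (esym D y)"
  using assms
proof (induction n arbitrary: D)
  case 0
  have maps: "D \<in> carrier A \<rightarrow> carrier W" by (rule DO_maps[OF 0(1)])
  then have cl: "D q \<in> carrier W" if "q \<in> carrier A" for q using that by auto
  have lin: "dl W z D p = p \<odot>\<^bsub>W\<^esub> dl W z D \<one>" if "z \<in> carrier A" "p \<in> carrier A" for z p
    using that 0(1) dl_maps[OF maps] by (intro ord_1[of "dl W z D" p]) (auto simp: DO_def)
  have der: "derivation W (\<lambda>z. dl W z D \<one>)"
  proof -
    have "dl W (a \<otimes> b) D \<one> = a \<odot>\<^bsub>W\<^esub> dl W b D \<one> \<oplus>\<^bsub>W\<^esub> b \<odot>\<^bsub>W\<^esub> dl W a D \<one>"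
      if "a \<in> carrier A" "b \<in> carrier A" for a b
    proof -
      have "D (b \<otimes> a) = dl W b D a \<oplus>\<^bsub>W\<^esub> b \<odot>\<^bsub>W\<^esub> D a" "D (a \<otimes> \<one>) = dl W a D \<one> \<oplus>\<^bsub>W\<^esub> a \<odot>\<^bsub>W\<^esub> D \<one>"
        using that by (intro dl_expand maps; simp)+
      then have "D (a \<otimes> b) = a \<odot>\<^bsub>W\<^esub> dl W b D \<one> \<oplus>\<^bsub>W\<^esub> (b \<odot>\<^bsub>W\<^esub> dl W a D \<one> \<oplus>\<^bsub>W\<^esub> (a \<otimes> b) \<odot>\<^bsub>W\<^esub> D \<one>)"
        using that cl maps lin[OF that(2,1)]
        by (simp add: smult_r_distr smult_assoc1[symmetric] R.m_comm)
      then show ?thesis using that cl maps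
        by (subst dl_def) (simp add: smult_l_minus M.r_neg M.a_assoc)
    qed
    moreover have "dl W (a \<oplus> b) D \<one> = dl W a D \<one> \<oplus>\<^bsub>W\<^esub> dl W b D \<one>"
      if "a \<in> carrier A" "b \<in> carrier A" for a b
    proof -
      have "D (a \<oplus> b) = D a \<oplus>\<^bsub>W\<^esub> D b" using 0(1) that by (simp add: DO_def Klin_def)
      then show ?thesis using that cl by (simp add: dl_def R.minus_add smult_l_distr M.a_ac)
    qed
    moreover have "dl W c D \<one> = \<zero>\<^bsub>W\<^esub>" if "c \<in> K" for c
    proof -
      have "D (c \<otimes> \<one>) = c \<odot>\<^bsub>W\<^esub> D \<one>" using 0(1) that unfolding DO_def Klin_def by blast
      then show ?thesis using K_carrier[OF that] cl by (simp add: dl_def smult_l_minus M.r_neg)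
    qed
    ultimately show ?thesis using maps by (simp add: derivation_def)
  qed
  have "esym D y p = \<zero>\<^bsub>W\<^esub>" if p: "p \<in> carrier A" for p
  proof -
    have "dl W y D p = p \<odot>\<^bsub>W\<^esub> lsum W (\<lambda>x. dd x y \<odot>\<^bsub>W\<^esub> dl W x D \<one>) xs"
      using lin[OF 0(2) p] good[unfolded good_def, rule_format, OF der 0(2)] by simp
    also have "\<dots> = lsum W (\<lambda>x. p \<odot>\<^bsub>W\<^esub> (dd x y \<odot>\<^bsub>W\<^esub> dl W x D \<one>)) xs"
      using p maps 0(2) by (intro lsum_smult) auto
    also have "\<dots> = lsum W (\<lambda>x. dl W x D (dd x y \<otimes> p)) xs"
    proof (intro lsum_cong refl)
      fix x assume "x \<in> set xs"
      then show "p \<odot>\<^bsub>W\<^esub> (dd x y \<odot>\<^bsub>W\<^esub> dl W x D \<one>) = dl W x D (dd x y \<otimes> p)"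
        using p maps 0(2) lin[of x "dd x y \<otimes> p"] by (simp add: smult_assoc1[symmetric] R.m_comm)
    qed
    finally show ?thesis
      using p maps 0(2) by (simp add: esym_def neg_one_smult M.r_neg)
  qed
  then have "DO W 0 (esym D y) = DO W 0 (\<lambda>p. \<zero>\<^bsub>W\<^esub>)" by (intro DO_cong) simp
  then show ?case using DO_zero by simp
next
  case (Suc n)
  have maps: "D \<in> carrier A \<rightarrow> carrier W" by (rule DO_maps[OF Suc.prems(1)])
  have DOx: "DO W (Suc (Suc n)) (dl W x D)" if "x \<in> carrier A" for x
    using Suc.prems(1) that by (rule DO_dl)
  have S: "DO W (Suc (Suc n)) (\<lambda>p. lsum W (\<lambda>x. dl W x D (dd x y \<otimes> p)) xs)"
  proof (rule DO_lsum)
    show "DO W (Suc (Suc n)) (\<lambda>p. dl W x D (dd x y \<otimes> p))" if "x \<in> set xs" for x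
      using DOx that Suc.prems(2) by (intro DO_plus[of _ "dl W x D"]) auto
  qed
  have "DO W (Suc (Suc n)) (\<lambda>p. dl W y D p \<oplus>\<^bsub>W\<^esub> (\<ominus> \<one>) \<odot>\<^bsub>W\<^esub> lsum W (\<lambda>x. dl W x D (dd x y \<otimes> p)) xs)"
    using DOx S Suc.prems(2) by (intro DO_add DO_smult) auto
  then have kl: "Klin W (esym D y)" unfolding esym_def[abs_def] by (simp add: DO_def)
  have "ord W n (dl W z (esym D y))" if z: "z \<in> carrier A" for z
  proof -
    have "dl W z (esym D y) p = esym (dl W z D) y p" if p: "p \<in> carrier A" for p
    proof -
      have "dl W z (esym D y) p = dl W z (dl W y D) p \<oplus>\<^bsub>W\<^esub>
          (\<ominus> \<one>) \<odot>\<^bsub>W\<^esub> dl W z (\<lambda>p. lsum W (\<lambda>x. dl W x D (dd x y \<otimes> p)) xs) p"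
        unfolding esym_def[abs_def]
        using maps z p Suc.prems(2) DO_maps[OF S] by (subst dl_add) (auto simp: dl_smult dl_maps)
      also have "dl W z (\<lambda>p. lsum W (\<lambda>x. dl W x D (dd x y \<otimes> p)) xs) p =
          lsum W (\<lambda>x. dl W z (\<lambda>p. dl W x D (dd x y \<otimes> p)) p) xs"
        using maps z p Suc.prems(2) by (intro dl_lsum) auto
      also have "\<dots> = lsum W (\<lambda>x. dl W x (dl W z D) (dd x y \<otimes> p)) xs"
      proof (intro lsum_cong refl)
        fix x assume x: "x \<in> set xs"
        have "dl W z (\<lambda>p. dl W x D (dd x y \<otimes> p)) p = dl W z (dl W x D) (dd x y \<otimes> p)"
          using x p z Suc.prems(2) by (intro dl_plus) auto
        then show "dl W z (\<lambda>p. dl W x D (dd x y \<otimes> p)) p = dl W x (dl W z D) (dd x y \<otimes> p)"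
          using x p z Suc.prems(2) maps dl_commute[of D x z "dd x y \<otimes> p"] by simp
      qed
      finally show ?thesis
        unfolding esym_def[of "dl W z D"] dl_commute[OF maps Suc.prems(2) z p] .
    qed
    moreover have "DO W n (esym (dl W z D) y)"
      using DOx[OF z] Suc.prems(2) by (rule Suc.IH)
    ultimately show ?thesis using ord_cong[of "dl W z (esym D y)" "esym (dl W z D) y"] by (simp add: DO_def)
  qed
  with kl show ?case by (simp add: DO_def)
qed

definition nu :: "nat \<Rightarrow> 'a" where "nu n = [n] \<cdot> \<one>"

lemma nu_closed [simp]: "nu n \<in> carrier A" by (simp add: nu_def)
lemma nu_0 [simp]: "nu 0 = \<zero>" by (simp add: nu_def)
lemma nu_Suc: "nu (Suc n) = nu n \<oplus> \<one>" by (simp add: nu_def)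

text \<open>On symbols of order \<open>n\<close> the operator \<open>euler\<close> is multiplication by \<open>n\<close>; this is
  where the rational numbers are needed.\<close>

definition euler :: "('a \<Rightarrow> 'c) \<Rightarrow> 'a \<Rightarrow> 'c" where
  "euler D p = lsum W (\<lambda>x. dl W x D (dd x p)) xs"

lemma DO_euler_sum: "DO W (Suc n) D \<Longrightarrow> DO W (Suc n) (euler D)"
  unfolding euler_def[abs_def]
  by (intro DO_lsum DO_comp_derivation[of n "dl W _ D" "dd _"] DO_dl dd) auto

text \<open>\<open>dl W y\<close> of \<open>euler D\<close> is \<open>euler\<close> of
  \<open>dl W y D\<close> plus the expansion of \<open>dl W y D\<close> in the coordinates, and the
  latter is \<open>dl W y D\<close> up to \<open>esym\<close>. So each application of
  \<open>dl\<close> accounts for one unit of the eigenvalue.\<close>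

lemma DO_euler:
  assumes "DO W (Suc n) D"
  shows "DO W n (\<lambda>p. euler D p \<oplus>\<^bsub>W\<^esub> (\<ominus> nu n) \<odot>\<^bsub>W\<^esub> D p)"
  using assms
proof (induction n arbitrary: D)
  case 0
  have maps: "D \<in> carrier A \<rightarrow> carrier W" by (rule DO_maps[OF 0(1)])
  have "dl W x D p = \<zero>\<^bsub>W\<^esub>" if "x \<in> carrier A" "p \<in> carrier A" for x p
    using 0 that by (simp add: DO_def)
  then have "euler D p = lsum W (\<lambda>x. \<zero>\<^bsub>W\<^esub>) xs" if "p \<in> carrier A" for p
    unfolding euler_def using that by (intro lsum_cong) auto
  then have "DO W 0 (\<lambda>p. euler D p \<oplus>\<^bsub>W\<^esub> (\<ominus> nu 0) \<odot>\<^bsub>W\<^esub> D p) = DO W 0 (\<lambda>p. \<zero>\<^bsub>W\<^esub>)"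
    using maps by (intro DO_cong) (auto simp: Pi_def)
  then show ?case using DO_zero by simp
next
  case (Suc n)
  have maps: "D \<in> carrier A \<rightarrow> carrier W" by (rule DO_maps[OF Suc.prems])
  have cl: "D q \<in> carrier W" if "q \<in> carrier A" for q using that maps by auto
  have eud: "DO W (Suc (Suc n)) (euler D)" using Suc.prems by (rule DO_euler_sum)
  have eu: "euler D \<in> carrier A \<rightarrow> carrier W" by (rule DO_maps[OF eud])
  have kl: "Klin W (\<lambda>p. euler D p \<oplus>\<^bsub>W\<^esub> (\<ominus> nu (Suc n)) \<odot>\<^bsub>W\<^esub> D p)"
    using DO_add[OF eud DO_smult[OF Suc.prems, of "\<ominus> nu (Suc n)"]] by (simp add: DO_def)
  have "ord W n (dl W y (\<lambda>p. euler D p \<oplus>\<^bsub>W\<^esub> (\<ominus> nu (Suc n)) \<odot>\<^bsub>W\<^esub> D p))" if y: "y \<in> carrier A" for y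
  proof -
    let ?E = "dl W y D"
    have Em: "?E \<in> carrier A \<rightarrow> carrier W" using maps y by (rule dl_maps)
    have DE: "DO W (Suc n) ?E" using Suc.prems y by (rule DO_dl)
    have euE: "euler ?E \<in> carrier A \<rightarrow> carrier W" by (rule DO_maps[OF DO_euler_sum[OF DE]])
    have e1: "dl W y (euler D) p = euler ?E p \<oplus>\<^bsub>W\<^esub> lsum W (\<lambda>x. dl W x D (dd x y \<otimes> p)) xs"
      if p: "p \<in> carrier A" for p
    proof -
      have "dl W y (euler D) p = lsum W (\<lambda>x. dl W y (\<lambda>p. dl W x D (dd x p)) p) xs"
        unfolding euler_def[abs_def] using maps y p by (intro dl_lsum) auto
      also have "\<dots> = lsum W (\<lambda>x. dl W x ?E (dd x p) \<oplus>\<^bsub>W\<^esub> dl W x D (dd x y \<otimes> p)) xs"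
      proof (intro lsum_cong refl)
        fix x assume x: "x \<in> set xs"
        have kx: "Klin W (dl W x D)" using DO_dl[OF Suc.prems, of x] x by (simp add: DO_def)
        have "dl W x D (dd x (y \<otimes> p)) = dl W x D (y \<otimes> dd x p) \<oplus>\<^bsub>W\<^esub> dl W x D (p \<otimes> dd x y)"
          using kx x y p by (simp add: Klin_def dd_mult)
        then have "dl W y (\<lambda>p. dl W x D (dd x p)) p = dl W y (dl W x D) (dd x p) \<oplus>\<^bsub>W\<^esub> dl W x D (p \<otimes> dd x y)"
          using x y p maps by (subst (1 2) dl_def) (simp add: M.a_ac)
        then show "dl W y (\<lambda>p. dl W x D (dd x p)) p = dl W x ?E (dd x p) \<oplus>\<^bsub>W\<^esub> dl W x D (dd x y \<otimes> p)"
          using dl_commute[OF maps, of x y "dd x p"] x y p by (simp add: R.m_comm)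
      qed
      also have "\<dots> = euler ?E p \<oplus>\<^bsub>W\<^esub> lsum W (\<lambda>x. dl W x D (dd x y \<otimes> p)) xs"
        unfolding euler_def using y p maps Em by (intro lsum_add) auto
      finally show ?thesis .
    qed
    have "DO W n (dl W y (\<lambda>p. euler D p \<oplus>\<^bsub>W\<^esub> (\<ominus> nu (Suc n)) \<odot>\<^bsub>W\<^esub> D p))"
    proof (rule DO_sum_decomp)
      show "DO W n (\<lambda>p. euler ?E p \<oplus>\<^bsub>W\<^esub> (\<ominus> nu n) \<odot>\<^bsub>W\<^esub> ?E p)" using DE by (rule Suc.IH)
      show "DO W n (\<lambda>p. (\<ominus> \<one>) \<odot>\<^bsub>W\<^esub> esym D y p)"
        using DO_esym[OF Suc.prems y] by (intro DO_smult) auto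
      fix p assume p: "p \<in> carrier A"
      define L where "L = lsum W (\<lambda>x. dl W x D (dd x y \<otimes> p)) xs"
      have L: "L \<in> carrier W" unfolding L_def using maps y p by (intro lsum_closed) auto
      have "dl W y (\<lambda>p. euler D p \<oplus>\<^bsub>W\<^esub> (\<ominus> nu (Suc n)) \<odot>\<^bsub>W\<^esub> D p) p =
          dl W y (euler D) p \<oplus>\<^bsub>W\<^esub> (\<ominus> nu (Suc n)) \<odot>\<^bsub>W\<^esub> ?E p"
        using eu maps y p by (subst dl_add) (auto simp: dl_smult)
      also have "\<dots> = euler ?E p \<oplus>\<^bsub>W\<^esub> (\<ominus> nu n) \<odot>\<^bsub>W\<^esub> ?E p \<oplus>\<^bsub>W\<^esub> (\<ominus> \<one>) \<odot>\<^bsub>W\<^esub> esym D y p"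
      proof -
        have "euler ?E p \<in> carrier W" "?E p \<in> carrier W" using euE Em p by auto
        then show ?thesis using L
          by (simp add: e1[OF p] esym_def L_def[symmetric] nu_Suc R.minus_add smult_l_distr smult_r_distr
              neg_one_smult M.a_ac M.minus_add)
      qed
      finally show "dl W y (\<lambda>p. euler D p \<oplus>\<^bsub>W\<^esub> (\<ominus> nu (Suc n)) \<odot>\<^bsub>W\<^esub> D p) p =
        euler ?E p \<oplus>\<^bsub>W\<^esub> (\<ominus> nu n) \<odot>\<^bsub>W\<^esub> ?E p \<oplus>\<^bsub>W\<^esub> (\<ominus> \<one>) \<odot>\<^bsub>W\<^esub> esym D y p" .
    qed
    then show ?thesis by (simp add: DO_def)
  qed
  with kl show ?case by (simp add: DO_def)
qed

text \<open>The Euler relation solved for \<open>D\<close>. Inductions over the order of a single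
  operator run on this decomposition: composing with coordinate derivations is the only way in which
  order is produced.\<close>

lemma DO_split:
  assumes "DO W (Suc (Suc n)) D"
  obtains E F where "DO W (Suc n) E" "\<And>x. x \<in> set xs \<Longrightarrow> DO W (Suc n) (F x)"
    "\<And>p. p \<in> carrier A \<Longrightarrow> D p = lsum W (\<lambda>x. F x (dd x p)) xs \<oplus>\<^bsub>W\<^esub> E p"
proof -
  have maps: "D \<in> carrier A \<rightarrow> carrier W" by (rule DO_maps[OF assms])
  \<comment> \<open>The order is < n + 2, so the symbol has degree n + 1.\<close>
  define u where "u = inv (nu (Suc n))"
  have unit: "nu (Suc n) \<in> Units A" unfolding nu_def by (rule rational) simp
  then have u: "u \<in> carrier A" "u \<otimes> nu (Suc n) = \<one>" by (simp_all add: u_def)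
  let ?R = "\<lambda>p. euler D p \<oplus>\<^bsub>W\<^esub> (\<ominus> nu (Suc n)) \<odot>\<^bsub>W\<^esub> D p"
  have R: "DO W (Suc n) ?R" using assms by (rule DO_euler)
  show ?thesis
  proof
    show "DO W (Suc n) (\<lambda>p. (\<ominus> u) \<odot>\<^bsub>W\<^esub> ?R p)" using R u by (intro DO_smult) auto
    show "DO W (Suc n) (\<lambda>p. u \<odot>\<^bsub>W\<^esub> dl W x D p)" if "x \<in> set xs" for x
      using DO_dl[OF assms, of x] that u by (intro DO_smult) auto
    fix p assume p: "p \<in> carrier A"
    have c: "euler D p \<in> carrier W" "D p \<in> carrier W"
      using DO_closed[OF DO_euler_sum[OF assms] p] maps p by auto
    have "lsum W (\<lambda>x. u \<odot>\<^bsub>W\<^esub> dl W x D (dd x p)) xs = u \<odot>\<^bsub>W\<^esub> euler D p"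
      unfolding euler_def using maps p u by (intro lsum_smult[symmetric]) auto
    moreover have "(\<ominus> u) \<odot>\<^bsub>W\<^esub> ?R p = \<ominus>\<^bsub>W\<^esub> (u \<odot>\<^bsub>W\<^esub> euler D p) \<oplus>\<^bsub>W\<^esub> (u \<otimes> nu (Suc n)) \<odot>\<^bsub>W\<^esub> D p"
      using c u(1) by (simp add: smult_r_distr smult_l_minus smult_r_minus smult_assoc1[symmetric] R.l_minus R.r_minus)
    ultimately show "D p = lsum W (\<lambda>x. u \<odot>\<^bsub>W\<^esub> dl W x D (dd x p)) xs \<oplus>\<^bsub>W\<^esub> (\<ominus> u) \<odot>\<^bsub>W\<^esub> ?R p"
      using c u by (simp add: u(2) M.cancel_simps)
  qed
qed

end

section \<open>Spencer complexes\<close>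

context diffcalc
begin

definition tuples :: "nat \<Rightarrow> 'u list set" where
  "tuples i = {bs. length bs = i \<and> set bs \<subseteq> carrier A}"

lemma tuples_0 [simp]: "bs \<in> tuples 0 \<longleftrightarrow> bs = []"
  by (auto simp: tuples_def)

lemma tuples_Nil [simp]: "[] \<in> tuples i \<longleftrightarrow> i = 0"
  by (auto simp: tuples_def)

lemma tuples_Cons [simp]: "b # bs \<in> tuples (Suc i) \<longleftrightarrow> b \<in> carrier A \<and> bs \<in> tuples i"
  by (auto simp: tuples_def)

lemma tuples_SucE:
  assumes "bs \<in> tuples (Suc i)"
  obtains c cs where "bs = c # cs" "c \<in> carrier A" "cs \<in> tuples i"
  using assms by (cases bs) (auto simp: tuples_def)

text \<open>\<open>Sp W S n i\<close> consists of the skew forms in \<open>i\<close> arguments whose values are operators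
  \<open>A \<rightarrow> S \<subseteq> W\<close> of order \<open>< n\<close> and which are derivations in each argument for the module structure
  by which the ring acts on the arguments of the operators.\<close>

primrec Sp :: "('u, 'w) module \<Rightarrow> 'w set \<Rightarrow> nat \<Rightarrow> nat \<Rightarrow> ('u list \<Rightarrow> 'u \<Rightarrow> 'w) \<Rightarrow> bool" where
  "Sp W S n 0 \<theta> \<longleftrightarrow> DO W n (\<theta> []) \<and> \<theta> [] \<in> carrier A \<rightarrow> S"
| "Sp W S n (Suc i) \<theta> \<longleftrightarrow> (\<forall>b\<in>carrier A. Sp W S n i (\<lambda>bs. \<theta> (b # bs))) \<and>
     (\<forall>bs\<in>tuples i. pder W (\<lambda>b. \<theta> (b # bs))) \<and>
     (\<forall>b\<in>carrier A. \<forall>c\<in>carrier A. \<forall>bs. \<forall>a\<in>carrier A. c # bs \<in> tuples i \<longrightarrow>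
        \<theta> (b # c # bs) a \<oplus>\<^bsub>W\<^esub> \<theta> (c # b # bs) a = \<zero>\<^bsub>W\<^esub>)"

text \<open>The Spencer differential: the argument of the operator moves into the first slot of the
  form and the operator is evaluated at one. The degree of the form goes down by one, the order goes
  up by one.\<close>

definition dS :: "('u list \<Rightarrow> 'u \<Rightarrow> 'w) \<Rightarrow> 'u list \<Rightarrow> 'u \<Rightarrow> 'w" where
  "dS \<theta> bs a = \<theta> (a # bs) \<one>"

text \<open>The alternating sum in which each entry in turn becomes the distinguished argument of
  \<open>\<eta>\<close> while the others keep their order. There is no normalizing factor, so a form
  which is skew already is multiplied by its degree.\<close>

primrec alt :: "('u, 'w) module \<Rightarrow> 'u list \<Rightarrow> ('u \<Rightarrow> 'u list \<Rightarrow> 'u \<Rightarrow> 'w) \<Rightarrow> 'u \<Rightarrow> 'w" where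
  "alt W [] \<eta> = (\<lambda>a. \<zero>\<^bsub>W\<^esub>)"
| "alt W (b # bs) \<eta> = (\<lambda>a. \<eta> b bs a \<oplus>\<^bsub>W\<^esub> (\<ominus> \<one>) \<odot>\<^bsub>W\<^esub> alt W bs (\<lambda>x r. \<eta> x (b # r)) a)"

text \<open>Additive closure only: the sets \<open>DR 0 s Q\<close>, in which forms are going to
  take their values, are in general not stable under the action on arguments.\<close>

definition subgrp :: "('u, 'w) module \<Rightarrow> 'w set \<Rightarrow> bool" where
  "subgrp W S \<longleftrightarrow> S \<subseteq> carrier W \<and> \<zero>\<^bsub>W\<^esub> \<in> S \<and> (\<forall>x\<in>S. \<forall>y\<in>S. x \<oplus>\<^bsub>W\<^esub> y \<in> S) \<and>
     (\<forall>x\<in>S. (\<ominus> \<one>) \<odot>\<^bsub>W\<^esub> x \<in> S)"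

text \<open>\<open>regular2\<close> and \<open>regular1\<close> state the exactness of the Spencer complexes of operators with values in
  \<open>S\<close> above and in the lowest order: the symbol module of such operators is regular in the
  sense of Castelnuovo and Mumford.\<close>

definition dropping :: "('u, 'w) module \<Rightarrow> nat \<Rightarrow> nat \<Rightarrow> ('u list \<Rightarrow> 'u \<Rightarrow> 'w) \<Rightarrow> bool" where
  "dropping W n i \<theta> \<longleftrightarrow> (\<forall>j. i = Suc j \<longrightarrow> (\<forall>bs\<in>tuples j. ord W n (dS \<theta> bs)))"

definition closed_form :: "('u, 'w) module \<Rightarrow> nat \<Rightarrow> ('u list \<Rightarrow> 'u \<Rightarrow> 'w) \<Rightarrow> bool" where
  "closed_form W i \<theta> \<longleftrightarrow> (case i of 0 \<Rightarrow> \<theta> [] \<one> = \<zero>\<^bsub>W\<^esub>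
     | Suc j \<Rightarrow> (\<forall>bs\<in>tuples j. \<forall>a\<in>carrier A. dS \<theta> bs a = \<zero>\<^bsub>W\<^esub>))"

definition regular2 :: "('u, 'w) module \<Rightarrow> 'w set \<Rightarrow> bool" where
  "regular2 W S \<longleftrightarrow> (\<forall>q i \<theta>. Sp W S (Suc (Suc (Suc q))) i \<theta> \<longrightarrow> dropping W (Suc (Suc (Suc q))) i \<theta> \<longrightarrow>
     (\<exists>\<psi>. Sp W S (Suc (Suc q)) (Suc i) \<psi> \<and> Sp W S (Suc (Suc q)) i (\<lambda>bs a. \<theta> bs a \<oplus>\<^bsub>W\<^esub> dS \<psi> bs a)))"

definition regular1 :: "('u, 'w) module \<Rightarrow> 'w set \<Rightarrow> bool" where
  "regular1 W S \<longleftrightarrow> (\<forall>i \<theta>. Sp W S 2 i \<theta> \<longrightarrow> closed_form W i \<theta> \<longrightarrow>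
     (\<exists>\<psi>. Sp W S 2 (Suc i) \<psi> \<and> (\<forall>bs\<in>tuples i. \<forall>a\<in>carrier A. \<theta> bs a = dS \<psi> bs a)))"

lemma Sp_cong:
  assumes "\<And>bs a. bs \<in> tuples i \<Longrightarrow> a \<in> carrier A \<Longrightarrow> \<theta> bs a = \<phi> bs a"
  shows "Sp W S n i \<theta> = Sp W S n i \<phi>"
  using assms
proof (induction i arbitrary: \<theta> \<phi>)
  case 0
  have "DO W n (\<theta> []) = DO W n (\<phi> [])" using 0 by (intro DO_cong) auto
  moreover have "\<theta> [] \<in> carrier A \<rightarrow> S \<longleftrightarrow> \<phi> [] \<in> carrier A \<rightarrow> S" using 0 by (auto simp: Pi_def)
  ultimately show ?case by simp
next
  case (Suc i)
  have "Sp W S n i (\<lambda>bs. \<theta> (b # bs)) = Sp W S n i (\<lambda>bs. \<phi> (b # bs))" if "b \<in> carrier A" for b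
    using Suc.prems that by (intro Suc.IH) simp
  moreover have "pder W (\<lambda>b. \<theta> (b # bs)) = pder W (\<lambda>b. \<phi> (b # bs))" if "bs \<in> tuples i" for bs
    using Suc.prems that by (intro pder_cong) simp
  moreover have "\<theta> (b # c # bs) a = \<phi> (b # c # bs) a" "\<theta> (c # b # bs) a = \<phi> (c # b # bs) a"
    if "b \<in> carrier A" "c \<in> carrier A" "a \<in> carrier A" "c # bs \<in> tuples i" for b c bs a
    using that by (intro Suc.prems; cases i; simp)+
  ultimately show ?case by auto
qed

lemma Sp_carrier_update:
  "C \<subseteq> carrier W \<Longrightarrow> S \<subseteq> C \<Longrightarrow> Sp (W\<lparr>carrier := C\<rparr>) S n i \<theta> \<longleftrightarrow> Sp W S n i \<theta>"
  by (induction i arbitrary: \<theta>) (auto simp: DO_carrier_update)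

lemma one_K: "\<one> \<in> K"
  using subring_K by (rule subringE(3))

end

section \<open>Operations on skew forms of operators\<close>

context diffmod
begin

lemma subgrp_carrier: "subgrp W (carrier W)"
  by (simp add: subgrp_def)

lemma Sp_subset: "Sp W S n i \<theta> \<Longrightarrow> S \<subseteq> T \<Longrightarrow> Sp W T n i \<theta>"
  by (induction i arbitrary: \<theta>) auto

lemma Sp_DO: "Sp W S n i \<theta> \<Longrightarrow> bs \<in> tuples i \<Longrightarrow> DO W n (\<theta> bs)"
proof (induction i arbitrary: \<theta> bs)
  case (Suc i)
  from Suc.prems(2) show ?case
    by (rule tuples_SucE) (use Suc.prems(1) Suc.IH[of "\<lambda>bs. \<theta> (_ # bs)"] in auto)
qed simp

lemma Sp_range: "Sp W S n i \<theta> \<Longrightarrow> bs \<in> tuples i \<Longrightarrow> a \<in> carrier A \<Longrightarrow> \<theta> bs a \<in> S"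
proof (induction i arbitrary: \<theta> bs)
  case (Suc i)
  from Suc.prems(2) show ?case
    by (rule tuples_SucE) (use Suc.prems(1,3) Suc.IH[of "\<lambda>bs. \<theta> (_ # bs)"] in auto)
qed auto

lemma Sp_closed: "Sp W S n i \<theta> \<Longrightarrow> bs \<in> tuples i \<Longrightarrow> a \<in> carrier A \<Longrightarrow> \<theta> bs a \<in> carrier W"
  using DO_closed[OF Sp_DO] .

lemma SpD:
  assumes "Sp W S n (Suc i) \<theta>"
  shows "b \<in> carrier A \<Longrightarrow> Sp W S n i (\<lambda>bs. \<theta> (b # bs))"
    "bs \<in> tuples i \<Longrightarrow> pder W (\<lambda>b. \<theta> (b # bs))"
    "b \<in> carrier A \<Longrightarrow> c \<in> carrier A \<Longrightarrow> c # bs \<in> tuples i \<Longrightarrow> a \<in> carrier A \<Longrightarrow>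
       \<theta> (b # c # bs) a \<oplus>\<^bsub>W\<^esub> \<theta> (c # b # bs) a = \<zero>\<^bsub>W\<^esub>"
  using assms by auto

lemma Sp_change:
  assumes "Sp W S n i \<theta>" "\<And>bs. bs \<in> tuples i \<Longrightarrow> DO W m (\<theta> bs)"
    "\<And>bs a. bs \<in> tuples i \<Longrightarrow> a \<in> carrier A \<Longrightarrow> \<theta> bs a \<in> T"
  shows "Sp W T m i \<theta>"
  using assms by (induction i arbitrary: \<theta>) auto

lemma Sp_lower:
  assumes "Sp W S n i \<theta>" "\<And>bs. bs \<in> tuples i \<Longrightarrow> DO W m (\<theta> bs)"
  shows "Sp W S m i \<theta>"
  using assms Sp_range[OF assms(1)] by (intro Sp_change[OF assms(1)]) auto

lemma Sp_mono: "Sp W S n i \<theta> \<Longrightarrow> n \<le> m \<Longrightarrow> Sp W S m i \<theta>"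
  by (rule Sp_lower) (auto intro: DO_mono Sp_DO)

text \<open>Every operation on single operators that respects orders, the derivation rule and the
  vanishing of sums acts on forms. Scalars, \<open>dl\<close>, the action on arguments and
  evaluation of inner operators at one are all instances.\<close>

lemma Sp_map:
  assumes "Sp W S n i \<theta>"
    and DO: "\<And>bs. bs \<in> tuples i \<Longrightarrow> DO V m (\<lambda>a. F (\<theta> bs) a)"
    and rng: "\<And>bs a. bs \<in> tuples i \<Longrightarrow> a \<in> carrier A \<Longrightarrow> F (\<theta> bs) a \<in> T"
    and pder: "\<And>\<Phi>. pder W \<Phi> \<Longrightarrow> (\<And>b. b \<in> carrier A \<Longrightarrow> \<Phi> b \<in> carrier A \<rightarrow> carrier W) \<Longrightarrow> pder V (\<lambda>b. F (\<Phi> b))"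
    and add: "\<And>D E a. D \<in> carrier A \<rightarrow> carrier W \<Longrightarrow> E \<in> carrier A \<rightarrow> carrier W \<Longrightarrow>
      (\<And>a. a \<in> carrier A \<Longrightarrow> D a \<oplus>\<^bsub>W\<^esub> E a = \<zero>\<^bsub>W\<^esub>) \<Longrightarrow> a \<in> carrier A \<Longrightarrow> F D a \<oplus>\<^bsub>V\<^esub> F E a = \<zero>\<^bsub>V\<^esub>"
  shows "Sp V T m i (\<lambda>bs a. F (\<theta> bs) a)"
  using assms(1,2,3)
proof (induction i arbitrary: \<theta>)
  case 0
  then show ?case by auto
next
  case (Suc i)
  note sp = SpD[OF Suc.prems(1)]
  have maps: "\<theta> bs \<in> carrier A \<rightarrow> carrier W" if "bs \<in> tuples (Suc i)" for bs
    by (rule DO_maps[OF Sp_DO[OF Suc.prems(1) that]])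
  have 1: "Sp V T m i (\<lambda>bs a. F (\<theta> (b # bs)) a)" if "b \<in> carrier A" for b
    using sp(1)[OF that] Suc.prems(2,3) that by (intro Suc.IH[of "\<lambda>bs. \<theta> (b # bs)"]) auto
  have 2: "pder V (\<lambda>b. F (\<theta> (b # bs)))" if "bs \<in> tuples i" for bs
    using sp(2)[OF that] maps that by (intro pder[of "\<lambda>b. \<theta> (b # bs)"]) auto
  have 3: "F (\<theta> (b # c # bs)) a \<oplus>\<^bsub>V\<^esub> F (\<theta> (c # b # bs)) a = \<zero>\<^bsub>V\<^esub>"
    if "b \<in> carrier A" "c \<in> carrier A" "c # bs \<in> tuples i" "a \<in> carrier A" for b c bs a
    using that sp(3)[OF that(1-3)] by (intro add maps) (cases i; simp)+
  show ?case using 1 2 3 by simp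
qed

lemma Sp_smult:
  assumes "Sp W S n i \<theta>" "c \<in> carrier A" "\<And>x. x \<in> S \<Longrightarrow> c \<odot>\<^bsub>W\<^esub> x \<in> S"
  shows "Sp W S n i (\<lambda>bs a. c \<odot>\<^bsub>W\<^esub> \<theta> bs a)"
proof (rule Sp_map[OF assms(1), where F = "\<lambda>D a. c \<odot>\<^bsub>W\<^esub> D a"])
  show "DO W n (\<lambda>a. c \<odot>\<^bsub>W\<^esub> \<theta> bs a)" if "bs \<in> tuples i" for bs
    using Sp_DO[OF assms(1) that] assms(2) by (rule DO_smult)
  show "c \<odot>\<^bsub>W\<^esub> \<theta> bs a \<in> S" if "bs \<in> tuples i" "a \<in> carrier A" for bs a
    using Sp_range[OF assms(1) that] by (rule assms(3))
  show "pder W (\<lambda>b a. c \<odot>\<^bsub>W\<^esub> \<Phi> b a)" if "pder W \<Phi>" "\<And>b. b \<in> carrier A \<Longrightarrow> \<Phi> b \<in> carrier A \<rightarrow> carrier W" for \<Phi>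
    using that assms(2) by (intro pder_smult) auto
  show "c \<odot>\<^bsub>W\<^esub> D a \<oplus>\<^bsub>W\<^esub> c \<odot>\<^bsub>W\<^esub> E a = \<zero>\<^bsub>W\<^esub>"
    if "D \<in> carrier A \<rightarrow> carrier W" "E \<in> carrier A \<rightarrow> carrier W"
      "\<And>a. a \<in> carrier A \<Longrightarrow> D a \<oplus>\<^bsub>W\<^esub> E a = \<zero>\<^bsub>W\<^esub>" "a \<in> carrier A" for D E a
    using that assms(2) by (subst smult_r_distr[symmetric]) auto
qed

lemma Sp_neg: "Sp W S n i \<theta> \<Longrightarrow> subgrp W S \<Longrightarrow> Sp W S n i (\<lambda>bs a. (\<ominus> \<one>) \<odot>\<^bsub>W\<^esub> \<theta> bs a)"
  by (rule Sp_smult) (auto simp: subgrp_def)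

lemma Sp_dl:
  assumes "Sp W (carrier W) (Suc n) i \<theta>" "y \<in> carrier A"
  shows "Sp W (carrier W) n i (\<lambda>bs a. dl W y (\<theta> bs) a)"
proof (rule Sp_map[OF assms(1)])
  show DO: "DO W n (dl W y (\<theta> bs))" if "bs \<in> tuples i" for bs
    using Sp_DO[OF assms(1) that] assms(2) by (rule DO_dl)
  show "dl W y (\<theta> bs) a \<in> carrier W" if "bs \<in> tuples i" "a \<in> carrier A" for bs a
    using DO_closed[OF DO] that by blast
  show "pder W (\<lambda>b. dl W y (\<Phi> b))" if "pder W \<Phi>" "\<And>b. b \<in> carrier A \<Longrightarrow> \<Phi> b \<in> carrier A \<rightarrow> carrier W" for \<Phi>
    using that assms(2) by (intro pder_dl) auto
  show "dl W y D a \<oplus>\<^bsub>W\<^esub> dl W y E a = \<zero>\<^bsub>W\<^esub>"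
    if "D \<in> carrier A \<rightarrow> carrier W" "E \<in> carrier A \<rightarrow> carrier W"
      "\<And>a. a \<in> carrier A \<Longrightarrow> D a \<oplus>\<^bsub>W\<^esub> E a = \<zero>\<^bsub>W\<^esub>" "a \<in> carrier A" for D E a
    using that assms(2) by (subst dl_add[symmetric]) (auto simp: dl_def)
qed

text \<open>Arguments change but the set of values does not grow, so this action on forms exists
  even where \<open>S\<close> is merely a subgroup.\<close>

lemma Sp_plus:
  assumes "Sp W S n i \<theta>" "c \<in> carrier A"
  shows "Sp W S n i (\<lambda>bs a. \<theta> bs (c \<otimes> a))"
proof (rule Sp_map[OF assms(1), where F = "\<lambda>D a. D (c \<otimes> a)"])
  show "DO W n (\<lambda>a. \<theta> bs (c \<otimes> a))" if "bs \<in> tuples i" for bs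
    using Sp_DO[OF assms(1) that] assms(2) by (rule DO_plus)
  show "\<theta> bs (c \<otimes> a) \<in> S" if "bs \<in> tuples i" "a \<in> carrier A" for bs a
    using Sp_range[OF assms(1)] that assms(2) by simp
  show "pder W (\<lambda>b a. \<Phi> b (c \<otimes> a))" if "pder W \<Phi>" for \<Phi>
    using that assms(2) unfolding pder_def by (simp add: R.m_lcomm K_carrier)
qed (use assms(2) in auto)

lemma Sp_zero: "subgrp W S \<Longrightarrow> Sp W S n i (\<lambda>bs a. \<zero>\<^bsub>W\<^esub>)"
  by (induction i) (auto simp: DO_zero subgrp_def pder_zero)

lemma Sp_add:
  assumes "Sp W S n i \<theta>" "Sp W S n i \<phi>" "subgrp W S"
  shows "Sp W S n i (\<lambda>bs a. \<theta> bs a \<oplus>\<^bsub>W\<^esub> \<phi> bs a)"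
  using assms(1,2)
proof (induction i arbitrary: \<theta> \<phi>)
  case 0
  then show ?case using assms(3) by (auto simp: subgrp_def Pi_iff intro!: DO_add)
next
  case (Suc i)
  note t = SpD[OF Suc.prems(1)] and p = SpD[OF Suc.prems(2)]
  have cl: "\<theta> bs a \<in> carrier W" "\<phi> bs a \<in> carrier W" if "bs \<in> tuples (Suc i)" "a \<in> carrier A" for bs a
    using Sp_closed[OF Suc.prems(1)] Sp_closed[OF Suc.prems(2)] that by auto
  have 1: "Sp W S n i (\<lambda>bs a. \<theta> (b # bs) a \<oplus>\<^bsub>W\<^esub> \<phi> (b # bs) a)" if "b \<in> carrier A" for b
    using t(1) p(1) that by (intro Suc.IH[of "\<lambda>bs. \<theta> (b # bs)" "\<lambda>bs. \<phi> (b # bs)"])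
  have 2: "pder W (\<lambda>b a. \<theta> (b # bs) a \<oplus>\<^bsub>W\<^esub> \<phi> (b # bs) a)" if "bs \<in> tuples i" for bs
    using t(2) p(2) cl that by (intro pder_add[of "\<lambda>b. \<theta> (b # bs)" "\<lambda>b. \<phi> (b # bs)"]) auto
  have 3: "(\<theta> (b # c # bs) a \<oplus>\<^bsub>W\<^esub> \<phi> (b # c # bs) a) \<oplus>\<^bsub>W\<^esub> (\<theta> (c # b # bs) a \<oplus>\<^bsub>W\<^esub> \<phi> (c # b # bs) a) = \<zero>\<^bsub>W\<^esub>"
    if "b \<in> carrier A" "c \<in> carrier A" "c # bs \<in> tuples i" "a \<in> carrier A" for b c bs a
  proof -
    have "b # c # bs \<in> tuples (Suc i)" "c # b # bs \<in> tuples (Suc i)" using that by (cases i; simp)+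
    then have "\<theta> (b # c # bs) a \<in> carrier W" "\<theta> (c # b # bs) a \<in> carrier W"
      "\<phi> (b # c # bs) a \<in> carrier W" "\<phi> (c # b # bs) a \<in> carrier W" using cl that(4) by auto
    moreover from this have "(\<theta> (b # c # bs) a \<oplus>\<^bsub>W\<^esub> \<theta> (c # b # bs) a) \<oplus>\<^bsub>W\<^esub> (\<phi> (b # c # bs) a \<oplus>\<^bsub>W\<^esub> \<phi> (c # b # bs) a) = \<zero>\<^bsub>W\<^esub>"
      using t(3)[OF that] p(3)[OF that] by simp
    ultimately show ?thesis by (simp add: M.a_ac)
  qed
  show ?case using 1 2 3 by simp
qed

lemma Sp_lsum:
  assumes "\<And>x. x \<in> set ys \<Longrightarrow> Sp W S n i (\<theta> x)" "subgrp W S"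
  shows "Sp W S n i (\<lambda>bs a. lsum W (\<lambda>x. \<theta> x bs a) ys)"
  using assms(1)
proof (induction ys)
  case Nil then show ?case using Sp_zero[OF assms(2)] by simp
next
  case (Cons x ys)
  then show ?case by (simp add: Sp_add[OF _ _ assms(2)])
qed

text \<open>In degree one this is \<open>DO_merge_pder\<close>. In higher degree skewness moves a
  remaining slot to the front, and the point is the product rule in that slot.\<close>

lemma Sp_d:
  assumes "Sp W S n (Suc i) \<theta>" "subgrp W S"
  shows "Sp W S (Suc n) i (dS \<theta>)"
  using assms(1)
proof (induction i arbitrary: \<theta>)
  case 0
  note sp = SpD[OF 0]
  have "DO W n (\<theta> [b])" "\<theta> [b] \<in> carrier A \<rightarrow> S" if "b \<in> carrier A" for b
    using sp(1)[OF that] by simp_all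
  then show ?case
    using DO_merge_pder[of "\<lambda>b. \<theta> [b]" n] sp(2)[of "[]"] by (auto simp: dS_def[abs_def])
next
  case (Suc i)
  note sp = SpD[OF Suc.prems]
  have cl: "\<theta> bs a \<in> carrier W" if "bs \<in> tuples (Suc (Suc i))" "a \<in> carrier A" for bs a
    using Sp_closed[OF Suc.prems] that by blast
  have swap: "\<theta> (c # b # bs) a = (\<ominus> \<one>) \<odot>\<^bsub>W\<^esub> \<theta> (b # c # bs) a"
    if "b \<in> carrier A" "c \<in> carrier A" "bs \<in> tuples i" "a \<in> carrier A" for b c bs a
  proof -
    have "\<theta> (c # b # bs) a \<oplus>\<^bsub>W\<^esub> \<theta> (b # c # bs) a = \<zero>\<^bsub>W\<^esub>" using sp(3) that by simp
    moreover have "\<theta> (b # c # bs) a \<in> carrier W" "\<theta> (c # b # bs) a \<in> carrier W" using cl that by auto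
    ultimately show ?thesis by (simp add: neg_one_smult M.minus_equality[symmetric])
  qed
  have 1: "Sp W S (Suc n) i (\<lambda>bs. dS \<theta> (b # bs))" if b: "b \<in> carrier A" for b
  proof -
    have "Sp W S (Suc n) i (\<lambda>bs a. (\<ominus> \<one>) \<odot>\<^bsub>W\<^esub> dS (\<lambda>bs. \<theta> (b # bs)) bs a)"
      using Suc.IH[OF sp(1)[OF b]] assms(2) by (rule Sp_neg)
    then show ?thesis
      by (rule Sp_cong[THEN iffD1, rotated]) (simp add: dS_def swap[OF b, symmetric])
  qed
  have 2: "pder W (\<lambda>b. dS \<theta> (b # bs))" if bs: "bs \<in> tuples i" for bs
  proof -
    have t: "\<theta> (a # b # bs) c \<in> carrier W" if "a \<in> carrier A" "b \<in> carrier A" "c \<in> carrier A" for a b c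
      using that bs cl by simp
    have pa: "pder W (\<lambda>b. \<theta> (b # a # bs))" if "a \<in> carrier A" for a
      using sp(2)[of "a # bs"] that bs by simp
    have add: "\<theta> (a # (b \<oplus> c) # bs) \<one> = \<theta> (a # b # bs) \<one> \<oplus>\<^bsub>W\<^esub> \<theta> (a # c # bs) \<one>"
      if "a \<in> carrier A" "b \<in> carrier A" "c \<in> carrier A" for a b c
      using that bs t by (simp add: swap[of _ a] pderD(1)[OF pa] smult_r_distr)
    \<comment> \<open>Both sides are expanded by the product rule in the first slot. The two terms
      in which \<open>b\<close> and \<open>c\<close> both occupy slots cancel by skewness.\<close>
    have mult: "\<theta> (a # (b \<otimes> c) # bs) \<one> = \<theta> ((c \<otimes> a) # b # bs) \<one> \<oplus>\<^bsub>W\<^esub> \<theta> ((b \<otimes> a) # c # bs) \<one>"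
      if abc: "a \<in> carrier A" "b \<in> carrier A" "c \<in> carrier A" for a b c
    proof -
      have "\<theta> (a # (b \<otimes> c) # bs) \<one> = (\<ominus> \<one>) \<odot>\<^bsub>W\<^esub> (\<theta> (b # a # bs) c \<oplus>\<^bsub>W\<^esub> \<theta> (c # a # bs) b)"
        using that bs t by (simp add: swap[of "b \<otimes> c" a] pderD(2)[OF pa])
      also have "\<dots> = \<theta> (a # b # bs) c \<oplus>\<^bsub>W\<^esub> \<theta> (a # c # bs) b"
        using that bs t by (simp add: swap[of b a] swap[of c a] smult_r_distr)
      finally have l: "\<theta> (a # (b \<otimes> c) # bs) \<one> = \<theta> (a # b # bs) c \<oplus>\<^bsub>W\<^esub> \<theta> (a # c # bs) b" .
      have "\<theta> ((c \<otimes> a) # b # bs) \<one> = \<theta> (c # b # bs) a \<oplus>\<^bsub>W\<^esub> \<theta> (a # b # bs) c"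
        "\<theta> ((b \<otimes> a) # c # bs) \<one> = \<theta> (b # c # bs) a \<oplus>\<^bsub>W\<^esub> \<theta> (a # c # bs) b"
        using abc by (simp_all add: pderD(2)[OF pa])
      moreover have "\<theta> (c # b # bs) a \<oplus>\<^bsub>W\<^esub> \<theta> (b # c # bs) a = \<zero>\<^bsub>W\<^esub>" using sp(3) abc bs by simp
      moreover have "(p \<oplus>\<^bsub>W\<^esub> q) \<oplus>\<^bsub>W\<^esub> (r \<oplus>\<^bsub>W\<^esub> s) = q \<oplus>\<^bsub>W\<^esub> s"
        if "p \<in> carrier W" "q \<in> carrier W" "r \<in> carrier W" "s \<in> carrier W" "p \<oplus>\<^bsub>W\<^esub> r = \<zero>\<^bsub>W\<^esub>" for p q r s
      proof -
        have "(p \<oplus>\<^bsub>W\<^esub> q) \<oplus>\<^bsub>W\<^esub> (r \<oplus>\<^bsub>W\<^esub> s) = (p \<oplus>\<^bsub>W\<^esub> r) \<oplus>\<^bsub>W\<^esub> (q \<oplus>\<^bsub>W\<^esub> s)"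
          using that(1-4) by (simp add: M.a_ac)
        then show ?thesis using that by simp
      qed
      ultimately have "\<theta> ((c \<otimes> a) # b # bs) \<one> \<oplus>\<^bsub>W\<^esub> \<theta> ((b \<otimes> a) # c # bs) \<one> =
         \<theta> (a # b # bs) c \<oplus>\<^bsub>W\<^esub> \<theta> (a # c # bs) b"
        using t abc by simp
      with l show ?thesis by simp
    qed
    have "\<theta> (a # c # bs) \<one> = \<zero>\<^bsub>W\<^esub>" if "c \<in> K" "a \<in> carrier A" for a c
      using that bs K_carrier[OF that(1)] pder_K[OF pa that(1), of a \<one>] by (simp add: swap[of c a])
    then show ?thesis using add mult by (simp add: pder_def dS_def)
  qed
  have 3: "dS \<theta> (b # c # bs) a \<oplus>\<^bsub>W\<^esub> dS \<theta> (c # b # bs) a = \<zero>\<^bsub>W\<^esub>"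
    if "b \<in> carrier A" "c \<in> carrier A" "c # bs \<in> tuples i" "a \<in> carrier A" for b c bs a
    using SpD(3)[OF sp(1)[OF that(4)]] that by (simp add: dS_def)
  show ?case using 1 2 3 by simp
qed

text \<open>Contracting twice puts one into the first slot, and derivations kill
  \<open>K\<close>.\<close>

lemma dS_dS:
  assumes "Sp W S n (Suc (Suc i)) \<theta>" "bs \<in> tuples i" "a \<in> carrier A"
  shows "dS (dS \<theta>) bs a = \<zero>\<^bsub>W\<^esub>"
  using pder_K[OF SpD(2)[OF assms(1), of "a # bs"] one_K] assms(2,3) by (simp add: dS_def)

lemma alt_closed:
  assumes "\<And>x r. x \<in> carrier A \<Longrightarrow> r \<in> tuples i \<Longrightarrow> \<eta> x r a \<in> carrier W" "bs \<in> tuples (Suc i)"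
  shows "alt W bs \<eta> a \<in> carrier W"
  using assms
proof (induction i arbitrary: bs \<eta>)
  case 0
  then show ?case by (auto elim!: tuples_SucE)
next
  case (Suc i)
  from Suc.prems(2) obtain c cs where c: "bs = c # cs" "c \<in> carrier A" "cs \<in> tuples (Suc i)"
    by (rule tuples_SucE)
  have "alt W cs (\<lambda>x r. \<eta> x (c # r)) a \<in> carrier W"
    using Suc.prems(1) c by (intro Suc.IH) auto
  then show ?case using Suc.prems(1) c by simp
qed

lemma alt_cong:
  assumes "\<And>x r. x \<in> carrier A \<Longrightarrow> r \<in> tuples i \<Longrightarrow> \<eta> x r a = \<zeta> x r c" "bs \<in> tuples (Suc i)"
  shows "alt W bs \<eta> a = alt W bs \<zeta> c"
  using assms
proof (induction i arbitrary: bs \<eta> \<zeta>)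
  case 0
  then show ?case by (auto elim!: tuples_SucE)
next
  case (Suc i)
  from Suc.prems(2) obtain d ds where d: "bs = d # ds" "d \<in> carrier A" "ds \<in> tuples (Suc i)"
    by (rule tuples_SucE)
  have "alt W ds (\<lambda>x r. \<eta> x (d # r)) a = alt W ds (\<lambda>x r. \<zeta> x (d # r)) c"
    using Suc.prems(1) d by (intro Suc.IH) auto
  then show ?case using Suc.prems(1) d by simp
qed

lemma alt_add:
  assumes "\<And>x r. x \<in> carrier A \<Longrightarrow> r \<in> tuples i \<Longrightarrow> \<eta> x r a \<in> carrier W"
    "\<And>x r. x \<in> carrier A \<Longrightarrow> r \<in> tuples i \<Longrightarrow> \<zeta> x r a \<in> carrier W" "bs \<in> tuples (Suc i)"
  shows "alt W bs (\<lambda>x r a. \<eta> x r a \<oplus>\<^bsub>W\<^esub> \<zeta> x r a) a = alt W bs \<eta> a \<oplus>\<^bsub>W\<^esub> alt W bs \<zeta> a"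
  using assms
proof (induction i arbitrary: bs \<eta> \<zeta>)
  case 0
  then show ?case by (auto elim!: tuples_SucE)
next
  case (Suc i)
  from Suc.prems(3) obtain d ds where d: "bs = d # ds" "d \<in> carrier A" "ds \<in> tuples (Suc i)"
    by (rule tuples_SucE)
  have "alt W ds (\<lambda>x r. \<eta> x (d # r)) a \<in> carrier W" "alt W ds (\<lambda>x r. \<zeta> x (d # r)) a \<in> carrier W"
    using Suc.prems(1,2) d by (auto intro!: alt_closed[where i = i])
  moreover have "alt W ds (\<lambda>x r a. \<eta> x (d # r) a \<oplus>\<^bsub>W\<^esub> \<zeta> x (d # r) a) a =
      alt W ds (\<lambda>x r. \<eta> x (d # r)) a \<oplus>\<^bsub>W\<^esub> alt W ds (\<lambda>x r. \<zeta> x (d # r)) a"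
    using Suc.prems(1,2) d by (intro Suc.IH[of "\<lambda>x r. \<eta> x (d # r)" "\<lambda>x r. \<zeta> x (d # r)"]) auto
  moreover have "\<eta> d ds a \<in> carrier W" "\<zeta> d ds a \<in> carrier W" using Suc.prems(1,2) d by auto
  ultimately show ?case using d by (simp add: smult_r_distr M.a_ac)
qed

lemma alt_zero: "alt W bs (\<lambda>x r a. \<zero>\<^bsub>W\<^esub>) = (\<lambda>a. \<zero>\<^bsub>W\<^esub>)"
  by (induction bs) simp_all

lemma alt_DO:
  assumes "\<And>x r. x \<in> carrier A \<Longrightarrow> r \<in> tuples i \<Longrightarrow> DO W n (\<eta> x r)" "bs \<in> tuples (Suc i)"
  shows "DO W n (alt W bs \<eta>)"
  using assms
proof (induction i arbitrary: bs \<eta>)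
  case 0
  from 0(2) obtain c where c: "bs = [c]" "c \<in> carrier A" by (auto elim!: tuples_SucE)
  have "DO W n (\<lambda>a. \<eta> c [] a \<oplus>\<^bsub>W\<^esub> (\<ominus> \<one>) \<odot>\<^bsub>W\<^esub> \<zero>\<^bsub>W\<^esub>)"
    using 0(1) c by (intro DO_add DO_smult DO_zero) auto
  then show ?case using c by simp
next
  case (Suc i)
  from Suc.prems(2) obtain c cs where c: "bs = c # cs" "c \<in> carrier A" "cs \<in> tuples (Suc i)"
    by (rule tuples_SucE)
  have "DO W n (alt W cs (\<lambda>x r. \<eta> x (c # r)))"
    using Suc.prems(1) c by (intro Suc.IH) auto
  then show ?case using Suc.prems(1) c by (simp add: DO_add DO_smult)
qed

lemma alt_pder:
  assumes "\<And>x r. x \<in> carrier A \<Longrightarrow> r \<in> tuples i \<Longrightarrow> pder W (\<lambda>b. \<zeta> b x r)"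
    "\<And>b x r a. b \<in> carrier A \<Longrightarrow> x \<in> carrier A \<Longrightarrow> r \<in> tuples i \<Longrightarrow> a \<in> carrier A \<Longrightarrow> \<zeta> b x r a \<in> carrier W"
    "bs \<in> tuples (Suc i)"
  shows "pder W (\<lambda>b. alt W bs (\<zeta> b))"
  using assms
proof (induction i arbitrary: bs \<zeta>)
  case 0
  from 0(3) obtain c where c: "bs = [c]" "c \<in> carrier A" by (auto elim!: tuples_SucE)
  have "pder W (\<lambda>b a. \<zeta> b c [] a \<oplus>\<^bsub>W\<^esub> (\<ominus> \<one>) \<odot>\<^bsub>W\<^esub> \<zero>\<^bsub>W\<^esub>)"
    using 0(1)[of c "[]"] 0(2) c by (intro pder_add[of "\<lambda>b. \<zeta> b c []"]) (auto simp: pder_zero)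
  then show ?case using c by simp
next
  case (Suc i)
  from Suc.prems(3) obtain c cs where c: "bs = c # cs" "c \<in> carrier A" "cs \<in> tuples (Suc i)"
    by (rule tuples_SucE)
  have cl: "alt W cs (\<lambda>x r. \<zeta> b x (c # r)) a \<in> carrier W" if "b \<in> carrier A" "a \<in> carrier A" for b a
    using Suc.prems(2) c that by (intro alt_closed[where i = i]) auto
  have "pder W (\<lambda>b. alt W cs (\<lambda>x r. \<zeta> b x (c # r)))"
    using Suc.prems(1,2) c by (intro Suc.IH[of "\<lambda>b x r. \<zeta> b x (c # r)"]) auto
  then have "pder W (\<lambda>b a. (\<ominus> \<one>) \<odot>\<^bsub>W\<^esub> alt W cs (\<lambda>x r. \<zeta> b x (c # r)) a)"
    using cl by (intro pder_smult) auto
  then have "pder W (\<lambda>b a. \<zeta> b c cs a \<oplus>\<^bsub>W\<^esub> (\<ominus> \<one>) \<odot>\<^bsub>W\<^esub> alt W cs (\<lambda>x r. \<zeta> b x (c # r)) a)"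
    using cl c Suc.prems(1)[of c cs] Suc.prems(2) by (intro pder_add[of "\<lambda>b. \<zeta> b c cs"]) auto
  then show ?case using c by simp
qed

text \<open>Skewness in the first two slots: the terms in which \<open>b\<close> or \<open>c\<close>
  is distinguished cancel in pairs because of the sign in \<open>alt\<close>, the remaining ones by
  skewness of the \<open>\<eta> x\<close>.\<close>

lemma Sp_alt:
  assumes "\<And>b. b \<in> carrier A \<Longrightarrow> Sp W S n i (\<eta> b)" "\<And>bs. bs \<in> tuples i \<Longrightarrow> pder W (\<lambda>b. \<eta> b bs)"
    "subgrp W S"
  shows "Sp W S n (Suc i) (\<lambda>bs. alt W bs \<eta>)"
  using assms(1,2)
proof (induction i arbitrary: \<eta>)
  case 0
  have "Sp W S n (Suc 0) (\<lambda>bs. \<eta> (hd bs) [])" using 0 by simp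
  then show ?case
  proof (rule Sp_cong[THEN iffD1, rotated])
    fix bs :: "'u list" and a assume "bs \<in> tuples (Suc 0)" and a: "a \<in> carrier A"
    then obtain b where b: "bs = [b]" "b \<in> carrier A" by (auto elim!: tuples_SucE)
    moreover have "\<eta> b [] a \<in> carrier W" using Sp_closed[OF 0(1)[OF b(2)]] a by simp
    ultimately show "\<eta> (hd bs) [] a = alt W bs \<eta> a" by simp
  qed
next
  case (Suc i)
  have cl: "\<eta> b bs a \<in> carrier W" if "b \<in> carrier A" "bs \<in> tuples (Suc i)" "a \<in> carrier A" for b bs a
    using Sp_closed[OF Suc.prems(1)] that by blast
  have 1: "Sp W S n (Suc i) (\<lambda>bs. alt W (b # bs) \<eta>)" if b: "b \<in> carrier A" for b
  proof -
    have "Sp W S n (Suc i) (\<lambda>bs. alt W bs (\<lambda>x r. \<eta> x (b # r)))"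
      using SpD(1)[OF Suc.prems(1)] Suc.prems(2) b by (intro Suc.IH) auto
    then have "Sp W S n (Suc i) (\<lambda>bs a. (\<ominus> \<one>) \<odot>\<^bsub>W\<^esub> alt W bs (\<lambda>x r. \<eta> x (b # r)) a)"
      using assms(3) by (rule Sp_neg)
    from Sp_add[OF Suc.prems(1)[OF b] this assms(3)] show ?thesis by simp
  qed
  have 2: "pder W (\<lambda>b. alt W (b # bs) \<eta>)" if bs: "bs \<in> tuples (Suc i)" for bs
  proof -
    have "pder W (\<lambda>b. alt W bs (\<lambda>x r. \<eta> x (b # r)))"
      using SpD(2)[OF Suc.prems(1)] cl bs by (intro alt_pder[where \<zeta> = "\<lambda>b x r. \<eta> x (b # r)"]) auto
    moreover have "alt W bs (\<lambda>x r. \<eta> x (b # r)) a \<in> carrier W" if "b \<in> carrier A" "a \<in> carrier A" for a b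
      using bs cl that by (intro alt_closed) auto
    ultimately have "pder W (\<lambda>b a. \<eta> b bs a \<oplus>\<^bsub>W\<^esub> (\<ominus> \<one>) \<odot>\<^bsub>W\<^esub> alt W bs (\<lambda>x r. \<eta> x (b # r)) a)"
      using Suc.prems(2)[OF bs] cl bs by (intro pder_add[of "\<lambda>b. \<eta> b bs"] pder_smult) auto
    then show ?thesis by simp
  qed
  have 3: "alt W (b # c # bs) \<eta> a \<oplus>\<^bsub>W\<^esub> alt W (c # b # bs) \<eta> a = \<zero>\<^bsub>W\<^esub>"
    if bc: "b \<in> carrier A" "c \<in> carrier A" "c # bs \<in> tuples (Suc i)" "a \<in> carrier A" for b c bs a
  proof -
    define u where "u = alt W bs (\<lambda>x s. \<eta> x (b # c # s)) a"
    define v where "v = alt W bs (\<lambda>x s. \<eta> x (c # b # s)) a"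
    have uv: "u \<in> carrier W \<and> v \<in> carrier W \<and> u \<oplus>\<^bsub>W\<^esub> v = \<zero>\<^bsub>W\<^esub>"
    proof (cases i)
      case 0 then show ?thesis using bc by (simp add: u_def v_def)
    next
      case (Suc j)
      have z: "\<eta> x (b # c # r) a \<oplus>\<^bsub>W\<^esub> \<eta> x (c # b # r) a = \<zero>\<^bsub>W\<^esub>" if "x \<in> carrier A" "r \<in> tuples j" for x r
        using SpD(3)[OF Suc.prems(1)[OF that(1)]] that bc Suc by simp
      have "u \<oplus>\<^bsub>W\<^esub> v = alt W bs (\<lambda>x r a. \<eta> x (b # c # r) a \<oplus>\<^bsub>W\<^esub> \<eta> x (c # b # r) a) a"
        unfolding u_def v_def using bc cl Suc by (intro alt_add[symmetric, where i = j]) auto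
      also have "\<dots> = alt W bs (\<lambda>x r a. \<zero>\<^bsub>W\<^esub>) a"
        using z bc Suc by (intro alt_cong[where i = j]) auto
      finally have "u \<oplus>\<^bsub>W\<^esub> v = \<zero>\<^bsub>W\<^esub>" by (simp add: alt_zero)
      moreover have "u \<in> carrier W" "v \<in> carrier W"
        unfolding u_def v_def using bc cl Suc by (intro alt_closed[where i = j]; simp)+
      ultimately show ?thesis by simp
    qed
    moreover have "\<eta> b (c # bs) a \<in> carrier W" "\<eta> c (b # bs) a \<in> carrier W" using cl bc by simp_all
    ultimately show ?thesis
      unfolding alt.simps u_def[symmetric] v_def[symmetric]
      by (simp add: neg_one_smult smult_r_distr M.minus_add M.a_ac M.cancel_simps)
  qed
  show ?case using 1 2 3 unfolding Sp.simps(2)[of _ _ _ "Suc i"] by blast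
qed

end

section \<open>The Koszul homotopy\<close>

context good_module
begin

lemma alt_self:
  assumes "Sp W S n i \<theta>" "bs \<in> tuples i" "a \<in> carrier A"
  shows "alt W bs (\<lambda>x r. \<theta> (x # r)) a = nu i \<odot>\<^bsub>W\<^esub> \<theta> bs a"
  using assms
proof (induction i arbitrary: \<theta> bs)
  case 0
  then show ?case using Sp_closed[OF 0(1)] by simp
next
  case (Suc i)
  from Suc.prems(2) obtain b cs where b: "bs = b # cs" "b \<in> carrier A" "cs \<in> tuples i"
    by (rule tuples_SucE)
  note sp = SpD[OF Suc.prems(1)]
  have cl: "\<theta> (b # cs) a \<in> carrier W" using Sp_closed[OF Suc.prems(1)] b Suc.prems by simp
  have IH: "alt W cs (\<lambda>x r. \<theta> (b # x # r)) a = nu i \<odot>\<^bsub>W\<^esub> \<theta> (b # cs) a"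
    using Suc.IH[OF sp(1)] b Suc.prems by simp
  have "alt W cs (\<lambda>x r. \<theta> (x # b # r)) a \<oplus>\<^bsub>W\<^esub> alt W cs (\<lambda>x r. \<theta> (b # x # r)) a = \<zero>\<^bsub>W\<^esub> \<and>
     alt W cs (\<lambda>x r. \<theta> (x # b # r)) a \<in> carrier W"
  proof (cases i)
    case 0 then show ?thesis using b by simp
  next
    case (Suc j)
    have c2: "\<theta> (x # y # r) a \<in> carrier W" if "x \<in> carrier A" "y \<in> carrier A" "r \<in> tuples j" for x y r
      using Sp_closed[OF Suc.prems(1)] that Suc.prems Suc by simp
    have "alt W cs (\<lambda>x r. \<theta> (x # b # r)) a \<oplus>\<^bsub>W\<^esub> alt W cs (\<lambda>x r. \<theta> (b # x # r)) a =
       alt W cs (\<lambda>x r a. \<theta> (x # b # r) a \<oplus>\<^bsub>W\<^esub> \<theta> (b # x # r) a) a"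
      using b Suc c2 by (intro alt_add[symmetric, where i = j]) auto
    also have "\<dots> = alt W cs (\<lambda>x r a. \<zero>\<^bsub>W\<^esub>) a"
      using sp(3)[of _ b] b Suc Suc.prems by (intro alt_cong[where i = j]) auto
    finally show ?thesis using b Suc c2 alt_closed[where i = j and \<eta> = "\<lambda>x r. \<theta> (x # b # r)"] by (simp add: alt_zero)
  qed
  then have "(\<ominus> \<one>) \<odot>\<^bsub>W\<^esub> alt W cs (\<lambda>x r. \<theta> (x # b # r)) a = nu i \<odot>\<^bsub>W\<^esub> \<theta> (b # cs) a"
    using cl unfolding IH by (metis M.minus_equality M.minus_minus M.a_comm neg_one_smult nu_closed smult_closed)
  then show ?case using b cl by (simp add: nu_Suc smult_l_distr M.a_comm)
qed

text \<open>A consequence of the product rule for \<open>y \<otimes> e \<otimes> a\<close>. On the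
  right every term contains a \<open>dl\<close> of an operator in \<open>a\<close>; if merging
  \<open>\<phi>\<close> does not raise its order, the sum on the left therefore has lower order than
  its summands.\<close>

lemma form_identity:
  assumes \<phi>: "pder W \<phi>" and cl: "\<And>b a. b \<in> carrier A \<Longrightarrow> a \<in> carrier A \<Longrightarrow> \<phi> b a \<in> carrier W"
    and y: "y \<in> carrier A" "e \<in> carrier A" "a \<in> carrier A"
  shows "dl W y (\<phi> a) e \<oplus>\<^bsub>W\<^esub> \<phi> y (e \<otimes> a) =
     dl W y (\<lambda>b. \<phi> b \<one>) (e \<otimes> a) \<oplus>\<^bsub>W\<^esub> (\<ominus> \<one>) \<odot>\<^bsub>W\<^esub> dl W y (\<phi> e) a"
proof -
  have "\<phi> (y \<otimes> e \<otimes> a) \<one> = \<phi> (y \<otimes> e) a \<oplus>\<^bsub>W\<^esub> \<phi> a (y \<otimes> e)"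
    using pderD(2)[OF \<phi>, of "y \<otimes> e" a \<one>] y by simp
  moreover have "\<phi> (y \<otimes> e) a = \<phi> y (e \<otimes> a) \<oplus>\<^bsub>W\<^esub> \<phi> e (y \<otimes> a)"
    using pderD(2)[OF \<phi>, of y e a] y by simp
  moreover have "\<phi> (e \<otimes> a) \<one> = \<phi> e a \<oplus>\<^bsub>W\<^esub> \<phi> a e"
    using pderD(2)[OF \<phi>, of e a \<one>] y by simp
  ultimately show ?thesis
    using y cl by (simp add: dl_def R.m_assoc smult_r_distr neg_one_smult smult_l_minus M.minus_add M.minus_minus M.a_ac M.cancel_simps)
qed

text \<open>\<open>dropping\<close> says that the symbol of \<open>\<theta>\<close> is a cycle of
  the symbol complex. The homotopy differentiates the symbol in the coordinates
  (\<open>\<eta>\<close>) and alternates; up to lower order \<open>dS\<close> of the result is q + 1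
  times \<open>\<theta>\<close> from the Euler operator and i times \<open>\<theta>\<close> from the
  slots, so division by q + 1 + i gives the correction. Both \<open>dl\<close> and scalars are
  applied to values, whence the full carrier as set of values.\<close>

lemma base_regular2:
  assumes \<theta>: "Sp W (carrier W) (Suc (Suc q)) i \<theta>" and drop: "dropping W (Suc (Suc q)) i \<theta>"
  obtains \<psi> where "Sp W (carrier W) (Suc q) (Suc i) \<psi>"
    "Sp W (carrier W) (Suc q) i (\<lambda>bs a. \<theta> bs a \<oplus>\<^bsub>W\<^esub> dS \<psi> bs a)"
proof -
  define \<eta> where "\<eta> b bs a = lsum W (\<lambda>x. dl W x (\<theta> bs) (dd x b \<otimes> a)) xs" for b bs a
  define \<psi>0 where "\<psi>0 bs = alt W bs \<eta>" for bs
  have DO\<theta>: "DO W (Suc (Suc q)) (\<theta> bs)" if "bs \<in> tuples i" for bs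
    using Sp_DO[OF \<theta> that] .
  have m\<theta>: "\<theta> bs \<in> carrier A \<rightarrow> carrier W" if "bs \<in> tuples i" for bs
    by (rule DO_maps[OF DO\<theta>[OF that]])
  have \<eta>Sp: "Sp W (carrier W) (Suc q) i (\<eta> b)" if "b \<in> carrier A" for b
    unfolding \<eta>_def[abs_def]
  proof (rule Sp_lsum[OF _ subgrp_carrier])
    show "Sp W (carrier W) (Suc q) i (\<lambda>bs a. dl W x (\<theta> bs) (dd x b \<otimes> a))" if "x \<in> set xs" for x
      using Sp_dl[OF \<theta>, of x] that \<open>b \<in> carrier A\<close>
      by (intro Sp_plus[where \<theta> = "\<lambda>bs a. dl W x (\<theta> bs) a"]) auto
  qed
  have \<eta>p: "pder W (\<lambda>b. \<eta> b bs)" if "bs \<in> tuples i" for bs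
    unfolding \<eta>_def[abs_def]
  proof (rule pder_lsum)
    fix x assume x: "x \<in> set xs"
    have "Klin W (dl W x (\<theta> bs))" using DO_dl[OF DO\<theta>[OF that], of x] x by (simp add: DO_def)
    then show "pder W (\<lambda>b a. dl W x (\<theta> bs) (dd x b \<otimes> a))" using dd[OF x] by (rule pder_comp)
  qed (use m\<theta>[OF that] in simp)
  have \<psi>0: "Sp W (carrier W) (Suc q) (Suc i) \<psi>0"
    unfolding \<psi>0_def using \<eta>Sp \<eta>p subgrp_carrier by (rule Sp_alt)
  have key: "\<exists>E. DO W (Suc q) E \<and> (\<forall>a\<in>carrier A. dS \<psi>0 bs a = nu (Suc q + i) \<odot>\<^bsub>W\<^esub> \<theta> bs a \<oplus>\<^bsub>W\<^esub> E a)"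
    if bs: "bs \<in> tuples i" for bs
  proof -
    define E1 where "E1 p = euler (\<theta> bs) p \<oplus>\<^bsub>W\<^esub> (\<ominus> nu (Suc q)) \<odot>\<^bsub>W\<^esub> \<theta> bs p" for p
    have E1: "DO W (Suc q) E1" unfolding E1_def[abs_def] by (rule DO_euler[OF DO\<theta>[OF bs]])
    have eu: "\<eta> a bs \<one> = euler (\<theta> bs) a" if "a \<in> carrier A" for a
      unfolding \<eta>_def euler_def using that by (intro lsum_cong) auto
    have euc: "euler (\<theta> bs) a \<in> carrier W" if "a \<in> carrier A" for a
      using DO_closed[OF DO_euler_sum[OF DO\<theta>[OF bs]] that] .
    have \<theta>c: "\<theta> bs a \<in> carrier W" if "a \<in> carrier A" for a using m\<theta>[OF bs] that by auto
    have e1: "euler (\<theta> bs) a = nu (Suc q) \<odot>\<^bsub>W\<^esub> \<theta> bs a \<oplus>\<^bsub>W\<^esub> E1 a" if "a \<in> carrier A" for a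
      using euc[OF that] \<theta>c[OF that] by (simp add: E1_def smult_l_minus M.a_ac M.cancel_simps)
    \<comment> \<open>The terms in which an old slot is distinguished add up to -i times
      \<open>\<theta>\<close>, up to lower order; with the sign in \<open>alt\<close> they
      contribute +i.\<close>
    have "\<exists>E2. DO W (Suc q) E2 \<and> (\<forall>a\<in>carrier A.
        alt W bs (\<lambda>x r. \<eta> x (a # r)) \<one> \<in> carrier W \<and>
        alt W bs (\<lambda>x r. \<eta> x (a # r)) \<one> \<oplus>\<^bsub>W\<^esub> nu i \<odot>\<^bsub>W\<^esub> \<theta> bs a = E2 a)"
    proof (cases i)
      case 0
      then show ?thesis using bs \<theta>c DO_zero by (intro exI[of _ "\<lambda>a. \<zero>\<^bsub>W\<^esub>"]) simp
    next
      case (Suc j)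
      define T where "T x r a = \<eta> x (a # r) \<one>" for x r a
      define R where "R x r a = T x r a \<oplus>\<^bsub>W\<^esub> \<theta> (x # r) a" for x r a
      have Tc: "T x r a \<in> carrier W" if "x \<in> carrier A" "r \<in> tuples j" "a \<in> carrier A" for x r a
        unfolding T_def using Sp_closed[OF \<eta>Sp[OF that(1)], of "a # r"] that Suc by simp
      have \<theta>c2: "\<theta> (x # r) a \<in> carrier W" if "x \<in> carrier A" "r \<in> tuples j" "a \<in> carrier A" for x r a
        using Sp_closed[OF \<theta>, of "x # r"] that Suc by simp
      have DR: "DO W (Suc q) (R x r)" if x: "x \<in> carrier A" and r: "r \<in> tuples j" for x r
      proof -
        define \<phi> where "\<phi> b = \<theta> (b # r)" for b
        have \<phi>: "pder W \<phi>" unfolding \<phi>_def using SpD(2)[OF \<theta>[unfolded Suc]] r by blast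
        have \<phi>D: "DO W (Suc (Suc q)) (\<phi> b)" if "b \<in> carrier A" for b
          unfolding \<phi>_def using DO\<theta> that r Suc by simp
        have \<phi>c: "\<phi> b a \<in> carrier W" if "b \<in> carrier A" "a \<in> carrier A" for a b
          using DO_closed[OF \<phi>D] that by blast
        \<comment> \<open>Merging in general raises the order by one; \<open>dropping\<close> keeps
          it at that of \<open>\<theta>\<close>. \<open>DO_merge_pder\<close> only supplies
          \<open>K\<close>-linearity here.\<close>
        have D1: "DO W (Suc (Suc q)) (\<lambda>b. \<phi> b \<one>)"
        proof -
          have "Klin W (\<lambda>b. \<phi> b \<one>)" using DO_merge_pder[OF \<phi> \<phi>D] by (simp add: DO_def)
          moreover have "ord W (Suc (Suc q)) (dS \<theta> r)" using drop Suc r by (simp add: dropping_def del: ord.simps)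
          moreover have "dS \<theta> r = (\<lambda>b. \<phi> b \<one>)" by (simp add: dS_def \<phi>_def fun_eq_iff)
          ultimately show ?thesis unfolding DO_def by simp
        qed
        have m1: "(\<lambda>b. \<phi> b \<one>) \<in> carrier A \<rightarrow> carrier W" by (rule DO_maps[OF D1])
        have "DO W (Suc q) (\<lambda>a. lsum W (\<lambda>y. dl W y (\<lambda>b. \<phi> b \<one>) (dd y x \<otimes> a) \<oplus>\<^bsub>W\<^esub> (\<ominus> \<one>) \<odot>\<^bsub>W\<^esub> dl W y (\<phi> (dd y x)) a) xs)"
        proof (rule DO_lsum)
          fix y assume y: "y \<in> set xs"
          have "DO W (Suc q) (\<lambda>a. dl W y (\<lambda>b. \<phi> b \<one>) (dd y x \<otimes> a))"
            using DO_dl[OF D1, of y] y x by (intro DO_plus) auto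
          moreover have "DO W (Suc q) (dl W y (\<phi> (dd y x)))"
            using \<phi>D y x by (intro DO_dl) auto
          ultimately show "DO W (Suc q) (\<lambda>a. dl W y (\<lambda>b. \<phi> b \<one>) (dd y x \<otimes> a) \<oplus>\<^bsub>W\<^esub> (\<ominus> \<one>) \<odot>\<^bsub>W\<^esub> dl W y (\<phi> (dd y x)) a)"
            by (intro DO_add DO_smult) auto
        qed
        then show ?thesis
        proof (rule DO_cong[THEN iffD1, rotated])
          fix a assume a: "a \<in> carrier A"
          have "T x r a = lsum W (\<lambda>y. dl W y (\<phi> a) (dd y x)) xs"
            unfolding T_def \<eta>_def \<phi>_def using x by (intro lsum_cong) auto
          moreover have "\<theta> (x # r) a = lsum W (\<lambda>y. \<phi> y (dd y x \<otimes> a)) xs"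
            using pder_expand[OF \<phi> \<phi>D x a] by (simp add: \<phi>_def)
          moreover have mm: "\<phi> b \<in> carrier A \<rightarrow> carrier W" if "b \<in> carrier A" for b
            by (rule DO_maps[OF \<phi>D[OF that]])
          ultimately have "R x r a = lsum W (\<lambda>y. dl W y (\<phi> a) (dd y x) \<oplus>\<^bsub>W\<^esub> \<phi> y (dd y x \<otimes> a)) xs"
            unfolding R_def using x a \<phi>c by (subst lsum_add) auto
          also have "\<dots> = lsum W (\<lambda>y. dl W y (\<lambda>b. \<phi> b \<one>) (dd y x \<otimes> a) \<oplus>\<^bsub>W\<^esub> (\<ominus> \<one>) \<odot>\<^bsub>W\<^esub> dl W y (\<phi> (dd y x)) a) xs"
            using x a by (intro lsum_cong refl form_identity[OF \<phi> \<phi>c]) auto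
          finally show "lsum W (\<lambda>y. dl W y (\<lambda>b. \<phi> b \<one>) (dd y x \<otimes> a) \<oplus>\<^bsub>W\<^esub> (\<ominus> \<one>) \<odot>\<^bsub>W\<^esub> dl W y (\<phi> (dd y x)) a) xs = R x r a"
            by simp
        qed
      qed
      have "DO W (Suc q) (alt W bs R)" using DR bs Suc by (intro alt_DO[where i = j]) auto
      moreover have "alt W bs (\<lambda>x r. \<eta> x (a # r)) \<one> = alt W bs T a" for a
        using bs Suc by (intro alt_cong[where i = j]) (auto simp: T_def)
      moreover have "alt W bs T a \<oplus>\<^bsub>W\<^esub> nu i \<odot>\<^bsub>W\<^esub> \<theta> bs a = alt W bs R a" if a: "a \<in> carrier A" for a
      proof -
        have "nu i \<odot>\<^bsub>W\<^esub> \<theta> bs a = alt W bs (\<lambda>x r. \<theta> (x # r)) a"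
          using alt_self[OF \<theta> bs a] by simp
        moreover have "alt W bs R a = alt W bs T a \<oplus>\<^bsub>W\<^esub> alt W bs (\<lambda>x r. \<theta> (x # r)) a"
          unfolding R_def[abs_def] using bs Suc a Tc \<theta>c2 by (intro alt_add[where i = j]) auto
        ultimately show ?thesis by simp
      qed
      moreover have "alt W bs T a \<in> carrier W" if a: "a \<in> carrier A" for a
        using bs Suc a Tc by (intro alt_closed[where i = j]) auto
      ultimately show ?thesis by (intro exI[of _ "alt W bs R"]) simp
    qed
    then obtain E2 where E2: "DO W (Suc q) E2"
      and e2: "\<And>a. a \<in> carrier A \<Longrightarrow> alt W bs (\<lambda>x r. \<eta> x (a # r)) \<one> \<in> carrier W"
        "\<And>a. a \<in> carrier A \<Longrightarrow> alt W bs (\<lambda>x r. \<eta> x (a # r)) \<one> \<oplus>\<^bsub>W\<^esub> nu i \<odot>\<^bsub>W\<^esub> \<theta> bs a = E2 a"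
      by blast
    have "DO W (Suc q) (\<lambda>a. E1 a \<oplus>\<^bsub>W\<^esub> (\<ominus> \<one>) \<odot>\<^bsub>W\<^esub> E2 a)" using E1 E2 by (intro DO_add DO_smult) auto
    moreover have "dS \<psi>0 bs a = nu (Suc q + i) \<odot>\<^bsub>W\<^esub> \<theta> bs a \<oplus>\<^bsub>W\<^esub> (E1 a \<oplus>\<^bsub>W\<^esub> (\<ominus> \<one>) \<odot>\<^bsub>W\<^esub> E2 a)"
      if a: "a \<in> carrier A" for a
    proof -
      define L where "L = alt W bs (\<lambda>x r. \<eta> x (a # r)) \<one>"
      have "dS \<psi>0 bs a = euler (\<theta> bs) a \<oplus>\<^bsub>W\<^esub> (\<ominus> \<one>) \<odot>\<^bsub>W\<^esub> L"
        using a by (simp add: dS_def \<psi>0_def eu L_def)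
      moreover have "L \<in> carrier W" "E2 a = L \<oplus>\<^bsub>W\<^esub> nu i \<odot>\<^bsub>W\<^esub> \<theta> bs a" using e2[OF a] by (simp_all add: L_def)
      moreover have "nu (Suc q + i) = nu (Suc q) \<oplus> nu i"
        unfolding nu_def by (simp add: R.add.nat_pow_mult del: R.add.nat_pow_Suc)
      moreover have "E1 a \<in> carrier W" using DO_closed[OF E1 a] .
      ultimately show ?thesis using \<theta>c[OF a]
        by (simp add: e1[OF a] smult_l_distr smult_r_distr neg_one_smult M.minus_add M.a_ac M.cancel_simps)
    qed
    ultimately show ?thesis by blast
  qed
  define u where "u = inv (nu (Suc q + i))"
  have "nu (Suc q + i) \<in> Units A" unfolding nu_def by (rule rational) simp
  then have u: "u \<in> carrier A" "u \<otimes> nu (Suc q + i) = \<one>" by (simp_all add: u_def)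
  define \<psi> where "\<psi> bs a = (\<ominus> u) \<odot>\<^bsub>W\<^esub> \<psi>0 bs a" for bs a
  have \<psi>: "Sp W (carrier W) (Suc q) (Suc i) \<psi>"
    unfolding \<psi>_def[abs_def] using \<psi>0 u by (intro Sp_smult) auto
  have "Sp W (carrier W) (Suc (Suc q)) i (\<lambda>bs a. \<theta> bs a \<oplus>\<^bsub>W\<^esub> dS \<psi> bs a)"
    using \<theta> Sp_d[OF \<psi> subgrp_carrier] subgrp_carrier by (rule Sp_add)
  then have "Sp W (carrier W) (Suc q) i (\<lambda>bs a. \<theta> bs a \<oplus>\<^bsub>W\<^esub> dS \<psi> bs a)"
  proof (rule Sp_lower)
    fix bs assume bs: "bs \<in> tuples i"
    obtain E where E: "DO W (Suc q) E"
      and e: "\<And>a. a \<in> carrier A \<Longrightarrow> dS \<psi>0 bs a = nu (Suc q + i) \<odot>\<^bsub>W\<^esub> \<theta> bs a \<oplus>\<^bsub>W\<^esub> E a"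
      using key[OF bs] by blast
    have "DO W (Suc q) (\<lambda>a. (\<ominus> u) \<odot>\<^bsub>W\<^esub> E a)" using E u by (intro DO_smult) auto
    then show "DO W (Suc q) (\<lambda>a. \<theta> bs a \<oplus>\<^bsub>W\<^esub> dS \<psi> bs a)"
    proof (rule DO_cong[THEN iffD1, rotated])
      fix a assume a: "a \<in> carrier A"
      have c: "\<theta> bs a \<in> carrier W" "E a \<in> carrier W" using m\<theta>[OF bs] a DO_closed[OF E a] by auto
      have "dS \<psi> bs a = (\<ominus> u) \<odot>\<^bsub>W\<^esub> dS \<psi>0 bs a" by (simp add: dS_def \<psi>_def)
      also have "\<dots> = \<ominus>\<^bsub>W\<^esub> ((u \<otimes> nu (Suc q + i)) \<odot>\<^bsub>W\<^esub> \<theta> bs a) \<oplus>\<^bsub>W\<^esub> (\<ominus> u) \<odot>\<^bsub>W\<^esub> E a"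
        using c u(1) by (simp add: e[OF a] smult_r_distr smult_l_minus smult_assoc1)
      finally show "(\<ominus> u) \<odot>\<^bsub>W\<^esub> E a = \<theta> bs a \<oplus>\<^bsub>W\<^esub> dS \<psi> bs a"
        using c u by (simp add: u(2) M.cancel_simps)
    qed
  qed
  with \<psi> show ?thesis using that by blast
qed

text \<open>In lowest order the correction leaves operators of order < 1. These are linear and
  vanish at one because the form is closed, so they are zero.\<close>

lemma base_regular1:
  assumes \<theta>: "Sp W (carrier W) 2 i \<theta>" and cl: "closed_form W i \<theta>"
  obtains \<psi> where "Sp W (carrier W) 1 (Suc i) \<psi>"
    "\<And>bs a. bs \<in> tuples i \<Longrightarrow> a \<in> carrier A \<Longrightarrow> \<theta> bs a = dS \<psi> bs a"
proof -
  have "dropping W (Suc (Suc 0)) i \<theta>"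
  proof (unfold dropping_def, intro allI impI ballI)
    fix j bs assume "i = Suc j" "bs \<in> tuples j"
    then have "ord W (Suc (Suc 0)) (dS \<theta> bs) = ord W (Suc (Suc 0)) (\<lambda>a. \<zero>\<^bsub>W\<^esub>)"
      using cl by (intro ord_cong) (simp add: closed_form_def)
    then show "ord W (Suc (Suc 0)) (dS \<theta> bs)" using ord_zero by blast
  qed
  then obtain \<psi> where \<psi>: "Sp W (carrier W) (Suc 0) (Suc i) \<psi>"
    and \<chi>: "Sp W (carrier W) (Suc 0) i (\<lambda>bs a. \<theta> bs a \<oplus>\<^bsub>W\<^esub> dS \<psi> bs a)"
    using base_regular2[of 0 i \<theta>] \<theta> by (auto simp: numeral_2_eq_2)
  have z: "\<theta> bs a \<oplus>\<^bsub>W\<^esub> dS \<psi> bs a = \<zero>\<^bsub>W\<^esub>" if bs: "bs \<in> tuples i" and a: "a \<in> carrier A" for bs a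
  proof -
    let ?\<chi> = "\<lambda>a. \<theta> bs a \<oplus>\<^bsub>W\<^esub> dS \<psi> bs a"
    have D: "DO W (Suc 0) ?\<chi>" using Sp_DO[OF \<chi> bs] .
    have "?\<chi> \<one> = \<zero>\<^bsub>W\<^esub>"
    proof (cases i)
      case 0
      then have "\<theta> bs \<one> = \<zero>\<^bsub>W\<^esub>" "bs = []" using cl bs by (simp_all add: closed_form_def)
      moreover have "dS \<psi> [] \<one> = \<zero>\<^bsub>W\<^esub>"
        using pder_K[OF SpD(2)[OF \<psi>] one_K, of "[]" \<one>] 0 by (simp add: dS_def)
      ultimately show ?thesis by simp
    next
      case (Suc j)
      then obtain c cs where c: "bs = c # cs" "c \<in> carrier A" "cs \<in> tuples j" using bs by (auto elim: tuples_SucE)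
      have "\<theta> (c # cs) \<one> = \<zero>\<^bsub>W\<^esub>" using cl Suc c by (simp add: closed_form_def dS_def)
      moreover have "dS \<psi> (c # cs) \<one> = \<zero>\<^bsub>W\<^esub>"
        using dS_dS[OF \<psi>[unfolded Suc] c(3,2)] by (simp add: dS_def)
      ultimately show ?thesis using c by simp
    qed
    then show ?thesis using ord_1[of ?\<chi> a] D a DO_maps[OF D] by (simp add: DO_def)
  qed
  define \<psi>' where "\<psi>' bs a = (\<ominus> \<one>) \<odot>\<^bsub>W\<^esub> \<psi> bs a" for bs a
  show ?thesis
  proof
    show "Sp W (carrier W) 1 (Suc i) \<psi>'" unfolding \<psi>'_def[abs_def] using \<psi> subgrp_carrier by (simp only: One_nat_def) (rule Sp_neg)
    fix bs a assume ba: "bs \<in> tuples i" "a \<in> carrier A"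
    have "\<theta> bs a \<in> carrier W" "dS \<psi> bs a \<in> carrier W"
      using Sp_closed[OF \<theta> ba] Sp_closed[OF Sp_d[OF \<psi> subgrp_carrier] ba] by auto
    then have "\<theta> bs a = (\<ominus> \<one>) \<odot>\<^bsub>W\<^esub> dS \<psi> bs a"
      using z[OF ba] by (simp add: neg_one_smult M.minus_equality[symmetric] M.a_comm)
    then show "\<theta> bs a = dS \<psi>' bs a" by (simp add: dS_def \<psi>'_def)
  qed
qed

end

section \<open>Iterated differential operators\<close>

context diffmod
begin

lemma DO_restrict [simp]: "DO W n (restrict D (carrier A)) = DO W n D"
  by (rule DO_cong) simp

lemma ord_iff_foldr_delta:
  "D \<in> carrier A \<rightarrow> carrier W \<Longrightarrow> ord W n D \<longleftrightarrow>
     (\<forall>as. length as = n \<and> set as \<subseteq> carrier A \<longrightarrow>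
       (\<forall>p\<in>carrier A. foldr (delta (regular_module A) W) as D p = \<zero>\<^bsub>W\<^esub>))"
proof (induction n arbitrary: D)
  case 0 then show ?case by simp
next
  case (Suc n)
  have d: "delta (regular_module A) W a D p = dl W a D p" if "a \<in> carrier A" "p \<in> carrier A" for a p
    using that Suc.prems funcset_mem[OF Suc.prems] by (simp add: delta_def dl_def smult_l_minus M.minus_eq)
  have dm: "delta (regular_module A) W a D \<in> carrier A \<rightarrow> carrier W" if "a \<in> carrier A" for a
    using d[OF that] dl_maps[OF Suc.prems that] by (auto simp: Pi_def)
  have "ord W (Suc n) D \<longleftrightarrow> (\<forall>a\<in>carrier A. ord W n (delta (regular_module A) W a D))"
    using ord_cong[of "delta (regular_module A) W _ D"] d by (metis ord.simps(2))
  also have "\<dots> \<longleftrightarrow> (\<forall>a\<in>carrier A. \<forall>as. length as = n \<and> set as \<subseteq> carrier A \<longrightarrow>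
       (\<forall>p\<in>carrier A. foldr (delta (regular_module A) W) (as @ [a]) D p = \<zero>\<^bsub>W\<^esub>))"
    using Suc.IH[OF dm] by simp
  also have "\<dots> \<longleftrightarrow> (\<forall>as. length as = Suc n \<and> set as \<subseteq> carrier A \<longrightarrow>
       (\<forall>p\<in>carrier A. foldr (delta (regular_module A) W) as D p = \<zero>\<^bsub>W\<^esub>))" (is "?L \<longleftrightarrow> ?R")
  proof
    assume L: ?L
    show ?R
    proof (intro allI impI)
      fix as assume as: "length as = Suc n \<and> set as \<subseteq> carrier A"
      then obtain bs b where "as = bs @ [b]" by (cases as rule: rev_cases) auto
      then show "\<forall>p\<in>carrier A. foldr (delta (regular_module A) W) as D p = \<zero>\<^bsub>W\<^esub>" using L as by auto
    qed
  next
    assume R: ?R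
    show ?L
    proof (intro ballI allI impI)
      fix a as p assume "a \<in> carrier A" "length as = n \<and> set as \<subseteq> carrier A" "p \<in> carrier A"
      then show "foldr (delta (regular_module A) W) (as @ [a]) D p = \<zero>\<^bsub>W\<^esub>"
        using R[rule_format, of "as @ [a]" p] by simp
    qed
  qed
  finally show ?case .
qed

text \<open>The bridge to the definitions: order at most \<open>k\<close> there is order <
  \<open>Suc k\<close> here.\<close>

lemma diff_ops_iff:
  "D \<in> diff_ops K A k (regular_module A) W \<longleftrightarrow> D \<in> extensional (carrier A) \<and> DO W (Suc k) D"
proof
  assume D: "D \<in> diff_ops K A k (regular_module A) W"
  then have m: "D \<in> carrier A \<rightarrow> carrier W" by (auto simp: diff_ops_def lin_maps_def)
  show "D \<in> extensional (carrier A) \<and> DO W (Suc k) D"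
    using D ord_iff_foldr_delta[OF m] by (auto simp: diff_ops_def lin_maps_def DO_def Klin_def PiE_def simp del: ord.simps)
next
  assume D: "D \<in> extensional (carrier A) \<and> DO W (Suc k) D"
  then have m: "D \<in> carrier A \<rightarrow> carrier W" using DO_maps by blast
  show "D \<in> diff_ops K A k (regular_module A) W"
    using D ord_iff_foldr_delta[OF m] by (auto simp: diff_ops_def lin_maps_def DO_def Klin_def PiE_def simp del: ord.simps)
qed

lemma Klin_neg: "Klin W D \<Longrightarrow> p \<in> carrier A \<Longrightarrow> D (\<ominus> p) = (\<ominus> \<one>) \<odot>\<^bsub>W\<^esub> D p"
proof -
  assume D: "Klin W D" and p: "p \<in> carrier A"
  have "\<ominus> \<one> \<in> K" using subring_K one_K by (rule subringE(5))
  then have "D ((\<ominus> \<one>) \<otimes> p) = (\<ominus> \<one>) \<odot>\<^bsub>W\<^esub> D p" using D p unfolding Klin_def by blast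
  then show ?thesis using p by (simp add: R.l_minus)
qed

text \<open>Operators with values in operators: the order with respect to the action on arguments.\<close>

primrec pord :: "nat \<Rightarrow> ('u \<Rightarrow> 'u \<Rightarrow> 'w) \<Rightarrow> bool" where
  "pord 0 E \<longleftrightarrow> (\<forall>a\<in>carrier A. \<forall>p\<in>carrier A. E a p = \<zero>\<^bsub>W\<^esub>)"
| "pord (Suc n) E \<longleftrightarrow> (\<forall>x\<in>carrier A. pord n (\<lambda>a p. E (x \<otimes> a) p \<oplus>\<^bsub>W\<^esub> E a ((\<ominus> x) \<otimes> p)))"

lemma pord_cong:
  "(\<And>a p. a \<in> carrier A \<Longrightarrow> p \<in> carrier A \<Longrightarrow> E a p = F a p) \<Longrightarrow> pord n E = pord n F"
proof (induction n arbitrary: E F)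
  case (Suc n)
  have "pord n (\<lambda>a p. E (x \<otimes> a) p \<oplus>\<^bsub>W\<^esub> E a ((\<ominus> x) \<otimes> p)) = pord n (\<lambda>a p. F (x \<otimes> a) p \<oplus>\<^bsub>W\<^esub> F a ((\<ominus> x) \<otimes> p))"
    if "x \<in> carrier A" for x
    using that Suc.prems by (intro Suc.IH) simp
  then show ?case by simp
qed simp

lemma pord_dl:
  assumes "pord n E" "x \<in> carrier A" "\<And>a. a \<in> carrier A \<Longrightarrow> E a \<in> carrier A \<rightarrow> carrier W"
  shows "pord n (\<lambda>a. dl W x (E a))"
  using assms(1,3)
proof (induction n arbitrary: E)
  case 0 then show ?case using assms(2) by (simp add: dl_def)
next
  case (Suc n)
  have cl: "E a p \<in> carrier W" if "a \<in> carrier A" "p \<in> carrier A" for a p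
    using Suc.prems(2) that by blast
  have "pord n (\<lambda>a p. dl W x (E (y \<otimes> a)) p \<oplus>\<^bsub>W\<^esub> dl W x (E a) ((\<ominus> y) \<otimes> p))" if y: "y \<in> carrier A" for y
  proof -
    have "pord n (\<lambda>a. dl W x (\<lambda>p. E (y \<otimes> a) p \<oplus>\<^bsub>W\<^esub> E a ((\<ominus> y) \<otimes> p)))"
      using Suc.prems(1) cl y by (intro Suc.IH) auto
    then show ?thesis
    proof (rule pord_cong[THEN iffD1, rotated])
      fix a p assume "a \<in> carrier A" "p \<in> carrier A"
      moreover have "(\<ominus> y) \<otimes> (x \<otimes> p) = x \<otimes> ((\<ominus> y) \<otimes> p)" if "p \<in> carrier A" for p
        using that y assms(2) by (simp add: R.m_lcomm)
      ultimately show "dl W x (\<lambda>p. E (y \<otimes> a) p \<oplus>\<^bsub>W\<^esub> E a ((\<ominus> y) \<otimes> p)) p =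
          dl W x (E (y \<otimes> a)) p \<oplus>\<^bsub>W\<^esub> dl W x (E a) ((\<ominus> y) \<otimes> p)"
        using y assms(2) cl by (simp add: dl_def smult_r_distr M.a_ac)
    qed
  qed
  then show ?case by simp
qed

text \<open>Orders at most n - 1 and m - 1 add up to n + m - 2, as for a composition.
  \<open>dl W x\<close> of the merged operator is the sum of a part acting on the outer entry and a
  part acting on the inner one, and these lower \<open>n\<close> and \<open>m\<close>
  respectively.\<close>

lemma ord_merge:
  assumes "pord n E" "\<And>a. a \<in> carrier A \<Longrightarrow> DO W m (E a)" "n + m = Suc t"
  shows "ord W t (\<lambda>a. E a \<one>)"
  using assms
proof (induction t arbitrary: n m E)
  case 0
  then have "n = 0 \<or> m = 0" by presburger
  then show ?case using 0(1,2) DO_0 by auto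
next
  case (Suc t)
  note DE = Suc.prems(2)
  have cl: "E a p \<in> carrier W" if "a \<in> carrier A" "p \<in> carrier A" for a p
    using DO_closed[OF DE] that by blast
  show ?case
  proof (cases "n = 0 \<or> m = 0")
    case True
    then have "E a \<one> = \<zero>\<^bsub>W\<^esub>" if "a \<in> carrier A" for a
      using Suc.prems(1) DO_0[of "E a"] DE[OF that] that by auto
    then have "ord W (Suc t) (\<lambda>a. E a \<one>) = ord W (Suc t) (\<lambda>a. \<zero>\<^bsub>W\<^esub>)" by (intro ord_cong) simp
    then show ?thesis using ord_zero by blast
  next
    case False
    then obtain n' m' where nm: "n = Suc n'" "m = Suc m'" by (cases n; cases m) auto
    have "ord W t (dl W x (\<lambda>a. E a \<one>))" if x: "x \<in> carrier A" for x
    proof -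
      define E1 where "E1 a p = E (x \<otimes> a) p \<oplus>\<^bsub>W\<^esub> E a ((\<ominus> x) \<otimes> p)" for a p
      have D1: "DO W m (E1 a)" if "a \<in> carrier A" for a
        unfolding E1_def[abs_def] using DE x that by (intro DO_add DO_plus[of _ "E a"]) auto
      have "ord W t (\<lambda>a. E1 a \<one>)"
        using Suc.prems(1,3) nm x D1 by (intro Suc.IH[of n' E1 m]) (auto simp: E1_def[abs_def])
      moreover have "ord W t (\<lambda>a. dl W x (E a) \<one>)"
        using Suc.prems nm x DO_maps[OF DE] by (intro Suc.IH[of n "\<lambda>a. dl W x (E a)" m'] pord_dl DO_dl) auto
      ultimately have "ord W t (\<lambda>a. E1 a \<one> \<oplus>\<^bsub>W\<^esub> dl W x (E a) \<one>)"
        using x cl D1 DO_closed[OF D1] by (intro ord_add) (auto simp: dl_def)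
      then show ?thesis
      proof (rule ord_cong[THEN iffD1, rotated])
        fix a assume a: "a \<in> carrier A"
        have "Klin W (E a)" using DE[OF a] by (simp add: DO_def)
        then have "E a (\<ominus> x) = \<ominus>\<^bsub>W\<^esub> E a x" using Klin_neg[of "E a" x] x cl[OF a x] by (simp add: neg_one_smult)
        then show "E1 a \<one> \<oplus>\<^bsub>W\<^esub> dl W x (E a) \<one> = dl W x (\<lambda>a. E a \<one>) a"
          using a x cl by (simp add: E1_def dl_def M.a_ac M.cancel_simps)
      qed
    qed
    then show ?thesis by simp
  qed
qed

end

section \<open>Modules of iterated operators and partial vanishing conditions\<close>

context diffcalc
begin

abbreviation "Wm s Q \<equiv> Diffp_seq K A s Q"

text \<open>\<open>DR r s Q\<close> is the set of iterated operators of type \<open>s\<close> which vanish when one of the entries at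
  the positions \<open>\<ge> r\<close> (counted from 0) is \<open>\<one>\<close>.  It interpolates between
  $\mathrm{D}_s(Q)$ (\<open>r = 0\<close>) and $\mathrm{Diff}^+_s Q$ (\<open>r = length s\<close>).\<close>

primrec DR :: "nat \<Rightarrow> nat list \<Rightarrow> ('u, 'q) module \<Rightarrow> ('u, 'q) iter set" where
  "DR r [] = (\<lambda>Q. Base ` carrier Q)"
| "DR r (k # s) = (\<lambda>Q. Fn ` {D \<in> extensional (carrier A). DO (Wm s Q) (Suc k) D \<and>
     (\<forall>a\<in>carrier A. D a \<in> DR (r - 1) s Q) \<and> (r = 0 \<longrightarrow> D \<one> = \<zero>\<^bsub>Wm s Q\<^esub>)})"

end

lemma Base_module_simps [simp]:
  "carrier (Base_module Q) = Base ` carrier Q" "zero (Base_module Q) = Base \<zero>\<^bsub>Q\<^esub>"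
  "x \<oplus>\<^bsub>Base_module Q\<^esub> y = Base (un_Base x \<oplus>\<^bsub>Q\<^esub> un_Base y)"
  "a \<odot>\<^bsub>Base_module Q\<^esub> x = Base (a \<odot>\<^bsub>Q\<^esub> un_Base x)"
  by (simp_all add: Base_module_def transport_module_def)

lemma Diffp_seq_Cons_simps:
  "carrier (Diffp_seq K A (k # s) Q) = Fn ` {D \<in> diff_ops K A k (regular_module A) (Diffp_seq K A s Q).
     D ` carrier A \<subseteq> carrier (Diffp_seq K A s Q)}"
  "zero (Diffp_seq K A (k # s) Q) = Fn (\<lambda>p\<in>carrier A. \<zero>\<^bsub>Diffp_seq K A s Q\<^esub>)"
  "x \<oplus>\<^bsub>Diffp_seq K A (k # s) Q\<^esub> y = Fn (\<lambda>p\<in>carrier A. un_Fn x p \<oplus>\<^bsub>Diffp_seq K A s Q\<^esub> un_Fn y p)"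
  "a \<odot>\<^bsub>Diffp_seq K A (k # s) Q\<^esub> x = Fn (\<lambda>p\<in>carrier A. un_Fn x (a \<otimes>\<^bsub>A\<^esub> p))"
  by (simp_all add: Fn_module_def transport_module_def Diff_plus_def map_module_def)

lemma D_seq_Cons_simps:
  "carrier (D_seq K A (k # s) S Q) = Fn ` {D \<in> diff_ops K A k (regular_module A) (Diffp_seq K A s Q).
     D ` carrier A \<subseteq> carrier (D_seq K A s S Q) \<and> D \<one>\<^bsub>A\<^esub> = \<zero>\<^bsub>D_seq K A s S Q\<^esub>}"
  "zero (D_seq K A (k # s) S Q) = Fn (\<lambda>p\<in>carrier A. \<zero>\<^bsub>D_seq K A s S Q\<^esub>)"
  "x \<oplus>\<^bsub>D_seq K A (k # s) S Q\<^esub> y = Fn (\<lambda>p\<in>carrier A. un_Fn x p \<oplus>\<^bsub>D_seq K A s S Q\<^esub> un_Fn y p)"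
  "a \<odot>\<^bsub>D_seq K A (k # s) S Q\<^esub> x = Fn (\<lambda>p\<in>carrier A. a \<odot>\<^bsub>D_seq K A s S Q\<^esub> un_Fn x p)"
  by (auto simp: Fn_module_def transport_module_def Der_dot_def Diff_dot_def map_module_def Let_def)

lemma D_seq_add_zero:
  "zero (D_seq K A s Q Q) = zero (Diffp_seq K A s Q)" "add (D_seq K A s Q Q) = add (Diffp_seq K A s Q)"
proof (induction s)
  case (Cons k s)
  case 1 show ?case using Cons by (simp add: D_seq_Cons_simps Diffp_seq_Cons_simps del: D_seq.simps Diffp_seq.simps)
  case 2 show ?case using Cons
    by (intro ext) (simp add: D_seq_Cons_simps Diffp_seq_Cons_simps del: D_seq.simps Diffp_seq.simps)
qed simp_all

declare Diffp_seq.simps(2) [simp del] D_seq.simps(2) [simp del]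

context diffcalc
begin

lemma module_Wm: "module A Q \<Longrightarrow> module A (Wm s Q)"
proof (induction s)
  case Nil
  interpret Q: module A Q by fact
  have "abelian_group (Base_module Q)"
    by (rule abelian_groupI) (auto simp: Q.M.a_ac intro: Q.M.l_neg)
  then show ?case
    by (auto intro!: moduleI simp: is_cring Q.smult_l_distr Q.smult_r_distr Q.smult_assoc1)
next
  case (Cons k s)
  interpret V: diffmod A K "Wm s Q"
    using Cons diffcalc_axioms by (intro diffmod.intro)
  have c: "carrier (Wm (k # s) Q) = Fn ` {D \<in> extensional (carrier A). DO (Wm s Q) (Suc k) D}"
    using V.DO_maps by (fastforce simp: Diffp_seq_Cons_simps(1) V.diff_ops_iff Pi_iff)
  have mem: "Fn (\<lambda>p\<in>carrier A. D p) \<in> carrier (Wm (k # s) Q)" if "DO (Wm s Q) (Suc k) D" for D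
    unfolding c by (intro imageI CollectI conjI restrict_extensional V.DO_restrict[THEN iffD2] that)
  have dest: "DO (Wm s Q) (Suc k) (un_Fn x)" "x = Fn (un_Fn x)" "un_Fn x \<in> extensional (carrier A)"
    "\<And>p. p \<in> carrier A \<Longrightarrow> un_Fn x p \<in> carrier (Wm s Q)"
    if "x \<in> carrier (Wm (k # s) Q)" for x
    using that V.DO_closed by (auto simp: c)
  have eqI: "x = y" if "x \<in> carrier (Wm (k # s) Q)" "y \<in> carrier (Wm (k # s) Q)"
    "\<And>p. p \<in> carrier A \<Longrightarrow> un_Fn x p = un_Fn y p" for x y
    using extensionalityI[OF dest(3)[OF that(1)] dest(3)[OF that(2)] that(3)] dest(2)[OF that(1)] dest(2)[OF that(2)]
    by simp
  have zero: "\<zero>\<^bsub>Wm (k # s) Q\<^esub> \<in> carrier (Wm (k # s) Q)"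
    unfolding Diffp_seq_Cons_simps(2-4) by (intro mem V.DO_zero)
  have add: "x \<oplus>\<^bsub>Wm (k # s) Q\<^esub> y \<in> carrier (Wm (k # s) Q)"
    if "x \<in> carrier (Wm (k # s) Q)" "y \<in> carrier (Wm (k # s) Q)" for x y
    unfolding Diffp_seq_Cons_simps(2-4) using dest(1)[OF that(1)] dest(1)[OF that(2)] by (intro mem V.DO_add)
  have smult: "a \<odot>\<^bsub>Wm (k # s) Q\<^esub> x \<in> carrier (Wm (k # s) Q)"
    if "a \<in> carrier A" "x \<in> carrier (Wm (k # s) Q)" for a x
    unfolding Diffp_seq_Cons_simps(2-4) using dest(1)[OF that(2)] that(1) by (intro mem V.DO_plus[of _ "un_Fn x"])
  have ap: "un_Fn (x \<oplus>\<^bsub>Wm (k # s) Q\<^esub> y) p = un_Fn x p \<oplus>\<^bsub>Wm s Q\<^esub> un_Fn y p"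
    "un_Fn (a \<odot>\<^bsub>Wm (k # s) Q\<^esub> x) p = un_Fn x (a \<otimes> p)" "un_Fn \<zero>\<^bsub>Wm (k # s) Q\<^esub> p = \<zero>\<^bsub>Wm s Q\<^esub>"
    if "p \<in> carrier A" for x y a p
    using that by (simp_all add: Diffp_seq_Cons_simps(2-4))
  have ag: "abelian_group (Wm (k # s) Q)"
  proof (rule abelian_groupI)
    fix x y z assume x: "x \<in> carrier (Wm (k # s) Q)" and y: "y \<in> carrier (Wm (k # s) Q)" and z: "z \<in> carrier (Wm (k # s) Q)"
    show "x \<oplus>\<^bsub>Wm (k # s) Q\<^esub> y = y \<oplus>\<^bsub>Wm (k # s) Q\<^esub> x"
      using x y by - (rule eqI; simp add: add smult zero ap dest(4) V.M.a_comm)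
    show "x \<oplus>\<^bsub>Wm (k # s) Q\<^esub> y \<oplus>\<^bsub>Wm (k # s) Q\<^esub> z = x \<oplus>\<^bsub>Wm (k # s) Q\<^esub> (y \<oplus>\<^bsub>Wm (k # s) Q\<^esub> z)"
      using x y z by - (rule eqI; simp add: add smult zero ap dest(4) V.M.a_assoc)
    show "\<zero>\<^bsub>Wm (k # s) Q\<^esub> \<oplus>\<^bsub>Wm (k # s) Q\<^esub> x = x"
      using x zero by - (rule eqI; simp add: add smult zero ap dest(4))
    have "Fn (\<lambda>p\<in>carrier A. (\<ominus> \<one>) \<odot>\<^bsub>Wm s Q\<^esub> un_Fn x p) \<in> carrier (Wm (k # s) Q)"
      using dest(1)[OF x] by (intro mem V.DO_smult) simp_all
    moreover from this have "Fn (\<lambda>p\<in>carrier A. (\<ominus> \<one>) \<odot>\<^bsub>Wm s Q\<^esub> un_Fn x p) \<oplus>\<^bsub>Wm (k # s) Q\<^esub> x = \<zero>\<^bsub>Wm (k # s) Q\<^esub>"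
      using x zero by - (rule eqI; simp add: add smult zero ap dest(4) V.neg_one_smult V.M.l_neg)
    ultimately show "\<exists>y\<in>carrier (Wm (k # s) Q). y \<oplus>\<^bsub>Wm (k # s) Q\<^esub> x = \<zero>\<^bsub>Wm (k # s) Q\<^esub>" by blast
  qed (use zero add in auto)
  show ?case
  proof (rule moduleI[OF is_cring ag])
    fix a b x y
    assume a: "a \<in> carrier A" and b: "b \<in> carrier A"
      and x: "x \<in> carrier (Wm (k # s) Q)"
    have addF: "un_Fn x (p \<oplus> q) = un_Fn x p \<oplus>\<^bsub>Wm s Q\<^esub> un_Fn x q" if "p \<in> carrier A" "q \<in> carrier A" for p q
      using dest(1)[OF x] that by (simp add: DO_def Klin_def)
    show "(a \<oplus> b) \<odot>\<^bsub>Wm (k # s) Q\<^esub> x = a \<odot>\<^bsub>Wm (k # s) Q\<^esub> x \<oplus>\<^bsub>Wm (k # s) Q\<^esub> b \<odot>\<^bsub>Wm (k # s) Q\<^esub> x"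
      using a b x by - (rule eqI; simp add: add smult zero ap R.l_distr addF)
    show "(a \<otimes> b) \<odot>\<^bsub>Wm (k # s) Q\<^esub> x = a \<odot>\<^bsub>Wm (k # s) Q\<^esub> (b \<odot>\<^bsub>Wm (k # s) Q\<^esub> x)"
      using a b x by - (rule eqI; simp add: add smult zero ap R.m_ac)
  next
    fix a x y assume "a \<in> carrier A" "x \<in> carrier (Wm (k # s) Q)" "y \<in> carrier (Wm (k # s) Q)"
    then show "a \<odot>\<^bsub>Wm (k # s) Q\<^esub> (x \<oplus>\<^bsub>Wm (k # s) Q\<^esub> y) = a \<odot>\<^bsub>Wm (k # s) Q\<^esub> x \<oplus>\<^bsub>Wm (k # s) Q\<^esub> a \<odot>\<^bsub>Wm (k # s) Q\<^esub> y"
      by - (rule eqI; simp add: add smult zero ap)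
  next
    fix x assume "x \<in> carrier (Wm (k # s) Q)"
    then show "\<one> \<odot>\<^bsub>Wm (k # s) Q\<^esub> x = x"
      by - (rule eqI; simp add: add smult zero ap)
  qed (use smult in blast)
qed

lemma diffmod_Wm: "module A Q \<Longrightarrow> diffmod A K (Wm s Q)"
  using module_Wm diffcalc_axioms by (intro diffmod.intro)

lemma carrier_Wm_Cons:
  assumes "module A Q"
  shows "carrier (Wm (k # s) Q) = Fn ` {D \<in> extensional (carrier A). DO (Wm s Q) (Suc k) D}"
proof -
  interpret V: diffmod A K "Wm s Q" using assms by (rule diffmod_Wm)
  show ?thesis using V.DO_maps by (fastforce simp: Diffp_seq_Cons_simps(1) V.diff_ops_iff Pi_iff)
qed

lemma lsum_Wm_Cons:
  "lsum (Wm (k # s) Q) f ys = Fn (\<lambda>p\<in>carrier A. lsum (Wm s Q) (\<lambda>x. un_Fn (f x) p) ys)"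
  by (induction ys) (auto simp: Diffp_seq_Cons_simps(2-4) intro!: restrict_ext)

lemma DR_ConsI:
  assumes "module A Q" "DO (Wm s Q) (Suc k) D" "\<And>a. a \<in> carrier A \<Longrightarrow> D a \<in> DR (r - 1) s Q"
    "r = 0 \<Longrightarrow> D \<one> = \<zero>\<^bsub>Wm s Q\<^esub>"
  shows "Fn (\<lambda>a\<in>carrier A. D a) \<in> DR r (k # s) Q"
proof -
  interpret V: diffmod A K "Wm s Q" using assms(1) by (rule diffmod_Wm)
  show ?thesis unfolding DR.simps
    by (intro imageI CollectI conjI restrict_extensional V.DO_restrict[THEN iffD2] assms(2)) (use assms in auto)
qed

lemma DR_ConsE:
  assumes "x \<in> DR r (k # s) Q"
  obtains D where "x = Fn D" "D \<in> extensional (carrier A)" "DO (Wm s Q) (Suc k) D"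
    "\<And>a. a \<in> carrier A \<Longrightarrow> D a \<in> DR (r - 1) s Q" "r = 0 \<Longrightarrow> D \<one> = \<zero>\<^bsub>Wm s Q\<^esub>"
  using assms by auto

lemma DR_subset: "module A Q \<Longrightarrow> DR r s Q \<subseteq> carrier (Wm s Q)"
  by (cases s) (auto simp: carrier_Wm_Cons)

lemma carrier_D_seq:
  assumes "module A Q"
  shows "carrier (D_seq K A s Q Q) = DR 0 s Q"
proof (induction s)
  case (Cons k s)
  interpret V: diffmod A K "Wm s Q" using assms by (rule diffmod_Wm)
  show ?case using Cons by (auto simp: D_seq_Cons_simps V.diff_ops_iff D_seq_add_zero image_subset_iff)
qed simp

lemma DR_Suc_subset: "DR r s Q \<subseteq> DR (Suc r) s Q"
proof (induction s arbitrary: r)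
  case (Cons k s)
  show ?case using Cons[of "r - 1"] by (cases r) auto
qed simp

lemma DR_full: assumes "module A Q" "length s \<le> r" shows "DR r s Q = carrier (Wm s Q)"
  using assms(2)
proof (induction s arbitrary: r)
  case (Cons k s)
  interpret V: diffmod A K "Wm s Q" using assms(1) by (rule diffmod_Wm)
  have "DR (r - 1) s Q = carrier (Wm s Q)" using Cons by auto
  then show ?case using Cons.prems assms(1) by (auto simp: carrier_Wm_Cons V.DO_closed)
qed simp

lemma DR_mono: "\<lbrakk>module A Q; list_all2 (\<le>) s t\<rbrakk> \<Longrightarrow> DR r s Q \<subseteq> DR r t Q \<and> carrier (Wm s Q) \<subseteq> carrier (Wm t Q)
   \<and> zero (Wm s Q) = zero (Wm t Q) \<and> add (Wm s Q) = add (Wm t Q) \<and> smult (Wm s Q) = smult (Wm t Q)"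
proof (induction s arbitrary: r t)
  case Nil then show ?case by simp
next
  case (Cons k s)
  from Cons.prems obtain l t' where t: "t = l # t'" "k \<le> l" "list_all2 (\<le>) s t'"
    by (auto simp: list_all2_Cons1)
  note IH = Cons.IH[OF Cons.prems(1) t(3)]
  interpret V: diffmod A K "Wm s Q" using Cons.prems(1) by (rule diffmod_Wm)
  interpret V': diffmod A K "Wm t' Q" using Cons.prems(1) by (rule diffmod_Wm)
  have dl: "dl (Wm s Q) = dl (Wm t' Q)" using IH by (simp add: dl_def fun_eq_iff)
  have ord: "ord (Wm s Q) n D = ord (Wm t' Q) n D" for n D
    by (induction n arbitrary: D) (simp_all add: IH dl)
  have DO: "DO (Wm t' Q) (Suc l) D" if "DO (Wm s Q) (Suc k) D" for D
  proof -
    have "DO (Wm t' Q) (Suc k) D" using that IH by (auto simp: DO_def Klin_def ord simp del: ord.simps)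
    then show ?thesis by (rule V'.DO_mono) (use t(2) in simp)
  qed
  have "DR r (k # s) Q \<subseteq> DR r (l # t') Q"
  proof
    fix x assume "x \<in> DR r (k # s) Q"
    then obtain D where D: "x = Fn D" "D \<in> extensional (carrier A)" "DO (Wm s Q) (Suc k) D"
      "\<forall>a\<in>carrier A. D a \<in> DR (r - 1) s Q" "r = 0 \<longrightarrow> D \<one> = \<zero>\<^bsub>Wm s Q\<^esub>" by auto
    have "\<forall>a\<in>carrier A. D a \<in> DR (r - 1) t' Q" using D(4) IH[of "r - 1"] by blast
    moreover have "r = 0 \<longrightarrow> D \<one> = \<zero>\<^bsub>Wm t' Q\<^esub>" using D(5) IH by simp
    ultimately show "x \<in> DR r (l # t') Q" using D(2) DO[OF D(3)] unfolding D(1) DR.simps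
      by (intro imageI CollectI conjI)
  qed
  moreover have "carrier (Wm (k # s) Q) \<subseteq> carrier (Wm (l # t') Q)"
    unfolding carrier_Wm_Cons[OF Cons.prems(1)] using DO by (intro image_mono) blast
  moreover have "zero (Wm (k # s) Q) = zero (Wm (l # t') Q) \<and> add (Wm (k # s) Q) = add (Wm (l # t') Q) \<and>
     smult (Wm (k # s) Q) = smult (Wm (l # t') Q)"
    using IH by (simp add: Diffp_seq_Cons_simps(2-4) fun_eq_iff)
  ultimately show ?case unfolding t(1) by blast
qed

text \<open>As -1 lies in \<open>K\<close> and operators are \<open>K\<close>-linear, it acts on
  arguments as it acts on values. Hence \<open>DR 0 s Q\<close> is closed under -1, as
  \<open>subgrp\<close> requires, although it is not stable under general scalars.\<close>

lemma Wm_neg: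
  assumes "module A Q" "x \<in> carrier (Wm (k # s) Q)"
  shows "(\<ominus> \<one>) \<odot>\<^bsub>Wm (k # s) Q\<^esub> x = Fn (\<lambda>p\<in>carrier A. (\<ominus> \<one>) \<odot>\<^bsub>Wm s Q\<^esub> un_Fn x p)"
proof -
  interpret V: diffmod A K "Wm s Q" using assms(1) by (rule diffmod_Wm)
  obtain D where D: "x = Fn D" "DO (Wm s Q) (Suc k) D" using assms(2) carrier_Wm_Cons[OF assms(1)] by auto
  then have "D (\<ominus> p) = (\<ominus> \<one>) \<odot>\<^bsub>Wm s Q\<^esub> D p" if "p \<in> carrier A" for p
    using that by (intro V.Klin_neg) (auto simp: DO_def)
  then show ?thesis by (auto simp: Diffp_seq_Cons_simps(2-4) D(1) R.l_minus intro!: restrict_ext)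
qed

lemma subgrp_DR: "module A Q \<Longrightarrow> subgrp (Wm s Q) (DR r s Q)"
proof (induction s arbitrary: r)
  case Nil
  interpret Q: module A Q by fact
  show ?case by (auto simp: subgrp_def)
next
  case (Cons k s)
  interpret V: diffmod A K "Wm s Q" using Cons.prems by (rule diffmod_Wm)
  interpret V': diffmod A K "Wm (k # s) Q" using Cons.prems by (rule diffmod_Wm)
  note IH = Cons.IH[OF Cons.prems, of "r - 1", unfolded subgrp_def]
  have add: "x \<oplus>\<^bsub>Wm (k # s) Q\<^esub> y \<in> DR r (k # s) Q" if x: "x \<in> DR r (k # s) Q" and y: "y \<in> DR r (k # s) Q" for x y
  proof (rule DR_ConsE[OF x], rule DR_ConsE[OF y])
    fix D E
    assume D: "x = Fn D" "DO (Wm s Q) (Suc k) D" "\<And>a. a \<in> carrier A \<Longrightarrow> D a \<in> DR (r - 1) s Q"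
      "r = 0 \<Longrightarrow> D \<one> = \<zero>\<^bsub>Wm s Q\<^esub>"
    and E: "y = Fn E" "DO (Wm s Q) (Suc k) E" "\<And>a. a \<in> carrier A \<Longrightarrow> E a \<in> DR (r - 1) s Q"
      "r = 0 \<Longrightarrow> E \<one> = \<zero>\<^bsub>Wm s Q\<^esub>"
    show ?thesis unfolding Diffp_seq_Cons_simps(3) D(1) E(1) iter.sel
      by (rule DR_ConsI[OF Cons.prems V.DO_add[OF D(2) E(2)]]) (use D(3,4) E(3,4) IH in auto)
  qed
  have zero: "\<zero>\<^bsub>Wm (k # s) Q\<^esub> \<in> DR r (k # s) Q"
    unfolding Diffp_seq_Cons_simps(2) by (rule DR_ConsI[OF Cons.prems V.DO_zero]) (use IH in auto)
  have neg: "(\<ominus> \<one>) \<odot>\<^bsub>Wm (k # s) Q\<^esub> x \<in> DR r (k # s) Q" if x: "x \<in> DR r (k # s) Q" for x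
  proof (rule DR_ConsE[OF x])
    fix D
    assume D: "x = Fn D" "DO (Wm s Q) (Suc k) D" "\<And>a. a \<in> carrier A \<Longrightarrow> D a \<in> DR (r - 1) s Q"
      "r = 0 \<Longrightarrow> D \<one> = \<zero>\<^bsub>Wm s Q\<^esub>"
    have "x \<in> carrier (Wm (k # s) Q)" using x DR_subset Cons.prems by blast
    then have "(\<ominus> \<one>) \<odot>\<^bsub>Wm (k # s) Q\<^esub> x = Fn (\<lambda>p\<in>carrier A. (\<ominus> \<one>) \<odot>\<^bsub>Wm s Q\<^esub> D p)"
      using Wm_neg[OF Cons.prems] D(1) by simp
    moreover have "DO (Wm s Q) (Suc k) (\<lambda>p. (\<ominus> \<one>) \<odot>\<^bsub>Wm s Q\<^esub> D p)" using D(2) by (rule V.DO_smult) simp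
    ultimately show ?thesis
      using D(3,4) IH by (simp only:) (rule DR_ConsI[OF Cons.prems], auto)
  qed
  show ?case unfolding subgrp_def using add zero neg DR_subset[OF Cons.prems] by blast
qed

text \<open>The action only touches the first entry, and with \<open>Suc r\<close> this entry
  carries no condition. In \<open>DR 0\<close> it would move the zero away from one.\<close>

lemma DR_smult:
  assumes "module A Q" "x \<in> DR (Suc r) s Q" "a \<in> carrier A"
  shows "a \<odot>\<^bsub>Wm s Q\<^esub> x \<in> DR (Suc r) s Q"
proof (cases s)
  case Nil
  interpret Q: module A Q by fact
  show ?thesis using assms Nil by auto
next
  case (Cons k t)
  interpret V: diffmod A K "Wm t Q" using assms by (intro diffmod_Wm)
  have x: "x \<in> DR (Suc r) (k # t) Q" using assms(2) Cons by simp
  show ?thesis unfolding Cons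
  proof (rule DR_ConsE[OF x])
    fix D
    assume D: "x = Fn D" "DO (Wm t Q) (Suc k) D" "\<And>a. a \<in> carrier A \<Longrightarrow> D a \<in> DR (Suc r - 1) t Q"
    have "DO (Wm t Q) (Suc k) (\<lambda>p. D (a \<otimes> p))" using D(2) assms(3) by (rule V.DO_plus)
    then show "a \<odot>\<^bsub>Wm (k # t) Q\<^esub> x \<in> DR (Suc r) (k # t) Q"
      unfolding Diffp_seq_Cons_simps(4) D(1) iter.sel
      using D(3) assms(1,3) by (intro DR_ConsI) auto
  qed
qed

lemma submodule_update:
  assumes "module A V" "subgrp V C" "\<And>a x. a \<in> carrier A \<Longrightarrow> x \<in> C \<Longrightarrow> a \<odot>\<^bsub>V\<^esub> x \<in> C"
  shows "module A (V\<lparr>carrier := C\<rparr>)"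
proof -
  interpret V: module A V by fact
  have C: "C \<subseteq> carrier V" "\<zero>\<^bsub>V\<^esub> \<in> C" "\<And>x y. x \<in> C \<Longrightarrow> y \<in> C \<Longrightarrow> x \<oplus>\<^bsub>V\<^esub> y \<in> C"
    "\<And>x. x \<in> C \<Longrightarrow> (\<ominus> \<one>) \<odot>\<^bsub>V\<^esub> x \<in> C"
    using assms(2) by (auto simp: subgrp_def)
  have "abelian_group (V\<lparr>carrier := C\<rparr>)"
  proof (rule abelian_groupI)
    fix x assume "x \<in> carrier (V\<lparr>carrier := C\<rparr>)"
    then have x: "x \<in> C" by simp
    then have "(\<ominus> \<one>) \<odot>\<^bsub>V\<^esub> x \<oplus>\<^bsub>V\<^esub> x = \<zero>\<^bsub>V\<^esub>" using C(1) by (auto simp: V.neg_one_smult V.M.l_neg)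
    then show "\<exists>y\<in>carrier (V\<lparr>carrier := C\<rparr>). y \<oplus>\<^bsub>V\<lparr>carrier := C\<rparr>\<^esub> x = \<zero>\<^bsub>V\<lparr>carrier := C\<rparr>\<^esub>"
      using C(4)[OF x] by auto
  qed (use C in \<open>auto simp: V.M.a_ac subset_iff\<close>)
  then show ?thesis
    using C(1) assms(3) by (intro moduleI) (auto simp: is_cring V.smult_l_distr V.smult_r_distr V.smult_assoc1 subset_iff)
qed

lemma module_DR: "module A Q \<Longrightarrow> module A ((Wm s Q)\<lparr>carrier := DR (Suc r) s Q\<rparr>)"
  using module_Wm subgrp_DR DR_smult by (intro submodule_update) auto

end

section \<open>The frame relation in modules of iterated operators\<close>

context frame
begin

lemma good_submodule:
  assumes "good V" "C \<subseteq> carrier V"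
  shows "good (V\<lparr>carrier := C\<rparr>)"
proof -
  have "derivation V X" if "derivation (V\<lparr>carrier := C\<rparr>) X" for X
    using that assms(2) by (auto simp: derivation_def Pi_iff)
  then show ?thesis using assms(1) unfolding good_def by simp
qed

text \<open>A derivation into a module of operators is a \<open>pder\<close> family of operators, so
  goodness of the outer module is \<open>pder_expand\<close> for the inner one.\<close>

lemma good_Wm: "module A Q \<Longrightarrow> good Q \<Longrightarrow> good (Wm s Q)"
proof (induction s)
  case Nil
  interpret Q: module A Q by fact
  show ?case unfolding good_def
  proof (intro allI impI ballI)
    fix X a assume X: "derivation (Wm [] Q) X" and a: "a \<in> carrier A"
    have Xc: "un_Base (X b) \<in> carrier Q \<and> X b = Base (un_Base (X b))" if "b \<in> carrier A" for b
      using derivationD(2)[OF X that] by auto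
    have "derivation Q (\<lambda>b. un_Base (X b))"
      using X Xc unfolding derivation_def by auto
    then have "un_Base (X a) = lsum Q (\<lambda>x. dd x a \<odot>\<^bsub>Q\<^esub> un_Base (X x)) xs"
      using Nil(2) a unfolding good_def by blast
    moreover have "lsum (Wm [] Q) f ys = Base (lsum Q (\<lambda>x. un_Base (f x)) ys)" for f :: "'u \<Rightarrow> ('u, 'a) iter" and ys
      by (induction ys) simp_all
    ultimately show "X a = lsum (Wm [] Q) (\<lambda>x. dd x a \<odot>\<^bsub>Wm [] Q\<^esub> X x) xs"
      using Xc[OF a] by simp
  qed
next
  case (Cons k s)
  interpret V: good_module A K xs dd "Wm s Q"
    using Cons diffmod_Wm frame_axioms by (intro good_module.intro framed_module.intro good_module_axioms.intro) auto
  show ?case unfolding good_def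
  proof (intro allI impI ballI)
    fix X a assume X: "derivation (Wm (k # s) Q) X" and a: "a \<in> carrier A"
    note Xd = derivationD[OF X]
    define \<Phi> where "\<Phi> b = un_Fn (X b)" for b
    have Xc: "X b = Fn (\<Phi> b) \<and> \<Phi> b \<in> extensional (carrier A) \<and> DO (Wm s Q) (Suc k) (\<Phi> b)" if "b \<in> carrier A" for b
      using Xd(2)[OF that] by (auto simp: carrier_Wm_Cons[OF Cons.prems(1)] \<Phi>_def)
    have \<Phi>c: "\<Phi> b c \<in> carrier (Wm s Q)" if "b \<in> carrier A" "c \<in> carrier A" for b c
      using V.DO_closed[of "Suc k" "\<Phi> b" c] Xc that by blast
    have p: "pder (Wm s Q) \<Phi>"
      unfolding pder_def
    proof (intro conjI ballI)
      fix b c d assume bcd: "b \<in> carrier A" "c \<in> carrier A" "d \<in> carrier A"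
      show "\<Phi> (b \<oplus> c) d = \<Phi> b d \<oplus>\<^bsub>Wm s Q\<^esub> \<Phi> c d"
        using bcd by (simp add: \<Phi>_def Xd(3) Diffp_seq_Cons_simps(2-4))
      have "\<Phi> (b \<otimes> c) d = \<Phi> c (b \<otimes> d) \<oplus>\<^bsub>Wm s Q\<^esub> \<Phi> b (c \<otimes> d)"
        using bcd by (simp add: \<Phi>_def Xd(4) Diffp_seq_Cons_simps(2-4))
      then show "\<Phi> (b \<otimes> c) d = \<Phi> b (c \<otimes> d) \<oplus>\<^bsub>Wm s Q\<^esub> \<Phi> c (b \<otimes> d)"
        using V.M.a_comm \<Phi>c bcd by simp
    next
      fix c d assume "c \<in> K" "d \<in> carrier A"
      then show "\<Phi> c d = \<zero>\<^bsub>Wm s Q\<^esub>" by (simp add: \<Phi>_def Xd(5) Diffp_seq_Cons_simps(2-4))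
    qed
    have "\<Phi> a p = lsum (Wm s Q) (\<lambda>x. \<Phi> x (dd x a \<otimes> p)) xs" if "p \<in> carrier A" for p
      using Xc a that by (intro V.pder_expand[OF p]) auto
    moreover have "lsum (Wm (k # s) Q) (\<lambda>x. dd x a \<odot>\<^bsub>Wm (k # s) Q\<^esub> X x) xs =
        Fn (\<lambda>p\<in>carrier A. lsum (Wm s Q) (\<lambda>x. \<Phi> x (dd x a \<otimes> p)) xs)"
      unfolding lsum_Wm_Cons
      by (intro arg_cong[where f = Fn] restrict_ext lsum_cong refl) (simp add: \<Phi>_def Diffp_seq_Cons_simps(2-4))
    ultimately have "lsum (Wm (k # s) Q) (\<lambda>x. dd x a \<odot>\<^bsub>Wm (k # s) Q\<^esub> X x) xs = Fn (\<lambda>p\<in>carrier A. \<Phi> a p)"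
      by (simp only:) (intro arg_cong[where f = Fn] restrict_ext, simp)
    then show "X a = lsum (Wm (k # s) Q) (\<lambda>x. dd x a \<odot>\<^bsub>Wm (k # s) Q\<^esub> X x) xs"
      using Xc[OF a] by (simp add: extensional_restrict)
  qed
qed

lemma good_module_Wm: "module A Q \<Longrightarrow> good Q \<Longrightarrow> good_module A K xs dd (Wm s Q)"
  using good_Wm diffmod_Wm frame_axioms by (intro good_module.intro framed_module.intro good_module_axioms.intro) auto

lemma good_module_DR:
  assumes "module A Q" "good Q"
  shows "good_module A K xs dd ((Wm s Q)\<lparr>carrier := DR (Suc r) s Q\<rparr>)"
  using good_submodule[OF good_Wm[OF assms] DR_subset[OF assms(1)]] module_DR[OF assms(1)] frame_axioms diffcalc_axioms
  by (intro good_module.intro framed_module.intro good_module_axioms.intro diffmod.intro) auto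

end

section \<open>Lifting along evaluation at one\<close>

context diffmod
begin

lemma DO_hom:
  assumes "module A V" "DO W n D"
    and h: "\<And>x. x \<in> carrier W \<Longrightarrow> h x \<in> carrier V"
      "\<And>x y. x \<in> carrier W \<Longrightarrow> y \<in> carrier W \<Longrightarrow> h (x \<oplus>\<^bsub>W\<^esub> y) = h x \<oplus>\<^bsub>V\<^esub> h y"
      "\<And>a x. a \<in> carrier A \<Longrightarrow> x \<in> carrier W \<Longrightarrow> h (a \<odot>\<^bsub>W\<^esub> x) = a \<odot>\<^bsub>V\<^esub> h x"
  shows "DO V n (\<lambda>a. h (D a))"
proof -
  interpret V: diffmod A K V using assms(1) diffcalc_axioms by (intro diffmod.intro)
  have "ord V n (\<lambda>a. h (D a))" if "ord W n D" "D \<in> carrier A \<rightarrow> carrier W" for n D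
    using that
  proof (induction n arbitrary: D)
    case 0
    have "h \<zero>\<^bsub>W\<^esub> = \<zero>\<^bsub>V\<^esub>" using h(3)[of \<zero> "\<zero>\<^bsub>W\<^esub>"] h(1)[of "\<zero>\<^bsub>W\<^esub>"] by simp
    then show ?case using 0 by simp
  next
    case (Suc n)
    have "ord V n (dl V x (\<lambda>a. h (D a)))" if x: "x \<in> carrier A" for x
    proof -
      have "ord V n (\<lambda>a. h (dl W x D a))" using Suc.prems x dl_maps by (intro Suc.IH) auto
      then show ?thesis
      proof (rule ord_cong[THEN iffD1, rotated])
        fix p assume p: "p \<in> carrier A"
        have "D (x \<otimes> p) \<in> carrier W" "D p \<in> carrier W" using Suc.prems(2) x p by auto
        then show "h (dl W x D p) = dl V x (\<lambda>a. h (D a)) p" using x p by (simp add: dl_def h)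
      qed
    qed
    then show ?case by simp
  qed
  then have "ord V n (\<lambda>a. h (D a))" using assms(2) DO_maps by (auto simp: DO_def)
  moreover have "Klin V (\<lambda>a. h (D a))"
  proof -
    have kl: "Klin W D" using assms(2) by (simp add: DO_def)
    have "D a \<in> carrier W" if "a \<in> carrier A" for a using DO_closed[OF assms(2) that] .
    then show ?thesis using kl by (simp add: Klin_def h K_carrier)
  qed
  ultimately show ?thesis by (simp add: DO_def)
qed

lemma derivation_DO:
  assumes "derivation W X"
  shows "DO W 2 X"
proof -
  note X = derivationD[OF assms]
  have "DO W (Suc (Suc 0)) (\<lambda>b. \<one> \<odot>\<^bsub>W\<^esub> X b)"
  proof (rule DO_merge_pder[where \<Phi> = "\<lambda>b a. a \<odot>\<^bsub>W\<^esub> X b"])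
    show "pder W (\<lambda>b a. a \<odot>\<^bsub>W\<^esub> X b)"
      using X(2) by (simp add: pder_def X(3-5) smult_r_distr smult_assoc1[symmetric] M.a_comm R.m_comm)
    show "DO W (Suc 0) (\<lambda>a. a \<odot>\<^bsub>W\<^esub> X b)" if "b \<in> carrier A" for b using X(2)[OF that] by (rule DO_1I)
  qed
  then show ?thesis unfolding numeral_2_eq_2 by (rule DO_cong[THEN iffD1, rotated]) (simp add: X)
qed

lemma closed_form_dS:
  assumes "Sp W S n (Suc i) \<psi>"
  shows "closed_form W i (dS \<psi>)"
proof (cases i)
  case 0
  then show ?thesis using pder_K[OF SpD(2)[OF assms] one_K, of "[]" \<one>] by (simp add: closed_form_def dS_def)
next
  case (Suc j)
  then show ?thesis using dS_dS[OF assms[unfolded Suc]] by (simp add: closed_form_def)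
qed

lemma closed_form_add:
  "closed_form W i \<theta> \<Longrightarrow> closed_form W i \<phi> \<Longrightarrow> closed_form W i (\<lambda>bs a. \<theta> bs a \<oplus>\<^bsub>W\<^esub> \<phi> bs a)"
  by (cases i) (simp_all add: closed_form_def dS_def)

lemma closed_form_dropping: "closed_form W i \<theta> \<Longrightarrow> dropping W n i \<theta>"
proof (unfold dropping_def, intro allI impI ballI)
  fix j bs assume "closed_form W i \<theta>" "i = Suc j" "bs \<in> tuples j"
  then have "ord W n (dS \<theta> bs) = ord W n (\<lambda>a. \<zero>\<^bsub>W\<^esub>)"
    by (intro ord_cong) (simp add: closed_form_def)
  then show "ord W n (dS \<theta> bs)" using ord_zero by blast
qed

text \<open>Correcting the symbol lowers the order step by step until \<open>regular1\<close>
  applies. No gain of order is claimed for \<open>\<psi>\<close>: an operator of order < 1 with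
  values in D_(m,s) is linear with all multiples vanishing at one, hence zero. For the same reason
  \<open>regular2\<close> starts with forms of order < 3.\<close>

lemma closed_exact:
  assumes "regular2 W S" "regular1 W S" "subgrp W S"
    and "Sp W S (Suc (Suc q)) i \<theta>" "closed_form W i \<theta>"
  obtains \<psi> where "Sp W S (Suc (Suc q)) (Suc i) \<psi>"
    "\<And>bs a. bs \<in> tuples i \<Longrightarrow> a \<in> carrier A \<Longrightarrow> \<theta> bs a = dS \<psi> bs a"
proof -
  have "\<exists>\<psi>. Sp W S (Suc (Suc q)) (Suc i) \<psi> \<and> (\<forall>bs\<in>tuples i. \<forall>a\<in>carrier A. \<theta> bs a = dS \<psi> bs a)"
    using assms(4,5)
  proof (induction q arbitrary: \<theta>)
    case 0
    then show ?case using assms(2) by (simp add: regular1_def numeral_2_eq_2 del: Sp.simps)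
  next
    case (Suc q)
    obtain \<psi>0 where \<psi>0: "Sp W S (Suc (Suc q)) (Suc i) \<psi>0"
      "Sp W S (Suc (Suc q)) i (\<lambda>bs a. \<theta> bs a \<oplus>\<^bsub>W\<^esub> dS \<psi>0 bs a)"
      using assms(1) Suc.prems(1) closed_form_dropping[OF Suc.prems(2)] unfolding regular2_def by blast
    have "closed_form W i (\<lambda>bs a. \<theta> bs a \<oplus>\<^bsub>W\<^esub> dS \<psi>0 bs a)"
      using Suc.prems(2) closed_form_dS[OF \<psi>0(1)] by (rule closed_form_add)
    from Suc.IH[OF \<psi>0(2) this] obtain \<zeta> where \<zeta>: "Sp W S (Suc (Suc q)) (Suc i) \<zeta>"
      "\<And>bs a. bs \<in> tuples i \<Longrightarrow> a \<in> carrier A \<Longrightarrow> \<theta> bs a \<oplus>\<^bsub>W\<^esub> dS \<psi>0 bs a = dS \<zeta> bs a" by blast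
    define \<psi> where "\<psi> bs a = \<zeta> bs a \<oplus>\<^bsub>W\<^esub> (\<ominus> \<one>) \<odot>\<^bsub>W\<^esub> \<psi>0 bs a" for bs a
    have "Sp W S (Suc (Suc q)) (Suc i) \<psi>"
      unfolding \<psi>_def[abs_def] using \<zeta>(1) Sp_neg[OF \<psi>0(1) assms(3)] assms(3) by (rule Sp_add)
    then have "Sp W S (Suc (Suc (Suc q))) (Suc i) \<psi>" by (rule Sp_mono) simp
    moreover have "\<theta> bs a = dS \<psi> bs a" if "bs \<in> tuples i" "a \<in> carrier A" for bs a
    proof -
      have c: "\<theta> bs a \<in> carrier W" "dS \<psi>0 bs a \<in> carrier W"
        using Sp_closed[OF Suc.prems(1) that] Sp_closed[OF Sp_d[OF \<psi>0(1) assms(3)] that] by auto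
      have "dS \<psi> bs a = dS \<zeta> bs a \<oplus>\<^bsub>W\<^esub> (\<ominus> \<one>) \<odot>\<^bsub>W\<^esub> dS \<psi>0 bs a" by (simp add: dS_def \<psi>_def)
      also have "\<dots> = \<theta> bs a" using c by (simp add: \<zeta>(2)[OF that, symmetric] neg_one_smult M.a_ac M.cancel_simps)
      finally show ?thesis by simp
    qed
    ultimately show ?case by blast
  qed
  then show ?thesis using that by blast
qed

end

context good_module
begin

lemma Klin_nu: "Klin W D \<Longrightarrow> p \<in> carrier A \<Longrightarrow> D (nu n \<otimes> p) = nu n \<odot>\<^bsub>W\<^esub> D p"
proof (induction n)
  case 0
  then show ?case using Klin_zero[of D] by (auto simp: Klin_def Pi_iff)
next
  case (Suc n)
  have "D p \<in> carrier W" using Suc.prems by (auto simp: Klin_def)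
  then show ?case using Suc by (simp add: nu_Suc R.l_distr smult_l_distr) (simp add: Klin_def)
qed

text \<open>\<open>K\<close> need not contain the rational numbers; linearity over integral
  multiples of one is inverted instead.\<close>

lemma Klin_inv_nu:
  assumes "Klin W D" "p \<in> carrier A"
  shows "D (inv (nu (Suc n)) \<otimes> p) = inv (nu (Suc n)) \<odot>\<^bsub>W\<^esub> D p"
proof -
  have u: "nu (Suc n) \<in> Units A" unfolding nu_def by (rule rational) simp
  define v where "v = inv (nu (Suc n))"
  have v: "v \<in> carrier A" "v \<otimes> nu (Suc n) = \<one>" "nu (Suc n) \<otimes> v = \<one>" using u by (simp_all add: v_def)
  have c: "D (v \<otimes> p) \<in> carrier W" using assms v by (auto simp: Klin_def)
  have "D (nu (Suc n) \<otimes> (v \<otimes> p)) = nu (Suc n) \<odot>\<^bsub>W\<^esub> D (v \<otimes> p)" using assms v by (intro Klin_nu) auto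
  moreover have "nu (Suc n) \<otimes> (v \<otimes> p) = p" using assms v by (simp add: R.m_assoc[symmetric])
  ultimately have "v \<odot>\<^bsub>W\<^esub> D p = (v \<otimes> nu (Suc n)) \<odot>\<^bsub>W\<^esub> D (v \<otimes> p)" using v(1) c by (simp add: smult_assoc1)
  then show ?thesis using v(2) c by (simp add: v_def)
qed

text \<open>A linear operator is lifted by lifting its value at one. By \<open>DO_split\<close> all
  others are built from linear ones and from derivations applied to the argument, and the latter do
  not involve the target.\<close>

lemma DO_lift:
  assumes V: "framed_module A K xs dd V"
    and h: "\<And>x y. x \<in> carrier V \<Longrightarrow> y \<in> carrier V \<Longrightarrow> h (x \<oplus>\<^bsub>V\<^esub> y) = h x \<oplus>\<^bsub>W\<^esub> h y"
      "\<And>a x. a \<in> carrier A \<Longrightarrow> x \<in> carrier V \<Longrightarrow> h (a \<odot>\<^bsub>V\<^esub> x) = a \<odot>\<^bsub>W\<^esub> h x"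
      "h \<zero>\<^bsub>V\<^esub> = \<zero>\<^bsub>W\<^esub>" "h ` carrier V = carrier W"
    and D: "DO W (Suc n) D"
  shows "\<exists>L. DO V (Suc n) L \<and> (\<forall>a\<in>carrier A. h (L a) = D a)"
  using D
proof (induction n arbitrary: D)
  case 0
  interpret V: framed_module A K xs dd V by fact
  have "D \<one> \<in> carrier W" using DO_closed[OF 0] by simp
  then obtain v where v: "v \<in> carrier V" "h v = D \<one>" using h(4) by (metis imageE)
  have "h (a \<odot>\<^bsub>V\<^esub> v) = D a" if "a \<in> carrier A" for a
    using ord_1[of D a] 0 DO_maps[OF 0] that v h(2) by (simp add: DO_def)
  then show ?case using V.DO_1I[OF v(1)] by blast
next
  case (Suc n)
  interpret V: framed_module A K xs dd V by fact
  obtain E F where EF: "DO W (Suc n) E" "\<And>x. x \<in> set xs \<Longrightarrow> DO W (Suc n) (F x)"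
    "\<And>p. p \<in> carrier A \<Longrightarrow> D p = lsum W (\<lambda>x. F x (dd x p)) xs \<oplus>\<^bsub>W\<^esub> E p"
    using DO_split[OF Suc.prems] by blast
  obtain L where L: "DO V (Suc n) L" "\<forall>a\<in>carrier A. h (L a) = E a" using Suc.IH[OF EF(1)] by blast
  have "\<forall>x. \<exists>M. x \<in> set xs \<longrightarrow> DO V (Suc n) M \<and> (\<forall>a\<in>carrier A. h (M a) = F x a)"
    using Suc.IH[OF EF(2)] by blast
  then obtain M where M: "\<And>x. x \<in> set xs \<Longrightarrow> DO V (Suc n) (M x)"
    "\<And>x a. x \<in> set xs \<Longrightarrow> a \<in> carrier A \<Longrightarrow> h (M x a) = F x a" by metis
  have Mc: "M x a \<in> carrier V" if "x \<in> set xs" "a \<in> carrier A" for x a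
    using V.DO_closed[OF M(1)[OF that(1)] that(2)] .
  have 1: "DO V (Suc (Suc n)) (\<lambda>a. lsum V (\<lambda>x. M x (dd x a)) xs)"
  proof (rule V.DO_lsum)
    show "DO V (Suc (Suc n)) (\<lambda>a. M x (dd x a))" if "x \<in> set xs" for x
      using M(1)[OF that] dd[OF that] by (rule V.DO_comp_derivation)
  qed
  have "DO V (Suc (Suc n)) (\<lambda>a. lsum V (\<lambda>x. M x (dd x a)) xs \<oplus>\<^bsub>V\<^esub> L a)"
    by (rule V.DO_add[OF 1 V.DO_mono[OF L(1)]]) simp
  moreover have "h (lsum V (\<lambda>x. M x (dd x a)) xs \<oplus>\<^bsub>V\<^esub> L a) = D a" if a: "a \<in> carrier A" for a
  proof -
    have "h (lsum V (\<lambda>x. M x (dd x a)) xs \<oplus>\<^bsub>V\<^esub> L a) = h (lsum V (\<lambda>x. M x (dd x a)) xs) \<oplus>\<^bsub>W\<^esub> h (L a)"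
      using V.DO_closed[OF 1 a] V.DO_closed[OF L(1) a] by (intro h)
    also have "h (lsum V (\<lambda>x. M x (dd x a)) xs) = lsum W (\<lambda>x. h (M x (dd x a))) xs"
      by (rule lsum_hom[where A = A]) (use h Mc a V.module_axioms in auto)
    also have "\<dots> = lsum W (\<lambda>x. F x (dd x a)) xs" using M(2) a by (intro lsum_cong) auto
    finally show ?thesis using EF(3)[OF a] L(2) a by simp
  qed
  ultimately show ?case by blast
qed

end

text \<open>Evaluation at one makes 0 -> \<open>S'\<close> -> \<open>N\<close> -> \<open>S\<close>
  -> 0 a complex whose exactness, order by order, is the content of this part. \<open>N\<close> is
  stable under the action on arguments, while \<open>S\<close> and \<open>S'\<close> in general are
  not; so the Koszul homotopy lives on \<open>N\<close>, and exactness for \<open>S'\<close> is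
  obtained from \<open>N\<close> and \<open>S\<close> by a chase.\<close>

locale syzygy = frame +
  fixes Q and s :: "nat list" and m :: nat
  assumes module_Q: "module A Q" and good_Q: "good Q"
begin

abbreviation "W \<equiv> Wm s Q"
abbreviation "S \<equiv> DR 0 s Q"
abbreviation "W' \<equiv> Wm (m # s) Q"
abbreviation "S' \<equiv> DR 0 (m # s) Q"
abbreviation "N \<equiv> Wm (m # s) Q\<lparr>carrier := DR (Suc 0) (m # s) Q\<rparr>"

sublocale W: good_module A K xs dd W
  using good_module_Wm[OF module_Q good_Q] .

sublocale W': good_module A K xs dd W'
  using good_module_Wm[OF module_Q good_Q] .

sublocale N: good_module A K xs dd N
  using good_module_DR[OF module_Q good_Q] .

definition mu :: "('a list \<Rightarrow> 'a \<Rightarrow> ('a, 'c) iter) \<Rightarrow> 'a list \<Rightarrow> 'a \<Rightarrow> ('a, 'c) iter" where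
  "mu \<theta> bs a = un_Fn (\<theta> bs a) \<one>"

lemma N_ops:
  "x \<oplus>\<^bsub>W'\<^esub> y = Fn (\<lambda>p\<in>carrier A. un_Fn x p \<oplus>\<^bsub>W\<^esub> un_Fn y p)"
  "a \<odot>\<^bsub>W'\<^esub> x = Fn (\<lambda>p\<in>carrier A. un_Fn x (a \<otimes> p))"
  "\<zero>\<^bsub>W'\<^esub> = Fn (\<lambda>p\<in>carrier A. \<zero>\<^bsub>W\<^esub>)"
  by (simp_all add: Diffp_seq_Cons_simps(2-4))

lemma N_D:
  assumes "x \<in> DR (Suc 0) (m # s) Q"
  shows "DO W (Suc m) (un_Fn x)" "p \<in> carrier A \<Longrightarrow> un_Fn x p \<in> S" "p \<in> carrier A \<Longrightarrow> un_Fn x p \<in> carrier W"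
    "un_Fn x \<in> extensional (carrier A)" "x = Fn (un_Fn x)"
proof -
  obtain D where D: "x = Fn D" "D \<in> extensional (carrier A)" "DO W (Suc m) D"
    "\<And>a. a \<in> carrier A \<Longrightarrow> D a \<in> DR (Suc 0 - 1) s Q"
    using DR_ConsE[OF assms] by metis
  then show "DO W (Suc m) (un_Fn x)" "p \<in> carrier A \<Longrightarrow> un_Fn x p \<in> S" "p \<in> carrier A \<Longrightarrow> un_Fn x p \<in> carrier W"
    "un_Fn x \<in> extensional (carrier A)" "x = Fn (un_Fn x)"
    using W.DO_closed[OF D(3)] by auto
qed

lemma N_zero_iff:
  assumes "x \<in> DR (Suc 0) (m # s) Q"
  shows "x = \<zero>\<^bsub>W'\<^esub> \<longleftrightarrow> (\<forall>p\<in>carrier A. un_Fn x p = \<zero>\<^bsub>W\<^esub>)"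
proof
  assume "\<forall>p\<in>carrier A. un_Fn x p = \<zero>\<^bsub>W\<^esub>"
  then have "un_Fn x = (\<lambda>p\<in>carrier A. \<zero>\<^bsub>W\<^esub>)"
    using N_D(4)[OF assms] by (intro extensionalityI[of _ "carrier A"]) auto
  then show "x = \<zero>\<^bsub>W'\<^esub>" using N_D(5)[OF assms] by (simp add: N_ops)
qed (simp add: N_ops)

lemma S'_iff: "x \<in> S' \<longleftrightarrow> x \<in> DR (Suc 0) (m # s) Q \<and> un_Fn x \<one> = \<zero>\<^bsub>W\<^esub>"
  by auto

lemma ord_N_iff:
  "D \<in> carrier A \<rightarrow> carrier N \<Longrightarrow> ord N n D \<longleftrightarrow> W.pord n (\<lambda>a. un_Fn (D a))"
proof (induction n arbitrary: D)
  case 0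
  then show ?case using N_zero_iff by (auto simp: Pi_iff)
next
  case (Suc n)
  have "ord N n (dl N x D) \<longleftrightarrow> W.pord n (\<lambda>a p. un_Fn (D (x \<otimes> a)) p \<oplus>\<^bsub>W\<^esub> un_Fn (D a) ((\<ominus> x) \<otimes> p))"
    if x: "x \<in> carrier A" for x
  proof -
    have "ord N n (dl N x D) \<longleftrightarrow> W.pord n (\<lambda>a. un_Fn (dl N x D a))"
      using Suc.prems x by (intro Suc.IH N.dl_maps)
    also have "\<dots> \<longleftrightarrow> W.pord n (\<lambda>a p. un_Fn (D (x \<otimes> a)) p \<oplus>\<^bsub>W\<^esub> un_Fn (D a) ((\<ominus> x) \<otimes> p))"
      by (intro W.pord_cong) (simp add: dl_def N_ops)
    finally show ?thesis .
  qed
  then show ?case by simp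
qed

lemma mu_DO:
  assumes "DO N n D"
  shows "DO W (n + m) (\<lambda>a. un_Fn (D a) \<one>)" "a \<in> carrier A \<Longrightarrow> un_Fn (D a) \<one> \<in> S"
proof -
  have maps: "D \<in> carrier A \<rightarrow> carrier N" using N.DO_maps[OF assms] .
  then have DN: "D a \<in> DR (Suc 0) (m # s) Q" if "a \<in> carrier A" for a using that by auto
  have "W.pord n (\<lambda>a. un_Fn (D a))" using assms ord_N_iff[OF maps] by (simp add: DO_def)
  then have "ord W (n + m) (\<lambda>a. un_Fn (D a) \<one>)"
    using N_D(1)[OF DN] by (intro W.ord_merge[where m = "Suc m"]) auto
  moreover have "Klin W (\<lambda>a. un_Fn (D a) \<one>)"
    unfolding Klin_def
  proof (intro conjI ballI)
    show "(\<lambda>a. un_Fn (D a) \<one>) \<in> carrier A \<rightarrow> carrier W" using N_D(3)[OF DN] by auto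
    fix a b assume "a \<in> carrier A" "b \<in> carrier A"
    then have "D (a \<oplus> b) = D a \<oplus>\<^bsub>W'\<^esub> D b" using assms by (simp add: DO_def Klin_def)
    then show "un_Fn (D (a \<oplus> b)) \<one> = un_Fn (D a) \<one> \<oplus>\<^bsub>W\<^esub> un_Fn (D b) \<one>" by (simp add: N_ops)
  next
    fix c a assume ca: "c \<in> K" "a \<in> carrier A"
    then have "D (c \<otimes> a) = c \<odot>\<^bsub>W'\<^esub> D a" using assms by (simp add: DO_def Klin_def)
    then have "un_Fn (D (c \<otimes> a)) \<one> = un_Fn (D a) (c \<otimes> \<one>)" by (simp add: N_ops)
    moreover have "un_Fn (D a) (c \<otimes> \<one>) = c \<odot>\<^bsub>W\<^esub> un_Fn (D a) \<one>"
      using N_D(1)[OF DN[OF ca(2)]] ca unfolding DO_def Klin_def by blast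
    ultimately show "un_Fn (D (c \<otimes> a)) \<one> = c \<odot>\<^bsub>W\<^esub> un_Fn (D a) \<one>" by simp
  qed
  ultimately show "DO W (n + m) (\<lambda>a. un_Fn (D a) \<one>)" by (simp add: DO_def)
  show "a \<in> carrier A \<Longrightarrow> un_Fn (D a) \<one> \<in> S" using N_D(2)[OF DN] by simp
qed

lemma Sp_mu:
  assumes "Sp N (carrier N) n i \<theta>"
  shows "Sp W S (n + m) i (mu \<theta>)"
proof -
  have "Sp W S (n + m) i (\<lambda>bs a. un_Fn (\<theta> bs a) \<one>)"
  proof (rule N.Sp_map[OF assms, where F = "\<lambda>D a. un_Fn (D a) \<one>"])
    show "DO W (n + m) (\<lambda>a. un_Fn (\<theta> bs a) \<one>)" if "bs \<in> tuples i" for bs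
      using N.Sp_DO[OF assms that] by (rule mu_DO)
    show "un_Fn (\<theta> bs a) \<one> \<in> S" if "bs \<in> tuples i" "a \<in> carrier A" for bs a
      using mu_DO(2)[OF N.Sp_DO[OF assms that(1)] that(2)] .
    show "pder W (\<lambda>b a. un_Fn (\<Phi> b a) \<one>)" if "pder N \<Phi>" for \<Phi>
      using that by (simp add: pder_def N_ops)
    show "un_Fn (D a) \<one> \<oplus>\<^bsub>W\<^esub> un_Fn (E a) \<one> = \<zero>\<^bsub>W\<^esub>"
      if "\<And>a. a \<in> carrier A \<Longrightarrow> D a \<oplus>\<^bsub>N\<^esub> E a = \<zero>\<^bsub>N\<^esub>" "a \<in> carrier A" for D E a
      using arg_cong[OF that(1)[OF that(2)], of "\<lambda>x. un_Fn x \<one>"] by (simp add: N_ops)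
  qed
  then show ?thesis by (simp add: mu_def[abs_def])
qed

lemma C_subset: "DR (Suc 0) (m # s) Q \<subseteq> carrier W'" "S' \<subseteq> DR (Suc 0) (m # s) Q"
  by (rule DR_subset[OF module_Q], rule DR_Suc_subset)

lemma Sp_S'_N: "Sp W' S' n i \<theta> \<Longrightarrow> Sp N (carrier N) n i \<theta>"
proof -
  assume "Sp W' S' n i \<theta>"
  then have "Sp N S' n i \<theta>" using Sp_carrier_update[OF C_subset] by blast
  then show ?thesis by (rule N.Sp_subset) (use C_subset in simp)
qed

lemma Sp_N_S':
  assumes "Sp N (carrier N) n i \<theta>" "\<And>bs a. bs \<in> tuples i \<Longrightarrow> a \<in> carrier A \<Longrightarrow> mu \<theta> bs a = \<zero>\<^bsub>W\<^esub>"
  shows "Sp W' S' n i \<theta>"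
proof -
  have "Sp N S' n i \<theta>"
  proof (rule N.Sp_change[OF assms(1)])
    show "DO N n (\<theta> bs)" if "bs \<in> tuples i" for bs using N.Sp_DO[OF assms(1) that] .
    show "\<theta> bs a \<in> S'" if "bs \<in> tuples i" "a \<in> carrier A" for bs a
      using N.Sp_range[OF assms(1) that] assms(2)[OF that] unfolding S'_iff by (simp add: mu_def)
  qed
  then show ?thesis using Sp_carrier_update[OF C_subset] by blast
qed

lemma mu_S':
  assumes "Sp W' S' n i \<theta>" "bs \<in> tuples i" "a \<in> carrier A"
  shows "mu \<theta> bs a = \<zero>\<^bsub>W\<^esub>"
  using W'.Sp_range[OF assms] by (simp add: S'_iff mu_def del: DR.simps)

lemma mu_lsum: "un_Fn (lsum N f ys) \<one> = lsum W (\<lambda>x. un_Fn (f x) \<one>) ys"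
  by (simp add: lsum_Wm_Cons)

text \<open>\<open>DO_split\<close> is of no help here, since its summands leave \<open>S\<close>.
  Instead \<open>regular2\<close> writes \<open>D\<close> as a lower order part minus
  \<open>dS \<psi>\<close> with values in \<open>S\<close>, and \<open>pder_expand\<close> turns the
  latter into operators of lower order composed with coordinate derivations. All pieces are lifted
  by induction and put together again.\<close>

lemma lift_operator:
  assumes reg: "regular2 W S" and m: "0 < m"
    and D: "DO W (Suc n + m) D" "\<And>a. a \<in> carrier A \<Longrightarrow> D a \<in> S"
  obtains L where "DO N (Suc n) L" "\<And>a. a \<in> carrier A \<Longrightarrow> un_Fn (L a) \<one> = D a"
proof -
  have "\<exists>L. DO N (Suc n) L \<and> (\<forall>a\<in>carrier A. un_Fn (L a) \<one> = D a)"
    using D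
  proof (induction n arbitrary: D)
    case 0
    \<comment> \<open>An operator of order at most m is itself an element of \<open>N\<close>; the
      linear operator through it evaluates to it at one.\<close>
    define w where "w = Fn (\<lambda>a\<in>carrier A. D a)"
    have "w \<in> DR (Suc 0) (m # s) Q"
      unfolding w_def using 0 module_Q by (intro DR_ConsI) auto
    then have "DO N (Suc 0) (\<lambda>a. a \<odot>\<^bsub>N\<^esub> w)" by (intro N.DO_1I) simp
    moreover have "un_Fn (a \<odot>\<^bsub>N\<^esub> w) \<one> = D a" if "a \<in> carrier A" for a
      using that by (simp add: N_ops w_def)
    ultimately show ?case by blast
  next
    case (Suc n)
    \<comment> \<open>With m > 0 the order bound takes the form \<open>Suc (Suc (Suc _))\<close>
      required by \<open>regular2\<close>.\<close>
    obtain m' where m': "m = Suc m'" using m by (cases m) auto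
    have "Sp W S (Suc (Suc (Suc (n + m')))) 0 (\<lambda>bs. D)" using Suc.prems by (simp add: m')
    then obtain \<psi> where \<psi>: "Sp W S (Suc (Suc (n + m'))) (Suc 0) \<psi>"
      "Sp W S (Suc (Suc (n + m'))) 0 (\<lambda>bs a. D a \<oplus>\<^bsub>W\<^esub> dS \<psi> bs a)"
      using reg unfolding regular2_def dropping_def by blast
    have o: "Suc n + m = Suc (Suc (n + m'))" by (simp add: m')
    define \<phi> where "\<phi> b a = (\<ominus> \<one>) \<odot>\<^bsub>W\<^esub> \<psi> [b] a" for b a
    have \<psi>': "Sp W S (Suc (Suc (n + m'))) (Suc 0) (\<lambda>bs a. (\<ominus> \<one>) \<odot>\<^bsub>W\<^esub> \<psi> bs a)"
      using \<psi>(1) subgrp_DR[OF module_Q] by (rule W.Sp_neg)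
    have \<phi>D: "DO W (Suc n + m) (\<phi> b)" and \<phi>S: "a \<in> carrier A \<Longrightarrow> \<phi> b a \<in> S"
      and \<phi>p: "pder W \<phi>" if "b \<in> carrier A" for b a
      using W.Sp_DO[OF \<psi>', of "[b]"] W.Sp_range[OF \<psi>', of "[b]"] W.SpD(2)[OF \<psi>', of "[]"] that
      by (auto simp: \<phi>_def[abs_def] m')
    obtain LE where LE: "DO N (Suc n) LE" "\<forall>a\<in>carrier A. un_Fn (LE a) \<one> = D a \<oplus>\<^bsub>W\<^esub> dS \<psi> [] a"
      using Suc.IH[of "\<lambda>a. D a \<oplus>\<^bsub>W\<^esub> dS \<psi> [] a"] \<psi>(2) o by auto
    have "\<forall>x. \<exists>M. x \<in> set xs \<longrightarrow> DO N (Suc n) M \<and> (\<forall>a\<in>carrier A. un_Fn (M a) \<one> = \<phi> x a)"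
      using Suc.IH[OF \<phi>D \<phi>S] by auto
    then obtain M where M: "\<And>x. x \<in> set xs \<Longrightarrow> DO N (Suc n) (M x)"
      "\<And>x a. x \<in> set xs \<Longrightarrow> a \<in> carrier A \<Longrightarrow> un_Fn (M x a) \<one> = \<phi> x a" by metis
    have 1: "DO N (Suc (Suc n)) (\<lambda>a. lsum N (\<lambda>x. M x (dd x a)) xs)"
    proof (rule N.DO_lsum)
      show "DO N (Suc (Suc n)) (\<lambda>a. M x (dd x a))" if "x \<in> set xs" for x
        using M(1)[OF that] dd[OF that] by (rule N.DO_comp_derivation)
    qed
    have "DO N (Suc (Suc n)) (\<lambda>a. lsum N (\<lambda>x. M x (dd x a)) xs \<oplus>\<^bsub>N\<^esub> LE a)"
      by (rule N.DO_add[OF 1 N.DO_mono[OF LE(1)]]) simp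
    moreover have "un_Fn (lsum N (\<lambda>x. M x (dd x a)) xs \<oplus>\<^bsub>N\<^esub> LE a) \<one> = D a" if a: "a \<in> carrier A" for a
    proof -
      have "un_Fn (lsum N (\<lambda>x. M x (dd x a)) xs \<oplus>\<^bsub>N\<^esub> LE a) \<one> =
          un_Fn (lsum N (\<lambda>x. M x (dd x a)) xs) \<one> \<oplus>\<^bsub>W\<^esub> un_Fn (LE a) \<one>" by (simp add: N_ops)
      also have "un_Fn (lsum N (\<lambda>x. M x (dd x a)) xs) \<one> = lsum W (\<lambda>x. \<phi> x (dd x a \<otimes> \<one>)) xs"
        unfolding mu_lsum using M(2) a by (intro lsum_cong) auto
      also have "\<dots> = \<phi> a \<one>" using W.pder_expand[OF \<phi>p \<phi>D a, of \<one>] a by simp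
      finally have e: "un_Fn (lsum N (\<lambda>x. M x (dd x a)) xs \<oplus>\<^bsub>N\<^esub> LE a) \<one> =
          (\<ominus> \<one>) \<odot>\<^bsub>W\<^esub> \<psi> [a] \<one> \<oplus>\<^bsub>W\<^esub> (D a \<oplus>\<^bsub>W\<^esub> \<psi> [a] \<one>)"
        using LE(2) a by (simp add: \<phi>_def dS_def)
      moreover have "\<psi> [a] \<one> \<in> carrier W" "D a \<in> carrier W"
        using W.Sp_closed[OF \<psi>(1), of "[a]" \<one>] a W.DO_closed[OF Suc.prems(1) a] by auto
      ultimately show ?thesis by (simp add: W.neg_one_smult W.M.cancel_simps)
    qed
    ultimately show ?case by blast
  qed
  then show ?thesis using that by blast
qed

lemma un_Fn_alt:
  assumes "bs \<in> tuples (Suc i)"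
    "\<And>x r. x \<in> carrier A \<Longrightarrow> r \<in> tuples i \<Longrightarrow> \<eta> x r a \<in> carrier N"
  shows "un_Fn (alt N bs \<eta> a) \<one> = alt W bs (\<lambda>x r a. un_Fn (\<eta> x r a) \<one>) a"
  using assms
proof (induction i arbitrary: bs \<eta>)
  case 0
  then obtain c where c: "bs = [c]" "c \<in> carrier A" by (auto elim!: tuples_SucE)
  have "(\<ominus> \<one>) \<odot>\<^bsub>N\<^esub> \<zero>\<^bsub>N\<^esub> = \<zero>\<^bsub>N\<^esub>" "(\<ominus> \<one>) \<odot>\<^bsub>W\<^esub> \<zero>\<^bsub>W\<^esub> = \<zero>\<^bsub>W\<^esub>" by (rule N.smult_r_null W.smult_r_null, simp)+
  then show ?case using c by (simp add: N_ops)
next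
  case (Suc i)
  from Suc.prems(1) obtain c cs where c: "bs = c # cs" "c \<in> carrier A" "cs \<in> tuples (Suc i)"
    by (rule tuples_SucE)
  have "alt N cs (\<lambda>x r. \<eta> x (c # r)) a \<in> carrier N"
    using c Suc.prems(2) by (intro N.alt_closed[where i = i]) auto
  then have k: "Klin W (un_Fn (alt N cs (\<lambda>x r. \<eta> x (c # r)) a))" using N_D(1) by (simp add: DO_def)
  have "un_Fn (alt N cs (\<lambda>x r. \<eta> x (c # r)) a) \<one> = alt W cs (\<lambda>x r a. un_Fn (\<eta> x (c # r) a) \<one>) a"
    using c Suc.prems(2) by (intro Suc.IH) auto
  then show ?case using c W.Klin_neg[OF k, of \<one>] by (simp add: N_ops)
qed

text \<open>Lifts chosen at the coordinates extend to a family which is a derivation in the new slot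
  but not skew. Alternating makes it skew; as the form to be lifted is skew already, its image only
  gets multiplied by the degree, which is then divided out.\<close>

lemma lift_form:
  assumes reg: "regular2 W S" and m: "0 < m" and \<theta>: "Sp W S (Suc n + m) i \<theta>"
  obtains \<psi> where "Sp N (carrier N) (Suc n) i \<psi>"
    "\<And>bs a. bs \<in> tuples i \<Longrightarrow> a \<in> carrier A \<Longrightarrow> mu \<psi> bs a = \<theta> bs a"
proof -
  have "\<exists>\<psi>. Sp N (carrier N) (Suc n) i \<psi> \<and> (\<forall>bs\<in>tuples i. \<forall>a\<in>carrier A. mu \<psi> bs a = \<theta> bs a)"
    using \<theta>
  proof (induction i arbitrary: \<theta>)
    case 0
    then have "DO W (Suc n + m) (\<theta> [])" "\<And>a. a \<in> carrier A \<Longrightarrow> \<theta> [] a \<in> S" by auto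
    then obtain L where L: "DO N (Suc n) L" "\<And>a. a \<in> carrier A \<Longrightarrow> un_Fn (L a) \<one> = \<theta> [] a"
      using lift_operator[OF reg m] by metis
    show ?case using L N.DO_maps[OF L(1)] by (intro exI[of _ "\<lambda>bs. L"]) (simp add: mu_def)
  next
    case (Suc i)
    have "\<forall>x. \<exists>\<psi>. x \<in> set xs \<longrightarrow> Sp N (carrier N) (Suc n) i \<psi> \<and>
        (\<forall>bs\<in>tuples i. \<forall>a\<in>carrier A. mu \<psi> bs a = \<theta> (x # bs) a)"
      using Suc.IH[OF W.SpD(1)[OF Suc.prems]] by auto
    then obtain \<Psi> where \<Psi>: "\<And>x. x \<in> set xs \<Longrightarrow> Sp N (carrier N) (Suc n) i (\<Psi> x)"
      "\<And>x bs a. x \<in> set xs \<Longrightarrow> bs \<in> tuples i \<Longrightarrow> a \<in> carrier A \<Longrightarrow> mu (\<Psi> x) bs a = \<theta> (x # bs) a" by metis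
    define \<eta> where "\<eta> b bs a = lsum N (\<lambda>x. \<Psi> x bs (dd x b \<otimes> a)) xs" for b bs a
    have \<eta>Sp: "Sp N (carrier N) (Suc n) i (\<eta> b)" if "b \<in> carrier A" for b
      unfolding \<eta>_def[abs_def]
    proof (rule N.Sp_lsum[OF _ N.subgrp_carrier])
      show "Sp N (carrier N) (Suc n) i (\<lambda>bs a. \<Psi> x bs (dd x b \<otimes> a))" if "x \<in> set xs" for x
        using \<Psi>(1) that \<open>b \<in> carrier A\<close> by (intro N.Sp_plus) auto
    qed
    have \<eta>p: "pder N (\<lambda>b. \<eta> b bs)" if bs: "bs \<in> tuples i" for bs
      unfolding \<eta>_def[abs_def]
    proof (rule N.pder_lsum)
      fix x assume x: "x \<in> set xs"
      have D: "DO N (Suc n) (\<Psi> x bs)" using N.Sp_DO[OF \<Psi>(1)[OF x] bs] .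
      then have "Klin N (\<Psi> x bs)" by (simp add: DO_def)
      then show "pder N (\<lambda>b a. \<Psi> x bs (dd x b \<otimes> a))" using dd[OF x] by (rule N.pder_comp)
      show "\<Psi> x bs (dd x b \<otimes> a) \<in> carrier N" if "b \<in> carrier A" "a \<in> carrier A" for b a
        using N.DO_closed[OF D] x that by simp
    qed
    have alt: "Sp N (carrier N) (Suc n) (Suc i) (\<lambda>bs. alt N bs \<eta>)"
      using \<eta>Sp \<eta>p N.subgrp_carrier by (rule N.Sp_alt)
    define u where "u = inv (W.nu (Suc i))"
    have unit: "W.nu (Suc i) \<in> Units A" unfolding W.nu_def by (rule rational) simp
    then have u: "u \<in> carrier A" "u \<otimes> W.nu (Suc i) = \<one>" by (simp_all add: u_def)
    define \<psi> where "\<psi> bs a = u \<odot>\<^bsub>N\<^esub> alt N bs \<eta> a" for bs a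
    have "Sp N (carrier N) (Suc n) (Suc i) \<psi>"
      unfolding \<psi>_def[abs_def] using alt u(1) by (rule N.Sp_smult) (use u(1) N.smult_closed in blast)
    moreover have "mu \<psi> bs a = \<theta> bs a" if bs: "bs \<in> tuples (Suc i)" and a: "a \<in> carrier A" for bs a
    proof -
      have x: "alt N bs \<eta> a \<in> DR (Suc 0) (m # s) Q" using N.Sp_closed[OF alt bs a] by simp
      \<comment> \<open>In \<open>N\<close> the scalar acts on the argument;
        \<open>Klin_inv_nu\<close> moves it to the value.\<close>
      have "mu \<psi> bs a = un_Fn (alt N bs \<eta> a) (u \<otimes> \<one>)" by (simp add: mu_def \<psi>_def N_ops)
      also have "\<dots> = u \<odot>\<^bsub>W\<^esub> un_Fn (alt N bs \<eta> a) \<one>"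
        unfolding u_def by (intro W.Klin_inv_nu) (use N_D(1)[OF x] in \<open>simp_all add: DO_def\<close>)
      also have "un_Fn (alt N bs \<eta> a) \<one> = alt W bs (\<lambda>x r a. un_Fn (\<eta> x r a) \<one>) a"
        using bs N.Sp_closed[OF \<eta>Sp] a by (intro un_Fn_alt) auto
      also have "\<dots> = alt W bs (\<lambda>x r. \<theta> (x # r)) a"
      proof (rule W.alt_cong[OF _ bs])
        fix b r assume b: "b \<in> carrier A" and r: "r \<in> tuples i"
        have "un_Fn (\<eta> b r a) \<one> = lsum W (\<lambda>x. \<theta> (x # r) (dd x b \<otimes> a)) xs"
          unfolding \<eta>_def mu_lsum using \<Psi>(2) r b a by (intro lsum_cong) (auto simp: mu_def)
        also have "\<dots> = \<theta> (b # r) a"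
          using W.pder_expand[OF W.SpD(2)[OF Suc.prems r] _ b a] W.Sp_DO[OF Suc.prems] r by force
        finally show "un_Fn (\<eta> b r a) \<one> = \<theta> (b # r) a" .
      qed
      also have "\<dots> = W.nu (Suc i) \<odot>\<^bsub>W\<^esub> \<theta> bs a" using Suc.prems bs a by (rule W.alt_self)
      finally show ?thesis
        using u W.Sp_closed[OF Suc.prems bs a] by (simp add: W.smult_assoc1[symmetric])
    qed
    ultimately show ?case by blast
  qed
  then show ?thesis using that by blast
qed

text \<open>\<open>N\<close> provides a correction \<open>\<psi>\<close>, but its values need not
  vanish at one. Since \<open>mu \<theta>\<close> is zero, \<open>mu \<psi>\<close> is a cycle on
  symbols for \<open>S\<close>, one degree higher, hence equal to a boundary up to lower order.
  Lifting the data of this boundary back to \<open>N\<close> corrects \<open>\<psi>\<close> to a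
  form with values in \<open>S'\<close>.\<close>

lemma syzygy_regular2:
  assumes reg: "regular2 W S" and m: "0 < m"
  shows "regular2 W' S'"
  unfolding regular2_def
proof (intro allI impI)
  fix q i \<theta> assume \<theta>: "Sp W' S' (Suc (Suc (Suc q))) i \<theta>" and drop: "dropping W' (Suc (Suc (Suc q))) i \<theta>"
  obtain m' where m': "m = Suc m'" using m by (cases m) auto
  have \<theta>N: "Sp N (carrier N) (Suc (Suc (Suc q))) i \<theta>" using \<theta> by (rule Sp_S'_N)
  have "dropping N (Suc (Suc (Suc q))) i \<theta>" using drop unfolding dropping_def ord_carrier_update .
  then obtain \<psi> where \<psi>: "Sp N (carrier N) (Suc (Suc q)) (Suc i) \<psi>"
    "Sp N (carrier N) (Suc (Suc q)) i (\<lambda>bs a. \<theta> bs a \<oplus>\<^bsub>N\<^esub> dS \<psi> bs a)"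
    using N.base_regular2[OF \<theta>N] by blast
  have \<mu>\<psi>: "Sp W S (Suc (Suc (Suc (q + m')))) (Suc i) (mu \<psi>)" using Sp_mu[OF \<psi>(1)] by (simp add: m' del: Sp.simps)
  have "dropping W (Suc (Suc (Suc (q + m')))) (Suc i) (mu \<psi>)"
    unfolding dropping_def
  proof (intro allI impI ballI)
    fix j bs assume "Suc i = Suc j" "bs \<in> tuples j"
    then have bs: "bs \<in> tuples i" by simp
    have "ord W (Suc (Suc q) + m) (mu (\<lambda>bs a. \<theta> bs a \<oplus>\<^bsub>N\<^esub> dS \<psi> bs a) bs)"
      using W.Sp_DO[OF Sp_mu[OF \<psi>(2)] bs] by (simp add: DO_def del: ord.simps)
    then have "ord W (Suc (Suc q) + m) (dS (mu \<psi>) bs)"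
    proof (rule ord_cong[THEN iffD1, rotated])
      fix a assume a: "a \<in> carrier A"
      have "un_Fn (\<theta> bs a) \<one> = \<zero>\<^bsub>W\<^esub>" using mu_S'[OF \<theta> bs a] by (simp add: mu_def)
      moreover have "dS (mu \<psi>) bs a \<in> carrier W"
        using W.Sp_closed[OF \<mu>\<psi>, of "a # bs"] a bs by (simp add: dS_def)
      ultimately show "mu (\<lambda>bs a. \<theta> bs a \<oplus>\<^bsub>N\<^esub> dS \<psi> bs a) bs a = dS (mu \<psi>) bs a"
        by (simp add: mu_def dS_def N_ops)
    qed
    then show "ord W (Suc (Suc (Suc (q + m')))) (dS (mu \<psi>) bs)" by (simp add: m' del: ord.simps)
  qed
  then obtain \<chi> where \<chi>: "Sp W S (Suc (Suc (q + m'))) (Suc (Suc i)) \<chi>"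
    "Sp W S (Suc (Suc (q + m'))) (Suc i) (\<lambda>bs a. mu \<psi> bs a \<oplus>\<^bsub>W\<^esub> dS \<chi> bs a)"
    using reg \<mu>\<psi> unfolding regular2_def by blast
  have o: "Suc (Suc (q + m')) = Suc q + m" by (simp add: m')
  obtain X where X: "Sp N (carrier N) (Suc q) (Suc (Suc i)) X"
    "\<And>bs a. bs \<in> tuples (Suc (Suc i)) \<Longrightarrow> a \<in> carrier A \<Longrightarrow> mu X bs a = \<chi> bs a"
    using lift_form[OF reg m \<chi>(1)[unfolded o]] by metis
  obtain R where R: "Sp N (carrier N) (Suc q) (Suc i) R"
    "\<And>bs a. bs \<in> tuples (Suc i) \<Longrightarrow> a \<in> carrier A \<Longrightarrow> mu R bs a = mu \<psi> bs a \<oplus>\<^bsub>W\<^esub> dS \<chi> bs a"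
    using lift_form[OF reg m \<chi>(2)[unfolded o]] by metis
  \<comment> \<open>\<open>dS X\<close> cancels the symbol of \<open>mu \<psi>\<close> and is killed
    by \<open>dS\<close>, so it does not affect the correction of \<open>\<theta>\<close>.
    \<open>R\<close> removes what remains; its order is one below that of \<open>\<psi>\<close>, so
    that \<open>dS R\<close> stays within the order already reached.\<close>
  define \<psi>' where "\<psi>' bs a = (\<psi> bs a \<oplus>\<^bsub>N\<^esub> dS X bs a) \<oplus>\<^bsub>N\<^esub> (\<ominus> \<one>) \<odot>\<^bsub>N\<^esub> R bs a" for bs a
  have R': "Sp N (carrier N) (Suc q) (Suc i) (\<lambda>bs a. (\<ominus> \<one>) \<odot>\<^bsub>N\<^esub> R bs a)"
    using R(1) N.subgrp_carrier by (rule N.Sp_neg)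
  have dX: "Sp N (carrier N) (Suc (Suc q)) (Suc i) (dS X)" using X(1) N.subgrp_carrier by (rule N.Sp_d)
  have "Sp N (carrier N) (Suc (Suc q)) (Suc i) \<psi>'"
    unfolding \<psi>'_def[abs_def]
    by (rule N.Sp_add[OF N.Sp_add[OF \<psi>(1) dX N.subgrp_carrier] N.Sp_mono[OF R'] N.subgrp_carrier]) simp
  then have \<psi>': "Sp W' S' (Suc (Suc q)) (Suc i) \<psi>'"
  proof (rule Sp_N_S')
    fix bs a assume bs: "bs \<in> tuples (Suc i)" and a: "a \<in> carrier A"
    have Rk: "Klin W (un_Fn (R bs a))" using N_D(1) N.Sp_closed[OF R(1) bs a] by (simp add: DO_def)
    have "un_Fn (R bs a) (\<ominus> \<one>) = (\<ominus> \<one>) \<odot>\<^bsub>W\<^esub> mu R bs a" using W.Klin_neg[OF Rk, of \<one>] by (simp add: mu_def)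
    moreover have "mu (dS X) bs a = dS \<chi> bs a" using X(2)[of "a # bs" \<one>] a bs by (simp add: dS_def mu_def)
    moreover have "mu \<psi>' bs a = (mu \<psi> bs a \<oplus>\<^bsub>W\<^esub> mu (dS X) bs a) \<oplus>\<^bsub>W\<^esub> un_Fn (R bs a) (\<ominus> \<one>)"
      by (simp add: mu_def \<psi>'_def N_ops)
    moreover have "mu \<psi> bs a \<oplus>\<^bsub>W\<^esub> dS \<chi> bs a \<in> carrier W" using W.Sp_closed[OF \<chi>(2) bs a] .
    ultimately show "mu \<psi>' bs a = \<zero>\<^bsub>W\<^esub>" using R(2)[OF bs a] by (simp add: W.neg_one_smult W.M.r_neg)
  qed
  have "Sp W' S' (Suc (Suc (Suc q))) i (\<lambda>bs a. \<theta> bs a \<oplus>\<^bsub>W'\<^esub> dS \<psi>' bs a)"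
    by (rule W'.Sp_add[OF \<theta> W'.Sp_d[OF \<psi>' subgrp_DR[OF module_Q]] subgrp_DR[OF module_Q]])
  then have "Sp W' S' (Suc (Suc q)) i (\<lambda>bs a. \<theta> bs a \<oplus>\<^bsub>W'\<^esub> dS \<psi>' bs a)"
  proof (rule W'.Sp_lower)
    fix bs assume bs: "bs \<in> tuples i"
    have dR: "DO N (Suc (Suc q)) (\<lambda>a. dS (\<lambda>bs a. (\<ominus> \<one>) \<odot>\<^bsub>N\<^esub> R bs a) bs a)"
      using N.Sp_DO[OF N.Sp_d[OF R' N.subgrp_carrier] bs] .
    have "DO N (Suc (Suc q)) (\<lambda>a. (\<theta> bs a \<oplus>\<^bsub>N\<^esub> dS \<psi> bs a) \<oplus>\<^bsub>N\<^esub> dS (\<lambda>bs a. (\<ominus> \<one>) \<odot>\<^bsub>N\<^esub> R bs a) bs a)"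
      by (rule N.DO_add[OF N.Sp_DO[OF \<psi>(2) bs] dR])
    then have "DO N (Suc (Suc q)) (\<lambda>a. \<theta> bs a \<oplus>\<^bsub>N\<^esub> dS \<psi>' bs a)"
    proof (rule DO_cong[THEN iffD1, rotated])
      fix a assume a: "a \<in> carrier A"
      have z: "dS (dS X) bs a = \<zero>\<^bsub>N\<^esub>" using N.dS_dS[OF X(1) bs a] .
      have c: "\<theta> bs a \<in> carrier N" "\<psi> (a # bs) \<one> \<in> carrier N" "(\<ominus> \<one>) \<odot>\<^bsub>N\<^esub> R (a # bs) \<one> \<in> carrier N"
        using N.Sp_closed[OF \<theta>N bs a] N.Sp_closed[OF \<psi>(1), of "a # bs" \<one>] N.Sp_closed[OF R', of "a # bs" \<one>] a bs by auto
      have "dS \<psi>' bs a = (\<psi> (a # bs) \<one> \<oplus>\<^bsub>N\<^esub> dS (dS X) bs a) \<oplus>\<^bsub>N\<^esub> (\<ominus> \<one>) \<odot>\<^bsub>N\<^esub> R (a # bs) \<one>"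
        by (simp only: dS_def \<psi>'_def)
      also have "\<dots> = \<psi> (a # bs) \<one> \<oplus>\<^bsub>N\<^esub> (\<ominus> \<one>) \<odot>\<^bsub>N\<^esub> R (a # bs) \<one>"
        unfolding z using N.M.r_zero[OF c(2)] by simp
      finally have e: "dS \<psi>' bs a = \<psi> (a # bs) \<one> \<oplus>\<^bsub>N\<^esub> (\<ominus> \<one>) \<odot>\<^bsub>N\<^esub> R (a # bs) \<one>" .
      show "(\<theta> bs a \<oplus>\<^bsub>N\<^esub> dS \<psi> bs a) \<oplus>\<^bsub>N\<^esub> dS (\<lambda>bs a. (\<ominus> \<one>) \<odot>\<^bsub>N\<^esub> R bs a) bs a = \<theta> bs a \<oplus>\<^bsub>N\<^esub> dS \<psi>' bs a"
        unfolding e using N.M.a_assoc[OF c] by (simp only: dS_def)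
    qed
    then show "DO W' (Suc (Suc q)) (\<lambda>a. \<theta> bs a \<oplus>\<^bsub>W'\<^esub> dS \<psi>' bs a)"
      using DO_carrier_update[OF C_subset(1)] by simp
  qed
  with \<psi>' show "\<exists>\<psi>. Sp W' S' (Suc (Suc q)) (Suc i) \<psi> \<and> Sp W' S' (Suc (Suc q)) i (\<lambda>bs a. \<theta> bs a \<oplus>\<^bsub>W'\<^esub> dS \<psi> bs a)"
    by blast
qed

text \<open>The same chase with equalities instead of equalities of symbols:
  \<open>mu \<psi>\<close> is closed, so \<open>closed_exact\<close> gives a primitive of the same
  order. Its lift to \<open>N\<close> has order < 1 and its differential order < 2, which explains
  the loss against \<open>base_regular1\<close>.\<close>

lemma syzygy_regular1:
  assumes reg: "regular2 W S" "regular1 W S" and m: "0 < m"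
  shows "regular1 W' S'"
  unfolding regular1_def
proof (intro allI impI)
  fix i \<theta> assume \<theta>: "Sp W' S' 2 i \<theta>" and closed: "closed_form W' i \<theta>"
  obtain m' where m': "m = Suc m'" using m by (cases m) auto
  have \<theta>N: "Sp N (carrier N) 2 i \<theta>" using \<theta> by (rule Sp_S'_N)
  have "closed_form N i \<theta>" using closed by (simp add: closed_form_def cong: nat.case_cong)
  then obtain \<psi> where \<psi>: "Sp N (carrier N) 1 (Suc i) \<psi>"
    "\<And>bs a. bs \<in> tuples i \<Longrightarrow> a \<in> carrier A \<Longrightarrow> \<theta> bs a = dS \<psi> bs a"
    using N.base_regular1[OF \<theta>N] by metis
  have \<mu>\<psi>: "Sp W S (Suc (Suc m')) (Suc i) (mu \<psi>)" using Sp_mu[OF \<psi>(1)] by (simp add: m' del: Sp.simps)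
  have "closed_form W (Suc i) (mu \<psi>)"
    using mu_S'[OF \<theta>] \<psi>(2) by (simp add: closed_form_def dS_def mu_def)
  then obtain \<zeta> where \<zeta>: "Sp W S (Suc (Suc m')) (Suc (Suc i)) \<zeta>"
    "\<And>bs a. bs \<in> tuples (Suc i) \<Longrightarrow> a \<in> carrier A \<Longrightarrow> mu \<psi> bs a = dS \<zeta> bs a"
    using W.closed_exact[OF reg subgrp_DR[OF module_Q] \<mu>\<psi>] by metis
  have o: "Suc (Suc m') = Suc 0 + m" by (simp add: m')
  obtain X where X: "Sp N (carrier N) (Suc 0) (Suc (Suc i)) X"
    "\<And>bs a. bs \<in> tuples (Suc (Suc i)) \<Longrightarrow> a \<in> carrier A \<Longrightarrow> mu X bs a = \<zeta> bs a"
    using lift_form[OF reg(1) m \<zeta>(1)[unfolded o]] by metis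
  define \<psi>' where "\<psi>' bs a = \<psi> bs a \<oplus>\<^bsub>N\<^esub> dS (\<lambda>bs a. (\<ominus> \<one>) \<odot>\<^bsub>N\<^esub> X bs a) bs a" for bs a
  have X': "Sp N (carrier N) (Suc 0) (Suc (Suc i)) (\<lambda>bs a. (\<ominus> \<one>) \<odot>\<^bsub>N\<^esub> X bs a)"
    using X(1) N.subgrp_carrier by (rule N.Sp_neg)
  have "Sp N (carrier N) 2 (Suc i) \<psi>'"
    unfolding \<psi>'_def[abs_def] numeral_2_eq_2
    by (rule N.Sp_add[OF N.Sp_mono[OF \<psi>(1)] N.Sp_d[OF X' N.subgrp_carrier] N.subgrp_carrier]) simp
  then have "Sp W' S' 2 (Suc i) \<psi>'"
  proof (rule Sp_N_S')
    fix bs a assume bs: "bs \<in> tuples (Suc i)" and a: "a \<in> carrier A"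
    have Xk: "Klin W (un_Fn (X (a # bs) \<one>))"
      using N_D(1) N.Sp_closed[OF X(1), of "a # bs" \<one>] a bs by (simp add: DO_def)
    have "un_Fn (X (a # bs) \<one>) (\<ominus> \<one>) = (\<ominus> \<one>) \<odot>\<^bsub>W\<^esub> mu X (a # bs) \<one>" using W.Klin_neg[OF Xk, of \<one>] by (simp add: mu_def)
    moreover have "mu X (a # bs) \<one> = mu \<psi> bs a" using X(2)[of "a # bs" \<one>] \<zeta>(2)[OF bs a] a bs by (simp add: dS_def)
    moreover have "mu \<psi>' bs a = mu \<psi> bs a \<oplus>\<^bsub>W\<^esub> un_Fn (X (a # bs) \<one>) (\<ominus> \<one>)"
      by (simp add: mu_def \<psi>'_def N_ops dS_def)
    moreover have "mu \<psi> bs a \<in> carrier W" using W.Sp_closed[OF \<mu>\<psi> bs a] .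
    ultimately show "mu \<psi>' bs a = \<zero>\<^bsub>W\<^esub>" by (simp add: W.neg_one_smult W.M.r_neg)
  qed
  moreover have "\<theta> bs a = dS \<psi>' bs a" if bs: "bs \<in> tuples i" and a: "a \<in> carrier A" for bs a
  proof -
    have z: "dS (dS (\<lambda>bs a. (\<ominus> \<one>) \<odot>\<^bsub>N\<^esub> X bs a)) bs a = \<zero>\<^bsub>N\<^esub>" using N.dS_dS[OF X' bs a] .
    have "dS \<psi>' bs a = dS \<psi> bs a \<oplus>\<^bsub>N\<^esub> dS (dS (\<lambda>bs a. (\<ominus> \<one>) \<odot>\<^bsub>N\<^esub> X bs a)) bs a" by (simp only: dS_def \<psi>'_def)
    also have "\<dots> = dS \<psi> bs a" unfolding z using N.M.r_zero[of "dS \<psi> bs a"] N.Sp_closed[OF \<theta>N bs a] \<psi>(2)[OF bs a] by simp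
    finally show ?thesis using \<psi>(2)[OF bs a] by simp
  qed
  ultimately show "\<exists>\<psi>. Sp W' S' 2 (Suc i) \<psi> \<and> (\<forall>bs\<in>tuples i. \<forall>a\<in>carrier A. \<theta> bs a = dS \<psi> bs a)" by blast
qed

end

context frame
begin

text \<open>Each syzygy step returns the two statements with unchanged bounds on the order, which
  makes an induction over \<open>s\<close> of any length possible.\<close>

theorem regular_DR:
  assumes "module A Q" "good Q" "pos_seq s"
  shows "regular2 (Wm s Q) (DR 0 s Q)" "regular1 (Wm s Q) (DR 0 s Q)"
proof -
  have "regular2 (Wm s Q) (DR 0 s Q) \<and> regular1 (Wm s Q) (DR 0 s Q)"
    using assms(3)
  proof (induction s)
    case Nil
    interpret V: good_module A K xs dd "Wm [] Q" by (rule good_module_Wm[OF assms(1,2)])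
    have e: "DR 0 [] Q = carrier (Wm [] Q)" by simp
    have "regular2 (Wm [] Q) (DR 0 [] Q)"
      unfolding e regular2_def
    proof (intro allI impI)
      fix q i \<theta>
      assume "Sp (Wm [] Q) (carrier (Wm [] Q)) (Suc (Suc (Suc q))) i \<theta>" "dropping (Wm [] Q) (Suc (Suc (Suc q))) i \<theta>"
      then show "\<exists>\<psi>. Sp (Wm [] Q) (carrier (Wm [] Q)) (Suc (Suc q)) (Suc i) \<psi> \<and>
          Sp (Wm [] Q) (carrier (Wm [] Q)) (Suc (Suc q)) i (\<lambda>bs a. \<theta> bs a \<oplus>\<^bsub>Wm [] Q\<^esub> dS \<psi> bs a)"
        by (rule V.base_regular2) blast
    qed
    moreover have "regular1 (Wm [] Q) (DR 0 [] Q)"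
      unfolding e regular1_def
    proof (intro allI impI)
      fix i \<theta> assume "Sp (Wm [] Q) (carrier (Wm [] Q)) 2 i \<theta>" "closed_form (Wm [] Q) i \<theta>"
      then obtain \<psi> where \<psi>: "Sp (Wm [] Q) (carrier (Wm [] Q)) 1 (Suc i) \<psi>"
        "\<And>bs a. bs \<in> tuples i \<Longrightarrow> a \<in> carrier A \<Longrightarrow> \<theta> bs a = dS \<psi> bs a"
        by (rule V.base_regular1) blast
      then have "Sp (Wm [] Q) (carrier (Wm [] Q)) 2 (Suc i) \<psi>" by (intro V.Sp_mono[OF \<psi>(1)]) simp
      with \<psi>(2) show "\<exists>\<psi>. Sp (Wm [] Q) (carrier (Wm [] Q)) 2 (Suc i) \<psi> \<and>
          (\<forall>bs\<in>tuples i. \<forall>a\<in>carrier A. \<theta> bs a = dS \<psi> bs a)" by blast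
    qed
    ultimately show ?case by blast
  next
    case (Cons m s)
    interpret syzygy A K xs dd Q s m
      using frame_axioms assms by (intro syzygy.intro syzygy_axioms.intro) auto
    have "regular2 (Wm s Q) (DR 0 s Q)" "regular1 (Wm s Q) (DR 0 s Q)" "0 < m" using Cons by auto
    then show ?case using syzygy_regular2 syzygy_regular1 by blast
  qed
  then show "regular2 (Wm s Q) (DR 0 s Q)" "regular1 (Wm s Q) (DR 0 s Q)" by auto
qed

end

section \<open>Insertion and multiplication of entries\<close>

context diffcalc
begin

primrec ins :: "nat \<Rightarrow> ('u, 'q) iter \<Rightarrow> ('u, 'q) iter" where
  "ins 0 x = un_Fn x \<one>"
| "ins (Suc p) x = Fn (\<lambda>a\<in>carrier A. ins p (un_Fn x a))"

primrec dup :: "nat \<Rightarrow> ('u, 'q) iter \<Rightarrow> ('u, 'q) iter" where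
  "dup 0 x = Fn (\<lambda>a\<in>carrier A. Fn (\<lambda>b\<in>carrier A. un_Fn x (a \<otimes> b)))"
| "dup (Suc p) x = Fn (\<lambda>a\<in>carrier A. dup p (un_Fn x a))"

primrec push :: "('u, 'q) module \<Rightarrow> nat \<Rightarrow> ('u, 'q) iter \<Rightarrow> ('u, 'q) iter" where
  "push Q 0 x = Fn (\<lambda>b\<in>carrier A. Base (b \<odot>\<^bsub>Q\<^esub> un_Base x))"
| "push Q (Suc n) x = Fn (\<lambda>a\<in>carrier A. push Q n (un_Fn x a))"

text \<open>Linearity is relative to a set because quotient maps will be given on a submodule of the
  target only.\<close>

definition linear_on :: "('u, 'v) module \<Rightarrow> ('u, 'w) module \<Rightarrow> 'v set \<Rightarrow> ('v \<Rightarrow> 'w) \<Rightarrow> bool" where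
  "linear_on V W C h \<longleftrightarrow> (\<forall>x\<in>C. \<forall>y\<in>C. h (x \<oplus>\<^bsub>V\<^esub> y) = h x \<oplus>\<^bsub>W\<^esub> h y) \<and>
     (\<forall>a\<in>carrier A. \<forall>x\<in>C. h (a \<odot>\<^bsub>V\<^esub> x) = a \<odot>\<^bsub>W\<^esub> h x)"

lemma DO_linear_on:
  assumes "module A V" "module A W" "linear_on V W C h" "C \<subseteq> carrier V" "h ` C \<subseteq> carrier W"
    "DO V n D" "D \<in> carrier A \<rightarrow> C" "subgrp V C" "\<And>a x. a \<in> carrier A \<Longrightarrow> x \<in> C \<Longrightarrow> a \<odot>\<^bsub>V\<^esub> x \<in> C"
  shows "DO W n (\<lambda>a. h (D a))"
proof -
  have "module A (V\<lparr>carrier := C\<rparr>)" by (rule submodule_update[OF assms(1,8,9)])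
  then interpret V: diffmod A K "V\<lparr>carrier := C\<rparr>" using diffcalc_axioms by (intro diffmod.intro)
  have D: "DO (V\<lparr>carrier := C\<rparr>) n D" using DO_carrier_update[OF assms(4), of n D] assms(6,7) by simp
  show ?thesis
    by (rule V.DO_hom[OF assms(2) D]) (use assms(3,5) in \<open>simp_all add: linear_on_def image_subset_iff\<close>)
qed

lemma ins_zero: "length u = p \<Longrightarrow> length v = p \<Longrightarrow> ins p \<zero>\<^bsub>Wm (u @ k # s) Q\<^esub> = \<zero>\<^bsub>Wm (v @ s) Q\<^esub>"
proof (induction p arbitrary: u v)
  case 0 then show ?case by (simp add: Diffp_seq_Cons_simps(2-4))
next
  case (Suc p)
  then obtain a u' b v' where uv: "u = a # u'" "v = b # v'" "length u' = p" "length v' = p"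
    by (auto simp: length_Suc_conv)
  show ?case unfolding uv(1,2) append_Cons ins.simps Diffp_seq_Cons_simps(2) iter.sel
    using Suc.IH[OF uv(3,4)] by (intro arg_cong[where f = Fn] restrict_ext) simp
qed

lemma ins_add: "length u = p \<Longrightarrow> length v = p \<Longrightarrow>
    ins p (x \<oplus>\<^bsub>Wm (u @ k # s) Q\<^esub> y) = ins p x \<oplus>\<^bsub>Wm (v @ s) Q\<^esub> ins p y"
proof (induction p arbitrary: u v x y)
  case 0 then show ?case by (simp add: Diffp_seq_Cons_simps(2-4))
next
  case (Suc p)
  then obtain a u' b v' where uv: "u = a # u'" "v = b # v'" "length u' = p" "length v' = p"
    by (auto simp: length_Suc_conv)
  show ?case unfolding uv(1,2) append_Cons ins.simps Diffp_seq_Cons_simps(3) iter.sel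
    using Suc.IH[OF uv(3,4)] by (intro arg_cong[where f = Fn] restrict_ext) simp
qed

text \<open>The ring acts through the first entry, so only insertion at a later position,
  \<open>Suc r\<close>, is linear.\<close>

lemma ins_linear:
  assumes "length u = r"
  shows "linear_on (Wm (u @ k # l # s) Q) (Wm (u @ m # s) Q) C (ins (Suc r))"
proof -
  have "ins (Suc r) (a \<odot>\<^bsub>Wm (u @ k # l # s) Q\<^esub> x) = a \<odot>\<^bsub>Wm (u @ m # s) Q\<^esub> ins (Suc r) x" if "a \<in> carrier A" for a x
    using that by (cases u) (auto simp: Diffp_seq_Cons_simps(2-4) intro!: restrict_ext)
  then show ?thesis
    unfolding linear_on_def using ins_add[of "u @ [k]" "Suc r" "u @ [m]" l s Q] assms by simp
qed

lemma dup_add: "length u = p \<Longrightarrow> length v = p \<Longrightarrow>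
    dup p (x \<oplus>\<^bsub>Wm (u @ l # s) Q\<^esub> y) = dup p x \<oplus>\<^bsub>Wm (v @ k # m # s) Q\<^esub> dup p y"
proof (induction p arbitrary: u v x y)
  case 0 then show ?case by (auto simp: Diffp_seq_Cons_simps(2-4) intro!: restrict_ext)
next
  case (Suc p)
  then obtain a u' b v' where uv: "u = a # u'" "v = b # v'" "length u' = p" "length v' = p"
    by (auto simp: length_Suc_conv)
  show ?case unfolding uv(1,2) append_Cons dup.simps Diffp_seq_Cons_simps(3) iter.sel
    using Suc.IH[OF uv(3,4)] by (intro arg_cong[where f = Fn] restrict_ext) simp
qed

lemma dup_smult: "length u = p \<Longrightarrow> length v = p \<Longrightarrow> a \<in> carrier A \<Longrightarrow>
    dup p (a \<odot>\<^bsub>Wm (u @ l # s) Q\<^esub> x) = a \<odot>\<^bsub>Wm (v @ k # m # s) Q\<^esub> dup p x"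
proof (cases p)
  case 0 assume "length u = p" "length v = p" "a \<in> carrier A"
  then show ?thesis using 0 by (auto simp: Diffp_seq_Cons_simps(2-4) R.m_assoc intro!: restrict_ext)
next
  case (Suc q) assume "length u = p" "length v = p" "a \<in> carrier A"
  then show ?thesis using Suc by (cases u; cases v) (auto simp: Diffp_seq_Cons_simps(2-4) intro!: restrict_ext)
qed

lemma dup_linear:
  "length u = p \<Longrightarrow> length v = p \<Longrightarrow> linear_on (Wm (u @ l # s) Q) (Wm (v @ k # m # s) Q) C (dup p)"
  unfolding linear_on_def by (simp add: dup_add dup_smult)

lemma push_linear:
  assumes "module A Q"
  shows "linear_on (Wm s Q) (Wm (s @ [k]) Q) (carrier (Wm s Q)) (push Q (length s))"
proof (induction s)
  case Nil
  interpret Q: module A Q by fact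
  show ?case
    by (auto simp: linear_on_def Diffp_seq_Cons_simps(2-4) Q.smult_r_distr Q.smult_assoc1[symmetric] R.m_comm intro!: restrict_ext)
next
  case (Cons l s)
  interpret V: diffmod A K "Wm s Q" using assms by (rule diffmod_Wm)
  have c: "un_Fn x a \<in> carrier (Wm s Q)" if "x \<in> carrier (Wm (l # s) Q)" "a \<in> carrier A" for x a
    using that V.DO_closed by (auto simp: carrier_Wm_Cons[OF assms])
  show ?case using Cons c by (auto simp: linear_on_def Diffp_seq_Cons_simps(2-4) intro!: restrict_ext)
qed

text \<open>Composition with a linear map preserves the order of an operator. An operation on inner
  entries is thus carried past an outer entry that is free of conditions.\<close>

lemma DR_induct_step:
  assumes Q: "module A Q" and Q': "module A Q'" and h: "linear_on (Wm s Q) (Wm t Q') (DR (Suc r) s Q) h"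
    and m: "\<And>x. x \<in> DR (Suc r) s Q \<Longrightarrow> h x \<in> DR (Suc r') t Q'"
    and x: "x \<in> DR (Suc (Suc r)) (k # s) Q"
  shows "Fn (\<lambda>a\<in>carrier A. h (un_Fn x a)) \<in> DR (Suc (Suc r')) (k # t) Q'"
proof (rule DR_ConsE[OF x])
  fix D
  assume D: "x = Fn D" "DO (Wm s Q) (Suc k) D" "\<And>a. a \<in> carrier A \<Longrightarrow> D a \<in> DR (Suc (Suc r) - 1) s Q"
  have "DO (Wm t Q') (Suc k) (\<lambda>a. h (D a))"
  proof (rule DO_linear_on[OF module_Wm[OF Q] module_Wm[OF Q'] h DR_subset[OF Q] _ D(2) _ subgrp_DR[OF Q]])
    show "h ` DR (Suc r) s Q \<subseteq> carrier (Wm t Q')" using m DR_subset[OF Q'] by blast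
    show "D \<in> carrier A \<rightarrow> DR (Suc r) s Q" using D(3) by simp
  qed (rule DR_smult[OF Q])
  then show ?thesis unfolding D(1) iter.sel using m D(3) Q' by (intro DR_ConsI) auto
qed

lemma DR_ConsI':
  assumes "module A Q" "DO (Wm s Q) (Suc k) D" "\<And>a. a \<in> carrier A \<Longrightarrow> D a \<in> DR r s Q"
  shows "Fn (\<lambda>a\<in>carrier A. D a) \<in> DR (Suc r) (k # s) Q"
  using assms by (intro DR_ConsI) auto

text \<open>At the position itself the result is the linear operator through \<open>X\<close>, of
  order < 1, so the new entry may be given any order \<open>k\<close>.\<close>

lemma dup_DR:
  assumes "module A Q" "X \<in> DR (Suc r) (u @ l # s) Q" "length u = r"
  shows "dup r X \<in> DR (Suc (Suc r)) (u @ k # l # s) Q"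
  using assms(2,3)
proof (induction r arbitrary: u X)
  case 0
  interpret V: diffmod A K "Wm (l # s) Q" using assms(1) by (rule diffmod_Wm)
  have X: "X \<in> DR (Suc 0) (l # s) Q" using 0 by simp
  then have "X \<in> carrier (Wm (l # s) Q)" using DR_subset[OF assms(1)] by blast
  then have "DO (Wm (l # s) Q) (Suc 0) (\<lambda>a. a \<odot>\<^bsub>Wm (l # s) Q\<^esub> X)" by (rule V.DO_1I)
  then have "DO (Wm (l # s) Q) (Suc k) (\<lambda>a. a \<odot>\<^bsub>Wm (l # s) Q\<^esub> X)" by (rule V.DO_mono) simp
  then have "Fn (\<lambda>a\<in>carrier A. a \<odot>\<^bsub>Wm (l # s) Q\<^esub> X) \<in> DR (Suc (Suc 0)) (k # l # s) Q"
    using DR_smult[OF assms(1) X] assms(1) by (intro DR_ConsI') auto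
  then show ?case using 0 by (simp add: Diffp_seq_Cons_simps(2-4) del: DR.simps)
next
  case (Suc r)
  then obtain k0 u' where u: "u = k0 # u'" "length u' = r" by (cases u) auto
  have "Fn (\<lambda>a\<in>carrier A. dup r (un_Fn X a)) \<in> DR (Suc (Suc (Suc r))) (k0 # (u' @ k # l # s)) Q"
    using Suc u dup_linear[OF u(2) u(2)] assms(1)
    by (intro DR_induct_step[where s = "u' @ l # s" and Q = Q]) auto
  then show ?case using u by simp
qed

text \<open>The appended entry is linear and does not vanish at one; by \<open>length s < r\<close>
  its position is free of conditions.\<close>

lemma push_DR:
  assumes "module A Q" "X \<in> DR r s Q" "length s < r"
  shows "push Q (length s) X \<in> DR r (s @ [k]) Q"
  using assms(2,3)
proof (induction s arbitrary: r X)
  case Nil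
  interpret V: diffmod A K "Wm [] Q" using assms(1) by (rule diffmod_Wm)
  obtain r' where r: "r = Suc r'" using Nil by (cases r) auto
  have "DO (Wm [] Q) (Suc 0) (\<lambda>a. a \<odot>\<^bsub>Wm [] Q\<^esub> X)" using Nil by (intro V.DO_1I) auto
  then have "DO (Wm [] Q) (Suc k) (\<lambda>a. a \<odot>\<^bsub>Wm [] Q\<^esub> X)" by (rule V.DO_mono) simp
  then have "Fn (\<lambda>a\<in>carrier A. a \<odot>\<^bsub>Wm [] Q\<^esub> X) \<in> DR (Suc r') [k] Q"
    using Nil V.smult_closed[of _ X] assms(1) by (intro DR_ConsI') auto
  then show ?case using r by (simp del: DR.simps)
next
  case (Cons l s)
  obtain r' where r: "r = Suc (Suc r')" using Cons.prems(2) by (cases r; cases "r - 1") auto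
  have full: "DR (Suc r') s Q = carrier (Wm s Q)" using Cons.prems(2) r assms(1) by (intro DR_full) auto
  have "Fn (\<lambda>a\<in>carrier A. push Q (length s) (un_Fn X a)) \<in> DR (Suc (Suc r')) (l # s @ [k]) Q"
    using Cons r push_linear[OF assms(1), of s k] assms(1) full
    by (intro DR_induct_step[where s = s and Q = Q]) auto
  then show ?case using r by simp
qed

end

section \<open>Merging two entries by insertion of one\<close>

context frame
begin

lemma ins_DR:
  assumes Q: "module A Q" "good Q" and X: "X \<in> DR (Suc (Suc r)) (u @ k # l # s) Q" and u: "length u = r"
  shows "ins (Suc r) X \<in> DR (Suc r) (u @ (k + l) # s) Q"
  using X u
proof (induction r arbitrary: u X)
  case 0
  interpret syzygy A K xs dd Q s l
    using frame_axioms Q by (intro syzygy.intro syzygy_axioms.intro)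
  have X: "X \<in> DR (Suc (Suc 0)) (k # l # s) Q" using 0 by simp
  show ?case
  proof (rule DR_ConsE[OF X])
    fix L assume L: "X = Fn L" "DO (Wm (l # s) Q) (Suc k) L" "\<And>a. a \<in> carrier A \<Longrightarrow> L a \<in> DR (Suc (Suc 0) - 1) (l # s) Q"
    have N: "DO N (Suc k) L"
      using L DO_carrier_update[OF DR_subset[OF Q(1)], of "Suc 0" "l # s" "Suc k" L] by auto
    have "Fn (\<lambda>a\<in>carrier A. un_Fn (L a) \<one>) \<in> DR (Suc 0) ((k + l) # s) Q"
      using mu_DO[OF N] Q(1) by (intro DR_ConsI') auto
    then show ?thesis using 0(2) L(1) by simp
  qed
next
  case (Suc r)
  then obtain k0 u' where u: "u = k0 # u'" "length u' = r" by (cases u) auto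
  have lin: "linear_on (Wm (u' @ k # l # s) Q) (Wm (u' @ (k + l) # s) Q) C (ins (Suc r))" for C
    by (rule ins_linear[OF u(2)])
  have "Fn (\<lambda>a\<in>carrier A. ins (Suc r) (un_Fn X a)) \<in> DR (Suc (Suc r)) (k0 # (u' @ (k + l) # s)) Q"
    using Suc.prems(1) u(1) by (intro DR_induct_step[OF Q(1) Q(1) lin Suc.IH[OF _ u(2)]]) simp_all
  then show ?case using u by simp
qed

text \<open>At the merged position this is \<open>lift_operator\<close>. Past an outer entry it
  follows from \<open>DO_lift\<close>, which applies because inner operators with a free first entry
  form modules on both sides.\<close>

lemma ins_surj:
  assumes Q: "module A Q" "good Q" and pos: "pos_seq s" "0 < l"
    and X: "X \<in> DR (Suc r) (u @ (k + l) # s) Q" and u: "length u = r"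
  shows "\<exists>Y\<in>DR (Suc (Suc r)) (u @ k # l # s) Q. ins (Suc r) Y = X"
  using X u
proof (induction r arbitrary: u X)
  case 0
  interpret syzygy A K xs dd Q s l
    using frame_axioms Q by (intro syzygy.intro syzygy_axioms.intro)
  have X: "X \<in> DR (Suc 0) ((k + l) # s) Q" using 0 by simp
  show ?case
  proof (rule DR_ConsE[OF X])
    fix D assume D: "X = Fn D" "D \<in> extensional (carrier A)" "DO W (Suc (k + l)) D" "\<And>a. a \<in> carrier A \<Longrightarrow> D a \<in> DR (Suc 0 - 1) s Q"
    obtain L where L: "DO N (Suc k) L" "\<And>a. a \<in> carrier A \<Longrightarrow> un_Fn (L a) \<one> = D a"
      using lift_operator[OF regular_DR(1)[OF Q pos(1)] pos(2), of k D] D by auto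
    have "Fn (\<lambda>a\<in>carrier A. L a) \<in> DR (Suc (Suc 0)) (k # l # s) Q"
      using L(1) N.DO_maps[OF L(1)] DO_carrier_update[OF C_subset(1)] Q(1) by (intro DR_ConsI') auto
    moreover have "Fn (\<lambda>a\<in>carrier A. un_Fn (L a) \<one>) = X"
      unfolding D(1) using L(2) D(2) by (auto intro!: extensionalityI[of _ "carrier A"])
    moreover have "ins (Suc 0) (Fn (\<lambda>a\<in>carrier A. L a)) = Fn (\<lambda>a\<in>carrier A. un_Fn (L a) \<one>)"
      by (auto intro!: restrict_ext)
    ultimately show ?thesis using 0(2) by (auto simp del: DR.simps ins.simps)
  qed
next
  case (Suc r)
  then obtain k0 u' where u: "u = k0 # u'" "length u' = r" by (cases u) auto
  let ?V = "Wm (u' @ k # l # s) Q\<lparr>carrier := DR (Suc (Suc r)) (u' @ k # l # s) Q\<rparr>"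
  let ?W = "Wm (u' @ (k + l) # s) Q\<lparr>carrier := DR (Suc r) (u' @ (k + l) # s) Q\<rparr>"
  interpret V: good_module A K xs dd ?V using good_module_DR[OF Q] .
  interpret W: good_module A K xs dd ?W using good_module_DR[OF Q] .
  have lin: "linear_on (Wm (u' @ k # l # s) Q) (Wm (u' @ (k + l) # s) Q) C (ins (Suc r))" for C
    by (rule ins_linear[OF u(2)])
  have X: "X \<in> DR (Suc (Suc r)) (k0 # u' @ (k + l) # s) Q" using Suc.prems u by simp
  show ?case
  proof (rule DR_ConsE[OF X])
    fix D assume D: "X = Fn D" "D \<in> extensional (carrier A)" "DO (Wm (u' @ (k + l) # s) Q) (Suc k0) D"
      "\<And>a. a \<in> carrier A \<Longrightarrow> D a \<in> DR (Suc (Suc r) - 1) (u' @ (k + l) # s) Q"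
    have WD: "DO ?W (Suc k0) D" using D DO_carrier_update[OF DR_subset[OF Q(1)]] by auto
    have z: "ins (Suc r) \<zero>\<^bsub>?V\<^esub> = \<zero>\<^bsub>?W\<^esub>" using ins_zero[of "u' @ [k]" "Suc r" "u' @ [k + l]" l s Q] u by simp
    have im: "ins (Suc r) ` carrier ?V = carrier ?W"
      using ins_DR[OF Q] Suc.IH u by (fastforce simp del: ins.simps)
    obtain L where L: "DO ?V (Suc k0) L" "\<And>a. a \<in> carrier A \<Longrightarrow> ins (Suc r) (L a) = D a"
      using W.DO_lift[OF V.framed_module_axioms _ _ z im WD] lin[of "carrier ?V"] unfolding linear_on_def by auto
    have "Fn (\<lambda>a\<in>carrier A. L a) \<in> DR (Suc (Suc (Suc r))) (k0 # u' @ k # l # s) Q"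
      using L(1) V.DO_maps[OF L(1)] DO_carrier_update[OF DR_subset[OF Q(1)]] Q(1) by (intro DR_ConsI') auto
    moreover have "Fn (\<lambda>a\<in>carrier A. ins (Suc r) (L a)) = X"
      unfolding D(1) using L(2) D(2) by (auto intro!: extensionalityI[of _ "carrier A"] simp del: ins.simps)
    moreover have "ins (Suc (Suc r)) (Fn (\<lambda>a\<in>carrier A. L a)) = Fn (\<lambda>a\<in>carrier A. ins (Suc r) (L a))"
      by (subst ins.simps(2)) (auto intro!: restrict_ext simp del: ins.simps)
    ultimately show ?thesis using u by (auto simp del: DR.simps ins.simps)
  qed
qed

text \<open>The obvious candidate, the linear operator through \<open>X\<close>, leaves D_s: its
  value at \<open>b\<close>, evaluated at one, is that of \<open>X\<close> at \<open>b\<close>. As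
  \<open>X\<close> vanishes at one, \<open>closed_exact\<close> gives a derivation \<open>z\<close>
  with the same evaluations. The difference has values in D_s and order at most 1, and it still
  takes the value \<open>X\<close> at one because \<open>z \<one>\<close> is zero.\<close>

lemma ins_surj_0:
  assumes Q: "module A Q" "good Q" and pos: "pos_seq s" "0 < k" and X: "X \<in> DR 0 s Q"
  shows "\<exists>Y\<in>DR (Suc 0) (k # s) Q. ins 0 Y = X"
proof (cases s)
  case Nil
  interpret V: diffmod A K "Wm [] Q" using Q(1) by (rule diffmod_Wm)
  have X': "X \<in> carrier (Wm [] Q)" using X Nil by simp
  have "DO (Wm [] Q) (Suc 0) (\<lambda>a. a \<odot>\<^bsub>Wm [] Q\<^esub> X)" using X' by (rule V.DO_1I)
  then have "DO (Wm [] Q) (Suc k) (\<lambda>a. a \<odot>\<^bsub>Wm [] Q\<^esub> X)" by (rule V.DO_mono) simp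
  then have "Fn (\<lambda>a\<in>carrier A. a \<odot>\<^bsub>Wm [] Q\<^esub> X) \<in> DR (Suc 0) [k] Q"
    using X' V.smult_closed Q(1) by (intro DR_ConsI') auto
  moreover have "ins 0 (Fn (\<lambda>a\<in>carrier A. a \<odot>\<^bsub>Wm [] Q\<^esub> X)) = X" using V.smult_one[OF X'] by simp
  ultimately show ?thesis using Nil by blast
next
  case (Cons m t)
  interpret syzygy A K xs dd Q t m
    using frame_axioms Q by (intro syzygy.intro syzygy_axioms.intro)
  have pt: "pos_seq t" "0 < m" using pos Cons by auto
  have X: "X \<in> DR 0 (m # t) Q" using X Cons by simp
  have XC: "X \<in> carrier W'" using X DR_subset[OF Q(1)] by blast
  show ?thesis unfolding Cons
  proof (rule DR_ConsE[OF X])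
    fix D assume D: "X = Fn D" "D \<in> extensional (carrier A)" "DO W (Suc m) D" "\<And>a. a \<in> carrier A \<Longrightarrow> D a \<in> DR (0 - 1) t Q"
      "0 = (0::nat) \<Longrightarrow> D \<one> = \<zero>\<^bsub>W\<^esub>"
    obtain m' where m': "m = Suc m'" using pt by (cases m) auto
    have "Sp W S (Suc (Suc m')) 0 (\<lambda>bs. D)" using D m' by simp
    moreover have "closed_form W 0 (\<lambda>bs. D)" using D(5) by (simp add: closed_form_def)
    ultimately obtain \<zeta> where \<zeta>: "Sp W S (Suc (Suc m')) (Suc 0) \<zeta>"
      "\<And>bs a. bs \<in> tuples 0 \<Longrightarrow> a \<in> carrier A \<Longrightarrow> D a = dS \<zeta> bs a"
      using W.closed_exact[OF regular_DR[OF Q pt(1)] subgrp_DR[OF Q(1)]] by metis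
    define z where "z b = Fn (\<lambda>c\<in>carrier A. \<zeta> [b] c)" for b
    have \<zeta>D: "DO W (Suc m) (\<zeta> [b])" "\<And>c. c \<in> carrier A \<Longrightarrow> \<zeta> [b] c \<in> S" if "b \<in> carrier A" for b
      using W.Sp_DO[OF \<zeta>(1), of "[b]"] W.Sp_range[OF \<zeta>(1), of "[b]"] that m' by auto
    have \<zeta>c: "\<zeta> [b] c \<in> carrier W" if "b \<in> carrier A" "c \<in> carrier A" for b c
      using W.DO_closed[OF \<zeta>D(1)] that by blast
    have zN: "z b \<in> DR (Suc 0) (m # t) Q" if "b \<in> carrier A" for b
      unfolding z_def using \<zeta>D that Q(1) by (intro DR_ConsI') auto
    then have zC: "z b \<in> carrier W'" if "b \<in> carrier A" for b using that C_subset by blast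
    have p: "pder W (\<lambda>b. \<zeta> [b])" using W.SpD(2)[OF \<zeta>(1), of "[]"] by simp
    have der: "derivation W' z"
      unfolding derivation_def
    proof (intro conjI ballI)
      show "z \<in> carrier A \<rightarrow> carrier W'" using zC by auto
      fix a b assume ab: "a \<in> carrier A" "b \<in> carrier A"
      show "z (a \<oplus> b) = z a \<oplus>\<^bsub>W'\<^esub> z b" using ab by (auto simp: z_def N_ops pderD(1)[OF p] intro!: restrict_ext)
      show "z (a \<otimes> b) = a \<odot>\<^bsub>W'\<^esub> z b \<oplus>\<^bsub>W'\<^esub> b \<odot>\<^bsub>W'\<^esub> z a"
        using ab \<zeta>c by (auto simp: z_def N_ops pderD(2)[OF p] W.M.a_comm intro!: restrict_ext)
    next
      fix c assume "c \<in> K" then show "z c = \<zero>\<^bsub>W'\<^esub>" using pder_K[OF p] by (auto simp: z_def N_ops intro!: restrict_ext)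
    qed
    define E where "E b = b \<odot>\<^bsub>W'\<^esub> X \<oplus>\<^bsub>W'\<^esub> (\<ominus> \<one>) \<odot>\<^bsub>W'\<^esub> z b" for b
    have "DO W' 2 E"
      unfolding E_def[abs_def]
      by (rule W'.DO_add[OF W'.DO_mono[OF W'.DO_1I[OF XC]] W'.DO_smult[OF W'.derivation_DO[OF der]]]) simp_all
    then have ED: "DO W' (Suc k) E" by (rule W'.DO_mono) (use pos(2) in simp)
    have ES: "E b \<in> S'" if b: "b \<in> carrier A" for b
    proof -
      have "E b = Fn (\<lambda>c\<in>carrier A. D (b \<otimes> c) \<oplus>\<^bsub>W\<^esub> (\<ominus> \<one>) \<odot>\<^bsub>W\<^esub> \<zeta> [b] c)"
        using Wm_neg[OF Q(1) zC[OF b]] D(1) by (auto simp: E_def N_ops z_def intro!: restrict_ext)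
      moreover have "DO W (Suc m) (\<lambda>c. D (b \<otimes> c) \<oplus>\<^bsub>W\<^esub> (\<ominus> \<one>) \<odot>\<^bsub>W\<^esub> \<zeta> [b] c)"
        by (rule W.DO_add[OF W.DO_plus[OF D(3) b] W.DO_smult[OF \<zeta>D(1)[OF b]]]) simp
      moreover have "D (b \<otimes> c) \<oplus>\<^bsub>W\<^esub> (\<ominus> \<one>) \<odot>\<^bsub>W\<^esub> \<zeta> [b] c \<in> DR 0 t Q" if "c \<in> carrier A" for c
        using D(4)[of "b \<otimes> c"] \<zeta>D(2)[OF b that] that b subgrp_DR[OF Q(1), of t 0] by (simp add: subgrp_def)
      moreover have "D (b \<otimes> \<one>) \<oplus>\<^bsub>W\<^esub> (\<ominus> \<one>) \<odot>\<^bsub>W\<^esub> \<zeta> [b] \<one> = \<zero>\<^bsub>W\<^esub>"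
        using \<zeta>(2)[of "[]" b] \<zeta>c[OF b, of \<one>] b by (simp add: dS_def W.neg_one_smult W.M.r_neg)
      ultimately show ?thesis using Q(1) by (simp only:) (intro DR_ConsI, auto)
    qed
    have "Fn (\<lambda>b\<in>carrier A. E b) \<in> DR (Suc 0) (k # m # t) Q" using ED ES Q(1) by (intro DR_ConsI') auto
    moreover have "ins 0 (Fn (\<lambda>b\<in>carrier A. E b)) = X"
    proof -
      have "z \<one> = \<zero>\<^bsub>W'\<^esub>" using derivationD(5)[OF der one_K] .
      then show ?thesis using W'.smult_one[OF XC] XC by (simp add: E_def)
    qed
    ultimately show "\<exists>Y\<in>DR (Suc 0) (k # m # t) Q. ins 0 Y = X" by blast
  qed
qed

lemma ins_DR_0:
  "X \<in> DR (Suc 0) (k # s) Q \<Longrightarrow> ins 0 X \<in> DR 0 s Q"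
  by auto

end

section \<open>Formal sums of values\<close>

context diffcalc
begin

primrec ev :: "'u list \<Rightarrow> ('u, 'q) iter \<Rightarrow> 'q" where
  "ev [] x = un_Base x"
| "ev (a # as) x = ev as (un_Fn x a)"

lemma tuples_Suc_snoc:
  assumes "w \<in> tuples (Suc n)"
  obtains as c where "w = as @ [c]" "as \<in> tuples n" "c \<in> carrier A"
proof -
  have "w \<noteq> []" using assms by (auto simp: tuples_def)
  then have "w = butlast w @ [last w]" by simp
  moreover have "butlast w \<in> tuples n" "last w \<in> carrier A"
    using assms \<open>w \<noteq> []\<close> by (auto simp: tuples_def dest: in_set_butlastD)
  ultimately show thesis by (rule that)
qed

lemma tuples_append [simp]: "as @ [c] \<in> tuples (Suc n) \<longleftrightarrow> as \<in> tuples n \<and> c \<in> carrier A"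
  by (auto simp: tuples_def)

lemma ev_carrier:
  assumes "module A Q" "X \<in> carrier (Wm s Q)" "as \<in> tuples (length s)"
  shows "ev as X \<in> carrier Q"
  using assms(2,3)
proof (induction s arbitrary: X as)
  case (Cons k s)
  interpret V: diffmod A K "Wm s Q" using assms(1) by (rule diffmod_Wm)
  obtain c cs where as: "as = c # cs" "c \<in> carrier A" "cs \<in> tuples (length s)"
    using Cons.prems(2) by (auto elim: tuples_SucE)
  have "un_Fn X c \<in> carrier (Wm s Q)"
    using Cons.prems(1) V.DO_closed as(2) by (auto simp: carrier_Wm_Cons[OF assms(1)])
  then show ?case using Cons.IH as by simp
qed auto

lemma ev_add: "as \<in> tuples (length s) \<Longrightarrow> ev as (x \<oplus>\<^bsub>Wm s Q\<^esub> y) = ev as x \<oplus>\<^bsub>Q\<^esub> ev as y"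
  by (induction s arbitrary: as x y) (auto simp: Diffp_seq_Cons_simps(2-4) elim!: tuples_SucE)

lemma ev_zero: "as \<in> tuples (length s) \<Longrightarrow> ev as \<zero>\<^bsub>Wm s Q\<^esub> = \<zero>\<^bsub>Q\<^esub>"
  by (induction s arbitrary: as) (auto simp: Diffp_seq_Cons_simps(2-4) elim!: tuples_SucE)

lemma ev_smult_Cons: "b \<in> carrier A \<Longrightarrow> ev (b # bs) (a \<odot>\<^bsub>Wm (k # s) Q\<^esub> x) = ev (a \<otimes> b # bs) x"
  by (simp add: Diffp_seq_Cons_simps(2-4))

lemma ev_ext:
  assumes "module A Q" "x \<in> carrier (Wm s Q)" "y \<in> carrier (Wm s Q)" "\<And>as. as \<in> tuples (length s) \<Longrightarrow> ev as x = ev as y"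
  shows "x = y"
  using assms(2-)
proof (induction s arbitrary: x y)
  case Nil then show ?case using Nil(3)[of "[]"] by auto
next
  case (Cons k s)
  interpret V: diffmod A K "Wm s Q" using assms(1) by (rule diffmod_Wm)
  obtain D E where D: "x = Fn D" "D \<in> extensional (carrier A)" "DO (Wm s Q) (Suc k) D"
    and E: "y = Fn E" "E \<in> extensional (carrier A)" "DO (Wm s Q) (Suc k) E"
    using Cons.prems(1,2) by (auto simp: carrier_Wm_Cons[OF assms(1)])
  have "D a = E a" if "a \<in> carrier A" for a
    using Cons.prems(3)[of "a # _"] that by (intro Cons.IH V.DO_closed[OF D(3)] V.DO_closed[OF E(3)]) (auto simp: D(1) E(1))
  then show ?case using D E by (auto intro: extensionalityI)
qed

lemma DR_vanish:
  assumes "module A Q" "X \<in> DR r s Q" "as \<in> tuples (length s)" "r \<le> p" "p < length s" "as ! p = \<one>"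
  shows "ev as X = \<zero>\<^bsub>Q\<^esub>"
  using assms(2-)
proof (induction s arbitrary: r p X as)
  case (Cons k s)
  obtain c cs where as: "as = c # cs" "c \<in> carrier A" "cs \<in> tuples (length s)"
    using Cons.prems(2) by (auto elim: tuples_SucE)
  show ?case
  proof (rule DR_ConsE[OF Cons.prems(1)])
    fix D assume D: "X = Fn D" "\<And>a. a \<in> carrier A \<Longrightarrow> D a \<in> DR (r - 1) s Q" "r = 0 \<Longrightarrow> D \<one> = \<zero>\<^bsub>Wm s Q\<^esub>"
    show ?thesis
    proof (cases p)
      case 0 then show ?thesis using D Cons.prems as ev_zero by auto
    next
      case (Suc q)
      then have "ev cs (D c) = \<zero>\<^bsub>Q\<^esub>"
        using D Cons.prems as by (intro Cons.IH[of _ "r - 1" _ q]) auto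
      then show ?thesis using D as by simp
    qed
  qed
qed simp

text \<open>Passing from \<open>Suc r\<close> to \<open>r\<close> adds a single condition, at
  position \<open>r\<close>, and that condition can be read off from values.\<close>

lemma DR_vanishI:
  assumes "module A Q" "X \<in> DR (Suc r) s Q" "r < length s"
    "\<And>as. as \<in> tuples (length s) \<Longrightarrow> as ! r = \<one> \<Longrightarrow> ev as X = \<zero>\<^bsub>Q\<^esub>"
  shows "X \<in> DR r s Q"
  using assms(2-)
proof (induction s arbitrary: r X)
  case (Cons k s)
  interpret V: diffmod A K "Wm s Q" using assms(1) by (rule diffmod_Wm)
  show ?case
  proof (rule DR_ConsE[OF Cons.prems(1)])
    fix D assume D: "X = Fn D" "D \<in> extensional (carrier A)" "DO (Wm s Q) (Suc k) D"
      "\<And>a. a \<in> carrier A \<Longrightarrow> D a \<in> DR (Suc r - 1) s Q"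
    have "D a \<in> DR (r - 1) s Q" if a: "a \<in> carrier A" for a
    proof (cases r)
      case 0 then show ?thesis using D(4) a by simp
    next
      case (Suc q)
      have "D a \<in> DR q s Q"
      proof (rule Cons.IH)
        show "D a \<in> DR (Suc q) s Q" using D(4)[OF a] Suc by simp
        show "q < length s" using Cons.prems(2) Suc by simp
        show "ev as (D a) = \<zero>\<^bsub>Q\<^esub>" if "as \<in> tuples (length s)" "as ! q = \<one>" for as
          using Cons.prems(3)[of "a # as"] that a Suc by (simp add: D(1))
      qed
      then show ?thesis using Suc by simp
    qed
    moreover have "D \<one> = \<zero>\<^bsub>Wm s Q\<^esub>" if "r = 0"
      using Cons.prems(3)[of "\<one> # _"] that
      by (intro ev_ext[OF assms(1) V.DO_closed[OF D(3)]]) (auto simp: D(1) ev_zero)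
    ultimately show ?thesis using D(1-3) by auto
  qed
qed simp

lemma ev_iter_map: "as \<in> tuples (length s) \<Longrightarrow> module A Q \<Longrightarrow> X \<in> carrier (Wm s Q) \<Longrightarrow> ev as (iter_map A h X) = h (ev as X)"
proof (induction s arbitrary: as X)
  case (Cons k s)
  interpret V: diffmod A K "Wm s Q" using Cons.prems(2) by (rule diffmod_Wm)
  have "un_Fn X c \<in> carrier (Wm s Q)" if "c \<in> carrier A" for c
    using Cons.prems that V.DO_closed by (auto simp: carrier_Wm_Cons)
  then show ?case using Cons by (auto elim!: tuples_SucE simp: carrier_Wm_Cons)
qed auto

lemma ev_iter_split: "as \<in> tuples n \<Longrightarrow> ev as (iter_split A n x) = (\<lambda>c\<in>carrier A. ev (as @ [c]) x)"
  by (induction n arbitrary: as x) (auto elim!: tuples_SucE)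

section \<open>Words and formal sums of words\<close>

primrec insw :: "nat \<Rightarrow> 'u list \<Rightarrow> 'u list" where
  "insw 0 w = \<one> # w"
| "insw (Suc p) w = hd w # insw p (tl w)"

primrec mulw :: "nat \<Rightarrow> 'u list \<Rightarrow> 'u list" where
  "mulw 0 w = (hd w \<otimes> hd (tl w)) # tl (tl w)"
| "mulw (Suc p) w = hd w # mulw p (tl w)"

lemma insw_tuples: "w \<in> tuples n \<Longrightarrow> p \<le> n \<Longrightarrow> insw p w \<in> tuples (Suc n)"
proof (induction p arbitrary: w n)
  case (Suc p) then show ?case by (cases n) (auto elim!: tuples_SucE)
qed simp

lemma mulw_tuples: "w \<in> tuples (Suc n) \<Longrightarrow> p < n \<Longrightarrow> mulw p w \<in> tuples n"
proof (induction p arbitrary: w n)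
  case 0 then show ?case by (cases n) (auto elim!: tuples_SucE)
next
  case (Suc p) then show ?case by (cases n) (auto elim!: tuples_SucE)
qed

lemma insw_nth: "p \<le> length w \<Longrightarrow> insw p w ! p = \<one>"
  by (induction p arbitrary: w) (auto simp: Suc_le_length_iff)

lemma insw_append: "p \<le> length w \<Longrightarrow> insw p (w @ v) = insw p w @ v"
  by (induction p arbitrary: w) (auto simp: Suc_le_length_iff)

lemma insw_last: "insw (length w) w = w @ [\<one>]"
  by (induction w) auto

lemma mulw_append: "Suc p < length w \<Longrightarrow> mulw p (w @ v) = mulw p w @ v"
proof (induction p arbitrary: w)
  case 0 then show ?case by (cases w; cases "tl w") auto
next
  case (Suc p) then show ?case by (cases w) auto
qed

lemma mulw_insw: "w \<in> tuples n \<Longrightarrow> p < n \<Longrightarrow> mulw p (insw (Suc p) w) = w"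
proof (induction p arbitrary: w n)
  case 0 then show ?case by (cases n) (auto elim!: tuples_SucE)
next
  case (Suc p) then show ?case by (cases n) (auto elim!: tuples_SucE)
qed

lemma ev_ins: "as \<in> tuples n \<Longrightarrow> p \<le> n \<Longrightarrow> ev as (ins p x) = ev (insw p as) x"
proof (induction p arbitrary: as n x)
  case (Suc p) then show ?case by (cases n) (auto elim!: tuples_SucE)
qed simp

lemma ev_dup: "as \<in> tuples n \<Longrightarrow> Suc p < n \<Longrightarrow> ev as (dup p x) = ev (mulw p as) x"
proof (induction p arbitrary: as n x)
  case 0 then obtain m where "n = Suc (Suc m)" by (cases n; cases "n - 1") auto
  then show ?case using 0 by (auto elim!: tuples_SucE)
next
  case (Suc p) then show ?case by (cases n) (auto elim!: tuples_SucE)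
qed

lemma ev_push: "as \<in> tuples n \<Longrightarrow> c \<in> carrier A \<Longrightarrow> ev (as @ [c]) (push Q n x) = c \<odot>\<^bsub>Q\<^esub> ev as x"
  by (induction n arbitrary: as x) (auto elim!: tuples_SucE)

text \<open>A word $a_1 \dots a_n c$ stands for the value $c \cdot X(a_1, \dots, a_n)$ of an unknown
  iterated operator $X$, a list of words for the sum of these values.  Appending \<open>\<one>\<close> to all
  words is the differential.  The operations \<open>insw\<close> and \<open>mulw\<close> may also hit the
  coefficient $c$.\<close>

definition evw :: "('u, 'q) module \<Rightarrow> ('u, 'q) iter \<Rightarrow> 'u list \<Rightarrow> 'q" where
  "evw Q X w = last w \<odot>\<^bsub>Q\<^esub> ev (butlast w) X"

definition evs :: "('u, 'q) module \<Rightarrow> ('u, 'q) iter \<Rightarrow> 'u list list \<Rightarrow> 'q" where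
  "evs Q X f = lsum Q (evw Q X) f"

definition FS :: "nat \<Rightarrow> 'u list list set" where
  "FS n = lists (tuples (Suc n))"

definition dw :: "'u list list \<Rightarrow> 'u list list" where
  "dw = map (\<lambda>w. w @ [\<one>])"

definition scal :: "'u \<Rightarrow> 'u list list \<Rightarrow> 'u list list" where
  "scal a = map (\<lambda>w. butlast w @ [a \<otimes> last w])"

lemma evw_snoc [simp]: "evw Q X (as @ [c]) = c \<odot>\<^bsub>Q\<^esub> ev as X"
  by (simp add: evw_def)

lemma FS_Nil [simp]: "[] \<in> FS n" and FS_append [simp]: "f @ g \<in> FS n \<longleftrightarrow> f \<in> FS n \<and> g \<in> FS n"
  by (auto simp: FS_def)

lemma FS_Cons [simp]: "w # f \<in> FS n \<longleftrightarrow> w \<in> tuples (Suc n) \<and> f \<in> FS n"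
  by (auto simp: FS_def)

lemma FS_mem: "f \<in> FS n \<Longrightarrow> w \<in> set f \<Longrightarrow> w \<in> tuples (Suc n)"
  by (auto simp: FS_def)

lemma FS_dw [simp]: "f \<in> FS n \<Longrightarrow> dw f \<in> FS (Suc n)"
  by (auto simp: FS_def dw_def)

lemma FS_scal [simp]: "a \<in> carrier A \<Longrightarrow> f \<in> FS n \<Longrightarrow> scal a f \<in> FS n"
proof -
  have "butlast w @ [a \<otimes> last w] \<in> tuples (Suc n)" if "a \<in> carrier A" "w \<in> tuples (Suc n)" for w
    using that(2) by (rule tuples_Suc_snoc) (use that(1) in simp)
  then show "a \<in> carrier A \<Longrightarrow> f \<in> FS n \<Longrightarrow> scal a f \<in> FS n" by (auto simp: FS_def scal_def)
qed

lemma FS_insw [simp]: "p \<le> Suc n \<Longrightarrow> f \<in> FS n \<Longrightarrow> map (insw p) f \<in> FS (Suc n)"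
  using insw_tuples by (auto simp: FS_def)

lemma FS_mulw [simp]: "p \<le> n \<Longrightarrow> f \<in> FS (Suc n) \<Longrightarrow> map (mulw p) f \<in> FS n"
  using mulw_tuples by (auto simp: FS_def)

lemma dw_append [simp]: "dw (f @ g) = dw f @ dw g" "dw [] = []"
  by (simp_all add: dw_def)

lemma scal_append [simp]: "scal a (f @ g) = scal a f @ scal a g" "scal a [] = []"
  by (simp_all add: scal_def)

lemma dw_insw: "p \<le> Suc n \<Longrightarrow> f \<in> FS n \<Longrightarrow> map (insw p) (dw f) = dw (map (insw p) f)"
  by (auto simp: dw_def FS_def tuples_def insw_append)

text \<open>Inserting one behind the coefficient makes the coefficient an argument, which is the
  differential. In lowest degree insertion takes place at this position.\<close>

lemma insw_eq_dw: "f \<in> FS n \<Longrightarrow> map (insw (Suc n)) f = dw f"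
proof -
  have "insw (Suc n) w = w @ [\<one>]" if "length w = Suc n" for w using insw_last[of w] that by simp
  then show "f \<in> FS n \<Longrightarrow> map (insw (Suc n)) f = dw f"
    by (auto simp: dw_def FS_def tuples_def simp del: insw.simps)
qed

lemma dw_mulw: "p < n \<Longrightarrow> f \<in> FS n \<Longrightarrow> map (mulw p) (dw f) = dw (map (mulw p) f)"
  by (auto simp: dw_def FS_def tuples_def mulw_append)

lemma mulw_insw_FS: "p \<le> n \<Longrightarrow> f \<in> FS n \<Longrightarrow> map (mulw p) (map (insw (Suc p)) f) = f"
  using mulw_insw by (auto simp: FS_def simp del: insw.simps intro!: map_idI)

lemma scal_insw: "p \<le> n \<Longrightarrow> f \<in> FS n \<Longrightarrow> scal a (map (insw p) f) = map (insw p) (scal a f)"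
proof -
  have "butlast (insw p w) @ [a \<otimes> last (insw p w)] = insw p (butlast w @ [a \<otimes> last w])"
    if "p \<le> n" "w \<in> tuples (Suc n)" for w
    using that(2) by (rule tuples_Suc_snoc) (use that(1) in \<open>simp add: insw_append tuples_def\<close>)
  then show "p \<le> n \<Longrightarrow> f \<in> FS n \<Longrightarrow> scal a (map (insw p) f) = map (insw p) (scal a f)"
    by (auto simp: scal_def FS_def)
qed

lemma evs_simps [simp]: "evs Q X [] = \<zero>\<^bsub>Q\<^esub>" "evs Q X (w # f) = evw Q X w \<oplus>\<^bsub>Q\<^esub> evs Q X f"
  by (simp_all add: evs_def)

lemma evw_carrier:
  assumes "module A Q" "X \<in> carrier (Wm s Q)" "w \<in> tuples (Suc (length s))"
  shows "evw Q X w \<in> carrier Q"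
proof -
  interpret Q: module A Q by fact
  show ?thesis using assms(3) by (rule tuples_Suc_snoc) (use ev_carrier[OF assms(1,2)] in simp)
qed

lemma evs_carrier:
  assumes "module A Q" "X \<in> carrier (Wm s Q)" "f \<in> FS (length s)"
  shows "evs Q X f \<in> carrier Q"
proof -
  interpret Q: module A Q by fact
  show ?thesis unfolding evs_def using evw_carrier[OF assms(1,2)] FS_mem[OF assms(3)] by blast
qed

lemma evs_append:
  assumes "module A Q" "X \<in> carrier (Wm s Q)" "f \<in> FS (length s)" "g \<in> FS (length s)"
  shows "evs Q X (f @ g) = evs Q X f \<oplus>\<^bsub>Q\<^esub> evs Q X g"
proof -
  interpret Q: module A Q by fact
  show ?thesis unfolding evs_def
    using evw_carrier[OF assms(1,2)] FS_mem[OF assms(3)] FS_mem[OF assms(4)] by (intro Q.lsum_append) auto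
qed

lemma evs_scal:
  assumes "module A Q" "X \<in> carrier (Wm s Q)" "f \<in> FS (length s)" "a \<in> carrier A"
  shows "evs Q X (scal a f) = a \<odot>\<^bsub>Q\<^esub> evs Q X f"
proof -
  interpret Q: module A Q by fact
  have "evw Q X (butlast w @ [a \<otimes> last w]) = a \<odot>\<^bsub>Q\<^esub> evw Q X w" if "w \<in> tuples (Suc (length s))" for w
    using that by (rule tuples_Suc_snoc) (use ev_carrier[OF assms(1,2)] assms(4) in \<open>simp add: Q.smult_assoc1\<close>)
  then show ?thesis unfolding evs_def scal_def lsum_map
    using evw_carrier[OF assms(1,2)] FS_mem[OF assms(3)] assms(4)
    by (subst Q.lsum_smult) (auto intro!: lsum_cong)
qed

lemma evs_map_cong: "(\<And>w. w \<in> set f \<Longrightarrow> evw Q X (h w) = evw Q Y w) \<Longrightarrow> evs Q X (map h f) = evs Q Y f"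
  unfolding evs_def lsum_map by (rule lsum_cong) auto

text \<open>For maps \<open>h\<close> that are only given on a submodule: the values of
  \<open>X\<close> lie in it, hence so do all sums.\<close>

lemma evs_hom:
  assumes "module A (Q\<lparr>carrier := V\<rparr>)" "module A Q'" "module A Q" "X \<in> carrier (Wm s Q)" "f \<in> FS (length s)"
    "linear_on Q Q' V h" "h ` V \<subseteq> carrier Q'" "\<And>as. as \<in> tuples (length s) \<Longrightarrow> ev as X \<in> V"
  shows "evs Q' (iter_map A h X) f = h (evs Q X f)" "evs Q X f \<in> V"
proof -
  interpret V: module A "Q\<lparr>carrier := V\<rparr>" by fact
  interpret Q': module A Q' by fact
  have h1: "h (x \<oplus>\<^bsub>Q\<^esub> y) = h x \<oplus>\<^bsub>Q'\<^esub> h y" if "x \<in> V" "y \<in> V" for x y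
    using assms(6) that by (simp add: linear_on_def)
  have h2: "h (a \<odot>\<^bsub>Q\<^esub> x) = a \<odot>\<^bsub>Q'\<^esub> h x" if "x \<in> V" "a \<in> carrier A" for x a
    using assms(6) that by (simp add: linear_on_def)
  have e: "evw Q' (iter_map A h X) w = h (evw Q X w)" "evw Q X w \<in> V" if "w \<in> tuples (Suc (length s))" for w
  proof -
    obtain as c where w: "w = as @ [c]" "as \<in> tuples (length s)" "c \<in> carrier A"
      using \<open>w \<in> _\<close> by (rule tuples_Suc_snoc)
    have "ev as (iter_map A h X) = h (ev as X)" by (rule ev_iter_map[OF w(2) assms(3,4)])
    then show "evw Q' (iter_map A h X) w = h (evw Q X w)" using w h2[OF assms(8)[OF w(2)] w(3)] by simp
    show "evw Q X w \<in> V" using w V.smult_closed[of c "ev as X"] assms(8)[OF w(2)] by simp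
  qed
  have z: "h \<zero>\<^bsub>Q\<^esub> = \<zero>\<^bsub>Q'\<^esub>"
    using h2[of "\<zero>\<^bsub>Q\<^esub>" \<zero>] assms(7) V.M.zero_closed V.smult_l_null[of "\<zero>\<^bsub>Q\<^esub>"] Q'.smult_l_null[of "h \<zero>\<^bsub>Q\<^esub>"] by auto
  show V: "evs Q X f \<in> V"
    using V.lsum_closed[of f "evw Q X"] e(2) FS_mem[OF assms(5)] by (simp add: evs_def)
  have "h (lsum (Q\<lparr>carrier := V\<rparr>) (evw Q X) f) = lsum Q' (\<lambda>w. h (evw Q X w)) f"
    using e(2) FS_mem[OF assms(5)] by (intro lsum_hom[OF _ _ assms(1)]) (simp_all add: z h1)
  then show "evs Q' (iter_map A h X) f = h (evs Q X f)"
    using FS_mem[OF assms(5)] by (auto simp: evs_def e(1) intro!: lsum_cong)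
qed

section \<open>Change of the target module and re-bracketing of the last entry\<close>

lemma iter_map_linear:
  assumes "module A Q" "linear_on Q Q' V h"
  shows "linear_on (Wm s Q) (Wm s Q') {Y \<in> carrier (Wm s Q). \<forall>as\<in>tuples (length s). ev as Y \<in> V} (iter_map A h)"
proof (induction s)
  case Nil
  show ?case using assms(2) by (fastforce simp: linear_on_def)
next
  case (Cons k s)
  interpret V: diffmod A K "Wm s Q" using assms(1) by (rule diffmod_Wm)
  let ?C = "\<lambda>s. {Y \<in> carrier (Wm s Q). \<forall>as\<in>tuples (length s). ev as Y \<in> V}"
  have c: "un_Fn Y a \<in> ?C s" "Y = Fn (un_Fn Y)" if "Y \<in> ?C (k # s)" "a \<in> carrier A" for Y a
  proof -
    have "\<forall>as\<in>tuples (length s). ev (a # as) Y \<in> V" using that by (simp del: ev.simps)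
    then show "un_Fn Y a \<in> ?C s" "Y = Fn (un_Fn Y)"
      using that V.DO_closed by (auto simp: carrier_Wm_Cons[OF assms(1)])
  qed
  have m: "iter_map A h Y = Fn (\<lambda>a\<in>carrier A. iter_map A h (un_Fn Y a))" if "Y \<in> ?C (k # s)" for Y
    using iter_map.simps(2)[of A h "un_Fn Y"] c(2)[OF that R.one_closed] by simp
  show ?case
    unfolding linear_on_def
  proof (intro conjI ballI)
    fix x y assume xy: "x \<in> ?C (k # s)" "y \<in> ?C (k # s)"
    have "iter_map A h (un_Fn x a \<oplus>\<^bsub>Wm s Q\<^esub> un_Fn y a) =
        iter_map A h (un_Fn x a) \<oplus>\<^bsub>Wm s Q'\<^esub> iter_map A h (un_Fn y a)" if "a \<in> carrier A" for a
      using Cons c(1)[OF xy(1) that] c(1)[OF xy(2) that] unfolding linear_on_def by blast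
    then show "iter_map A h (x \<oplus>\<^bsub>Wm (k # s) Q\<^esub> y) = iter_map A h x \<oplus>\<^bsub>Wm (k # s) Q'\<^esub> iter_map A h y"
      unfolding m[OF xy(1)] m[OF xy(2)] by (auto simp: Diffp_seq_Cons_simps(2-4) intro!: restrict_ext)
  next
    fix a x assume "a \<in> carrier A" "x \<in> ?C (k # s)"
    then show "iter_map A h (a \<odot>\<^bsub>Wm (k # s) Q\<^esub> x) = a \<odot>\<^bsub>Wm (k # s) Q'\<^esub> iter_map A h x"
      using m by (auto simp: Diffp_seq_Cons_simps(2-4) intro!: restrict_ext)
  qed
qed

lemma iter_map_DR:
  assumes Q: "module A Q" "module A Q'" and V: "subgrp Q V" "\<And>a x. a \<in> carrier A \<Longrightarrow> x \<in> V \<Longrightarrow> a \<odot>\<^bsub>Q\<^esub> x \<in> V"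
    and h: "linear_on Q Q' V h" "h ` V \<subseteq> carrier Q'"
    and X: "X \<in> DR r s Q" "\<And>as. as \<in> tuples (length s) \<Longrightarrow> ev as X \<in> V"
  shows "iter_map A h X \<in> DR r s Q'"
  using X
proof (induction s arbitrary: r X)
  case Nil then show ?case using h(2) by auto
next
  case (Cons k s)
  interpret W: diffmod A K "Wm s Q" using Q(1) by (rule diffmod_Wm)
  let ?C = "{Y \<in> carrier (Wm s Q). \<forall>as\<in>tuples (length s). ev as Y \<in> V}"
  have V': "\<zero>\<^bsub>Q\<^esub> \<in> V" "\<And>x y. x \<in> V \<Longrightarrow> y \<in> V \<Longrightarrow> x \<oplus>\<^bsub>Q\<^esub> y \<in> V" using V(1) by (auto simp: subgrp_def)
  have sm: "a \<odot>\<^bsub>Wm s Q\<^esub> Y \<in> ?C" if "a \<in> carrier A" "Y \<in> ?C" for a Y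
  proof (cases s)
    case Nil
    then have "a \<odot>\<^bsub>Wm s Q\<^esub> Y \<in> carrier (Wm s Q)" using that W.smult_closed by simp
    then show ?thesis using that V(2) Nil by auto
  next
    case (Cons l t)
    have "a \<odot>\<^bsub>Wm s Q\<^esub> Y \<in> carrier (Wm s Q)" using that W.smult_closed by simp
    then show ?thesis using that Cons by (auto simp: ev_smult_Cons elim!: tuples_SucE simp del: ev.simps)
  qed
  have sg: "subgrp (Wm s Q) ?C"
    using V' sm by (auto simp: subgrp_def ev_zero ev_add)
  show ?case
  proof (rule DR_ConsE[OF Cons.prems(1)])
    fix D assume D: "X = Fn D" "D \<in> extensional (carrier A)" "DO (Wm s Q) (Suc k) D"
      "\<And>a. a \<in> carrier A \<Longrightarrow> D a \<in> DR (r - 1) s Q" "r = 0 \<Longrightarrow> D \<one> = \<zero>\<^bsub>Wm s Q\<^esub>"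
    have Dv: "ev as (D a) \<in> V" if "a \<in> carrier A" "as \<in> tuples (length s)" for a as
      using Cons.prems(2)[of "a # as"] that by (simp add: D(1))
    have DC: "D \<in> carrier A \<rightarrow> ?C" using Dv W.DO_closed[OF D(3)] by auto
    have IH: "iter_map A h (D a) \<in> DR (r - 1) s Q'" if "a \<in> carrier A" for a
      using Cons.IH[OF D(4)[OF that] Dv[OF that]] .
    have im: "iter_map A h Y \<in> carrier (Wm s Q')" if "Y \<in> ?C" for Y
    proof -
      \<comment> \<open>With \<open>r = length s\<close> there are no vanishing conditions, so the
        induction hypothesis applies to arbitrary elements of \<open>?C\<close>.\<close>
      have "Y \<in> DR (length s) s Q" using that DR_full[OF Q(1), of s "length s"] by simp
      then show ?thesis using Cons.IH[of Y "length s"] that DR_subset[OF Q(2)] by blast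
    qed
    have "DO (Wm s Q') (Suc k) (\<lambda>a. iter_map A h (D a))"
      by (rule DO_linear_on[OF module_Wm[OF Q(1)] module_Wm[OF Q(2)] iter_map_linear[OF Q(1) h(1)] _ _ D(3) DC sg sm])
        (use im in auto)
    moreover have "iter_map A h (D \<one>) = \<zero>\<^bsub>Wm s Q'\<^esub>" if "r = 0"
    proof -
      interpret W': diffmod A K "Wm s Q'" using Q(2) by (rule diffmod_Wm)
      have "D \<one> \<in> ?C" using DC by auto
      then have "iter_map A h (\<zero> \<odot>\<^bsub>Wm s Q\<^esub> D \<one>) = \<zero> \<odot>\<^bsub>Wm s Q'\<^esub> iter_map A h (D \<one>)"
        using iter_map_linear[OF Q(1) h(1), of s] R.zero_closed unfolding linear_on_def by blast
      then show ?thesis using D(5)[OF that] im[OF \<open>D \<one> \<in> ?C\<close>] by simp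
    qed
    ultimately show ?thesis unfolding D(1) iter_map.simps using IH Q(2) by (intro DR_ConsI) auto
  qed
qed

text \<open>For the empty sequence the last operator becomes a value, and the action on its argument
  becomes the module structure of the new target. The outer entries only see a linear map on
  values.\<close>

lemma iter_split_DR:
  assumes Q: "module A Q" "module A (Diffp K A k (regular_module A) Q)"
  shows "linear_on (Wm (s @ [k]) Q) (Wm s (Diffp K A k (regular_module A) Q)) (carrier (Wm (s @ [k]) Q)) (iter_split A (length s))"
    "X \<in> DR r (s @ [k]) Q \<Longrightarrow> iter_split A (length s) X \<in> DR r s (Diffp K A k (regular_module A) Q)"
proof -
  let ?P = "Diffp K A k (regular_module A) Q"
  interpret Q: diffmod A K Q using Q(1) diffcalc_axioms by (intro diffmod.intro)
  have cP: "carrier ?P = {D \<in> extensional (carrier A). DO Q (Suc k) D}"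
    using Q.DO_maps by (fastforce simp: Diff_plus_def map_module_def Q.diff_ops_iff Pi_iff)
  have oP: "x \<oplus>\<^bsub>?P\<^esub> y = (\<lambda>p\<in>carrier A. x p \<oplus>\<^bsub>Q\<^esub> y p)" "a \<odot>\<^bsub>?P\<^esub> x = (\<lambda>p\<in>carrier A. x (a \<otimes> p))"
    "\<zero>\<^bsub>?P\<^esub> = (\<lambda>p\<in>carrier A. \<zero>\<^bsub>Q\<^esub>)" for x y a
    by (simp_all add: Diff_plus_def map_module_def)
  show lin: "linear_on (Wm (s @ [k]) Q) (Wm s ?P) (carrier (Wm (s @ [k]) Q)) (iter_split A (length s))" for s
  proof (induction s)
    case Nil
    show ?case by (auto simp: linear_on_def Diffp_seq_Cons_simps(2-4) oP intro!: restrict_ext)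
  next
    case (Cons l s)
    interpret V: diffmod A K "Wm (s @ [k]) Q" using Q(1) by (rule diffmod_Wm)
    have c: "un_Fn Y a \<in> carrier (Wm (s @ [k]) Q)" if "Y \<in> carrier (Wm (l # s @ [k]) Q)" "a \<in> carrier A" for Y a
      using that V.DO_closed by (auto simp: carrier_Wm_Cons[OF Q(1)])
    show ?case using Cons c by (auto simp: linear_on_def Diffp_seq_Cons_simps(2-4) intro!: restrict_ext)
  qed
  show "iter_split A (length s) X \<in> DR r s ?P" if "X \<in> DR r (s @ [k]) Q" for s X r
    using that
  proof (induction s arbitrary: r X)
    case Nil
    then obtain D where D: "X = Fn D" "DO (Wm [] Q) (Suc k) D" by auto
    have "DO Q (Suc k) (\<lambda>a. un_Base (D a))"
      by (rule diffmod.DO_hom[OF diffmod_Wm[OF Q(1)] Q(1) D(2)]) auto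
    then show ?case using D(1) by (auto simp: cP)
  next
    case (Cons l s)
    interpret V: diffmod A K "Wm (s @ [k]) Q" using Q(1) by (rule diffmod_Wm)
    have X: "X \<in> DR r (l # s @ [k]) Q" using Cons.prems by simp
    show ?case
    proof (rule DR_ConsE[OF X])
      fix D assume D: "X = Fn D" "DO (Wm (s @ [k]) Q) (Suc l) D"
        "\<And>a. a \<in> carrier A \<Longrightarrow> D a \<in> DR (r - 1) (s @ [k]) Q" "r = 0 \<Longrightarrow> D \<one> = \<zero>\<^bsub>Wm (s @ [k]) Q\<^esub>"
      have im: "iter_split A (length s) ` carrier (Wm (s @ [k]) Q) \<subseteq> carrier (Wm s ?P)"
        using Cons.IH[of _ "length (s @ [k])"] DR_full[OF Q(1), of "s @ [k]"] DR_subset[OF Q(2)] by blast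
      have "DO (Wm s ?P) (Suc l) (\<lambda>a. iter_split A (length s) (D a))"
        by (rule V.DO_hom[OF module_Wm[OF Q(2)] D(2)]) (use im lin[of s] in \<open>auto simp: linear_on_def\<close>)
      moreover have "iter_split A (length s) \<zero>\<^bsub>Wm (s @ [k]) Q\<^esub> = \<zero>\<^bsub>Wm s ?P\<^esub>"
      proof -
        interpret W': diffmod A K "Wm s ?P" using Q(2) by (rule diffmod_Wm)
        have "iter_split A (length s) (\<zero> \<odot>\<^bsub>Wm (s @ [k]) Q\<^esub> \<zero>\<^bsub>Wm (s @ [k]) Q\<^esub>) = \<zero> \<odot>\<^bsub>Wm s ?P\<^esub> iter_split A (length s) \<zero>\<^bsub>Wm (s @ [k]) Q\<^esub>"
          using lin[of s] R.zero_closed V.M.zero_closed unfolding linear_on_def by blast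
        moreover have "iter_split A (length s) \<zero>\<^bsub>Wm (s @ [k]) Q\<^esub> \<in> carrier (Wm s ?P)" using im V.M.zero_closed by blast
        ultimately show ?thesis by simp
      qed
      ultimately show ?thesis unfolding D(1) list.size add_0_right add_Suc_right iter_split.simps iter.sel
        using Cons.IH D(3,4) Q(2) by (intro DR_ConsI) auto
    qed
  qed
qed

end

section \<open>Quotients, products and modules of finite type\<close>

lemma module_image:
  assumes "module R M" "h ` carrier M = carrier N"
    and add: "\<And>x y. x \<in> carrier M \<Longrightarrow> y \<in> carrier M \<Longrightarrow> h (x \<oplus>\<^bsub>M\<^esub> y) = h x \<oplus>\<^bsub>N\<^esub> h y"
    and smult: "\<And>a x. a \<in> carrier R \<Longrightarrow> x \<in> carrier M \<Longrightarrow> h (a \<odot>\<^bsub>M\<^esub> x) = a \<odot>\<^bsub>N\<^esub> h x"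
    and zero: "h \<zero>\<^bsub>M\<^esub> = \<zero>\<^bsub>N\<^esub>"
  shows "module R N"
proof -
  interpret M: module R M by fact
  have ex: "\<exists>x\<in>carrier M. y = h x" if "y \<in> carrier N" for y using that assms(2) by auto
  have cl: "h x \<in> carrier N" if "x \<in> carrier M" for x using that assms(2) by auto
  have "abelian_group N"
  proof (rule abelian_groupI)
    fix x y assume "x \<in> carrier N" "y \<in> carrier N"
    then obtain x' y' where x: "x = h x'" "x' \<in> carrier M" and y: "y = h y'" "y' \<in> carrier M" using ex by blast
    show "x \<oplus>\<^bsub>N\<^esub> y \<in> carrier N" "x \<oplus>\<^bsub>N\<^esub> y = y \<oplus>\<^bsub>N\<^esub> x"
      unfolding x(1) y(1) add[OF x(2) y(2), symmetric] add[OF y(2) x(2), symmetric] M.M.a_comm[OF y(2) x(2)]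
      using cl[OF M.M.a_closed[OF x(2) y(2)]] by simp_all
  next
    fix x y z assume xyz: "x \<in> carrier N" "y \<in> carrier N" "z \<in> carrier N"
    obtain x' y' z' where "x = h x'" "y = h y'" "z = h z'" "x' \<in> carrier M" "y' \<in> carrier M" "z' \<in> carrier M"
      using ex[OF xyz(1)] ex[OF xyz(2)] ex[OF xyz(3)] by blast
    then show "x \<oplus>\<^bsub>N\<^esub> y \<oplus>\<^bsub>N\<^esub> z = x \<oplus>\<^bsub>N\<^esub> (y \<oplus>\<^bsub>N\<^esub> z)"
      by (simp add: add[symmetric] M.M.a_assoc)
  next
    show "\<zero>\<^bsub>N\<^esub> \<in> carrier N" using cl[OF M.M.zero_closed] zero by simp
    fix x assume "x \<in> carrier N"
    then obtain x' where x: "x = h x'" "x' \<in> carrier M" using ex by blast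
    then show "\<zero>\<^bsub>N\<^esub> \<oplus>\<^bsub>N\<^esub> x = x" by (simp add: add[symmetric] zero[symmetric])
    show "\<exists>y\<in>carrier N. y \<oplus>\<^bsub>N\<^esub> x = \<zero>\<^bsub>N\<^esub>"
      using x add[of "\<ominus>\<^bsub>M\<^esub> x'" x'] zero cl[of "\<ominus>\<^bsub>M\<^esub> x'"]
      by (intro bexI[of _ "h (\<ominus>\<^bsub>M\<^esub> x')"]) (simp_all add: M.M.l_neg)
  qed
  then show ?thesis
  proof (rule moduleI[OF M.is_cring])
    fix a b x assume a: "a \<in> carrier R" "b \<in> carrier R" "x \<in> carrier N"
    obtain x' where x: "x = h x'" "x' \<in> carrier M" using ex a by blast
    show "(a \<oplus>\<^bsub>R\<^esub> b) \<odot>\<^bsub>N\<^esub> x = a \<odot>\<^bsub>N\<^esub> x \<oplus>\<^bsub>N\<^esub> b \<odot>\<^bsub>N\<^esub> x" "(a \<otimes>\<^bsub>R\<^esub> b) \<odot>\<^bsub>N\<^esub> x = a \<odot>\<^bsub>N\<^esub> (b \<odot>\<^bsub>N\<^esub> x)"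
      using a x by (simp_all add: add[symmetric] smult[symmetric] M.smult_l_distr M.smult_assoc1)
  next
    fix a x y assume a: "a \<in> carrier R" "x \<in> carrier N" "y \<in> carrier N"
    obtain x' y' where x: "x = h x'" "x' \<in> carrier M" "y = h y'" "y' \<in> carrier M" using ex[OF a(2)] ex[OF a(3)] by blast
    show "a \<odot>\<^bsub>N\<^esub> (x \<oplus>\<^bsub>N\<^esub> y) = a \<odot>\<^bsub>N\<^esub> x \<oplus>\<^bsub>N\<^esub> a \<odot>\<^bsub>N\<^esub> y"
      using a x by (simp add: add[symmetric] smult[symmetric] M.smult_r_distr)
  next
    fix x assume a: "x \<in> carrier N"
    obtain x' where x: "x = h x'" "x' \<in> carrier M" using ex a by blast
    show "\<one>\<^bsub>R\<^esub> \<odot>\<^bsub>N\<^esub> x = x" using x by (simp add: smult[symmetric])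
    show "a \<odot>\<^bsub>N\<^esub> x \<in> carrier N" if "a \<in> carrier R" for a using x that by (simp add: smult[symmetric] cl)
  qed
qed

lemma quot_module_props:
  fixes M :: "('a, 'm) module"
  assumes "module R M" "submodule S R M"
  shows "(\<lambda>x. S +>\<^bsub>M\<^esub> x) ` carrier M = carrier (quot_module M S)"
    "x \<in> carrier M \<Longrightarrow> y \<in> carrier M \<Longrightarrow> S +>\<^bsub>M\<^esub> (x \<oplus>\<^bsub>M\<^esub> y) = (S +>\<^bsub>M\<^esub> x) \<oplus>\<^bsub>quot_module M S\<^esub> (S +>\<^bsub>M\<^esub> y)"
    "a \<in> carrier R \<Longrightarrow> x \<in> carrier M \<Longrightarrow> S +>\<^bsub>M\<^esub> (a \<odot>\<^bsub>M\<^esub> x) = a \<odot>\<^bsub>quot_module M S\<^esub> (S +>\<^bsub>M\<^esub> x)"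
    "S +>\<^bsub>M\<^esub> \<zero>\<^bsub>M\<^esub> = \<zero>\<^bsub>quot_module M S\<^esub>"
    "x \<in> carrier M \<Longrightarrow> S +>\<^bsub>M\<^esub> x = \<zero>\<^bsub>quot_module M S\<^esub> \<longleftrightarrow> x \<in> S"
    "x \<in> carrier M \<Longrightarrow> y \<in> S +>\<^bsub>M\<^esub> x \<longleftrightarrow> (\<exists>s\<in>S. y = s \<oplus>\<^bsub>M\<^esub> x)"
    "x \<in> carrier M \<Longrightarrow> y \<in> S +>\<^bsub>M\<^esub> x \<Longrightarrow> S +>\<^bsub>M\<^esub> y = S +>\<^bsub>M\<^esub> x"
    "x \<in> carrier M \<Longrightarrow> x \<in> S +>\<^bsub>M\<^esub> x"
proof -
  interpret module R M by fact
  note S = submoduleE[OF assms(2)]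
  interpret abelian_subgroup S M
    using submodule.axioms(1)[OF assms(2)] M.abelian_group_axioms
    by (intro abelian_subgroupI3 additive_subgroup.intro)
  show "x \<in> carrier M \<Longrightarrow> x \<in> S +>\<^bsub>M\<^esub> x" by (rule a_rcos_self)
  show "(\<lambda>x. S +>\<^bsub>M\<^esub> x) ` carrier M = carrier (quot_module M S)"
    by (auto simp: quot_module_def A_RCOSETS_def')
  show "x \<in> carrier M \<Longrightarrow> y \<in> carrier M \<Longrightarrow> S +>\<^bsub>M\<^esub> (x \<oplus>\<^bsub>M\<^esub> y) = (S +>\<^bsub>M\<^esub> x) \<oplus>\<^bsub>quot_module M S\<^esub> (S +>\<^bsub>M\<^esub> y)"
    by (simp add: quot_module_def a_rcos_sum)
  show z: "S +>\<^bsub>M\<^esub> \<zero>\<^bsub>M\<^esub> = \<zero>\<^bsub>quot_module M S\<^esub>" using S(1) by (simp add: quot_module_def)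
  show z': "x \<in> carrier M \<Longrightarrow> S +>\<^bsub>M\<^esub> x = \<zero>\<^bsub>quot_module M S\<^esub> \<longleftrightarrow> x \<in> S"
    using a_rcos_self a_rcos_const by (auto simp: quot_module_def)
  show mem: "y \<in> S +>\<^bsub>M\<^esub> x \<longleftrightarrow> (\<exists>s\<in>S. y = s \<oplus>\<^bsub>M\<^esub> x)" if "x \<in> carrier M" for x y
    by (auto simp: a_r_coset_def')
  show eq: "S +>\<^bsub>M\<^esub> y = S +>\<^bsub>M\<^esub> x" if "x \<in> carrier M" "y \<in> S +>\<^bsub>M\<^esub> x" for x y
    by (rule a_repr_independence'[OF that(2,1), symmetric])
  show "S +>\<^bsub>M\<^esub> (a \<odot>\<^bsub>M\<^esub> x) = a \<odot>\<^bsub>quot_module M S\<^esub> (S +>\<^bsub>M\<^esub> x)" if a: "a \<in> carrier R" and x: "x \<in> carrier M"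
  proof -
    have ax: "a \<odot>\<^bsub>M\<^esub> x \<in> carrier M" using a x by simp
    have "S +>\<^bsub>M\<^esub> (a \<odot>\<^bsub>M\<^esub> y) = S +>\<^bsub>M\<^esub> (a \<odot>\<^bsub>M\<^esub> x)" if y: "y \<in> S +>\<^bsub>M\<^esub> x" for y
    proof (rule eq[OF ax])
      obtain s where s: "s \<in> S" "y = s \<oplus>\<^bsub>M\<^esub> x" using y unfolding mem[OF x] by blast
      have "a \<odot>\<^bsub>M\<^esub> y = a \<odot>\<^bsub>M\<^esub> s \<oplus>\<^bsub>M\<^esub> a \<odot>\<^bsub>M\<^esub> x"
        unfolding s(2) using a x S(1) s(1) by (intro smult_r_distr) auto
      then show "a \<odot>\<^bsub>M\<^esub> y \<in> S +>\<^bsub>M\<^esub> (a \<odot>\<^bsub>M\<^esub> x)"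
        unfolding mem[OF ax] using S(4)[OF a s(1)] by blast
    qed
    then have "(\<Union>y\<in>S +>\<^bsub>M\<^esub> x. S +>\<^bsub>M\<^esub> (a \<odot>\<^bsub>M\<^esub> y)) = (\<Union>y\<in>S +>\<^bsub>M\<^esub> x. S +>\<^bsub>M\<^esub> (a \<odot>\<^bsub>M\<^esub> x))" by blast
    then show ?thesis using a_rcos_self[OF x] by (auto simp: quot_module_def)
  qed
qed

lemma module_quot:
  fixes M :: "('a, 'm) module"
  assumes "module R M" "submodule S R M"
  shows "module R (quot_module M S)"
  by (rule module_image[where N = "quot_module M S" and h = "\<lambda>x. S +>\<^bsub>M\<^esub> x", OF assms(1)
        quot_module_props(1)[OF assms] quot_module_props(2)[OF assms] quot_module_props(3)[OF assms]
        quot_module_props(4)[OF assms]])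

section \<open>Products, and families of iterated operators as single ones\<close>

definition prod_module :: "'i set \<Rightarrow> ('i \<Rightarrow> ('a, 'v) module) \<Rightarrow> ('a, 'i \<Rightarrow> 'v) module" where
  "prod_module T M = \<lparr>carrier = (\<Pi>\<^sub>E t\<in>T. carrier (M t)), mult = undefined, one = undefined,
     zero = (\<lambda>t\<in>T. \<zero>\<^bsub>M t\<^esub>), add = (\<lambda>f g. \<lambda>t\<in>T. f t \<oplus>\<^bsub>M t\<^esub> g t),
     smult = (\<lambda>a f. \<lambda>t\<in>T. a \<odot>\<^bsub>M t\<^esub> f t)\<rparr>"

lemma prod_module_simps [simp]:
  "carrier (prod_module T M) = (\<Pi>\<^sub>E t\<in>T. carrier (M t))" "\<zero>\<^bsub>prod_module T M\<^esub> = (\<lambda>t\<in>T. \<zero>\<^bsub>M t\<^esub>)"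
  "f \<oplus>\<^bsub>prod_module T M\<^esub> g = (\<lambda>t\<in>T. f t \<oplus>\<^bsub>M t\<^esub> g t)" "a \<odot>\<^bsub>prod_module T M\<^esub> f = (\<lambda>t\<in>T. a \<odot>\<^bsub>M t\<^esub> f t)"
  by (simp_all add: prod_module_def)

lemma prod_module_module:
  assumes "cring A" "\<And>t. t \<in> T \<Longrightarrow> module A (M t)"
  shows "module A (prod_module T M)"
proof -
  have g: "abelian_group (M t)" if "t \<in> T" for t using module.axioms(2)[OF assms(2)[OF that]] .
  have m: "abelian_monoid (M t)" if "t \<in> T" for t using abelian_group.axioms(1)[OF g[OF that]] .
  have "abelian_group (prod_module T M)"
  proof (rule abelian_groupI)
    fix x assume x: "x \<in> carrier (prod_module T M)"
    show "\<exists>y\<in>carrier (prod_module T M). y \<oplus>\<^bsub>prod_module T M\<^esub> x = \<zero>\<^bsub>prod_module T M\<^esub>"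
      using x g by (intro bexI[of _ "\<lambda>t\<in>T. \<ominus>\<^bsub>M t\<^esub> x t"])
        (auto intro!: restrict_ext abelian_group.l_neg abelian_group.a_inv_closed)
  qed (use m g in \<open>auto intro!: abelian_monoid.a_closed abelian_monoid.zero_closed restrict_ext
         abelian_monoid.a_comm abelian_monoid.a_assoc abelian_monoid.l_zero simp: PiE_def extensional_def Pi_def fun_eq_iff\<close>)
  then show ?thesis
    by (rule moduleI[OF assms(1)])
      (use assms in \<open>auto intro!: restrict_ext module.smult_closed module.smult_l_distr module.smult_r_distr
        module.smult_assoc1 simp: PiE_iff extensional_def fun_eq_iff module.smult_one\<close>)
qed

lemma lsum_prod_module: "lsum (prod_module T M) f xs = (\<lambda>t\<in>T. lsum (M t) (\<lambda>x. f x t) xs)"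
  by (induction xs) (auto intro!: restrict_ext)

context diffcalc
begin

text \<open>A family of iterated operators as one operator with values in the product.\<close>

primrec join :: "'i set \<Rightarrow> nat \<Rightarrow> ('i \<Rightarrow> ('u, 'v) iter) \<Rightarrow> ('u, 'i \<Rightarrow> 'v) iter" where
  "join T 0 F = Base (\<lambda>t\<in>T. un_Base (F t))"
| "join T (Suc n) F = Fn (\<lambda>a\<in>carrier A. join T n (\<lambda>t. un_Fn (F t) a))"

lemma join_cong: "(\<And>t. t \<in> T \<Longrightarrow> F t = G t) \<Longrightarrow> join T n F = join T n G"
proof (induction n arbitrary: F G)
  case (Suc n)
  have "join T n (\<lambda>t. un_Fn (F t) a) = join T n (\<lambda>t. un_Fn (G t) a)" for a
    using Suc.prems by (intro Suc.IH) simp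
  then show ?case by simp
qed (auto intro!: restrict_ext)

lemma ev_join: "as \<in> tuples n \<Longrightarrow> ev as (join T n F) = (\<lambda>t\<in>T. ev as (F t))"
  by (induction n arbitrary: as F) (auto elim!: tuples_SucE)

lemma join_zero: "join T (length s) (\<lambda>t. \<zero>\<^bsub>Wm s (M t)\<^esub>) = \<zero>\<^bsub>Wm s (prod_module T M)\<^esub>"
  by (induction s) (auto simp: Diffp_seq_Cons_simps(2-4) intro!: restrict_ext)

lemma join_add: "join T (length s) (\<lambda>t. F t \<oplus>\<^bsub>Wm s (M t)\<^esub> G t) =
    join T (length s) F \<oplus>\<^bsub>Wm s (prod_module T M)\<^esub> join T (length s) G"
  by (induction s arbitrary: F G) (auto simp: Diffp_seq_Cons_simps(2-4) intro!: restrict_ext)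

lemma join_smult: "a \<in> carrier A \<Longrightarrow> join T (length s) (\<lambda>t. a \<odot>\<^bsub>Wm s (M t)\<^esub> F t) =
    a \<odot>\<^bsub>Wm s (prod_module T M)\<^esub> join T (length s) F"
  by (cases s) (auto simp: Diffp_seq_Cons_simps(2-4) intro!: restrict_ext)

text \<open>One bound \<open>n\<close> serves all members of the family, so a family of any size is
  a single operator of finite order.\<close>

lemma DO_join:
  assumes "\<And>t. t \<in> T \<Longrightarrow> DO (Wm s (M t)) n (D t)"
    and "\<And>a. a \<in> carrier A \<Longrightarrow> join T (length s) (\<lambda>t. D t a) \<in> carrier (Wm s (prod_module T M))"
  shows "DO (Wm s (prod_module T M)) n (\<lambda>a. join T (length s) (\<lambda>t. D t a))"
  unfolding DO_def
proof
  have "Klin (Wm s (M t)) (D t)" if "t \<in> T" for t using assms(1)[OF that] by (simp add: DO_def)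
  then show "Klin (Wm s (prod_module T M)) (\<lambda>a. join T (length s) (\<lambda>t. D t a))"
    using assms(2) by (auto simp: Klin_def join_add[symmetric] join_smult[symmetric] K_carrier intro!: join_cong)
  have "ord (Wm s (prod_module T M)) n (\<lambda>a. join T (length s) (\<lambda>t. D t a))"
    if "\<And>t. t \<in> T \<Longrightarrow> ord (Wm s (M t)) n (D t)" for D
    using that
  proof (induction n arbitrary: D)
    case 0 then show ?case by (auto simp: join_zero[symmetric] intro!: join_cong)
  next
    case (Suc n)
    have "ord (Wm s (prod_module T M)) n (dl (Wm s (prod_module T M)) a (\<lambda>a. join T (length s) (\<lambda>t. D t a)))"
      if a: "a \<in> carrier A" for a
    proof -
      have "ord (Wm s (prod_module T M)) n (\<lambda>p. join T (length s) (\<lambda>t. dl (Wm s (M t)) a (D t) p))"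
        using Suc.prems a by (intro Suc.IH) simp
      then show ?thesis
        by (rule ord_cong[THEN iffD1, rotated]) (use a in \<open>simp add: dl_def join_add join_smult\<close>)
    qed
    then show ?case by simp
  qed
  then show "ord (Wm s (prod_module T M)) n (\<lambda>a. join T (length s) (\<lambda>t. D t a))"
    using assms(1) by (simp add: DO_def)
qed

lemma join_DR:
  assumes "\<And>t. t \<in> T \<Longrightarrow> module A (M t)" "\<And>t. t \<in> T \<Longrightarrow> F t \<in> DR r s (M t)"
  shows "join T (length s) F \<in> DR r s (prod_module T M)"
  using assms(2)
proof (induction s arbitrary: r F)
  case Nil
  have "un_Base (F t) \<in> carrier (M t)" if "t \<in> T" for t using Nil[OF that] by auto
  then show ?case by auto
next
  case (Cons k s)
  have U: "module A (prod_module T M)" using assms(1) R.is_cring by (intro prod_module_module)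
  have F: "DO (Wm s (M t)) (Suc k) (un_Fn (F t))" "\<And>a. a \<in> carrier A \<Longrightarrow> un_Fn (F t) a \<in> DR (r - 1) s (M t)"
    "r = 0 \<Longrightarrow> un_Fn (F t) \<one> = \<zero>\<^bsub>Wm s (M t)\<^esub>" if "t \<in> T" for t
    using Cons.prems[OF that] by auto
  have IH: "join T (length s) (\<lambda>t. un_Fn (F t) a) \<in> DR (r - 1) s (prod_module T M)" if "a \<in> carrier A" for a
    using F(2) that by (intro Cons.IH) auto
  have "Fn (\<lambda>a\<in>carrier A. join T (length s) (\<lambda>t. un_Fn (F t) a)) \<in> DR r (k # s) (prod_module T M)"
  proof (rule DR_ConsI[OF U _ IH])
    show "DO (Wm s (prod_module T M)) (Suc k) (\<lambda>a. join T (length s) (\<lambda>t. un_Fn (F t) a))"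
      using F(1) subsetD[OF DR_subset[OF U] IH] by (intro DO_join) auto
    show "join T (length s) (\<lambda>t. un_Fn (F t) \<one>) = \<zero>\<^bsub>Wm s (prod_module T M)\<^esub>" if "r = 0"
      unfolding join_zero[symmetric] using F(3)[OF _ that] by (rule join_cong)
  qed
  then show ?case by simp
qed

section \<open>Submodules of finite type\<close>

definition sub :: "('u, 'v) module \<Rightarrow> 'v set \<Rightarrow> bool" where
  "sub W S \<longleftrightarrow> subgrp W S \<and> (\<forall>a\<in>carrier A. \<forall>x\<in>S. a \<odot>\<^bsub>W\<^esub> x \<in> S)"

primrec fg :: "('u, 'v) module \<Rightarrow> 'v list \<Rightarrow> 'v set" where
  "fg W [] = {\<zero>\<^bsub>W\<^esub>}"
| "fg W (y # ys) = (\<lambda>(a, z). a \<odot>\<^bsub>W\<^esub> y \<oplus>\<^bsub>W\<^esub> z) ` (carrier A \<times> fg W ys)"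

lemma subI:
  assumes "module A W" "S \<subseteq> carrier W" "\<zero>\<^bsub>W\<^esub> \<in> S" "\<And>x y. x \<in> S \<Longrightarrow> y \<in> S \<Longrightarrow> x \<oplus>\<^bsub>W\<^esub> y \<in> S"
    "\<And>a x. a \<in> carrier A \<Longrightarrow> x \<in> S \<Longrightarrow> a \<odot>\<^bsub>W\<^esub> x \<in> S"
  shows "sub W S"
  using assms by (auto simp: sub_def subgrp_def)

lemma subD:
  assumes "sub W S"
  shows "S \<subseteq> carrier W" "\<zero>\<^bsub>W\<^esub> \<in> S" "x \<in> S \<Longrightarrow> y \<in> S \<Longrightarrow> x \<oplus>\<^bsub>W\<^esub> y \<in> S" "a \<in> carrier A \<Longrightarrow> x \<in> S \<Longrightarrow> a \<odot>\<^bsub>W\<^esub> x \<in> S"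
    "module A W \<Longrightarrow> submodule S A W" "module A W \<Longrightarrow> module A (W\<lparr>carrier := S\<rparr>)"
proof -
  show "module A W \<Longrightarrow> module A (W\<lparr>carrier := S\<rparr>)" using assms by (auto simp: sub_def intro: submodule_update)
  then show "module A W \<Longrightarrow> submodule S A W"
    using assms by (intro module.module_incl_imp_submodule) (auto simp: sub_def subgrp_def)
qed (use assms in \<open>auto simp: sub_def subgrp_def\<close>)

lemma fg_least: "sub W S \<Longrightarrow> set ys \<subseteq> S \<Longrightarrow> fg W ys \<subseteq> S"
  by (induction ys) (auto simp: sub_def subgrp_def)

lemma sub_fg:
  assumes "module A W" "set ys \<subseteq> carrier W"
  shows "sub W (fg W ys)"
  using assms(2)
proof (induction ys)
  interpret W: module A W by fact
  case Nil then show ?case by (auto intro!: subI[OF assms(1)])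
next
  interpret W: module A W by fact
  case (Cons y ys)
  have "set ys \<subseteq> carrier W" using Cons.prems by simp
  note S = subD(1-4)[OF Cons.IH[OF this]]
  have mem: "a \<odot>\<^bsub>W\<^esub> y \<oplus>\<^bsub>W\<^esub> z \<in> fg W (y # ys)" if "a \<in> carrier A" "z \<in> fg W ys" for a z
    using that by auto
  show ?case
  proof (rule subI[OF assms(1)])
    show "fg W (y # ys) \<subseteq> carrier W" using S(1) Cons.prems by auto
    show "\<zero>\<^bsub>W\<^esub> \<in> fg W (y # ys)" using mem[OF R.zero_closed S(2)] Cons.prems by simp
    fix x assume "x \<in> fg W (y # ys)"
    then obtain a u where x: "x = a \<odot>\<^bsub>W\<^esub> y \<oplus>\<^bsub>W\<^esub> u" "a \<in> carrier A" "u \<in> fg W ys" by auto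
    show "x \<oplus>\<^bsub>W\<^esub> x' \<in> fg W (y # ys)" if "x' \<in> fg W (y # ys)" for x'
    proof -
      obtain b v where x': "x' = b \<odot>\<^bsub>W\<^esub> y \<oplus>\<^bsub>W\<^esub> v" "b \<in> carrier A" "v \<in> fg W ys" using \<open>x' \<in> _\<close> by auto
      have "x \<oplus>\<^bsub>W\<^esub> x' = (a \<oplus> b) \<odot>\<^bsub>W\<^esub> y \<oplus>\<^bsub>W\<^esub> (u \<oplus>\<^bsub>W\<^esub> v)"
        using x x' S(1) Cons.prems by (auto simp: W.smult_l_distr W.M.a_ac subset_iff)
      then show ?thesis using mem[OF R.a_closed[OF x(2) x'(2)] S(3)[OF x(3) x'(3)]] by simp
    qed
    show "b \<odot>\<^bsub>W\<^esub> x \<in> fg W (y # ys)" if "b \<in> carrier A" for b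
    proof -
      have "b \<odot>\<^bsub>W\<^esub> x = (b \<otimes> a) \<odot>\<^bsub>W\<^esub> y \<oplus>\<^bsub>W\<^esub> b \<odot>\<^bsub>W\<^esub> u"
        using x that S(1) Cons.prems by (auto simp: W.smult_r_distr W.smult_assoc1)
      then show ?thesis using mem[OF R.m_closed[OF that x(2)] S(4)[OF that x(3)]] by simp
    qed
  qed
qed

lemma fg_gen:
  assumes "module A W" "set ys \<subseteq> carrier W"
  shows "set ys \<subseteq> fg W ys"
  using assms(2)
proof (induction ys)
  case (Cons y ys)
  interpret W: module A W by fact
  have S: "sub W (fg W ys)" using sub_fg[OF assms(1)] Cons.prems by simp
  have "fg W ys \<subseteq> fg W (y # ys)"
  proof
    fix z assume z: "z \<in> fg W ys"
    then have "z = \<zero> \<odot>\<^bsub>W\<^esub> y \<oplus>\<^bsub>W\<^esub> z" using Cons.prems subD(1)[OF S] by auto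
    then show "z \<in> fg W (y # ys)" using z by force
  qed
  moreover have "y \<in> fg W (y # ys)"
  proof -
    have "y = \<one> \<odot>\<^bsub>W\<^esub> y \<oplus>\<^bsub>W\<^esub> \<zero>\<^bsub>W\<^esub>" using Cons.prems by simp
    then show ?thesis using subD(2)[OF S] by force
  qed
  ultimately show ?case using Cons by auto
qed simp

lemma fg_mono: "module A W \<Longrightarrow> set zs \<subseteq> carrier W \<Longrightarrow> set ys \<subseteq> set zs \<Longrightarrow> fg W ys \<subseteq> fg W zs"
  using fg_least[OF sub_fg] fg_gen by blast

end

context good_module
begin

text \<open>By \<open>DO_split\<close> the values are sums of values of finitely many linear
  operators, and these are multiples of their values at one. Finite order thus confines an operator
  to a submodule of finite type.\<close>

lemma DO_fg:
  assumes "DO W n D"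
  shows "\<exists>ys. set ys \<subseteq> carrier W \<and> D ` carrier A \<subseteq> fg W ys"
proof -
  note m = module_axioms
  note fgD = subD(1-4)[OF sub_fg[OF m]]
  show ?thesis
    using assms
  proof (induction n arbitrary: D)
    case 0
    then show ?case using DO_0[OF 0] by (intro exI[of _ "[]"]) auto
  next
    case (Suc n)
    show ?case
    proof (cases n)
      case 0
      have "D p \<in> fg W [D \<one>]" if p: "p \<in> carrier A" for p
      proof -
        have "D p = p \<odot>\<^bsub>W\<^esub> D \<one>" using Suc.prems 0 ord_1[OF _ _ p] DO_maps by (simp add: DO_def Klin_def)
        then show ?thesis using p DO_closed[OF Suc.prems, of \<one>] fgD(4)[of "[D \<one>]"] fg_gen[OF m, of "[D \<one>]"]
          by (simp del: fg.simps)
      qed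
      then show ?thesis using DO_closed[OF Suc.prems, of \<one>] by (intro exI[of _ "[D \<one>]"]) auto
    next
      case (Suc n')
      obtain E F where EF: "DO W (Suc n') E" "\<And>x. x \<in> set xs \<Longrightarrow> DO W (Suc n') (F x)"
        "\<And>p. p \<in> carrier A \<Longrightarrow> D p = lsum W (\<lambda>x. F x (dd x p)) xs \<oplus>\<^bsub>W\<^esub> E p"
        using DO_split[of n' D] Suc.prems Suc by auto
      obtain zs where zs: "set zs \<subseteq> carrier W" "E ` carrier A \<subseteq> fg W zs" using Suc.IH[of E] EF(1) Suc by auto
      have "\<forall>x\<in>set xs. \<exists>y. set y \<subseteq> carrier W \<and> F x ` carrier A \<subseteq> fg W y"
        using Suc.IH EF(2) Suc by auto
      from bchoice[OF this] obtain ys where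
        ys': "\<forall>x\<in>set xs. set (ys x) \<subseteq> carrier W \<and> F x ` carrier A \<subseteq> fg W (ys x)" by blast
      note ys = bspec[OF ys']
      let ?Y = "concat (map ys xs) @ zs"
      have Y: "set ?Y \<subseteq> carrier W" using zs ys by auto
      have F: "F x p \<in> fg W ?Y" if "x \<in> set xs" "p \<in> carrier A" for x p
        using fg_mono[OF m Y, of "ys x"] ys[OF that(1)] that by auto
      have E: "E p \<in> fg W ?Y" if "p \<in> carrier A" for p
        using fg_mono[OF m Y, of zs] zs that by auto
      have L: "lsum W f us \<in> fg W ?Y" if "\<And>x. x \<in> set us \<Longrightarrow> f x \<in> fg W ?Y" for f and us :: "'u list"
        using that fgD(2,3)[OF Y] by (induction us) simp_all
      have "D p \<in> fg W ?Y" if p: "p \<in> carrier A" for p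
        unfolding EF(3)[OF p] by (intro fgD(3)[OF Y] L E[OF p] F) (use p in simp_all)
      then show ?thesis using Y by blast
    qed
  qed
qed

end

context frame
begin

text \<open>The outer operator stays in the span of finitely many inner ones. Multiples of these
  have shifted arguments but no new values, or multiples of old values if there are no entries left;
  so the generators found for the finitely many inner operators suffice.\<close>

lemma ev_fg:
  assumes "good Q" "module A Q" "X \<in> carrier (Wm s Q)"
  shows "\<exists>ys. set ys \<subseteq> carrier Q \<and> (\<forall>as\<in>tuples (length s). ev as X \<in> fg Q ys)"
  using assms(3)
proof (induction s arbitrary: X)
  case Nil
  then have "set [un_Base X] \<subseteq> carrier Q" by auto
  then show ?case using fg_gen[OF assms(2), of "[un_Base X]"] by (intro exI[of _ "[un_Base X]"]) (auto simp del: fg.simps)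
next
  case (Cons k s)
  interpret V: good_module A K xs dd "Wm s Q" using assms(2,1) by (rule good_module_Wm)
  obtain D where D: "X = Fn D" "DO (Wm s Q) (Suc k) D" using Cons.prems by (auto simp: carrier_Wm_Cons[OF assms(2)])
  obtain Xs where Xs: "set Xs \<subseteq> carrier (Wm s Q)" "D ` carrier A \<subseteq> fg (Wm s Q) Xs"
    using V.DO_fg[OF D(2)] by blast
  obtain ys where ys: "\<And>x. x \<in> set Xs \<Longrightarrow> set (ys x) \<subseteq> carrier Q \<and> (\<forall>as\<in>tuples (length s). ev as x \<in> fg Q (ys x))"
    using Cons.IH Xs(1) by (metis subsetD)
  let ?Y = "concat (map ys Xs)"
  have Y: "set ?Y \<subseteq> carrier Q" using ys by auto
  note fgD = subD(1-4)[OF sub_fg[OF assms(2) Y]]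
  have x: "ev as x \<in> fg Q ?Y" if "x \<in> set Xs" "as \<in> tuples (length s)" for x as
    using fg_mono[OF assms(2) Y, of "ys x"] ys[OF that(1)] that by auto
  have "sub (Wm s Q) {x \<in> carrier (Wm s Q). \<forall>as\<in>tuples (length s). ev as x \<in> fg Q ?Y}" (is "sub _ ?S")
  proof (rule subI[OF module_Wm[OF assms(2)]])
    fix a x assume a: "a \<in> carrier A" "x \<in> ?S"
    have "ev as (a \<odot>\<^bsub>Wm s Q\<^esub> x) \<in> fg Q ?Y" if "as \<in> tuples (length s)" for as
    proof (cases s)
      case Nil then show ?thesis using a that fgD(4) by auto
    next
      case (Cons l t)
      then show ?thesis using a that by (auto simp: ev_smult_Cons elim!: tuples_SucE simp del: ev.simps)
    qed
    then show "a \<odot>\<^bsub>Wm s Q\<^esub> x \<in> ?S" using a V.smult_closed by simp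
  qed (auto simp: ev_zero ev_add fgD)
  then have "fg (Wm s Q) Xs \<subseteq> ?S" using x Xs by (intro fg_least) auto
  then have "D c \<in> ?S" if "c \<in> carrier A" for c using Xs(2) that by blast
  then show ?case using Y by (intro exI[of _ ?Y]) (auto simp: D(1) elim!: tuples_SucE)
qed

end

section \<open>Modules in the subcategory\<close>

locale diff_closed = diffcalc A K for A :: "('u, 'z) ring_scheme" (structure) and K +
  fixes \<DD> :: "('u, 'u) module set"
  assumes closed: "differentially_closed K A \<DD>"
begin

lemma cat_module: "Q \<in> \<DD> \<Longrightarrow> module A Q"
  using closed by (auto simp: differentially_closed_def full_abelian_subcategory_def)

lemma linear_onD:
  assumes "linear_on V W C h"
  shows "x \<in> C \<Longrightarrow> y \<in> C \<Longrightarrow> h (x \<oplus>\<^bsub>V\<^esub> y) = h x \<oplus>\<^bsub>W\<^esub> h y"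
    "a \<in> carrier A \<Longrightarrow> x \<in> C \<Longrightarrow> h (a \<odot>\<^bsub>V\<^esub> x) = a \<odot>\<^bsub>W\<^esub> h x"
  using assms by (auto simp: linear_on_def)

lemma linear_on_zero:
  assumes "module A V" "module A W" "linear_on V W C h" "\<zero>\<^bsub>V\<^esub> \<in> C" "h ` C \<subseteq> carrier W"
  shows "h \<zero>\<^bsub>V\<^esub> = \<zero>\<^bsub>W\<^esub>"
proof -
  interpret V: module A V by fact
  interpret W: module A W by fact
  show ?thesis using linear_onD(2)[OF assms(3) R.zero_closed assms(4)] assms(4,5) by auto
qed

lemma in_catE:
  assumes "in_cat A \<DD> M"
  obtains Y h where "Y \<in> \<DD>" "module A M" "module A Y" "linear_on M Y (carrier M) h"
    "bij_betw h (carrier M) (carrier Y)"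
  using assms
  by (fastforce simp: in_cat_def isomorphic_modules_def mod_iso_def mod_hom_def lin_maps_def linear_on_def)

lemma bij_inv_linear:
  assumes "module A M" "module A Y" "linear_on M Y (carrier M) h" "bij_betw h (carrier M) (carrier Y)"
  shows "linear_on Y M (carrier Y) (inv_into (carrier M) h)"
    "bij_betw (inv_into (carrier M) h) (carrier Y) (carrier M)"
proof -
  interpret M: module A M by fact
  let ?g = "inv_into (carrier M) h"
  have inj: "inj_on h (carrier M)" and im: "h ` carrier M = carrier Y" using assms(4) by (auto simp: bij_betw_def)
  have g: "?g y \<in> carrier M" "h (?g y) = y" if "y \<in> carrier Y" for y
    using that im by (auto intro: inv_into_into f_inv_into_f)
  have e: "?g y = x" if "h x = y" "x \<in> carrier M" for x y using that inj by auto
  show "linear_on Y M (carrier Y) ?g"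
    unfolding linear_on_def
  proof (intro conjI ballI)
    fix x y assume "x \<in> carrier Y" "y \<in> carrier Y"
    then show "?g (x \<oplus>\<^bsub>Y\<^esub> y) = ?g x \<oplus>\<^bsub>M\<^esub> ?g y"
      using g linear_onD(1)[OF assms(3)] by (intro e) auto
  next
    fix a x assume "a \<in> carrier A" "x \<in> carrier Y"
    then show "?g (a \<odot>\<^bsub>Y\<^esub> x) = a \<odot>\<^bsub>M\<^esub> ?g x"
      using g linear_onD(2)[OF assms(3)] by (intro e) auto
  qed
  show "bij_betw ?g (carrier Y) (carrier M)" using assms(4) by (rule bij_betw_inv_into)
qed

lemma linear_mod_hom:
  assumes "linear_on M Y (carrier M) h" "h ` carrier M \<subseteq> carrier Y" "module A M"
  shows "restrict h (carrier M) \<in> mod_hom A M Y"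
proof -
  interpret M: module A M by fact
  show ?thesis using assms(1,2) by (auto simp: mod_hom_def lin_maps_def linear_on_def)
qed

lemma in_catI:
  assumes "Y \<in> \<DD>" "module A M" "linear_on Y M (carrier Y) h" "bij_betw h (carrier Y) (carrier M)"
  shows "in_cat A \<DD> M"
proof -
  note g = bij_inv_linear[OF cat_module[OF assms(1)] assms(2-4)]
  have "restrict (inv_into (carrier Y) h) (carrier M) \<in> mod_hom A M Y"
    using g by (intro linear_mod_hom assms(2)) (auto simp: bij_betw_def)
  then have "restrict (inv_into (carrier Y) h) (carrier M) \<in> mod_iso A M Y"
    using g(2) assms(1,2) cat_module by (auto simp: mod_iso_def bij_betw_restrict_eq)
  then show ?thesis using assms(1) by (auto simp: in_cat_def isomorphic_modules_def)
qed

text \<open>Cokernels are available for maps between objects only, so \<open>S\<close> is first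
  replaced by an isomorphic object mapping onto it. The result is stated as a surjection with kernel
  \<open>S\<close>, so that its target can be an actual object.\<close>

lemma cat_quot:
  assumes "Y \<in> \<DD>" "sub Y S"
  obtains Z p where "Z \<in> \<DD>" "linear_on Y Z (carrier Y) p" "p ` carrier Y = carrier Z"
    "\<And>y. y \<in> carrier Y \<Longrightarrow> p y = \<zero>\<^bsub>Z\<^esub> \<longleftrightarrow> y \<in> S"
proof -
  note mY = cat_module[OF assms(1)] and S = subD[OF assms(2)]
  have "in_cat A \<DD> (Y\<lparr>carrier := S\<rparr>)"
    using closed assms(1) S(5)[OF mY] by (auto simp: differentially_closed_def)
  then obtain M h where M: "M \<in> \<DD>" "module A (Y\<lparr>carrier := S\<rparr>)" "module A M" "linear_on (Y\<lparr>carrier := S\<rparr>) M S h" "bij_betw h S (carrier M)"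
    by (rule in_catE) simp
  note g = bij_inv_linear[OF M(2,3), simplified, OF M(4,5)]
  have "restrict (inv_into S h) (carrier M) \<in> mod_hom A M Y"
    using g S(1) by (intro linear_mod_hom M(3)) (auto simp: bij_betw_def linear_on_def)
  moreover have "\<forall>f\<in>mod_hom A M Y. in_cat A \<DD> (quot_module Y (f ` carrier M))"
    using closed assms(1) M(1) by (simp add: differentially_closed_def full_abelian_subcategory_def)
  ultimately have "in_cat A \<DD> (quot_module Y (restrict (inv_into S h) (carrier M) ` carrier M))" by (rule bspec[rotated])
  moreover have "restrict (inv_into S h) (carrier M) ` carrier M = S" using g(2) by (auto simp: bij_betw_def)
  ultimately have "in_cat A \<DD> (quot_module Y S)" by simp
  then obtain Z j where Z: "Z \<in> \<DD>" "module A (quot_module Y S)" "module A Z" "linear_on (quot_module Y S) Z (carrier (quot_module Y S)) j"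
    "bij_betw j (carrier (quot_module Y S)) (carrier Z)"
    by (rule in_catE)
  note q = quot_module_props[OF mY S(5)[OF mY]]
  have qc: "S +>\<^bsub>Y\<^esub> y \<in> carrier (quot_module Y S)" if "y \<in> carrier Y" for y using q(1) that by blast
  have jz: "j \<zero>\<^bsub>quot_module Y S\<^esub> = \<zero>\<^bsub>Z\<^esub>"
    using Z(5) module.axioms(2)[OF Z(2)]
    by (intro linear_on_zero[OF Z(2,3,4)]) (auto simp: bij_betw_def intro: abelian_monoid.zero_closed abelian_group.axioms(1))
  show thesis
  proof (rule that[OF Z(1)])
    show "linear_on Y Z (carrier Y) (\<lambda>y. j (S +>\<^bsub>Y\<^esub> y))"
      unfolding linear_on_def using linear_onD[OF Z(4)] qc q(2,3) by simp
    show "(\<lambda>y. j (S +>\<^bsub>Y\<^esub> y)) ` carrier Y = carrier Z"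
      using Z(5) q(1) by (auto simp: bij_betw_def image_image[symmetric])
    fix y assume y: "y \<in> carrier Y"
    have "j (S +>\<^bsub>Y\<^esub> y) = j \<zero>\<^bsub>quot_module Y S\<^esub> \<longleftrightarrow> S +>\<^bsub>Y\<^esub> y = \<zero>\<^bsub>quot_module Y S\<^esub>"
      using Z(5) qc[OF y] module.axioms(2)[OF Z(2)]
      by (intro inj_on_eq_iff[of j "carrier (quot_module Y S)"]) (auto simp: bij_betw_def intro: abelian_monoid.zero_closed abelian_group.axioms(1))
    then show "j (S +>\<^bsub>Y\<^esub> y) = \<zero>\<^bsub>Z\<^esub> \<longleftrightarrow> y \<in> S" using jz q(5)[OF y] by simp
  qed
qed

lemma in_cat_quot:
  assumes "in_cat A \<DD> V" "sub V S"
  obtains Z p where "Z \<in> \<DD>" "linear_on V Z (carrier V) p" "p ` carrier V = carrier Z"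
    "\<And>y. y \<in> carrier V \<Longrightarrow> p y = \<zero>\<^bsub>Z\<^esub> \<longleftrightarrow> y \<in> S"
proof -
  obtain Y h where Y: "Y \<in> \<DD>" "module A V" "module A Y" "linear_on V Y (carrier V) h"
    "bij_betw h (carrier V) (carrier Y)" using assms(1) by (rule in_catE)
  note S = subD[OF assms(2)]
  have hz: "h \<zero>\<^bsub>V\<^esub> = \<zero>\<^bsub>Y\<^esub>" using S Y(5) by (intro linear_on_zero[OF Y(2,3,4)]) (auto simp: bij_betw_def)
  have "sub Y (h ` S)"
  proof (rule subI[OF Y(3)])
    show "h ` S \<subseteq> carrier Y" using S(1) Y(5) by (auto simp: bij_betw_def)
    show "\<zero>\<^bsub>Y\<^esub> \<in> h ` S" using S(2) hz by (metis imageI)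
    fix x y assume "x \<in> h ` S" "y \<in> h ` S"
    then obtain x' y' where "x = h x'" "x' \<in> S" "y = h y'" "y' \<in> S" by blast
    then have "x \<oplus>\<^bsub>Y\<^esub> y = h (x' \<oplus>\<^bsub>V\<^esub> y')" "x' \<oplus>\<^bsub>V\<^esub> y' \<in> S"
      using S(3) linear_onD(1)[OF Y(4) subsetD[OF S(1)] subsetD[OF S(1)], of x' y'] by simp_all
    then show "x \<oplus>\<^bsub>Y\<^esub> y \<in> h ` S" by simp
  next
    fix a x assume "a \<in> carrier A" "x \<in> h ` S"
    then obtain x' where "x = h x'" "x' \<in> S" by blast
    then have "a \<odot>\<^bsub>Y\<^esub> x = h (a \<odot>\<^bsub>V\<^esub> x')" "a \<odot>\<^bsub>V\<^esub> x' \<in> S"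
      using S(4) \<open>a \<in> carrier A\<close> linear_onD(2)[OF Y(4) _ subsetD[OF S(1)], of a x'] by simp_all
    then show "a \<odot>\<^bsub>Y\<^esub> x \<in> h ` S" by simp
  qed
  then obtain Z p where Z: "Z \<in> \<DD>" "linear_on Y Z (carrier Y) p" "p ` carrier Y = carrier Z"
    "\<And>y. y \<in> carrier Y \<Longrightarrow> p y = \<zero>\<^bsub>Z\<^esub> \<longleftrightarrow> y \<in> h ` S" using cat_quot[OF Y(1)] by blast
  have hc: "h x \<in> carrier Y" if "x \<in> carrier V" for x using Y(5) that by (auto simp: bij_betw_def)
  show thesis
  proof (rule that[OF Z(1)])
    show "linear_on V Z (carrier V) (\<lambda>x. p (h x))"
      unfolding linear_on_def using linear_onD[OF Z(2)] linear_onD[OF Y(4)] hc by simp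
    show "(\<lambda>x. p (h x)) ` carrier V = carrier Z" using Z(3) Y(5) by (auto simp: bij_betw_def image_image[symmetric])
    show "p (h y) = \<zero>\<^bsub>Z\<^esub> \<longleftrightarrow> y \<in> S" if "y \<in> carrier V" for y
      using Z(4)[OF hc[OF that]] Y(5) S(1) that by (auto simp: bij_betw_def inj_on_def)
  qed
qed

text \<open>The image is isomorphic to the quotient by the kernel. \<open>W\<close> may have its
  carrier in any type, in particular in a product over all tests.\<close>

lemma in_cat_image:
  assumes V: "in_cat A \<DD> V" and W: "module A W" and g: "linear_on V W (carrier V) g" "g ` carrier V = carrier W"
  shows "in_cat A \<DD> W"
proof -
  obtain mV: "module A V" using V by (rule in_catE)
  interpret V: module A V by fact
  interpret W: module A W by fact
  let ?S = "{x \<in> carrier V. g x = \<zero>\<^bsub>W\<^esub>}"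
  have gz: "g \<zero>\<^bsub>V\<^esub> = \<zero>\<^bsub>W\<^esub>" using g(2) by (intro linear_on_zero[OF mV W g(1)]) auto
  have "sub V ?S"
    by (rule subI[OF mV]) (auto simp: gz linear_onD[OF g(1)])
  then obtain Z p where Z: "Z \<in> \<DD>" "linear_on V Z (carrier V) p" "p ` carrier V = carrier Z"
    "\<And>y. y \<in> carrier V \<Longrightarrow> p y = \<zero>\<^bsub>Z\<^esub> \<longleftrightarrow> y \<in> ?S" using in_cat_quot[OF V] by blast
  interpret Z: module A Z using cat_module[OF Z(1)] .
  have gc: "g x \<in> carrier W" "p x \<in> carrier Z" if "x \<in> carrier V" for x using g(2) Z(3) that by auto
  have pg: "p x = p y \<longleftrightarrow> g x = g y" if xy: "x \<in> carrier V" "y \<in> carrier V" for x y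
  proof -
    let ?m = "x \<oplus>\<^bsub>V\<^esub> (\<ominus> \<one>) \<odot>\<^bsub>V\<^esub> y"
    have n: "(\<ominus> \<one>) \<odot>\<^bsub>V\<^esub> y \<in> carrier V" using xy by simp
    have "p ?m = p x \<oplus>\<^bsub>Z\<^esub> \<ominus>\<^bsub>Z\<^esub> p y" "g ?m = g x \<oplus>\<^bsub>W\<^esub> \<ominus>\<^bsub>W\<^esub> g y"
      using xy gc[OF xy(2)] by (simp_all only: linear_onD(1)[OF Z(2) xy(1) n] linear_onD(1)[OF g(1) xy(1) n]
          linear_onD(2)[OF Z(2) _ xy(2)] linear_onD(2)[OF g(1) _ xy(2)] R.a_inv_closed R.one_closed
          W.neg_one_smult Z.neg_one_smult)
    moreover have "p ?m = \<zero>\<^bsub>Z\<^esub> \<longleftrightarrow> g ?m = \<zero>\<^bsub>W\<^esub>" using Z(4)[of ?m] xy by simp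
    moreover have "p x \<oplus>\<^bsub>Z\<^esub> \<ominus>\<^bsub>Z\<^esub> p y = \<zero>\<^bsub>Z\<^esub> \<longleftrightarrow> p x = p y" "g x \<oplus>\<^bsub>W\<^esub> \<ominus>\<^bsub>W\<^esub> g y = \<zero>\<^bsub>W\<^esub> \<longleftrightarrow> g x = g y"
      using gc xy Z.M.add.inv_solve_right'[of "\<zero>\<^bsub>Z\<^esub>" "p x" "p y"] W.M.add.inv_solve_right'[of "\<zero>\<^bsub>W\<^esub>" "g x" "g y"]
      by auto
    ultimately show ?thesis by simp
  qed
  define q where "q = inv_into (carrier V) p"
  have q: "q z \<in> carrier V" "p (q z) = z" if "z \<in> carrier Z" for z
    unfolding q_def using that Z(3) by (auto intro: inv_into_into f_inv_into_f)
  have gq: "g (q z) = g x" if "x \<in> carrier V" "p x = z" for x z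
    using pg[of "q z" x] q[of z] that gc by auto
  show ?thesis
  proof (rule in_catI[OF Z(1) W])
    show "linear_on Z W (carrier Z) (\<lambda>z. g (q z))"
      unfolding linear_on_def
    proof (intro conjI ballI)
      fix x y assume xy: "x \<in> carrier Z" "y \<in> carrier Z"
      have "g (q (x \<oplus>\<^bsub>Z\<^esub> y)) = g (q x \<oplus>\<^bsub>V\<^esub> q y)"
        using q xy by (intro gq) (simp_all add: linear_onD(1)[OF Z(2)])
      then show "g (q (x \<oplus>\<^bsub>Z\<^esub> y)) = g (q x) \<oplus>\<^bsub>W\<^esub> g (q y)" using q xy by (simp add: linear_onD(1)[OF g(1)])
    next
      fix a x assume xy: "a \<in> carrier A" "x \<in> carrier Z"
      have "g (q (a \<odot>\<^bsub>Z\<^esub> x)) = g (a \<odot>\<^bsub>V\<^esub> q x)"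
        using q xy by (intro gq) (simp_all add: linear_onD(2)[OF Z(2)])
      then show "g (q (a \<odot>\<^bsub>Z\<^esub> x)) = a \<odot>\<^bsub>W\<^esub> g (q x)" using q xy by (simp add: linear_onD(2)[OF g(1)])
    qed
    have "inj_on (\<lambda>z. g (q z)) (carrier Z)"
    proof (rule inj_onI)
      fix x y assume "x \<in> carrier Z" "y \<in> carrier Z" "g (q x) = g (q y)"
      then show "x = y" using pg[of "q x" "q y"] q by metis
    qed
    moreover have "(\<lambda>z. g (q z)) ` carrier Z = carrier W"
    proof
      show "(\<lambda>z. g (q z)) ` carrier Z \<subseteq> carrier W" using q gc by auto
      show "carrier W \<subseteq> (\<lambda>z. g (q z)) ` carrier Z"
      proof
        fix w assume "w \<in> carrier W"
        then obtain x where "x \<in> carrier V" "w = g x" using g(2) by auto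
        then show "w \<in> (\<lambda>z. g (q z)) ` carrier Z" using gq[of x "p x"] gc(2) by (metis imageI)
      qed
    qed
    ultimately show "bij_betw (\<lambda>z. g (q z)) (carrier Z) (carrier W)" by (simp add: bij_betw_def)
  qed
qed

text \<open>A module of finite type is a quotient of a finite sum of copies of \<open>A\<close>, so
  it belongs to the subcategory even when the module around it does not.\<close>

lemma in_cat_fg:
  assumes "module A W" "set ys \<subseteq> carrier W"
  shows "in_cat A \<DD> (W\<lparr>carrier := fg W ys\<rparr>)"
  using assms(2)
proof (induction ys)
  interpret W: module A W by fact
  case Nil
  obtain Z where Z: "Z \<in> \<DD>" "carrier Z = {\<zero>\<^bsub>Z\<^esub>}"
    using closed unfolding differentially_closed_def full_abelian_subcategory_def by blast
  interpret Z: module A Z using cat_module[OF Z(1)] .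
  show ?case
  proof (rule in_catI[OF Z(1)])
    show "module A (W\<lparr>carrier := fg W []\<rparr>)" using subD(6)[OF sub_fg[OF assms(1), of "[]"] assms(1)] by simp
  qed (auto simp: Z(2) linear_on_def bij_betw_def)
next
  interpret W: module A W by fact
  case (Cons y ys)
  have ys: "set ys \<subseteq> carrier W" "y \<in> carrier W" using Cons.prems by auto
  note F = subD[OF sub_fg[OF assms(1) ys(1)]]
  obtain Y h where Y: "Y \<in> \<DD>" "module A Y" "linear_on (W\<lparr>carrier := fg W ys\<rparr>) Y (fg W ys) h" "bij_betw h (fg W ys) (carrier Y)"
    using Cons.IH[OF ys(1)] by (auto elim: in_catE)
  define k where "k = inv_into (fg W ys) h"
  have k: "linear_on Y (W\<lparr>carrier := fg W ys\<rparr>) (carrier Y) k" "bij_betw k (carrier Y) (fg W ys)"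
    using bij_inv_linear[OF F(6)[OF assms(1)] Y(2), of h] Y(3,4) by (simp_all add: k_def)
  have kc: "k z \<in> carrier W" if "z \<in> carrier Y" for z using k(2) F(1) that by (auto simp: bij_betw_def)
  have R: "regular_module A \<in> \<DD>" using closed by (simp add: differentially_closed_def)
  have "in_cat A \<DD> (direct_sum (regular_module A) Y)"
    using closed R Y(1) by (simp add: differentially_closed_def full_abelian_subcategory_def)
  then show ?case
  proof (rule in_cat_image)
    show "module A (W\<lparr>carrier := fg W (y # ys)\<rparr>)" using subD(6)[OF sub_fg[OF assms(1) Cons.prems] assms(1)] .
    show "(\<lambda>(a, z). a \<odot>\<^bsub>W\<^esub> y \<oplus>\<^bsub>W\<^esub> k z) ` carrier (direct_sum (regular_module A) Y) = carrier (W\<lparr>carrier := fg W (y # ys)\<rparr>)"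
    proof -
      have "k ` carrier Y = fg W ys" using k(2) by (simp add: bij_betw_def)
      then have "carrier A \<times> fg W ys = map_prod id k ` (carrier A \<times> carrier Y)" by (simp add: map_prod_surj_on)
      then have "fg W (y # ys) = (\<lambda>(a, z). a \<odot>\<^bsub>W\<^esub> y \<oplus>\<^bsub>W\<^esub> z) ` map_prod id k ` (carrier A \<times> carrier Y)" by simp
      then show ?thesis by (simp add: direct_sum_def regular_module_def image_image case_prod_unfold)
    qed
    have kl: "k (x \<oplus>\<^bsub>Y\<^esub> z) = k x \<oplus>\<^bsub>W\<^esub> k z" "k (a \<odot>\<^bsub>Y\<^esub> x) = a \<odot>\<^bsub>W\<^esub> k x"
      if "a \<in> carrier A" "x \<in> carrier Y" "z \<in> carrier Y" for a x z
      using linear_onD[OF k(1)] that by simp_all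
    show "linear_on (direct_sum (regular_module A) Y) (W\<lparr>carrier := fg W (y # ys)\<rparr>)
        (carrier (direct_sum (regular_module A) Y)) (\<lambda>(a, z). a \<odot>\<^bsub>W\<^esub> y \<oplus>\<^bsub>W\<^esub> k z)"
      using kc kl ys(2) by (auto simp: linear_on_def direct_sum_def regular_module_def W.smult_l_distr W.smult_r_distr
          W.smult_assoc1 W.M.a_ac)
  qed
qed

lemma in_cat_Diffp: "Q \<in> \<DD> \<Longrightarrow> in_cat A \<DD> (Diffp K A k (regular_module A) Q)"
  using closed by (simp add: differentially_closed_def calculus_closed_def)

end

locale diff_cat = frame A K xs dd + diff_closed A K \<DD>
  for A :: "('u, 'z) ring_scheme" (structure) and K xs dd \<DD> +
  assumes cat_good: "\<And>Q. Q \<in> \<DD> \<Longrightarrow> good Q"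

section \<open>Formal sums modulo all tests\<close>

text \<open>Goodness is an equation of values and can be checked in each factor. It is available for
  the product of all tests although that product need not be an object.\<close>

lemma (in frame) good_prod_module:
  assumes "\<And>t. t \<in> T \<Longrightarrow> good (M t)"
  shows "good (prod_module T M)"
  unfolding good_def
proof (intro allI impI ballI)
  fix X a assume X: "derivation (prod_module T M) X" and a: "a \<in> carrier A"
  have Xc: "X b \<in> carrier (prod_module T M)" if "b \<in> carrier A" for b using X that by (auto simp: derivation_def)
  have "derivation (M t) (\<lambda>b. X b t)" if t: "t \<in> T" for t
    using X t Xc by (auto simp: derivation_def PiE_iff)
  then have "X a t = lsum (M t) (\<lambda>x. dd x a \<odot>\<^bsub>M t\<^esub> X x t) xs" if "t \<in> T" for t
    using assms[OF that] a that unfolding good_def by blast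
  then have "X a = (\<lambda>t\<in>T. lsum (M t) (\<lambda>x. dd x a \<odot>\<^bsub>M t\<^esub> X x t) xs)"
    using Xc[OF a] by (auto simp: PiE_iff intro: extensionalityI)
  also have "\<dots> = lsum (prod_module T M) (\<lambda>x. dd x a \<odot>\<^bsub>prod_module T M\<^esub> X x) xs"
    by (auto simp: lsum_prod_module intro!: restrict_ext lsum_cong)
  finally show "X a = lsum (prod_module T M) (\<lambda>x. dd x a \<odot>\<^bsub>prod_module T M\<^esub> X x) xs" .
qed

context diff_cat
begin

text \<open>Equality of formal sums in the object representing \<open>DR r s\<close> on \<open>\<DD>\<close>.\<close>

definition eqv :: "nat \<Rightarrow> nat list \<Rightarrow> 'u list list \<Rightarrow> 'u list list \<Rightarrow> bool" where
  "eqv r s f g \<longleftrightarrow> (\<forall>Q\<in>\<DD>. \<forall>X\<in>DR r s Q. evs Q X f = evs Q X g)"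

abbreviation "neg \<equiv> scal (\<ominus> \<one>)"

lemma DR_carrier: "Q \<in> \<DD> \<Longrightarrow> X \<in> DR r s Q \<Longrightarrow> X \<in> carrier (Wm s Q)"
  using DR_subset[OF cat_module] by blast

lemma eqv_refl [simp]: "eqv r s f f"
  by (simp add: eqv_def)

lemma eqvD: "eqv r s f g \<Longrightarrow> Q \<in> \<DD> \<Longrightarrow> X \<in> DR r s Q \<Longrightarrow> evs Q X f = evs Q X g"
  by (simp add: eqv_def)

lemma eqv_sym: "eqv r s f g \<Longrightarrow> eqv r s g f"
  by (simp add: eqv_def)

lemma eqv_trans [trans]: "eqv r s f g \<Longrightarrow> eqv r s g h \<Longrightarrow> eqv r s f h"
  by (simp add: eqv_def)

lemma eqv_append:
  assumes "eqv r s f f'" "eqv r s g g'" "f \<in> FS (length s)" "f' \<in> FS (length s)" "g \<in> FS (length s)" "g' \<in> FS (length s)"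
  shows "eqv r s (f @ g) (f' @ g')"
  using assms evs_append[OF cat_module DR_carrier] unfolding eqv_def by metis

lemma eqv_commute:
  assumes "f \<in> FS (length s)" "g \<in> FS (length s)"
  shows "eqv r s (f @ g) (g @ f)"
  unfolding eqv_def
proof (intro ballI)
  fix Q X assume Q: "Q \<in> \<DD>" "X \<in> DR r s Q"
  interpret Q: module A Q using Q(1) by (rule cat_module)
  note e = evs_append[OF cat_module[OF Q(1)] DR_carrier[OF Q]] and c = evs_carrier[OF cat_module[OF Q(1)] DR_carrier[OF Q]]
  show "evs Q X (f @ g) = evs Q X (g @ f)" using assms by (simp add: e c Q.M.a_comm)
qed

lemma eqv_neg:
  assumes "f \<in> FS (length s)"
  shows "eqv r s (neg f @ f) []"
  unfolding eqv_def
proof (intro ballI)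
  fix Q X assume Q: "Q \<in> \<DD>" "X \<in> DR r s Q"
  interpret Q: module A Q using Q(1) by (rule cat_module)
  note m = cat_module[OF Q(1)] DR_carrier[OF Q] assms
  have "evs Q X (neg f @ f) = \<ominus>\<^bsub>Q\<^esub> evs Q X f \<oplus>\<^bsub>Q\<^esub> evs Q X f"
    using evs_append[OF m(1,2) FS_scal[OF _ m(3)] m(3)] evs_scal[OF m] evs_carrier[OF m] by (simp add: Q.neg_one_smult)
  then show "evs Q X (neg f @ f) = evs Q X []" using evs_carrier[OF m] by (simp add: Q.M.l_neg)
qed

lemma eqv_mono: "eqv r t f g \<Longrightarrow> list_all2 (\<le>) s t \<Longrightarrow> eqv r s f g"
  using DR_mono[OF cat_module] unfolding eqv_def by blast

lemma eqv_Suc: "eqv (Suc r) s f g \<Longrightarrow> eqv r s f g"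
  using DR_Suc_subset unfolding eqv_def by blast

section \<open>Operations on words modulo tests\<close>

lemma evs_insw:
  assumes "p \<le> length t" "f \<in> FS (length t)"
  shows "evs Q X (map (insw p) f) = evs Q (ins p X) f"
proof (rule evs_map_cong)
  fix w assume "w \<in> set f"
  then have "w \<in> tuples (Suc (length t))" using assms(2) by (rule FS_mem[rotated])
  then show "evw Q X (insw p w) = evw Q (ins p X) w"
    by (rule tuples_Suc_snoc) (use assms(1) in \<open>simp add: insw_append tuples_def ev_ins[where n = "length t"]\<close>)
qed

lemma insw_zero:
  assumes "r \<le> p" "p \<le> n" "length s = Suc n" "f \<in> FS n"
  shows "eqv r s (map (insw p) f) []"
  unfolding eqv_def
proof (intro ballI)
  fix Q X assume Q: "Q \<in> \<DD>" "X \<in> DR r s Q"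
  interpret Q: module A Q using Q(1) by (rule cat_module)
  have z: "evw Q X (insw p w) = \<zero>\<^bsub>Q\<^esub>" if "w \<in> set f" for w
    using FS_mem[OF assms(4) that]
  proof (rule tuples_Suc_snoc)
    fix as c assume w: "w = as @ [c]" "as \<in> tuples n" "c \<in> carrier A"
    have "ev (insw p as) X = \<zero>\<^bsub>Q\<^esub>"
      using w assms insw_tuples[OF w(2) assms(2)]
      by (intro DR_vanish[OF cat_module[OF Q(1)] Q(2) _ assms(1)] insw_nth) (auto simp: tuples_def)
    then show ?thesis using w assms(2) by (simp add: insw_append tuples_def)
  qed
  have "lsum Q (\<lambda>w. evw Q X (insw p w)) f = lsum Q (\<lambda>w. \<zero>\<^bsub>Q\<^esub>) f"
    using z by (intro lsum_cong) auto
  then show "evs Q X (map (insw p) f) = evs Q X []" by (simp add: evs_def lsum_map)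
qed

text \<open>The second appended one turns the first into the last argument, and this position is
  subject to the vanishing condition.\<close>

lemma dw_zero:
  assumes "r \<le> Suc n" "length s = Suc (Suc n)" "f \<in> FS n"
  shows "eqv r s (dw (dw f)) []"
proof -
  have "dw (dw f) = map (insw (Suc n)) (dw f)" using insw_eq_dw[OF assms(3)] dw_insw[of "Suc n" n f] assms(3) by simp
  then show ?thesis using insw_zero[of r "Suc n" "Suc n" s "dw f"] assms by simp
qed

text \<open>Insertion is well defined on the quotients because \<open>ins\<close> takes tests of the
  split type to tests of the merged type.\<close>

lemma eqv_insw:
  assumes "eqv (Suc r) (u @ (k + l) # s) f g" "length u = r"
    "f \<in> FS (Suc (r + length s))" "g \<in> FS (Suc (r + length s))"
  shows "eqv (Suc (Suc r)) (u @ k # l # s) (map (insw (Suc r)) f) (map (insw (Suc r)) g)"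
  unfolding eqv_def
proof (intro ballI)
  fix Q X assume Q: "Q \<in> \<DD>" "X \<in> DR (Suc (Suc r)) (u @ k # l # s) Q"
  have "ins (Suc r) X \<in> DR (Suc r) (u @ (k + l) # s) Q"
    by (rule ins_DR[OF cat_module[OF Q(1)] cat_good[OF Q(1)] Q(2) assms(2)])
  then have "evs Q (ins (Suc r) X) f = evs Q (ins (Suc r) X) g" using assms(1) Q(1) by (simp add: eqv_def)
  then show "evs Q X (map (insw (Suc r)) f) = evs Q X (map (insw (Suc r)) g)"
    using evs_insw[of "Suc r" "u @ k # s" f Q X] evs_insw[of "Suc r" "u @ k # s" g Q X] assms by simp
qed

text \<open>Injectivity on the left of the exact sequences, dual to \<open>ins_surj\<close>: every
  test of the merged type comes from one of the split type.\<close>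

lemma eqv_insw_cancel:
  assumes "eqv (Suc (Suc r)) (u @ k # l # s) (map (insw (Suc r)) f) (map (insw (Suc r)) g)" "length u = r"
    "f \<in> FS (Suc (r + length s))" "g \<in> FS (Suc (r + length s))" "pos_seq s" "0 < l"
  shows "eqv (Suc r) (u @ (k + l) # s) f g"
  unfolding eqv_def
proof (intro ballI)
  fix Q X assume Q: "Q \<in> \<DD>" "X \<in> DR (Suc r) (u @ (k + l) # s) Q"
  obtain Y where Y: "Y \<in> DR (Suc (Suc r)) (u @ k # l # s) Q" "ins (Suc r) Y = X"
    using ins_surj[OF cat_module[OF Q(1)] cat_good[OF Q(1)] assms(5,6) Q(2) assms(2)] by blast
  have "evs Q Y (map (insw (Suc r)) f) = evs Q Y (map (insw (Suc r)) g)" using assms(1) Q(1) Y(1) by (simp add: eqv_def)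
  then show "evs Q X f = evs Q X g"
    using evs_insw[of "Suc r" "u @ k # s" f Q Y] evs_insw[of "Suc r" "u @ k # s" g Q Y] assms Y(2) by simp
qed

lemma eqv_insw_0:
  assumes "eqv 0 s f g" "f \<in> FS (length s)" "g \<in> FS (length s)"
  shows "eqv (Suc 0) (k # s) (map (insw 0) f) (map (insw 0) g)"
  unfolding eqv_def
proof (intro ballI)
  fix Q X assume Q: "Q \<in> \<DD>" "X \<in> DR (Suc 0) (k # s) Q"
  have "evs Q (ins 0 X) f = evs Q (ins 0 X) g" using assms(1) Q(1) ins_DR_0[OF Q(2)] by (simp add: eqv_def)
  then show "evs Q X (map (insw 0) f) = evs Q X (map (insw 0) g)"
    using evs_insw[of 0 s f Q X] evs_insw[of 0 s g Q X] assms by simp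
qed

lemma eqv_insw_cancel_0:
  assumes "eqv (Suc 0) (k # s) (map (insw 0) f) (map (insw 0) g)"
    "f \<in> FS (length s)" "g \<in> FS (length s)" "pos_seq s" "0 < k"
  shows "eqv 0 s f g"
  unfolding eqv_def
proof (intro ballI)
  fix Q X assume Q: "Q \<in> \<DD>" "X \<in> DR 0 s Q"
  obtain Y where Y: "Y \<in> DR (Suc 0) (k # s) Q" "ins 0 Y = X"
    using ins_surj_0[OF cat_module[OF Q(1)] cat_good[OF Q(1)] assms(4,5) Q(2)] by blast
  have "evs Q Y (map (insw 0) f) = evs Q Y (map (insw 0) g)" by (rule eqvD[OF assms(1) Q(1) Y(1)])
  then show "evs Q X f = evs Q X g"
    using evs_insw[of 0 s f Q Y] evs_insw[of 0 s g Q Y] assms Y(2) by simp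
qed

lemma evs_mulw:
  assumes "Suc p < n" "f \<in> FS n"
  shows "evs Q X (map (mulw p) f) = evs Q (dup p X) f"
proof (rule evs_map_cong)
  fix w assume "w \<in> set f"
  then have "w \<in> tuples (Suc n)" using assms(2) by (rule FS_mem[rotated])
  then show "evw Q X (mulw p w) = evw Q (dup p X) w"
    by (rule tuples_Suc_snoc) (use assms(1) in \<open>simp add: mulw_append tuples_def ev_dup[where n = n]\<close>)
qed

text \<open>Multiplication of neighbours is well defined for every order \<open>k\<close> of the
  first one, since \<open>dup\<close> produces tests with an arbitrary \<open>k\<close>.\<close>

lemma eqv_mulw:
  assumes "eqv (Suc (Suc r)) (u @ k # l # s) f g" "length u = r"
    "f \<in> FS (Suc (Suc (r + length s)))" "g \<in> FS (Suc (Suc (r + length s)))"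
  shows "eqv (Suc r) (u @ l # s) (map (mulw r) f) (map (mulw r) g)"
  unfolding eqv_def
proof (intro ballI)
  fix Q X assume Q: "Q \<in> \<DD>" "X \<in> DR (Suc r) (u @ l # s) Q"
  have "dup r X \<in> DR (Suc (Suc r)) (u @ k # l # s) Q"
    by (rule dup_DR[OF cat_module[OF Q(1)] Q(2) assms(2)])
  then have "evs Q (dup r X) f = evs Q (dup r X) g" using assms(1) Q(1) by (simp add: eqv_def)
  then show "evs Q X (map (mulw r) f) = evs Q X (map (mulw r) g)"
    using evs_mulw[OF _ assms(3), of r Q X] evs_mulw[OF _ assms(4), of r Q X] by simp
qed

lemma evs_push:
  assumes "module A Q" "X \<in> carrier (Wm s Q)" "f \<in> FS (length s)"
  shows "evs Q (push Q (length s) X) (dw f) = evs Q X f"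
  unfolding dw_def
proof (rule evs_map_cong)
  interpret Q: module A Q by fact
  fix w assume "w \<in> set f"
  then have "w \<in> tuples (Suc (length s))" using assms(3) by (rule FS_mem[rotated])
  then show "evw Q (push Q (length s) X) (w @ [\<one>]) = evw Q X w"
    by (rule tuples_Suc_snoc) (use ev_carrier[OF assms(1,2)] in \<open>simp add: evw_def butlast_append ev_push\<close>)
qed

text \<open>Where the new last entry is free, every test extends by a linear last entry, and the
  differential is injective.\<close>

lemma eqv_dw_cancel:
  assumes "eqv r (s @ [k]) (dw f) (dw g)" "length s < r" "f \<in> FS (length s)" "g \<in> FS (length s)"
  shows "eqv r s f g"
  unfolding eqv_def
proof (intro ballI)
  fix Q X assume Q: "Q \<in> \<DD>" "X \<in> DR r s Q"
  have "push Q (length s) X \<in> DR r (s @ [k]) Q" by (rule push_DR[OF cat_module[OF Q(1)] Q(2) assms(2)])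
  from eqvD[OF assms(1) Q(1) this] show "evs Q X f = evs Q X g"
    using evs_push[OF cat_module[OF Q(1)] DR_carrier[OF Q]] assms(3,4) by simp
qed

lemma evs_iter_split:
  assumes Q: "module A Q" "module A (Diffp K A k (regular_module A) Q)" "X \<in> DR r (s @ [k]) Q" "f \<in> FS (length s)"
    and b: "b \<in> carrier A"
  shows "evs (Diffp K A k (regular_module A) Q) (iter_split A (length s) X) f b =
    lsum Q (\<lambda>w. ev (butlast w @ [last w \<otimes> b]) X) f"
proof -
  let ?P = "Diffp K A k (regular_module A) Q"
  have oP: "x \<oplus>\<^bsub>?P\<^esub> y = (\<lambda>p\<in>carrier A. x p \<oplus>\<^bsub>Q\<^esub> y p)" "a \<odot>\<^bsub>?P\<^esub> x = (\<lambda>p\<in>carrier A. x (a \<otimes> p))"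
    "\<zero>\<^bsub>?P\<^esub> = (\<lambda>p\<in>carrier A. \<zero>\<^bsub>Q\<^esub>)" for x y a
    by (simp_all add: Diff_plus_def map_module_def)
  have l: "lsum ?P h f b = lsum Q (\<lambda>w. h w b) f" for h
    using b by (induction f) (simp_all add: oP)
  have e: "evw ?P (iter_split A (length s) X) w b = ev (butlast w @ [last w \<otimes> b]) X"
    if "w \<in> tuples (Suc (length s))" for w
    using that by (rule tuples_Suc_snoc) (use b in \<open>simp add: ev_iter_split oP\<close>)
  show ?thesis unfolding evs_def l using FS_mem[OF assms(4)] by (intro lsum_cong e) auto
qed

lemma evs_dw:
  assumes "module A Q" "X \<in> carrier (Wm (s @ [k]) Q)" "f \<in> FS (length s)"
  shows "evs Q X (dw f) = lsum Q (\<lambda>w. ev w X) f"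
proof -
  interpret Q: module A Q by fact
  show ?thesis
    unfolding evs_def dw_def lsum_map
    using FS_mem[OF assms(3)] ev_carrier[OF assms(1,2)] by (intro lsum_cong) (auto simp: Q.smult_one)
qed

text \<open>That the differential descends to the quotients is naturality in the target module: a family
  in \<open>Q\<close> of type \<open>s @ [k]\<close> is one of type \<open>s\<close> in the module of operators of order
  \<open>\<le> k\<close> with values in \<open>Q\<close>.\<close>

lemma eqv_dw:
  assumes "eqv r s f g" "f \<in> FS (length s)" "g \<in> FS (length s)"
  shows "eqv r (s @ [k]) (dw f) (dw g)"
  unfolding eqv_def
proof (intro ballI)
  fix Q X assume Q: "Q \<in> \<DD>" "X \<in> DR r (s @ [k]) Q"
  let ?P = "Diffp K A k (regular_module A) Q"
  obtain Y h where Y: "Y \<in> \<DD>" "module A ?P" "module A Y" "linear_on ?P Y (carrier ?P) h" "bij_betw h (carrier ?P) (carrier Y)"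
    using in_cat_Diffp[OF Q(1)] by (rule in_catE)
  interpret P: module A ?P by fact
  have hc: "h ` carrier ?P \<subseteq> carrier Y" using Y(5) by (simp add: bij_betw_def)
  note mQ = cat_module[OF Q(1)]
  have X1: "iter_split A (length s) X \<in> DR r s ?P" by (rule iter_split_DR(2)[OF mQ Y(2) Q(2)])
  then have X1c: "iter_split A (length s) X \<in> carrier (Wm s ?P)" using DR_subset[OF Y(2)] by blast
  have sg: "subgrp ?P (carrier ?P)" by (auto simp: subgrp_def)
  have X2: "iter_map A h (iter_split A (length s) X) \<in> DR r s Y"
    by (rule iter_map_DR[OF Y(2,3) sg P.smult_closed Y(4) hc X1 ev_carrier[OF Y(2) X1c]])
  have e: "h (evs ?P (iter_split A (length s) X) f) = evs Y (iter_map A h (iter_split A (length s) X)) f"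
    if "f \<in> FS (length s)" for f
    using evs_hom(1)[OF _ Y(3,2) X1c that Y(4) hc ev_carrier[OF Y(2) X1c]] Y(2) by simp
  have "h (evs ?P (iter_split A (length s) X) f) = h (evs ?P (iter_split A (length s) X) g)"
    using assms X2 Y(1) e by (simp add: eqv_def)
  then have "evs ?P (iter_split A (length s) X) f = evs ?P (iter_split A (length s) X) g"
    using Y(5) evs_carrier[OF Y(2) X1c] assms(2,3) by (auto simp: bij_betw_def inj_on_def)
  then have "lsum Q (\<lambda>w. ev (butlast w @ [last w \<otimes> \<one>]) X) f = lsum Q (\<lambda>w. ev (butlast w @ [last w \<otimes> \<one>]) X) g"
    unfolding evs_iter_split[OF mQ Y(2) Q(2) assms(2) R.one_closed, symmetric]
      evs_iter_split[OF mQ Y(2) Q(2) assms(3) R.one_closed, symmetric] by simp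
  moreover have "butlast w @ [last w \<otimes> \<one>] = w" if "w \<in> tuples (Suc (length s))" for w
    using that by (rule tuples_Suc_snoc) simp
  then have "lsum Q (\<lambda>w. ev (butlast w @ [last w \<otimes> \<one>]) X) f = evs Q X (dw f)" if "f \<in> FS (length s)" for f
    unfolding evs_dw[OF mQ DR_carrier[OF Q] that] using FS_mem[OF that] by (intro lsum_cong) auto
  ultimately show "evs Q X (dw f) = evs Q X (dw g)" using assms(2,3) by simp
qed

text \<open>The family of all tests \<open>(Q, X)\<close> is a single iterated operator with values in the product of
  the modules \<open>Q\<close>.  Its values lie in a submodule of finite type, which belongs to \<open>\<DD>\<close>, hence so
  does the quotient of this submodule by the sums with \<open>\<one>\<close> inserted.  Modulo these sums
  the family vanishes when the entry at position \<open>r\<close> is \<open>\<one>\<close>, so that it is a test for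
  \<open>DR r s\<close>.\<close>

lemma eqv_middle:
  assumes "eqv r s f []" "f \<in> FS (Suc n)" "length s = Suc n" "r \<le> n"
  shows "\<exists>g\<in>FS n. eqv (Suc r) s f (map (insw r) g)"
proof -
  define T where "T = {(Q, X). Q \<in> \<DD> \<and> X \<in> DR (Suc r) s Q}"
  define U where "U = prod_module T fst"
  have Tm: "module A (fst t)" "good (fst t)" "snd t \<in> DR (Suc r) s (fst t)" if "t \<in> T" for t
    using that cat_module cat_good by (auto simp: T_def)
  have U: "module A U" "good U"
    unfolding U_def using Tm good_prod_module prod_module_module[OF R.is_cring] by blast+
  interpret U: module A U by fact
  define X where "X = join T (length s) snd"
  have X: "X \<in> DR (Suc r) s U" unfolding X_def U_def by (rule join_DR[OF Tm(1,3)])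
  then have Xc: "X \<in> carrier (Wm s U)" using DR_subset[OF U(1)] by blast
  have eX: "evs U X h t = evs (fst t) (snd t) h" if "t \<in> T" "h \<in> FS (Suc n)" for t h
  proof -
    have "evw U X w t = evw (fst t) (snd t) w" if "w \<in> tuples (Suc (Suc n))" for w
      using that by (rule tuples_Suc_snoc) (use \<open>t \<in> T\<close> assms(3) in \<open>simp add: U_def X_def ev_join del: join.simps\<close>)
    then show ?thesis
      unfolding evs_def using FS_mem[OF that(2)] that(1) by (auto simp: U_def lsum_prod_module intro!: lsum_cong)
  qed
  obtain ys where ys: "set ys \<subseteq> carrier U" "\<And>as. as \<in> tuples (length s) \<Longrightarrow> ev as X \<in> fg U ys"
    using ev_fg[OF U(2,1) Xc] by blast
  let ?V = "U\<lparr>carrier := fg U ys\<rparr>"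
  have subV: "sub U (fg U ys)" using sub_fg[OF U(1) ys(1)] .
  note V = subD[OF subV]
  interpret V: module A ?V using V(6)[OF U(1)] .
  have cV: "in_cat A \<DD> ?V" by (rule in_cat_fg[OF U(1) ys(1)])
  have evV: "evs U X h \<in> fg U ys" if "h \<in> FS (Suc n)" for h
    using evs_hom(2)[OF V(6)[OF U(1)] U(1) U(1) Xc, of h "\<lambda>x. x"] that assms(3) V(1) ys(2) by (auto simp: linear_on_def)
  let ?S = "(\<lambda>g. evs U X (map (insw r) g)) ` FS n"
  have r: "r \<le> Suc n" using assms(4) by simp
  have "sub ?V ?S"
  proof (rule subI[OF V(6)[OF U(1)]])
    show "?S \<subseteq> carrier ?V" using evV FS_insw[OF r] by auto
    show "\<zero>\<^bsub>?V\<^esub> \<in> ?S" by (intro image_eqI[of _ _ "[]"]) simp_all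
    fix x y assume "x \<in> ?S" "y \<in> ?S"
    then obtain g h where gh: "g \<in> FS n" "h \<in> FS n" "x = evs U X (map (insw r) g)" "y = evs U X (map (insw r) h)" by blast
    then have "x \<oplus>\<^bsub>?V\<^esub> y = evs U X (map (insw r) (g @ h))"
      using evs_append[OF U(1) Xc, of "map (insw r) g" "map (insw r) h"] FS_insw[OF r] assms(3) by simp
    then show "x \<oplus>\<^bsub>?V\<^esub> y \<in> ?S" using gh FS_append by (intro image_eqI[of _ _ "g @ h"]) simp_all
  next
    fix a x assume a: "a \<in> carrier A" "x \<in> ?S"
    then obtain g where g: "g \<in> FS n" "x = evs U X (map (insw r) g)" by blast
    then have "a \<odot>\<^bsub>?V\<^esub> x = evs U X (map (insw r) (scal a g))"
      using evs_scal[OF U(1) Xc, of "map (insw r) g" a] FS_insw[OF r] assms(3,4) a scal_insw[of r n g a] by simp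
    then show "a \<odot>\<^bsub>?V\<^esub> x \<in> ?S" using g a by (intro image_eqI[of _ _ "scal a g"]) simp_all
  qed
  then obtain Z p where Z: "Z \<in> \<DD>" "linear_on ?V Z (fg U ys) p" "p ` fg U ys = carrier Z"
    "\<And>y. y \<in> fg U ys \<Longrightarrow> p y = \<zero>\<^bsub>Z\<^esub> \<longleftrightarrow> y \<in> ?S"
    by (rule in_cat_quot[OF cV]) auto
  have lin: "linear_on U Z (fg U ys) p" using Z(2) by (simp add: linear_on_def)
  note mZ = cat_module[OF Z(1)]
  interpret Z: module A Z by fact
  have pe: "evs Z (iter_map A p X) h = p (evs U X h)" if "h \<in> FS (Suc n)" for h
    using evs_hom(1)[OF V(6)[OF U(1)] mZ U(1) Xc _ lin _ ys(2)] Z(3) that assms(3) by auto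
  have sg: "subgrp U (fg U ys)" using subV by (simp add: sub_def)
  have Y1: "iter_map A p X \<in> DR (Suc r) s Z"
    by (rule iter_map_DR[OF U(1) mZ sg V(4) lin _ X ys(2)]) (use Z(3) in auto)
  have "iter_map A p X \<in> DR r s Z"
  proof (rule DR_vanishI[OF mZ Y1])
    show "r < length s" using assms(3,4) by simp
    fix as assume as: "as \<in> tuples (length s)" "as ! r = \<one>"
    \<comment> \<open>\<open>as\<close> with its entry one removed; inserting it again and taking
      the coefficient one expresses the value at \<open>as\<close> by an element of
      \<open>?S\<close>, which \<open>p\<close> kills.\<close>
    define bs where "bs = take r as @ drop (Suc r) as"
    have las: "length as = Suc n" using as assms(3) by (simp add: tuples_def)
    have "insw (length u) (u @ v) = u @ \<one> # v" for u v by (induction u) simp_all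
    from this[of "take r as" "drop (Suc r) as"] have ib: "insw r bs = as"
      using as(2) las assms(4) id_take_nth_drop[of r as] by (simp add: bs_def)
    have bs: "bs @ [\<one>] \<in> tuples (Suc n)"
      using as las assms(4) by (auto simp: bs_def tuples_def dest: in_set_takeD in_set_dropD)
    have "ev as (iter_map A p X) = evs Z (iter_map A p X) (map (insw r) [bs @ [\<one>]])"
    proof -
      have "insw r (bs @ [\<one>]) = as @ [\<one>]" using ib insw_append[of r bs "[\<one>]"] bs assms(4) by (simp add: tuples_def)
      moreover have "ev as (iter_map A p X) \<in> carrier Z" using ev_carrier[OF mZ _ as(1)] DR_subset[OF mZ] Y1 by blast
      ultimately show ?thesis by simp
    qed
    also have "\<dots> = p (evs U X (map (insw r) [bs @ [\<one>]]))" using FS_insw[OF r, of "[bs @ [\<one>]]"] bs by (intro pe) simp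
    also have "\<dots> = \<zero>\<^bsub>Z\<^esub>"
      using Z(4) evV[OF FS_insw[OF r, of "[bs @ [\<one>]]"]] bs by (simp del: list.map)
    finally show "ev as (iter_map A p X) = \<zero>\<^bsub>Z\<^esub>" .
  qed
  then have "evs Z (iter_map A p X) f = \<zero>\<^bsub>Z\<^esub>" using assms(1) Z(1) by (simp add: eqv_def)
  then have "evs U X f \<in> ?S" using pe[OF assms(2)] Z(4)[OF evV[OF assms(2)]] by simp
  then obtain g where g: "g \<in> FS n" "evs U X f = evs U X (map (insw r) g)" by blast
  have "evs Q Y f = evs Q Y (map (insw r) g)" if "Q \<in> \<DD>" "Y \<in> DR (Suc r) s Q" for Q Y
    using eX[of "(Q, Y)" f] eX[of "(Q, Y)" "map (insw r) g"] assms(2) FS_insw[OF r g(1)] that g(2) by (simp add: T_def)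
  then show ?thesis using g(1) by (auto simp: eqv_def)
qed

end

section \<open>Acyclicity and comparison\<close>

context diff_cat
begin

text \<open>The complexes for \<open>r \<ge> 1\<close> start in degree \<open>r - 1\<close>, so that only 0 is a boundary there.\<close>

definition bnd :: "nat \<Rightarrow> nat \<Rightarrow> 'u list list set" where
  "bnd r n = (if n < max r 1 then {[]} else dw ` FS (n - 1))"

lemma bnd_FS: "g \<in> bnd r n \<Longrightarrow> g \<in> FS n"
  using FS_dw[of _ "n - 1"] by (cases n) (auto simp: bnd_def split: if_splits)

text \<open>Two sums \<open>f\<close> and \<open>h\<close> appear in place of a difference, as sums
  of words have no subtraction. The last order in \<open>s\<close> belongs to the target of the
  differential, hence \<open>butlast\<close>.\<close>

definition acyclic_at :: "nat \<Rightarrow> nat \<Rightarrow> bool" where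
  "acyclic_at r n \<longleftrightarrow> (\<forall>s f h. length s = Suc n \<longrightarrow> pos_seq s \<longrightarrow> f \<in> FS n \<longrightarrow> h \<in> FS n \<longrightarrow>
     eqv r s (dw f) (dw h) \<longrightarrow> (\<exists>g\<in>bnd r n. eqv r (butlast s) f (g @ h)))"

lemma acyclic_atD:
  "\<lbrakk>acyclic_at r n; length s = Suc n; pos_seq s; f \<in> FS n; h \<in> FS n; eqv r s (dw f) (dw h)\<rbrakk> \<Longrightarrow>
     \<exists>g\<in>bnd r n. eqv r (butlast s) f (g @ h)"
  unfolding acyclic_at_def by blast

lemma eqv_diff:
  assumes "f \<in> FS (length s)" "h \<in> FS (length s)"
  shows "eqv r s f h \<Longrightarrow> eqv r s (f @ neg h) []"
    "eqv r s (f @ neg h) g \<Longrightarrow> g \<in> FS (length s) \<Longrightarrow> eqv r s f (g @ h)"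
proof -
  have nh: "neg h \<in> FS (length s)" using assms by simp
  show "eqv r s (f @ neg h) []" if "eqv r s f h"
  proof -
    have "eqv r s (f @ neg h) (h @ neg h)" using that assms nh by (intro eqv_append) simp_all
    also have "eqv r s (h @ neg h) (neg h @ h)" by (rule eqv_commute[OF assms(2) nh])
    also note eqv_neg[OF assms(2)]
    finally show ?thesis .
  qed
  show "eqv r s f (g @ h)" if g: "eqv r s (f @ neg h) g" "g \<in> FS (length s)"
  proof -
    have "eqv r s (f @ (neg h @ h)) (f @ [])" using assms nh eqv_neg by (intro eqv_append) simp_all
    then have "eqv r s f ((f @ neg h) @ h)" using eqv_sym by simp
    also have "eqv r s \<dots> (g @ h)" using g assms nh by (intro eqv_append) simp_all
    finally show ?thesis .
  qed
qed

lemma acyclic_atI: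
  assumes "\<And>s f. length s = Suc n \<Longrightarrow> pos_seq s \<Longrightarrow> f \<in> FS n \<Longrightarrow> eqv r s (dw f) [] \<Longrightarrow>
    \<exists>g\<in>bnd r n. eqv r (butlast s) f g"
  shows "acyclic_at r n"
  unfolding acyclic_at_def
proof (intro allI impI)
  fix s :: "nat list" and f h
  assume s: "length s = Suc n" "pos_seq s" and fh: "f \<in> FS n" "h \<in> FS n" and e: "eqv r s (dw f) (dw h)"
  define t where "t = butlast s"
  have t: "length t = n" "s = t @ [last s]" using s(1) by (cases s rule: rev_cases; simp add: t_def)+
  have nh: "neg h \<in> FS n" using fh by simp
  have "eqv r (t @ [last s]) (dw (neg h @ h)) (dw [])"
    using eqv_neg[of h t r] t(1) fh nh by (intro eqv_dw) simp_all
  then have n0: "eqv r s (dw (neg h) @ dw h) []" using t(2) by simp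
  have "eqv r s (dw f @ dw (neg h)) (dw h @ dw (neg h))"
    using e fh nh s(1) by (intro eqv_append) simp_all
  also have "eqv r s \<dots> (dw (neg h) @ dw h)" using fh nh s(1) by (intro eqv_commute) simp_all
  also note n0
  finally have "eqv r s (dw (f @ neg h)) []" by simp
  then obtain g where g: "g \<in> bnd r n" "eqv r t (f @ neg h) g"
    using assms[OF s, of "f @ neg h"] fh nh by (auto simp: t_def)
  then show "\<exists>g\<in>bnd r n. eqv r (butlast s) f (g @ h)"
    using eqv_diff(2)[of f t h r g] fh t(1) bnd_FS by (auto simp: t_def)
qed

text \<open>The start of the descending induction: n is the lowest degree of the complex and all
  entries are free, so the differential is injective there.\<close>

lemma acyclic_top: "acyclic_at (Suc n) n"
proof (rule acyclic_atI)
  fix s :: "nat list" and f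
  assume s: "length s = Suc n" "f \<in> FS n" "eqv (Suc n) s (dw f) []"
  have "s = butlast s @ [last s]" using s(1) by (cases s rule: rev_cases) auto
  then have "eqv (Suc n) (butlast s @ [last s]) (dw f) (dw [])" using s(3) by simp
  then have "eqv (Suc n) (butlast s) f []" by (rule eqv_dw_cancel) (use s in simp_all)
  then show "\<exists>g\<in>bnd (Suc n) n. eqv (Suc n) (butlast s) f g" by (auto simp: bnd_def)
qed

text \<open>\<open>\<beta>\<close> represents the image of \<open>f\<close> under the connecting
  map. If it is the boundary of \<open>\<gamma>\<close>, then \<open>f\<close> and the insertion of
  \<open>\<gamma>\<close> have the same differential in C(q + 2, ..), so they differ by a boundary
  there. On passing back to C(q + 1, ..) the insertion disappears.\<close>

lemma exact_of_connecting:
  assumes ac: "acyclic_at (Suc (Suc q)) n" and len: "length \<kappa> = q" "n = Suc (q + length \<rho>)"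
    and pos: "pos_seq (\<kappa> @ k # l # \<rho>)" and FS: "f \<in> FS n" "\<beta> \<in> FS n" "\<gamma> \<in> FS (n - 1)"
    and f: "eqv (Suc (Suc q)) (\<kappa> @ k # l # \<rho>) (dw f) (map (insw (Suc q)) \<beta>)"
    and \<beta>: "eqv (Suc q) (\<kappa> @ (k + l) # \<rho>) \<beta> (dw \<gamma>)"
  shows "\<exists>g\<in>FS (n - 1). eqv (Suc q) (butlast (\<kappa> @ k # l # \<rho>)) f (dw g)"
proof -
  let ?s = "\<kappa> @ k # l # \<rho>" and ?\<gamma> = "map (insw (Suc q)) \<gamma>"
  have \<gamma>: "?\<gamma> \<in> FS n" using FS_insw[of "Suc q" "n - 1" \<gamma>] FS(3) len by simp
  note f
  also have "eqv (Suc (Suc q)) ?s (map (insw (Suc q)) \<beta>) (map (insw (Suc q)) (dw \<gamma>))"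
    using len FS FS_dw[OF FS(3)] by (intro eqv_insw \<beta>) simp_all
  also have "map (insw (Suc q)) (dw \<gamma>) = dw ?\<gamma>" using dw_insw[of "Suc q" "n - 1" \<gamma>] FS(3) len by simp
  finally have e: "eqv (Suc (Suc q)) ?s (dw f) (dw ?\<gamma>)" .
  have "length ?s = Suc n" using len by simp
  from acyclic_atD[OF ac this pos FS(1) \<gamma> e]
  obtain g where g: "g \<in> bnd (Suc (Suc q)) n" "eqv (Suc (Suc q)) (butlast ?s) f (g @ ?\<gamma>)" by blast
  from g(2) have g': "eqv (Suc q) (butlast ?s) f (g @ ?\<gamma>)" by (rule eqv_Suc)
  show ?thesis
  \<comment> \<open>For \<open>\<rho> = []\<close> the degree is the lowest one of C(q + 2, ..),
    where only zero is a boundary, and the insertion of \<open>\<gamma>\<close> at the end is its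
    differential.\<close>
  proof (cases "\<rho> = []")
    case True
    then have "g = []" "?\<gamma> = dw \<gamma>" using g(1) len insw_eq_dw[of \<gamma> q] FS(3) by (simp_all add: bnd_def)
    then show ?thesis using g' FS(3) by auto
  next
    case False
    then have "length \<rho> > 0" by simp
    then obtain g0 where g0: "g = dw g0" "g0 \<in> FS (n - 1)" using g(1) len by (auto simp: bnd_def split: if_splits)
    have "eqv (Suc q) (butlast ?s) ?\<gamma> []" using FS(3) len \<open>length \<rho> > 0\<close> by (intro insw_zero[of _ _ "n - 1"]) (auto simp: Suc_le_eq)
    then have "eqv (Suc q) (butlast ?s) (g @ ?\<gamma>) (g @ [])"
      using bnd_FS[OF g(1)] \<gamma> len by (intro eqv_append) auto
    with g' have "eqv (Suc q) (butlast ?s) f (dw g0)" using eqv_trans g0(1) by simp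
    then show ?thesis using g0(2) by blast
  qed
qed

lemma connecting:
  assumes "length s = Suc n" "Suc q \<le> n" "f \<in> FS n" "eqv (Suc q) s (dw f) []"
  obtains \<beta> where "\<beta> \<in> FS n" "eqv (Suc (Suc q)) s (dw f) (map (insw (Suc q)) \<beta>)"
  using eqv_middle[of "Suc q" s "dw f" n] assms by auto

text \<open>A cocycle condition involves one entry more than the degree. Merging two entries removes
  one, so a new last entry has to be supplied, of any positive order \<open>x\<close>.\<close>

lemma connecting_cocycle:
  assumes "length \<kappa> = q" "n = Suc (q + length \<rho>)" "pos_seq (\<kappa> @ k # l # \<rho> @ [x])" "f \<in> FS n" "\<beta> \<in> FS n"
    and f: "eqv (Suc (Suc q)) (\<kappa> @ k # l # \<rho>) (dw f) (map (insw (Suc q)) \<beta>)"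
  shows "eqv (Suc q) (\<kappa> @ (k + l) # \<rho> @ [x]) (dw \<beta>) []"
proof (rule eqv_insw_cancel)
  have \<beta>: "map (insw (Suc q)) (dw \<beta>) = dw (map (insw (Suc q)) \<beta>)"
    using dw_insw[of "Suc q" n \<beta>] assms by simp
  have "eqv (Suc (Suc q)) ((\<kappa> @ k # l # \<rho>) @ [x]) (dw (map (insw (Suc q)) \<beta>)) (dw (dw f))"
    using assms FS_insw[of "Suc q" n \<beta>] by (intro eqv_dw eqv_sym[OF f]) simp_all
  also have "eqv (Suc (Suc q)) ((\<kappa> @ k # l # \<rho>) @ [x]) (dw (dw f)) []"
    using assms by (intro dw_zero[of _ n]) simp_all
  finally show "eqv (Suc (Suc q)) (\<kappa> @ k # l # \<rho> @ [x]) (map (insw (Suc q)) (dw \<beta>)) (map (insw (Suc q)) [])"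
    using \<beta> by simp
qed (use assms in auto)

text \<open>Multiplying two neighbouring entries is a homotopy: it splits the insertion of \<open>\<one>\<close>, which
  makes the restriction from \<open>L \<ge> k + l\<close> to \<open>l\<close> zero on cohomology.\<close>

lemma exact_of_larger:
  assumes ac: "acyclic_at (Suc (Suc q)) n" and len: "length \<kappa> = q" "n = Suc (q + length \<rho>)"
    and pos: "pos_seq (\<kappa> @ k # l # \<rho>)" and f: "f \<in> FS n" "eqv (Suc q) (\<kappa> @ k # (k + l) # \<rho>) (dw f) []"
  shows "\<exists>g\<in>FS (n - 1). eqv (Suc q) (butlast (\<kappa> @ k # l # \<rho>)) f (dw g)"
proof -
  obtain \<beta> where \<beta>: "\<beta> \<in> FS n" "eqv (Suc (Suc q)) (\<kappa> @ k # (k + l) # \<rho>) (dw f) (map (insw (Suc q)) \<beta>)"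
    using connecting[of "\<kappa> @ k # (k + l) # \<rho>" n q f] f len by auto
  have "FS n = FS (Suc (n - 1))" using len by simp
  then have \<gamma>: "map (mulw q) f \<in> FS (n - 1)" using FS_mulw[of q "n - 1" f] f(1) len by simp
  have "eqv (Suc q) (\<kappa> @ (k + l) # \<rho>) (map (mulw q) (map (insw (Suc q)) \<beta>)) (map (mulw q) (dw f))"
    using len f(1) \<beta>(1) FS_insw[of "Suc q" n \<beta>] by (intro eqv_mulw[OF eqv_sym[OF \<beta>(2)]]) (simp_all del: map_map)
  moreover have "map (mulw q) (map (insw (Suc q)) \<beta>) = \<beta>" by (rule mulw_insw_FS[OF _ \<beta>(1)]) (use len in simp)
  moreover have "map (mulw q) (dw f) = dw (map (mulw q) f)" by (rule dw_mulw[OF _ f(1)]) (use len in simp)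
  ultimately have "eqv (Suc q) (\<kappa> @ (k + l) # \<rho>) \<beta> (dw (map (mulw q) f))" by simp
  moreover have "eqv (Suc (Suc q)) (\<kappa> @ k # l # \<rho>) (dw f) (map (insw (Suc q)) \<beta>)"
    using \<beta>(2) by (rule eqv_mono) (simp add: list_all2_append list.rel_refl)
  ultimately show ?thesis by (intro exact_of_connecting[OF ac len pos f(1) \<beta>(1) \<gamma>])
qed

text \<open>Induction on the number of entries between the merged one and those which may be enlarged: the
  connecting map merges two entries and shortens \<open>t\<close> by one, at the price of a new entry at
  the end.\<close>

lemma pro_zero:
  fixes \<kappa> t us :: "nat list"
  assumes ac: "acyclic_at (Suc (Suc q)) n" and \<kappa>: "length \<kappa> = q" "Suc q \<le> n"
  shows "length t = j \<Longrightarrow> n = q + j + length us \<Longrightarrow> pos_seq (\<kappa> @ k # t @ us) \<Longrightarrow>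
    \<exists>us'. list_all2 (\<le>) us us' \<and> (\<forall>f\<in>FS n. eqv (Suc q) (\<kappa> @ k # t @ us') (dw f) [] \<longrightarrow>
      (\<exists>g\<in>FS (n - 1). eqv (Suc q) (butlast (\<kappa> @ k # t @ us)) f (dw g)))"
proof (induction j arbitrary: k t us)
  case 0
  then obtain l \<rho> where us: "us = l # \<rho>" "t = []" using \<kappa>(2) by (cases us) auto
  have "list_all2 (\<le>) us ((k + l) # \<rho>)" using us by (simp add: list.rel_refl)
  moreover have "\<exists>g\<in>FS (n - 1). eqv (Suc q) (butlast (\<kappa> @ k # t @ us)) f (dw g)"
    if "f \<in> FS n" "eqv (Suc q) (\<kappa> @ k # t @ (k + l) # \<rho>) (dw f) []" for f
    using exact_of_larger[OF ac \<kappa>(1), of \<rho> k l f] 0 us that by simp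
  ultimately show ?case by blast
next
  case (Suc j)
  then obtain l t' where t: "t = l # t'" "length t' = j" by (cases t) auto
  \<comment> \<open>The induction hypothesis may enlarge the appended entry too. Its enlarged value
    \<open>x\<close> is then the last entry in the cocycle condition for
    \<open>\<beta>\<close>.\<close>
  obtain ys where ys: "list_all2 (\<le>) (us @ [1]) ys" "\<And>f. f \<in> FS n \<Longrightarrow> eqv (Suc q) (\<kappa> @ (k + l) # t' @ ys) (dw f) [] \<Longrightarrow>
      \<exists>g\<in>FS (n - 1). eqv (Suc q) (butlast (\<kappa> @ (k + l) # t' @ us @ [1])) f (dw g)"
    using Suc.IH[OF t(2), of "us @ [1]" "k + l"] Suc.prems t by auto
  obtain us' x where x: "ys = us' @ [x]" "list_all2 (\<le>) us us'" "1 \<le> x"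
    using ys(1) by (auto simp: list_all2_append1 list_all2_Cons1)
  have len: "length us' = length us" using list_all2_lengthD[OF x(2)] by simp
  have "\<forall>y\<in>set us'. 0 < y" using x(2) Suc.prems(3) by (fastforce simp: list_all2_conv_all_nth in_set_conv_nth)
  then have pos: "pos_seq (\<kappa> @ k # l # (t' @ us') @ [x])" using Suc.prems(3) t x(3) by auto
  have "\<exists>g\<in>FS (n - 1). eqv (Suc q) (butlast (\<kappa> @ k # t @ us)) f (dw g)"
    if f: "f \<in> FS n" "eqv (Suc q) (\<kappa> @ k # t @ us') (dw f) []" for f
  proof -
    obtain \<beta> where \<beta>: "\<beta> \<in> FS n" "eqv (Suc (Suc q)) (\<kappa> @ k # l # t' @ us') (dw f) (map (insw (Suc q)) \<beta>)"
      using connecting[of "\<kappa> @ k # t @ us'" n q f] f \<kappa> Suc.prems t len by auto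
    have "eqv (Suc q) (\<kappa> @ (k + l) # t' @ ys) (dw \<beta>) []"
      using connecting_cocycle[OF \<kappa>(1) _ pos f(1) \<beta>(1)] \<beta>(2) Suc.prems t len x(1) by simp
    then obtain \<gamma> where \<gamma>: "\<gamma> \<in> FS (n - 1)" "eqv (Suc q) (butlast (\<kappa> @ (k + l) # t' @ us @ [1])) \<beta> (dw \<gamma>)"
      using ys(2) \<beta>(1) by blast
    have "butlast (\<kappa> @ (k + l) # t' @ us @ [1]) = \<kappa> @ (k + l) # t' @ us" by (simp add: butlast_append)
    moreover have "eqv (Suc (Suc q)) (\<kappa> @ k # l # t' @ us) (dw f) (map (insw (Suc q)) \<beta>)"
      using \<beta>(2) by (rule eqv_mono) (use x(2) in \<open>simp add: list_all2_appendI list.rel_refl\<close>)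
    ultimately show ?thesis
      using exact_of_connecting[OF ac \<kappa>(1), of "t' @ us" k l f \<beta> \<gamma>] Suc.prems t f(1) \<beta>(1) \<gamma> by simp
  qed
  then show ?case using x(2) by blast
qed

text \<open>\<open>pro_zero\<close> with \<open>us\<close> empty: there is nothing to enlarge, so it
  asserts that the identity is zero on cohomology. In the lowest degree this is replaced by
  \<open>acyclic_top\<close>.\<close>

lemma acyclic:
  assumes "Suc q \<le> Suc n"
  shows "acyclic_at (Suc q) n"
  using assms
proof (induction "n - q" arbitrary: q)
  case 0
  then show ?case using acyclic_top by (metis Suc_le_mono diff_is_0_eq le_antisym)
next
  case (Suc d)
  then have ac: "acyclic_at (Suc (Suc q)) n" and q: "Suc q \<le> n" by auto
  show ?case
  proof (rule acyclic_atI)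
    fix s :: "nat list" and f
    assume s: "length s = Suc n" "pos_seq s" "f \<in> FS n" "eqv (Suc q) s (dw f) []"
    define \<kappa> k t where "\<kappa> = take q s" and "k = s ! q" and "t = drop (Suc q) s"
    have e: "s = \<kappa> @ k # t @ []" "length \<kappa> = q" "length t = n - q"
      using s(1) q id_take_nth_drop[of q s] by (simp_all add: \<kappa>_def k_def t_def)
    have pos: "pos_seq (\<kappa> @ k # t @ [])" using s(2) e(1) by simp
    obtain us' where "list_all2 (\<le>) [] us'" "\<forall>f\<in>FS n. eqv (Suc q) (\<kappa> @ k # t @ us') (dw f) [] \<longrightarrow>
      (\<exists>g\<in>FS (n - 1). eqv (Suc q) (butlast (\<kappa> @ k # t @ [])) f (dw g))"
      using pro_zero[OF ac e(2) q e(3) _ pos] q by auto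
    then have "\<exists>g\<in>FS (n - 1). eqv (Suc q) (butlast s) f (dw g)"
      using s(3,4) e(1) by simp
    then show "\<exists>g\<in>bnd (Suc q) n. eqv (Suc q) (butlast s) f g" using q by (auto simp: bnd_def)
  qed
qed

section \<open>The shift of sequences on cohomology\<close>

lemma Nil_bnd [simp]: "[] \<in> bnd r n"
  by (auto simp: bnd_def dw_def intro!: image_eqI[of _ _ "[]"])

lemma bnd_cases:
  assumes "h \<in> bnd 0 n"
  obtains "n = 0" "h = []" | m h0 where "n = Suc m" "h = dw h0" "h0 \<in> FS m"
  using assms by (cases n) (auto simp: bnd_def)

text \<open>\<open>conn s f g\<close>: evaluating a closed \<open>s\<close>-form at \<open>\<one>\<close> in the first entry shifts the
  sequence by one place, \<open>g\<close> being the shift of \<open>f\<close>.\<close>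

definition conn :: "nat list \<Rightarrow> 'u list list \<Rightarrow> 'u list list \<Rightarrow> bool" where
  "conn s f g \<longleftrightarrow> eqv (Suc 0) s (dw f) (map (insw 0) g)"

lemma eqv_left: "eqv r s a b \<Longrightarrow> eqv r s a c \<Longrightarrow> eqv r s b c"
  by (simp add: eqv_def)

lemma conn_mono: "conn t f g \<Longrightarrow> list_all2 (\<le>) s t \<Longrightarrow> conn s f g"
  unfolding conn_def by (rule eqv_mono)

lemma conn_exists:
  assumes "length s = Suc n" "f \<in> FS n" "eqv 0 s (dw f) []"
  obtains g where "g \<in> FS n" "conn s f g"
  using eqv_middle[of 0 s "dw f" n] assms by (auto simp: conn_def)

lemma conn_cocycle:
  assumes "conn (k # s) f g" "length s = n" "f \<in> FS n" "g \<in> FS n" "pos_seq (k # s @ [x])"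
  shows "eqv 0 (s @ [x]) (dw g) []"
proof (rule eqv_insw_cancel_0)
  have g: "map (insw 0) (dw g) = dw (map (insw 0) g)" using dw_insw[of 0 n g] assms by simp
  have "eqv (Suc 0) ((k # s) @ [x]) (dw (map (insw 0) g)) (dw (dw f))"
    using assms FS_insw[of 0 n g] unfolding conn_def by (intro eqv_dw eqv_sym[of _ _ "dw f"]) simp_all
  also have "eqv (Suc 0) ((k # s) @ [x]) (dw (dw f)) []" using assms by (intro dw_zero[of _ n]) simp_all
  finally show "eqv (Suc 0) (k # s @ [x]) (map (insw 0) (dw g)) (map (insw 0) [])" using g by simp
qed (use assms in auto)

text \<open>The insertion of a closed sum is closed in C(1, ..); this complex is acyclic, and a
  primitive of the insertion has the given sum as its shift.\<close>

lemma conn_surj: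
  assumes "length s = n" "g \<in> FS n" "eqv 0 (s @ [x]) (dw g) []" "pos_seq (k # s @ [x])"
  obtains f where "f \<in> FS n" "conn (k # s) f g"
proof -
  have "eqv (Suc 0) (k # s @ [x]) (map (insw 0) (dw g)) (map (insw 0) [])"
    using assms by (intro eqv_insw_0) simp_all
  then have "eqv (Suc 0) (k # s @ [x]) (dw (map (insw 0) g)) (dw [])" using dw_insw[of 0 n g] assms by simp
  then obtain h where h: "h \<in> bnd (Suc 0) (Suc n)" "eqv (Suc 0) (butlast (k # s @ [x])) (map (insw 0) g) (h @ [])"
    using acyclic_atD[OF acyclic, of 0 "Suc n" "k # s @ [x]" "map (insw 0) g" "[]"] assms FS_insw[of 0 n g] by auto
  have "butlast (k # s @ [x]) = k # s" by (simp add: butlast_append)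
  then have "eqv (Suc 0) (k # s) h (map (insw 0) g)" using h(2) eqv_sym by simp
  then show thesis using h(1) that by (auto simp: bnd_def conn_def)
qed

lemma cocycle_of_conn:
  assumes "conn s f g" "length s = Suc n" "g \<in> FS n"
  shows "eqv 0 s (dw f) []"
proof -
  have "eqv 0 s (dw f) (map (insw 0) g)" using assms(1) unfolding conn_def by (rule eqv_Suc)
  also have "eqv 0 s (map (insw 0) g) []" using assms by (intro insw_zero[of _ _ n]) simp_all
  finally show ?thesis .
qed

text \<open>The shift preserves coboundaries. A coboundary \<open>f\<close> of C(0, ..) is, in C(1,
  ..), a boundary plus the insertion of some \<open>h'\<close>; comparing differentials and
  cancelling the insertion shows that \<open>g\<close> is the differential of
  \<open>h'\<close>.\<close>

lemma conn_exact:
  assumes c: "conn (k # s) f g" and n: "length s = n" "f \<in> FS n" "g \<in> FS n" "pos_seq (k # s)"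
    and h: "h \<in> bnd 0 n" "eqv 0 (butlast (k # s)) f h"
  shows "\<exists>h'\<in>bnd 0 n. eqv 0 s g h'"
  using h(1)
proof (rule bnd_cases)
  assume n0: "n = 0" "h = []"
  then have "eqv (Suc 0) [] f []" using h(2) n(1) by (auto simp: eqv_def)
  then have "eqv (Suc 0) ([] @ [k]) (dw f) (dw [])" using n n0 by (intro eqv_dw) simp_all
  then have "eqv (Suc 0) (k # s) (dw f) (map (insw 0) [])" using n n0 by simp
  then have "eqv (Suc 0) (k # s) (map (insw 0) g) (map (insw 0) [])"
    by (rule eqv_left[OF c[unfolded conn_def]])
  then have "eqv 0 s g []" by (rule eqv_insw_cancel_0) (use n in auto)
  then show ?thesis using Nil_bnd by blast
next
  fix m h0 assume m: "n = Suc m" "h = dw h0" "h0 \<in> FS m"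
  define t where "t = butlast (k # s)"
  have t: "length t = Suc m" "k # s = t @ [last (k # s)]"
    using n(1) m(1) unfolding t_def
    by (simp only: length_butlast, simp) (rule append_butlast_last_id[symmetric], simp)
  have hF: "h \<in> FS (length t)" "f \<in> FS (length t)" using m n t by simp_all
  have "eqv 0 t (f @ neg h) []" using h(2) hF eqv_diff(1) by (simp add: t_def)
  then obtain h' where h': "h' \<in> FS m" "eqv (Suc 0) t (f @ neg h) (map (insw 0) h')"
    using eqv_middle[of 0 t "f @ neg h" m] hF t by auto
  have "eqv (Suc 0) t f (map (insw 0) h' @ h)"
    using eqv_diff(2)[OF hF(2,1) h'(2)] FS_insw[of 0 m h'] h'(1) t by simp
  then have "eqv (Suc 0) (t @ [last (k # s)]) (dw f) (dw (map (insw 0) h' @ h))"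
    using hF t FS_insw[of 0 m h'] h'(1) by (intro eqv_dw) simp_all
  then have "eqv (Suc 0) (k # s) (dw f) (dw (map (insw 0) h') @ dw h)" unfolding t(2)[symmetric] by simp
  also have "eqv (Suc 0) (k # s) (dw (map (insw 0) h') @ dw h) (dw (map (insw 0) h') @ [])"
    using n m FS_insw[of 0 m h'] h'(1) dw_zero[of "Suc 0" m "k # s" h0] by (intro eqv_append eqv_refl) simp_all
  also have "dw (map (insw 0) h') @ [] = map (insw 0) (dw h')" using dw_insw[of 0 m h'] h'(1) by simp
  finally have "eqv (Suc 0) (k # s) (dw f) (map (insw 0) (dw h'))" .
  then have "eqv (Suc 0) (k # s) (map (insw 0) g) (map (insw 0) (dw h'))"
    by (rule eqv_left[OF c[unfolded conn_def]])
  then have "eqv 0 s g (dw h')" by (rule eqv_insw_cancel_0) (use n m h'(1) in auto)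
  moreover have "dw h' \<in> bnd 0 n" using m h'(1) by (simp add: bnd_def)
  ultimately show ?thesis by blast
qed

text \<open>The shift is injective on cohomology. If \<open>g\<close> and \<open>g2\<close> differ
  by the differential of \<open>h0\<close>, then \<open>f\<close> and \<open>f2\<close>, after
  adding the insertion of \<open>h0\<close>, have the same differential in C(1, ..) and differ by a
  boundary as this complex is acyclic; in C(0, ..) the insertion is zero.\<close>

lemma conn_reflects:
  assumes c: "conn (k # s) f g" "conn (k # s) f2 g2"
    and n: "length s = n" "f \<in> FS n" "g \<in> FS n" "f2 \<in> FS n" "g2 \<in> FS n" "pos_seq (k # s)"
    and h: "h' \<in> bnd 0 n" "eqv 0 s g (h' @ g2)"
  shows "\<exists>h\<in>bnd 0 n. eqv 0 (butlast (k # s)) f (h @ f2)"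
proof -
  define t where "t = butlast (k # s)"
  have t: "length t = n" using n(1) by (simp only: t_def length_butlast) simp
  \<comment> \<open>C(0, ..) and C(1, ..) both start in degree 0.\<close>
  have b: "bnd (Suc 0) n = bnd 0 n" by (simp add: bnd_def)
  have ac: "\<exists>h\<in>bnd 0 n. eqv (Suc 0) (t) f (h @ u)"
    if "u \<in> FS n" "eqv (Suc 0) (k # s) (dw f) (dw u)" for u
    using acyclic_atD[OF acyclic, of 0 n "k # s" f u, folded t_def] that n by (simp add: b)
  note \<open>conn (k # s) f g\<close>[unfolded conn_def]
  also have "eqv (Suc 0) (k # s) (map (insw 0) g) (map (insw 0) (h' @ g2))"
    using h bnd_FS n by (intro eqv_insw_0) simp_all
  finally have e: "eqv (Suc 0) (k # s) (dw f) (map (insw 0) h' @ map (insw 0) g2)" by simp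
  note h(1)
  then show ?thesis
  proof (rule bnd_cases)
    assume "n = 0" "h' = []"
    then have "eqv (Suc 0) (k # s) (dw f) (dw f2)"
      using e eqv_trans[OF _ eqv_sym[OF c(2)[unfolded conn_def]]] by simp
    then show ?thesis using ac[OF n(4)] eqv_Suc unfolding t_def by blast
  next
    fix m h0 assume m: "n = Suc m" "h' = dw h0" "h0 \<in> FS m"
    define u where "u = map (insw 0) h0"
    have u: "u \<in> FS n" using FS_insw[of 0 m h0] m by (simp add: u_def)
    note e
    also have "map (insw 0) h' = dw u" using dw_insw[of 0 m h0] m by (simp add: u_def)
    also have "eqv (Suc 0) (k # s) (dw u @ map (insw 0) g2) (dw u @ dw f2)"
      using c(2) u n FS_insw[of 0 n g2] unfolding conn_def by (intro eqv_append eqv_refl eqv_sym[of _ _ "dw f2"]) simp_all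
    finally have "eqv (Suc 0) (k # s) (dw f) (dw (u @ f2))" by simp
    then obtain h1 where h1: "h1 \<in> bnd 0 n" "eqv (Suc 0) (t) f (h1 @ u @ f2)"
      using ac[of "u @ f2"] u n by auto
    from h1(2) have "eqv 0 (t) f (h1 @ u @ f2)" by (rule eqv_Suc)
    also have "eqv 0 (t) u []"
      unfolding u_def using m t by (intro insw_zero[of _ _ m]) simp_all

    then have "eqv 0 (t) (h1 @ u @ f2) (h1 @ [] @ f2)"
      using u n t bnd_FS[OF h1(1)] by (intro eqv_append eqv_refl) simp_all
    finally show ?thesis using h1(1) unfolding t_def by auto
  qed
qed

text \<open>Surjectivity and injectivity in cohomology of degree n for the canonical map from type
  \<open>t\<close> to type \<open>s\<close>. On formal sums this map is the identity, so only the
  equivalences differ.\<close>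

definition comparison :: "nat \<Rightarrow> nat list \<Rightarrow> nat list \<Rightarrow> bool" where
  "comparison n s t \<longleftrightarrow>
     (\<forall>g\<in>FS n. eqv 0 s (dw g) [] \<longrightarrow>
        (\<exists>f\<in>FS n. eqv 0 t (dw f) [] \<and> (\<exists>h\<in>bnd 0 n. eqv 0 (butlast s) f (h @ g)))) \<and>
     (\<forall>f\<in>FS n. eqv 0 t (dw f) [] \<longrightarrow> (\<forall>h\<in>bnd 0 n. eqv 0 (butlast s) f h \<longrightarrow>
        (\<exists>h'\<in>bnd 0 n. eqv 0 (butlast t) f h')))"

text \<open>By \<open>conn_mono\<close> the shift commutes with the passage from \<open>t\<close> to
  \<open>s\<close>, and it is bijective on cohomology for both types. The appended 1 makes up for
  the dropped entry; it must be the same on both sides.\<close>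

lemma comparison_step:
  assumes IH: "comparison n (s @ [1]) (t @ [1])" and le: "k \<le> l" "list_all2 (\<le>) s t"
    and len: "length s = n" and pos: "pos_seq (k # s)"
  shows "comparison n (k # s) (l # t)"
proof -
  have len': "length t = n" using le(2) len list_all2_lengthD by force
  have "\<forall>y\<in>set t. 0 < y" using le(2) pos by (fastforce simp: list_all2_conv_all_nth in_set_conv_nth)
  then have pos': "pos_seq (k # s @ [1])" "pos_seq (l # t @ [1])" "pos_seq (l # t)" using pos le(1) by auto
  have mono: "list_all2 (\<le>) (k # s) (l # t)" using le by simp
  have "\<exists>f\<in>FS n. eqv 0 (l # t) (dw f) [] \<and> (\<exists>h\<in>bnd 0 n. eqv 0 (butlast (k # s)) f (h @ g))"
    if g: "g \<in> FS n" "eqv 0 (k # s) (dw g) []" for g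
  proof -
    obtain g' where g': "g' \<in> FS n" "conn (k # s) g g'" using conn_exists[of "k # s" n g] g len by auto
    have "eqv 0 (s @ [1]) (dw g') []" by (rule conn_cocycle[OF g'(2) len g(1) g'(1) pos'(1)])
    then obtain f' h where f': "f' \<in> FS n" "eqv 0 (t @ [1]) (dw f') []" "h \<in> bnd 0 n" "eqv 0 s f' (h @ g')"
      using IH g'(1) unfolding comparison_def by auto
    obtain f where f: "f \<in> FS n" "conn (l # t) f f'" by (rule conn_surj[OF len' f'(1,2) pos'(2)])
    have "eqv 0 (l # t) (dw f) []" by (rule cocycle_of_conn[OF f(2) _ f'(1)]) (simp add: len')
    moreover have "\<exists>h\<in>bnd 0 n. eqv 0 (butlast (k # s)) f (h @ g)"
      by (rule conn_reflects[OF conn_mono[OF f(2) mono] g'(2) len f(1) f'(1) g(1) g'(1) pos f'(3,4)])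
    ultimately show ?thesis using f(1) by blast
  qed
  moreover have "\<exists>h'\<in>bnd 0 n. eqv 0 (butlast (l # t)) f h'"
    if f: "f \<in> FS n" "eqv 0 (l # t) (dw f) []" "h \<in> bnd 0 n" "eqv 0 (butlast (k # s)) f h" for f h
  proof -
    obtain f' where f': "f' \<in> FS n" "conn (l # t) f f'" using conn_exists[of "l # t" n f] f len' by auto
    obtain h' where h': "h' \<in> bnd 0 n" "eqv 0 s f' h'"
      using conn_exact[OF conn_mono[OF f'(2) mono] len f(1) f'(1) pos f(3,4)] by blast
    have "eqv 0 (t @ [1]) (dw f') []" by (rule conn_cocycle[OF f'(2) len' f(1) f'(1) pos'(2)])
    then obtain h'' where h'': "h'' \<in> bnd 0 n" "eqv 0 t f' (h'' @ [])"
      using IH f'(1) h' unfolding comparison_def by auto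
    have "conn (l # t) [] []" by (simp add: conn_def)
    from conn_reflects[OF f'(2) this len' f(1) f'(1) _ _ pos'(3) h'']
    show ?thesis by simp
  qed
  ultimately show ?thesis unfolding comparison_def by blast
qed

lemma comparison_refl: "comparison n s s"
  unfolding comparison_def
proof (intro conjI ballI impI)
  fix g assume "g \<in> FS n" "eqv 0 s (dw g) []"
  then show "\<exists>f\<in>FS n. eqv 0 s (dw f) [] \<and> (\<exists>h\<in>bnd 0 n. eqv 0 (butlast s) f (h @ g))"
    by (intro bexI[of _ g] conjI bexI[of _ "[]"]) simp_all
qed blast

lemma comparison:
  assumes "list_all2 (\<le>) s t" "pos_seq s" "length s = Suc n"
  shows "comparison n s t"
proof -
  \<comment> \<open>\<open>j\<close> counts the entries shifted away and replaced by ones. When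
    \<open>s'\<close> is empty, both types consist of ones only.\<close>
  have "list_all2 (\<le>) s' t' \<Longrightarrow> pos_seq s' \<Longrightarrow> length s' + j = Suc n \<Longrightarrow>
      comparison n (s' @ replicate j 1) (t' @ replicate j 1)" for s' t' j
  proof (induction s' arbitrary: t' j)
    case Nil
    then show ?case by (simp add: comparison_refl)
  next
    case (Cons k s')
    then obtain l t'' where t: "t' = l # t''" "k \<le> l" "list_all2 (\<le>) s' t''" by (auto simp: list_all2_Cons1)
    have "comparison n (s' @ replicate (Suc j) 1) (t'' @ replicate (Suc j) 1)"
      using Cons t by (intro Cons.IH) auto
    then have "comparison n ((s' @ replicate j 1) @ [1]) ((t'' @ replicate j 1) @ [1])"
      by (simp add: replicate_append_same)
    then have "comparison n (k # s' @ replicate j 1) (l # t'' @ replicate j 1)"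
      using t Cons.prems by (intro comparison_step) (auto simp: list_all2_appendI list.rel_refl)
    then show ?case using t by simp
  qed
  from this[of s t 0] show ?thesis using assms by simp
qed

end

section \<open>Representing objects\<close>

context diff_closed
begin

lemma mod_homD:
  assumes "h \<in> mod_hom A L Q"
  shows "linear_on L Q (carrier L) h" "h ` carrier L \<subseteq> carrier Q" "h \<in> extensional (carrier L)"
    "x \<in> carrier L \<Longrightarrow> h x \<in> carrier Q"
  using assms by (auto simp: mod_hom_def lin_maps_def linear_on_def PiE_def)

lemma iter_map_hom:
  assumes "module A L" "module A Q" "h \<in> mod_hom A L Q" "X \<in> DR r s L"
  shows "iter_map A h X \<in> DR r s Q" "f \<in> FS (length s) \<Longrightarrow> evs Q (iter_map A h X) f = h (evs L X f)"
    "as \<in> tuples (length s) \<Longrightarrow> ev as (iter_map A h X) = h (ev as X)"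
proof -
  interpret L: module A L by fact
  have X: "X \<in> carrier (Wm s L)" using assms(4) DR_subset[OF assms(1)] by blast
  note h = mod_homD[OF assms(3)] and e = ev_carrier[OF assms(1) X]
  have sg: "subgrp L (carrier L)" by (auto simp: subgrp_def)
  show "iter_map A h X \<in> DR r s Q"
    by (rule iter_map_DR[OF assms(1,2) sg L.smult_closed h(1,2) assms(4) e])
  show "evs Q (iter_map A h X) f = h (evs L X f)" if "f \<in> FS (length s)"
    by (rule evs_hom(1)[OF _ assms(2,1) X that h(1,2) e]) (use assms(1) in simp)
  show "as \<in> tuples (length s) \<Longrightarrow> ev as (iter_map A h X) = h (ev as X)"
    by (rule ev_iter_map[OF _ assms(1) X])
qed

text \<open>Representability through the universal element \<open>u\<close>, in a form that also
  covers the empty sequence, for which the representing object is prescribed.\<close>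

definition represents :: "('u, 'u) module \<Rightarrow> nat list \<Rightarrow> ('u, 'u) iter \<Rightarrow> bool" where
  "represents L s u \<longleftrightarrow> L \<in> \<DD> \<and> u \<in> DR 0 s L \<and>
     (\<forall>Q\<in>\<DD>. \<forall>X\<in>DR 0 s Q. \<exists>h\<in>mod_hom A L Q. iter_map A h u = X) \<and>
     (\<forall>Q\<in>\<DD>. \<forall>h\<in>mod_hom A L Q. \<forall>h'\<in>mod_hom A L Q. iter_map A h u = iter_map A h' u \<longrightarrow> h = h')"

lemma represents_strict:
  assumes "strict_representation A \<DD> (DD K A s) (iter_map A) L e"
  defines "u \<equiv> e L (\<lambda>\<omega>\<in>carrier L. \<omega>)"
  shows "represents L s u" "Q \<in> \<DD> \<Longrightarrow> h \<in> mod_hom A L Q \<Longrightarrow> e Q h = iter_map A h u"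
proof -
  have L: "L \<in> \<DD>" and iso: "\<And>Q. Q \<in> \<DD> \<Longrightarrow> e Q \<in> mod_iso A (Hom A L Q) (DD K A s Q)"
    and nat: "\<And>Q Q' f h. Q \<in> \<DD> \<Longrightarrow> Q' \<in> \<DD> \<Longrightarrow> f \<in> mod_hom A Q Q' \<Longrightarrow> h \<in> mod_hom A L Q \<Longrightarrow>
      e Q' (compose (carrier L) f h) = iter_map A f (e Q h)"
    using assms(1) by (auto simp: strict_representation_def)
  have bij: "bij_betw (e Q) (mod_hom A L Q) (DR 0 s Q)" if "Q \<in> \<DD>" for Q
    using iso[OF that] carrier_D_seq[OF cat_module[OF that], of s]
    by (simp add: mod_iso_def Hom_def map_module_def)
  have id: "(\<lambda>\<omega>\<in>carrier L. \<omega>) \<in> mod_hom A L L"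
    using cat_module[OF L] linear_mod_hom[of L L "\<lambda>x. x"] by (simp add: linear_on_def)
  show e: "e Q h = iter_map A h u" if "Q \<in> \<DD>" "h \<in> mod_hom A L Q" for Q h
  proof -
    have "compose (carrier L) h (\<lambda>\<omega>\<in>carrier L. \<omega>) = h"
      using mod_homD(3)[OF that(2)] by (auto simp: compose_def extensional_def)
    then show ?thesis using nat[OF L that(1,2) id] by (simp add: u_def)
  qed
  show "represents L s u"
    unfolding represents_def
  proof (intro conjI ballI impI)
    show "L \<in> \<DD>" by (rule L)
    show "u \<in> DR 0 s L" unfolding u_def using bij_betwE[OF bij[OF L]] id by blast
    show "\<exists>h\<in>mod_hom A L Q. iter_map A h u = X" if Q: "Q \<in> \<DD>" "X \<in> DR 0 s Q" for Q X
    proof -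
      have "X \<in> e Q ` mod_hom A L Q" unfolding bij_betw_imp_surj_on[OF bij[OF Q(1)]] by (rule Q(2))
      then obtain h where h: "h \<in> mod_hom A L Q" "e Q h = X" by blast
      have "iter_map A h u = X" using e[OF Q(1) h(1)] h(2) by simp
      then show ?thesis using h(1) by (rule bexI)
    qed
    show "h = h'" if "Q \<in> \<DD>" "h \<in> mod_hom A L Q" "h' \<in> mod_hom A L Q" "iter_map A h u = iter_map A h' u" for Q h h'
      using inj_onD[OF bij_betw_imp_inj_on[OF bij[OF that(1)]] _ that(2,3)] that(4) e[OF that(1)] that(2,3) by simp
  qed
qed

lemma regular_in_cat: "regular_module A \<in> \<DD>"
  using closed by (simp add: differentially_closed_def)

lemma represents_Nil: "represents (regular_module A) [] (Base \<one>)"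
  unfolding represents_def
proof (intro conjI ballI impI)
  show "\<exists>h\<in>mod_hom A (regular_module A) Q. iter_map A h (Base \<one>) = X" if X: "Q \<in> \<DD>" "X \<in> DR 0 [] Q" for Q X
  proof -
    interpret Q: module A Q using cat_module[OF X(1)] .
    obtain q where q: "X = Base q" "q \<in> carrier Q" using X(2) by auto
    have "restrict (\<lambda>a. a \<odot>\<^bsub>Q\<^esub> q) (carrier (regular_module A)) \<in> mod_hom A (regular_module A) Q"
      using q(2) cat_module[OF regular_in_cat]
      by (intro linear_mod_hom) (auto simp: linear_on_def regular_module_def Q.smult_l_distr Q.smult_assoc1)
    then show ?thesis using q by (intro bexI) (auto simp: regular_module_def)
  qed
  show "h = h'" if "h \<in> mod_hom A (regular_module A) Q" "h' \<in> mod_hom A (regular_module A) Q"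
    "iter_map A h (Base \<one>) = iter_map A h' (Base \<one>)" for Q :: "('u, 'u) module" and h h'
  proof (rule extensionalityI[OF mod_homD(3)[OF that(1)] mod_homD(3)[OF that(2)]])
    fix a assume "a \<in> carrier (regular_module A)"
    then have a: "a \<in> carrier A" "a \<odot>\<^bsub>regular_module A\<^esub> \<one> = a" "\<one> \<in> carrier (regular_module A)" by (simp_all add: regular_module_def)
    have "h (a \<odot>\<^bsub>regular_module A\<^esub> \<one>) = h' (a \<odot>\<^bsub>regular_module A\<^esub> \<one>)"
      using linear_onD(2)[OF mod_homD(1)[OF that(1)] a(1,3)] linear_onD(2)[OF mod_homD(1)[OF that(2)] a(1,3)] that(3) by simp
    then show "h a = h' a" unfolding a(2) .
  qed
qed (use regular_in_cat in \<open>auto simp: regular_module_def\<close>)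

text \<open>Projection and zero map to the quotient of \<open>L\<close> by the span of the values of
  \<open>u\<close> agree on \<open>u\<close>, so they are equal and the quotient is zero. Closure
  under submodules and quotients keeps the argument inside \<open>\<DD>\<close>.\<close>

lemma represents_span:
  assumes "represents L s u"
  shows "evs L u ` FS (length s) = carrier L"
proof -
  let ?S = "evs L u ` FS (length s)"
  have L: "L \<in> \<DD>" "u \<in> DR 0 s L" using assms by (auto simp: represents_def)
  have uniq: "\<And>Q h h'. Q \<in> \<DD> \<Longrightarrow> h \<in> mod_hom A L Q \<Longrightarrow> h' \<in> mod_hom A L Q \<Longrightarrow> iter_map A h u = iter_map A h' u \<Longrightarrow> h = h'"
    using assms by (simp add: represents_def)
  note mL = cat_module[OF L(1)]
  interpret L: module A L by fact
  have uc: "u \<in> carrier (Wm s L)" using L(2) DR_subset[OF mL] by blast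
  have "sub L ?S"
  proof (rule subI[OF mL])
    show "?S \<subseteq> carrier L" using evs_carrier[OF mL uc] by auto
    show "\<zero>\<^bsub>L\<^esub> \<in> ?S" by (intro image_eqI[of _ _ "[]"]) simp_all
    fix x y assume "x \<in> ?S" "y \<in> ?S"
    then obtain f g where "x = evs L u f" "f \<in> FS (length s)" "y = evs L u g" "g \<in> FS (length s)" by blast
    then show "x \<oplus>\<^bsub>L\<^esub> y \<in> ?S" using evs_append[OF mL uc, of f g] by (intro image_eqI[of _ _ "f @ g"]) simp_all
  next
    fix a x assume "a \<in> carrier A" "x \<in> ?S"
    then obtain f where "x = evs L u f" "f \<in> FS (length s)" "a \<in> carrier A" by blast
    then show "a \<odot>\<^bsub>L\<^esub> x \<in> ?S" using evs_scal[OF mL uc, of f a] by (intro image_eqI[of _ _ "scal a f"]) simp_all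
  qed
  then obtain Z p where Z: "Z \<in> \<DD>" "linear_on L Z (carrier L) p" "p ` carrier L = carrier Z"
    "\<And>y. y \<in> carrier L \<Longrightarrow> p y = \<zero>\<^bsub>Z\<^esub> \<longleftrightarrow> y \<in> ?S" using cat_quot[OF L(1)] by blast
  note mZ = cat_module[OF Z(1)]
  interpret Z: module A Z by fact
  let ?p = "restrict p (carrier L)" and ?z = "restrict (\<lambda>x. \<zero>\<^bsub>Z\<^esub>) (carrier L)"
  have hom: "?p \<in> mod_hom A L Z" "?z \<in> mod_hom A L Z"
    using Z(2,3) mL by (auto intro!: linear_mod_hom simp: linear_on_def)
  have "iter_map A ?p u = iter_map A ?z u"
  proof (rule ev_ext[OF mZ])
    show "iter_map A ?p u \<in> carrier (Wm s Z)" "iter_map A ?z u \<in> carrier (Wm s Z)"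
      using iter_map_hom(1)[OF mL mZ hom(1) L(2)] iter_map_hom(1)[OF mL mZ hom(2) L(2)] DR_subset[OF mZ] by blast+
    fix as assume as: "as \<in> tuples (length s)"
    have c: "ev as u \<in> carrier L" by (rule ev_carrier[OF mL uc as])
    have "evs L u [as @ [\<one>]] = ev as u" using c by simp
    moreover have "[as @ [\<one>]] \<in> FS (length s)" using as by simp
    ultimately have "ev as u \<in> ?S" by (metis imageI)
    then show "ev as (iter_map A ?p u) = ev as (iter_map A ?z u)"
      using Z(4)[OF c] c iter_map_hom(3)[OF mL mZ hom(1) L(2) as] iter_map_hom(3)[OF mL mZ hom(2) L(2) as] by simp
  qed
  then have "?p = ?z" using uniq Z(1) hom by blast
  then have "p x = \<zero>\<^bsub>Z\<^esub>" if "x \<in> carrier L" for x using that by (metis restrict_apply')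
  then show ?thesis using Z(4) evs_carrier[OF mL uc] by blast
qed

text \<open>For an operator that vanishes at one, \<open>dl\<close> applied twice and evaluated at
  one is the defect of the product rule; so order at most 1 means that the product rule
  holds.\<close>

lemma derivation_iff_DR:
  assumes "module A Q"
  shows "derivation Q X \<Longrightarrow> Fn (\<lambda>a\<in>carrier A. Base (X a)) \<in> DR 0 [1] Q"
    "Fn D \<in> DR 0 [1] Q \<Longrightarrow> derivation Q (\<lambda>a. un_Base (D a))"
proof -
  interpret Q: diffmod A K Q using assms diffcalc_axioms by (intro diffmod.intro)
  interpret V: diffmod A K "Wm [] Q" using assms by (rule diffmod_Wm)
  show "Fn (\<lambda>a\<in>carrier A. Base (X a)) \<in> DR 0 [1] Q" if X: "derivation Q X"
  proof (rule DR_ConsI[OF assms])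
    have "DO Q 2 X" using X by (rule Q.derivation_DO)
    then show "DO (Wm [] Q) (Suc 1) (\<lambda>a. Base (X a))"
      by (intro Q.DO_hom[OF module_Wm[OF assms]]) (simp_all add: numeral_2_eq_2)
    show "Base (X a) \<in> DR (0 - 1) [] Q" if "a \<in> carrier A" for a using X that by (auto simp: derivation_def)
    show "Base (X \<one>) = \<zero>\<^bsub>Wm [] Q\<^esub>" using derivationD(5)[OF X one_K] by simp
  qed
  show "derivation Q (\<lambda>a. un_Base (D a))" if "Fn D \<in> DR 0 [1] Q"
  proof -
    have "DO (Wm [] Q) (Suc 1) D" and D1: "D \<one> = Base \<zero>\<^bsub>Q\<^esub>" using that by auto
    then have E: "DO Q (Suc 1) (\<lambda>a. un_Base (D a))" by (intro V.DO_hom[OF assms]) auto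
    define X where "X = (\<lambda>a. un_Base (D a))"
    have X: "Klin Q X" "ord Q (Suc (Suc 0)) X" "X \<one> = \<zero>\<^bsub>Q\<^esub>" using E D1 by (simp_all add: DO_def X_def del: ord.simps)
    have c: "X a \<in> carrier Q" if "a \<in> carrier A" for a using X(1) that by (auto simp: Klin_def)
    have "X (a \<otimes> b) = a \<odot>\<^bsub>Q\<^esub> X b \<oplus>\<^bsub>Q\<^esub> b \<odot>\<^bsub>Q\<^esub> X a" if ab: "a \<in> carrier A" "b \<in> carrier A" for a b
    proof -
      have "dl Q a (dl Q b X) \<one> = \<zero>\<^bsub>Q\<^esub>" using X(2) ab by simp
      then have "X (a \<otimes> b) \<oplus>\<^bsub>Q\<^esub> \<ominus>\<^bsub>Q\<^esub> (b \<odot>\<^bsub>Q\<^esub> X a) \<oplus>\<^bsub>Q\<^esub> \<ominus>\<^bsub>Q\<^esub> (a \<odot>\<^bsub>Q\<^esub> X b) = \<zero>\<^bsub>Q\<^esub>"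
        using ab c X(3) by (simp add: dl_def Q.smult_l_minus R.m_comm)
      then have "X (a \<otimes> b) \<oplus>\<^bsub>Q\<^esub> \<ominus>\<^bsub>Q\<^esub> (a \<odot>\<^bsub>Q\<^esub> X b \<oplus>\<^bsub>Q\<^esub> b \<odot>\<^bsub>Q\<^esub> X a) = \<zero>\<^bsub>Q\<^esub>"
        using ab c by (simp add: Q.M.minus_add Q.M.a_ac)
      then show ?thesis using ab c Q.M.add.inv_solve_right'[of "\<zero>\<^bsub>Q\<^esub>" "X (a \<otimes> b)" "a \<odot>\<^bsub>Q\<^esub> X b \<oplus>\<^bsub>Q\<^esub> b \<odot>\<^bsub>Q\<^esub> X a"] by simp
    qed
    moreover have "X k = \<zero>\<^bsub>Q\<^esub>" if "k \<in> K" for k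
    proof -
      have "X (k \<otimes> \<one>) = k \<odot>\<^bsub>Q\<^esub> X \<one>" using X(1) that by (simp add: Klin_def)
      then show ?thesis using X(3) that K_carrier by simp
    qed
    ultimately show ?thesis using X(1) unfolding derivation_def X_def[symmetric] by (auto simp: Klin_def)
  qed
qed

lemma free_module_prod:
  "finite X \<Longrightarrow> free_module A X = prod_module X (\<lambda>_. regular_module A)"
  by (simp add: free_module_def prod_module_def regular_module_def)

lemma sub_lsum:
  assumes "sub W S" "\<And>x. x \<in> set us \<Longrightarrow> f x \<in> S"
  shows "lsum W f us \<in> S"
  using assms(2) subD(2,3)[OF assms(1)] by (induction us) simp_all

lemma (in module) lsum_delta:
  assumes "distinct us" "y \<in> set us" "\<And>x. x \<in> set us \<Longrightarrow> e x \<in> carrier M"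
  shows "lsum M (\<lambda>x. (if x = y then \<one> else \<zero>) \<odot>\<^bsub>M\<^esub> e x) us = e y"
  using assms
proof (induction us)
  case (Cons z us)
  have z: "lsum M (\<lambda>x. (if x = y then \<one> else \<zero>) \<odot>\<^bsub>M\<^esub> e x) us = \<zero>\<^bsub>M\<^esub>" if "y \<notin> set us"
  proof -
    have "lsum M (\<lambda>x. (if x = y then \<one> else \<zero>) \<odot>\<^bsub>M\<^esub> e x) us = lsum M (\<lambda>x. \<zero>\<^bsub>M\<^esub>) us"
      using that Cons.prems(3) by (intro lsum_cong) auto
    then show ?thesis by simp
  qed
  show ?case
  proof (cases "z = y")
    case True
    then show ?thesis using Cons.prems z by simp
  next
    case False
    then show ?thesis using Cons by simp
  qed
qed simp

text \<open>The dual basis lemma: finitely many differentials \<open>d y\<close> generate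
  \<open>L\<close>, and the coordinates of a section \<open>h\<close> of the free cover, composed
  with \<open>d\<close>, are the derivations \<open>dd y\<close>. That \<open>h\<close> is a section
  is the frame relation for \<open>d\<close>; all derivations into objects factor through
  \<open>d\<close> and inherit it.\<close>

lemma frame_exists:
  assumes zc: "zero_characteristic A" and u: "represents L [1] u"
    and "projective_module A L" "finite_type A L"
  shows "\<exists>xs dd. diff_cat A K xs dd \<DD>"
proof -
  have L: "L \<in> \<DD>" "u \<in> DR 0 [1] L" using u by (auto simp: represents_def)
  note mL = cat_module[OF L(1)]
  interpret L: module A L by fact
  define d where "d a = un_Base (un_Fn u a)" for a
  have "u = Fn (un_Fn u)" using L(2) by auto
  then have "derivation L d" unfolding d_def using derivation_iff_DR(2)[OF mL, of "un_Fn u"] L(2) by metis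
  note d = derivationD[OF this]
  have fin: "\<exists>as. set as \<subseteq> carrier A \<and> b \<in> fg L (map d as)" if "b \<in> carrier L" for b
  proof -
    obtain f where f: "f \<in> FS 1" "b = evs L u f" using represents_span[OF u] \<open>b \<in> _\<close> by auto
    have w: "hd w \<in> carrier A" "\<exists>c\<in>carrier A. evw L u w = c \<odot>\<^bsub>L\<^esub> d (hd w)" if "w \<in> set f" for w
      using FS_mem[OF f(1) that] by (auto elim!: tuples_SucE simp: evw_def d_def)
    then have c: "set (map hd f) \<subseteq> carrier A" by auto
    then have dc: "set (map d (map hd f)) \<subseteq> carrier L" using d(2) by auto
    have "evw L u w \<in> fg L (map d (map hd f))" if "w \<in> set f" for w
    proof -
      have "d (hd w) \<in> fg L (map d (map hd f))" using fg_gen[OF mL dc] that by auto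
      then show ?thesis using w(2)[OF that] subD(4)[OF sub_fg[OF mL dc]] by auto
    qed
    then have "b \<in> fg L (map d (map hd f))" unfolding f(2) evs_def by (rule sub_lsum[OF sub_fg[OF mL dc]])
    then show ?thesis using c by blast
  qed
  obtain B where B: "finite B" "B \<subseteq> carrier L" "span_module A L B = carrier L"
    using assms(4) by (auto simp: finite_type_def)
  obtain bs where bs: "set bs = B" using finite_list[OF B(1)] by blast
  have "\<forall>b\<in>B. \<exists>as. set as \<subseteq> carrier A \<and> b \<in> fg L (map d as)" using fin B(2) by blast
  from bchoice[OF this] obtain as where as: "\<forall>b\<in>B. set (as b) \<subseteq> carrier A \<and> b \<in> fg L (map d (as b))" by blast
  \<comment> \<open>The ring elements themselves index the free module, so that it is of the type of
    test modules in \<open>projective_module\<close>; this forces repetitions to be removed.\<close>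
  define ys where "ys = remdups (concat (map as bs))"
  have ys: "set ys \<subseteq> carrier A" "distinct ys" using as bs by (auto simp: ys_def)
  have dys: "set (map d ys) \<subseteq> carrier L" using ys d(2) by auto
  note S = subD[OF sub_fg[OF mL dys]]
  have "b \<in> fg L (map d ys)" if "b \<in> B" for b
    using fg_mono[OF mL dys, of "map d (as b)"] as bs that by (auto simp: ys_def)
  then have "span_module A L B \<subseteq> fg L (map d ys)" unfolding span_module_def using S(5)[OF mL] by blast
  then have full: "fg L (map d ys) = carrier L" using B(3) S(1) by blast
  define F where "F = free_module A (set ys)"
  have Fp: "F = prod_module (set ys) (\<lambda>_. regular_module A)" unfolding F_def by (rule free_module_prod) simp
  have Fc: "carrier F = (set ys \<rightarrow>\<^sub>E carrier A)" and Fa: "x \<oplus>\<^bsub>F\<^esub> y = (\<lambda>t\<in>set ys. x t \<oplus> y t)"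
    and Fs: "a \<odot>\<^bsub>F\<^esub> x = (\<lambda>t\<in>set ys. a \<otimes> x t)" and Fz: "\<zero>\<^bsub>F\<^esub> = (\<lambda>t\<in>set ys. \<zero>)" for x y a
    by (simp_all add: Fp regular_module_def)
  have mF: "module A F" unfolding Fp using cat_module[OF regular_in_cat] R.is_cring by (intro prod_module_module)
  define g where "g x = lsum L (\<lambda>y. x y \<odot>\<^bsub>L\<^esub> d y) ys" for x
  have dy: "d y \<in> carrier L" "y \<in> carrier A" if "y \<in> set ys" for y using d(2) ys that by auto
  have xy: "x y \<in> carrier A" if "x \<in> carrier F" "y \<in> set ys" for x y using that by (auto simp: Fc)
  have glin: "linear_on F L (carrier F) g"
    unfolding linear_on_def
  proof (intro conjI ballI)
    fix x y assume x: "x \<in> carrier F" "y \<in> carrier F"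
    have "g (x \<oplus>\<^bsub>F\<^esub> y) = lsum L (\<lambda>t. x t \<odot>\<^bsub>L\<^esub> d t \<oplus>\<^bsub>L\<^esub> y t \<odot>\<^bsub>L\<^esub> d t) ys"
      unfolding g_def using x xy dy by (intro lsum_cong) (auto simp: Fa L.smult_l_distr)
    then show "g (x \<oplus>\<^bsub>F\<^esub> y) = g x \<oplus>\<^bsub>L\<^esub> g y" unfolding g_def using x xy dy by (simp add: L.lsum_add)
  next
    fix a x assume x: "a \<in> carrier A" "x \<in> carrier F"
    have "g (a \<odot>\<^bsub>F\<^esub> x) = lsum L (\<lambda>t. a \<odot>\<^bsub>L\<^esub> (x t \<odot>\<^bsub>L\<^esub> d t)) ys"
      unfolding g_def using x xy dy by (intro lsum_cong) (auto simp: Fs L.smult_assoc1)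
    then show "g (a \<odot>\<^bsub>F\<^esub> x) = a \<odot>\<^bsub>L\<^esub> g x" unfolding g_def using x xy dy by (simp add: L.lsum_smult)
  qed
  have gc: "g ` carrier F \<subseteq> carrier L" unfolding g_def using xy dy by auto
  interpret F: module A F by fact
  have "sub L (g ` carrier F)"
  proof (rule subI[OF mL gc])
    show "\<zero>\<^bsub>L\<^esub> \<in> g ` carrier F" using linear_on_zero[OF mF mL glin F.M.zero_closed gc] F.M.zero_closed by (metis imageI)
    fix x y assume "x \<in> g ` carrier F" "y \<in> g ` carrier F"
    then obtain x' y' where "x = g x'" "x' \<in> carrier F" "y = g y'" "y' \<in> carrier F" by blast
    then have "x \<oplus>\<^bsub>L\<^esub> y = g (x' \<oplus>\<^bsub>F\<^esub> y')" "x' \<oplus>\<^bsub>F\<^esub> y' \<in> carrier F"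
      using linear_onD(1)[OF glin] F.M.a_closed[of x' y'] by (simp_all del: Fa)
    then show "x \<oplus>\<^bsub>L\<^esub> y \<in> g ` carrier F" by simp
  next
    fix a x assume "a \<in> carrier A" "x \<in> g ` carrier F"
    then obtain x' where "x = g x'" "x' \<in> carrier F" "a \<in> carrier A" by blast
    then have "a \<odot>\<^bsub>L\<^esub> x = g (a \<odot>\<^bsub>F\<^esub> x')" "a \<odot>\<^bsub>F\<^esub> x' \<in> carrier F"
      using linear_onD(2)[OF glin] F.smult_closed[of a x'] by (simp_all del: Fs)
    then show "a \<odot>\<^bsub>L\<^esub> x \<in> g ` carrier F" by simp
  qed
  moreover have "d y \<in> g ` carrier F" if "y \<in> set ys" for y
  proof -
    have "g (\<lambda>x\<in>set ys. if x = y then \<one> else \<zero>) = lsum L (\<lambda>x. (if x = y then \<one> else \<zero>) \<odot>\<^bsub>L\<^esub> d x) ys"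
      unfolding g_def by (intro lsum_cong) auto
    also have "\<dots> = d y" using ys(2) that dy by (intro L.lsum_delta) auto
    finally show ?thesis by (intro image_eqI[of _ _ "\<lambda>x\<in>set ys. if x = y then \<one> else \<zero>"]) (auto simp: Fc)
  qed
  ultimately have "fg L (map d ys) \<subseteq> g ` carrier F" by (intro fg_least) auto
  then have gs: "g ` carrier F = carrier L" using full gc by blast
  have gh: "restrict g (carrier F) \<in> mod_hom A F L" by (rule linear_mod_hom[OF glin gc mF])
  have id: "(\<lambda>x\<in>carrier L. x) \<in> mod_hom A L L" using mL linear_mod_hom[of L L "\<lambda>x. x"] by (simp add: linear_on_def)
  have gs': "restrict g (carrier F) ` carrier F = carrier L" using gs by simp
  obtain h where h: "h \<in> mod_hom A L F" "\<And>x. x \<in> carrier L \<Longrightarrow> restrict g (carrier F) (h x) = (\<lambda>x\<in>carrier L. x) x"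
    using assms(3) gh id gs' mF mL unfolding projective_module_def by blast
  note hD = mod_homD[OF h(1)]
  define dd where "dd y a = h (d a) y" for y a
  have ddc: "dd y a \<in> carrier A" if "y \<in> set ys" "a \<in> carrier A" for y a
    unfolding dd_def using xy hD(4) d(2) that by blast
  have der: "derivation (regular_module A) (dd y)" if y: "y \<in> set ys" for y
    unfolding derivation_def
  proof (intro conjI ballI)
    show "dd y \<in> carrier A \<rightarrow> carrier (regular_module A)" using ddc y by (simp add: regular_module_def)
    fix a b assume ab: "a \<in> carrier A" "b \<in> carrier A"
    show "dd y (a \<oplus> b) = dd y a \<oplus>\<^bsub>regular_module A\<^esub> dd y b"
      using ab y linear_onD(1)[OF hD(1)] d(2) by (simp add: dd_def d(3) Fa regular_module_def)
    show "dd y (a \<otimes> b) = a \<odot>\<^bsub>regular_module A\<^esub> dd y b \<oplus>\<^bsub>regular_module A\<^esub> b \<odot>\<^bsub>regular_module A\<^esub> dd y a"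
      using ab y linear_onD[OF hD(1)] d(2) by (simp add: dd_def d(4) Fa Fs regular_module_def)
  next
    fix c assume "c \<in> K"
    then show "dd y c = \<zero>\<^bsub>regular_module A\<^esub>"
      using d(5) linear_on_zero[OF mL mF hD(1) _ hD(2)] y by (simp add: dd_def Fz regular_module_def)
  qed
  have G: "X a = lsum Q (\<lambda>y. dd y a \<odot>\<^bsub>Q\<^esub> X y) ys" if Q: "Q \<in> \<DD>" and X: "derivation Q X" and a: "a \<in> carrier A" for Q X a
  proof -
    note mQ = cat_module[OF Q]
    obtain k where k: "k \<in> mod_hom A L Q" "iter_map A k u = Fn (\<lambda>a\<in>carrier A. Base (X a))"
      using u Q derivation_iff_DR(1)[OF mQ X] unfolding represents_def by blast
    have Xk: "X a = k (d a)" if "a \<in> carrier A" for a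
      using iter_map_hom(3)[OF mL mQ k(1) L(2), of "[a]"] k(2) that by (simp add: d_def)
    note kD = mod_homD[OF k(1)]
    have "d a = lsum L (\<lambda>y. dd y a \<odot>\<^bsub>L\<^esub> d y) ys"
      using h(2)[of "d a"] hD(4)[of "d a"] d(2)[OF a] by (simp add: g_def dd_def)
    then have "X a = k (lsum L (\<lambda>y. dd y a \<odot>\<^bsub>L\<^esub> d y) ys)" using Xk[OF a] by simp
    also have "\<dots> = lsum Q (\<lambda>y. k (dd y a \<odot>\<^bsub>L\<^esub> d y)) ys"
      using linear_on_zero[OF mL mQ kD(1) L.M.zero_closed kD(2)] linear_onD(1)[OF kD(1)] mL ddc dy a
      by (intro lsum_hom[where A = A]) auto
    also have "\<dots> = lsum Q (\<lambda>y. dd y a \<odot>\<^bsub>Q\<^esub> X y) ys"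
      using linear_onD(2)[OF kD(1)] ddc dy a Xk by (intro lsum_cong) auto
    finally show ?thesis .
  qed
  have "frame A K ys dd"
  proof (intro frame.intro frame_axioms.intro diffcalc_axioms)
    show "[n] \<cdot> \<one> \<in> Units A" if "0 < n" for n :: nat using zc that by (simp add: zero_characteristic_def)
    show "X a = lsum (regular_module A) (\<lambda>x. dd x a \<otimes> X x) ys"
      if "derivation (regular_module A) X" "a \<in> carrier A" for X a
      using G[OF regular_in_cat that] by (simp add: regular_module_def)
  qed (use ys der in auto)
  then have "diff_cat A K ys dd \<DD>"
    using diff_closed_axioms G by (intro diff_cat.intro diff_cat_axioms.intro) (simp_all add: frame.good_def)
  then show ?thesis by blast
qed

end

section \<open>Cohomology of cochain complexes\<close>

lemma a_r_coset_carrier_update [simp]: "S +>\<^bsub>M\<lparr>carrier := C\<rparr>\<^esub> x = S +>\<^bsub>M\<^esub> x"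
  by (simp add: a_r_coset_def r_coset_def)

lemma mod_homE:
  assumes "h \<in> mod_hom R M N"
  shows "x \<in> carrier M \<Longrightarrow> h x \<in> carrier N" "x \<in> carrier M \<Longrightarrow> y \<in> carrier M \<Longrightarrow> h (x \<oplus>\<^bsub>M\<^esub> y) = h x \<oplus>\<^bsub>N\<^esub> h y"
    "c \<in> carrier R \<Longrightarrow> x \<in> carrier M \<Longrightarrow> h (c \<odot>\<^bsub>M\<^esub> x) = c \<odot>\<^bsub>N\<^esub> h x"
  using assms by (auto simp: mod_hom_def lin_maps_def)

lemma mod_hom_zero:
  assumes "module R M" "module R N" "h \<in> mod_hom R M N"
  shows "h \<zero>\<^bsub>M\<^esub> = \<zero>\<^bsub>N\<^esub>"
proof -
  interpret M: module R M by fact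
  interpret N: module R N by fact
  show ?thesis
    using mod_homE(3)[OF assms(3) M.R.zero_closed M.M.zero_closed] mod_homE(1)[OF assms(3) M.M.zero_closed] by simp
qed

lemma mod_iso_sym:
  assumes "isomorphic_modules R M N"
  shows "isomorphic_modules R N M"
proof -
  obtain f where f: "f \<in> mod_hom R M N" "module R M" "module R N" "bij_betw f (carrier M) (carrier N)"
    using assms by (auto simp: isomorphic_modules_def mod_iso_def)
  interpret M: module R M by fact
  let ?g = "restrict (inv_into (carrier M) f) (carrier N)"
  have inj: "inj_on f (carrier M)" and im: "f ` carrier M = carrier N" using f(4) by (auto simp: bij_betw_def)
  have g: "inv_into (carrier M) f y \<in> carrier M" "f (inv_into (carrier M) f y) = y" if "y \<in> carrier N" for y
    using that im by (auto intro: inv_into_into f_inv_into_f)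
  have e: "inv_into (carrier M) f y = x" if "f x = y" "x \<in> carrier M" for x y using that inj by auto
  interpret N: module R N by fact
  have "?g \<in> mod_hom R N M"
    unfolding mod_hom_def lin_maps_def
  proof (intro CollectI conjI ballI)
    show "?g \<in> carrier N \<rightarrow>\<^sub>E carrier M" using g by auto
    fix x y assume xy: "x \<in> carrier N" "y \<in> carrier N"
    have "inv_into (carrier M) f (x \<oplus>\<^bsub>N\<^esub> y) = inv_into (carrier M) f x \<oplus>\<^bsub>M\<^esub> inv_into (carrier M) f y"
      using g xy mod_homE(2)[OF f(1)] by (intro e) auto
    then show "?g (x \<oplus>\<^bsub>N\<^esub> y) = ?g x \<oplus>\<^bsub>M\<^esub> ?g y" using xy by simp
  next
    fix c x assume xy: "c \<in> carrier R" "x \<in> carrier N"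
    have "inv_into (carrier M) f (c \<odot>\<^bsub>N\<^esub> x) = c \<odot>\<^bsub>M\<^esub> inv_into (carrier M) f x"
      using g xy mod_homE(3)[OF f(1)] by (intro e) auto
    then show "?g (c \<odot>\<^bsub>N\<^esub> x) = c \<odot>\<^bsub>M\<^esub> ?g x" using xy by simp
  qed
  then have "?g \<in> mod_iso R N M" using f(2-4) bij_betw_inv_into[OF f(4)] by (auto simp: mod_iso_def bij_betw_restrict_eq)
  then show ?thesis by (auto simp: isomorphic_modules_def)
qed

lemma cohomology_quotient:
  assumes "cochain_complex R C"
  shows "module R ((deg C n)\<lparr>carrier := cocycles C n\<rparr>)"
    "submodule (coboundaries C n) R ((deg C n)\<lparr>carrier := cocycles C n\<rparr>)"
proof -
  have M: "module R (deg C n)" and d: "differential C n \<in> mod_hom R (deg C n) (deg C (Suc n))"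
    and dd: "\<And>x. x \<in> carrier (deg C n) \<Longrightarrow> differential C (Suc n) (differential C n x) = \<zero>\<^bsub>deg C (Suc (Suc n))\<^esub>" for n
    using assms by (auto simp: cochain_complex_def)
  have z: "differential C n \<zero>\<^bsub>deg C n\<^esub> = \<zero>\<^bsub>deg C (Suc n)\<^esub>" for n using mod_hom_zero[OF M M d] .
  have neg: "a_inv (deg C n) x = (\<ominus>\<^bsub>R\<^esub> \<one>\<^bsub>R\<^esub>) \<odot>\<^bsub>deg C n\<^esub> x" "\<ominus>\<^bsub>R\<^esub> \<one>\<^bsub>R\<^esub> \<in> carrier R" if "x \<in> carrier (deg C n)" for x n
  proof -
    interpret N: module R "deg C n" using M .
    show "a_inv (deg C n) x = (\<ominus>\<^bsub>R\<^esub> \<one>\<^bsub>R\<^esub>) \<odot>\<^bsub>deg C n\<^esub> x" using N.neg_one_smult[OF that] by simp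
    show "\<ominus>\<^bsub>R\<^esub> \<one>\<^bsub>R\<^esub> \<in> carrier R" by simp
  qed
  interpret M: module R "deg C n" using M .
  interpret M': module R "deg C (Suc n)" using M .
  note dE = mod_homE[OF d[of n]]
  have sm: "c \<odot>\<^bsub>deg C n\<^esub> x \<in> cocycles C n" if "c \<in> carrier R" "x \<in> cocycles C n" for c x
    using that dE by (auto simp: cocycles_def)
  have Z: "submodule (cocycles C n) R (deg C n)"
  proof (rule M.submoduleI)
    show "a_inv (deg C n) x \<in> cocycles C n" if "x \<in> cocycles C n" for x
      using neg[of x n] sm that by (simp add: cocycles_def)
  qed (use sm z dE in \<open>auto simp: cocycles_def\<close>)
  from submodule.submodule_is_module[OF this M] show mZ: "module R ((deg C n)\<lparr>carrier := cocycles C n\<rparr>)" .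
  interpret Z: module R "(deg C n)\<lparr>carrier := cocycles C n\<rparr>" by fact
  have B: "coboundaries C n \<subseteq> cocycles C n" "\<zero>\<^bsub>deg C n\<^esub> \<in> coboundaries C n"
    "\<And>x y. x \<in> coboundaries C n \<Longrightarrow> y \<in> coboundaries C n \<Longrightarrow> x \<oplus>\<^bsub>deg C n\<^esub> y \<in> coboundaries C n"
    "\<And>c x. c \<in> carrier R \<Longrightarrow> x \<in> coboundaries C n \<Longrightarrow> c \<odot>\<^bsub>deg C n\<^esub> x \<in> coboundaries C n"
  proof -
    have "coboundaries C n \<subseteq> cocycles C n \<and> \<zero>\<^bsub>deg C n\<^esub> \<in> coboundaries C n \<and>
      (\<forall>x\<in>coboundaries C n. \<forall>y\<in>coboundaries C n. x \<oplus>\<^bsub>deg C n\<^esub> y \<in> coboundaries C n) \<and>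
      (\<forall>c\<in>carrier R. \<forall>x\<in>coboundaries C n. c \<odot>\<^bsub>deg C n\<^esub> x \<in> coboundaries C n)"
    proof (cases n)
      case 0
      then show ?thesis using z[of 0] M.M.zero_closed M.M.l_zero[OF M.M.zero_closed] M.smult_r_null
        by (auto simp: coboundaries_def cocycles_def)
    next
      case (Suc m)
      interpret N: module R "deg C m" using M .
      note dm = mod_homE[OF d[of m]]
      have b: "coboundaries C n = differential C m ` carrier (deg C m)" using Suc by (simp add: coboundaries_def)
      show ?thesis
        unfolding b
      proof (intro conjI ballI subsetI)
        show "x \<in> cocycles C n" if "x \<in> differential C m ` carrier (deg C m)" for x
          using that dm(1) dd[of _ m] Suc by (auto simp: cocycles_def)
        show "\<zero>\<^bsub>deg C n\<^esub> \<in> differential C m ` carrier (deg C m)" using z[of m] Suc N.M.zero_closed by (metis imageI)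
        fix x assume "x \<in> differential C m ` carrier (deg C m)"
        then obtain x' where x: "x = differential C m x'" "x' \<in> carrier (deg C m)" by blast
        show "x \<oplus>\<^bsub>deg C n\<^esub> y \<in> differential C m ` carrier (deg C m)" if "y \<in> differential C m ` carrier (deg C m)" for y
        proof -
          obtain y' where y: "y = differential C m y'" "y' \<in> carrier (deg C m)" using \<open>y \<in> _\<close> by blast
          have "x \<oplus>\<^bsub>deg C n\<^esub> y = differential C m (x' \<oplus>\<^bsub>deg C m\<^esub> y')" using x y dm(2) Suc by simp
          then show ?thesis using x y by simp
        qed
        show "c \<odot>\<^bsub>deg C n\<^esub> x \<in> differential C m ` carrier (deg C m)" if "c \<in> carrier R" for c
        proof -
          have "c \<odot>\<^bsub>deg C n\<^esub> x = differential C m (c \<odot>\<^bsub>deg C m\<^esub> x')" using x that dm(3) Suc by simp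
          then show ?thesis using x that by simp
        qed
      qed
    qed
    then show "coboundaries C n \<subseteq> cocycles C n" "\<zero>\<^bsub>deg C n\<^esub> \<in> coboundaries C n"
      "\<And>x y. x \<in> coboundaries C n \<Longrightarrow> y \<in> coboundaries C n \<Longrightarrow> x \<oplus>\<^bsub>deg C n\<^esub> y \<in> coboundaries C n"
      "\<And>c x. c \<in> carrier R \<Longrightarrow> x \<in> coboundaries C n \<Longrightarrow> c \<odot>\<^bsub>deg C n\<^esub> x \<in> coboundaries C n" by blast+
  qed
  show "submodule (coboundaries C n) R ((deg C n)\<lparr>carrier := cocycles C n\<rparr>)"
  proof (rule Z.submoduleI)
    fix x assume x: "x \<in> coboundaries C n"
    then have "x \<in> carrier ((deg C n)\<lparr>carrier := cocycles C n\<rparr>)" using B(1) by auto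
    from Z.neg_one_smult[OF this] have "a_inv ((deg C n)\<lparr>carrier := cocycles C n\<rparr>) x = (\<ominus>\<^bsub>R\<^esub> \<one>\<^bsub>R\<^esub>) \<odot>\<^bsub>deg C n\<^esub> x" by simp
    then show "a_inv ((deg C n)\<lparr>carrier := cocycles C n\<rparr>) x \<in> coboundaries C n" using B(4) x by simp
  qed (use B in auto)
qed

lemma quasi_isomorphismI:
  assumes map: "cochain_map R C C' f"
    and sur: "\<And>n z'. z' \<in> cocycles C' n \<Longrightarrow> \<exists>z\<in>cocycles C n. \<exists>b\<in>coboundaries C' n. f n z = b \<oplus>\<^bsub>deg C' n\<^esub> z'"
    and inj: "\<And>n z. z \<in> cocycles C n \<Longrightarrow> f n z \<in> coboundaries C' n \<Longrightarrow> z \<in> coboundaries C n"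
  shows "quasi_isomorphism R C C' f"
  unfolding quasi_isomorphism_def
proof (intro conjI allI map)
  fix n
  let ?Z = "(deg C n)\<lparr>carrier := cocycles C n\<rparr>" and ?B = "coboundaries C n"
    and ?Z' = "(deg C' n)\<lparr>carrier := cocycles C' n\<rparr>" and ?B' = "coboundaries C' n"
  have C: "cochain_complex R C" "cochain_complex R C'" and fh: "f n \<in> mod_hom R (deg C n) (deg C' n)"
    "\<And>n. f n \<in> mod_hom R (deg C n) (deg C' n)"
    "\<And>x. x \<in> carrier (deg C n) \<Longrightarrow> f (Suc n) (differential C n x) = differential C' n (f n x)"
    "\<And>n x. x \<in> carrier (deg C n) \<Longrightarrow> f (Suc n) (differential C n x) = differential C' n (f n x)"
    using map by (auto simp: cochain_map_def)
  note Q = cohomology_quotient[OF C(1), of n] and Q' = cohomology_quotient[OF C(2), of n]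
  interpret Z: module R ?Z using Q(1) .
  interpret Z': module R ?Z' using Q'(1) .
  note q = quot_module_props[OF Q] and q' = quot_module_props[OF Q']
  note H = module_quot[OF Q, folded cohomology_def] and H' = module_quot[OF Q', folded cohomology_def]
  have Mod: "module R (deg C n)" "module R (deg C' n)" for n using C by (auto simp: cochain_complex_def)
  have fZ: "f n z \<in> cocycles C' n" if "z \<in> cocycles C n" for z
    using that mod_homE(1)[OF fh(1)] fh(3)[of z] mod_hom_zero[OF Mod fh(2)[of "Suc n"]] by (simp add: cocycles_def)
  have fa: "f n (x \<oplus>\<^bsub>deg C n\<^esub> y) = f n x \<oplus>\<^bsub>deg C' n\<^esub> f n y" if "x \<in> cocycles C n" "y \<in> cocycles C n" for x y
    using that mod_homE(2)[OF fh(1)] by (simp add: cocycles_def)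
  have fB: "f n b \<in> ?B'" if "b \<in> ?B" for b
  proof (cases n)
    case 0
    then show ?thesis using that mod_hom_zero[OF Mod fh(1)] by (simp add: coboundaries_def)
  next
    case (Suc m)
    then obtain x where x: "x \<in> carrier (deg C m)" "b = differential C m x" using \<open>b \<in> ?B\<close> by (auto simp: coboundaries_def)
    then have "f n b = differential C' m (f m x)" using fh(4)[OF x(1)] Suc by simp
    then show ?thesis using mod_homE(1)[OF fh(2) x(1)] Suc by (auto simp: coboundaries_def)
  qed
  have qq: "?B +>\<^bsub>?Z\<^esub> z \<in> carrier (cohomology C n)" if "z \<in> cocycles C n" for z
    using q(1) that by (auto simp: cohomology_def)
  have cm: "cohomology_map C C' f n (?B +>\<^bsub>deg C n\<^esub> z) = ?B' +>\<^bsub>deg C' n\<^esub> f n z" if z: "z \<in> cocycles C n" for z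
  proof -
    have "?B' +>\<^bsub>deg C' n\<^esub> f n x = ?B' +>\<^bsub>deg C' n\<^esub> f n z" if x: "x \<in> ?B +>\<^bsub>deg C n\<^esub> z" for x
    proof -
      obtain b where b: "b \<in> ?B" "x = b \<oplus>\<^bsub>deg C n\<^esub> z" using q(6)[of z x] x z by auto
      have "b \<in> cocycles C n" using b(1) Z.submoduleE(1)[OF Q(2)] by auto
      then have "f n x = f n b \<oplus>\<^bsub>deg C' n\<^esub> f n z" using b(2) fa z by simp
      then have "f n x \<in> ?B' +>\<^bsub>deg C' n\<^esub> f n z" using q'(6)[of "f n z" "f n x"] fB[OF b(1)] fZ[OF z] by auto
      then show ?thesis using q'(7)[of "f n z" "f n x"] fZ[OF z] by simp
    qed
    moreover have "z \<in> ?B +>\<^bsub>deg C n\<^esub> z" using q(8)[of z] z by simp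

    ultimately have "(\<Union>x\<in>?B +>\<^bsub>deg C n\<^esub> z. ?B' +>\<^bsub>deg C' n\<^esub> f n x) = ?B' +>\<^bsub>deg C' n\<^esub> f n z" by blast
    then show ?thesis using qq[OF z] by (simp add: cohomology_map_def)
  qed
  have surj: "carrier (cohomology C n) = (\<lambda>z. ?B +>\<^bsub>deg C n\<^esub> z) ` cocycles C n"
    "carrier (cohomology C' n) = (\<lambda>z. ?B' +>\<^bsub>deg C' n\<^esub> z) ` cocycles C' n"
    using q(1) q'(1) by (auto simp: cohomology_def)
  show "cohomology_map C C' f n \<in> mod_iso R (cohomology C n) (cohomology C' n)"
    unfolding mod_iso_def
  proof (intro CollectI conjI H H')
    show "cohomology_map C C' f n \<in> mod_hom R (cohomology C n) (cohomology C' n)"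
      unfolding mod_hom_def lin_maps_def
    proof (intro CollectI conjI ballI)
      show "cohomology_map C C' f n \<in> carrier (cohomology C n) \<rightarrow>\<^sub>E carrier (cohomology C' n)"
        using cm fZ by (auto simp: surj cohomology_map_def[where C = C])
      fix X Y assume "X \<in> carrier (cohomology C n)" "Y \<in> carrier (cohomology C n)"
      then obtain x y where xy: "X = ?B +>\<^bsub>deg C n\<^esub> x" "x \<in> cocycles C n" "Y = ?B +>\<^bsub>deg C n\<^esub> y" "y \<in> cocycles C n"
        by (auto simp: surj)
      have "X \<oplus>\<^bsub>cohomology C n\<^esub> Y = ?B +>\<^bsub>deg C n\<^esub> (x \<oplus>\<^bsub>deg C n\<^esub> y)" using q(2)[of x y] xy by (simp add: cohomology_def)
      moreover have "x \<oplus>\<^bsub>deg C n\<^esub> y \<in> cocycles C n" using Z.M.a_closed[of x y] xy by simp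
      ultimately show "cohomology_map C C' f n (X \<oplus>\<^bsub>cohomology C n\<^esub> Y) =
        cohomology_map C C' f n X \<oplus>\<^bsub>cohomology C' n\<^esub> cohomology_map C C' f n Y"
        using xy cm fa fZ q'(2)[of "f n x" "f n y"] by (simp add: cohomology_def)
    next
      fix c X assume c: "c \<in> carrier R" and "X \<in> carrier (cohomology C n)"
      then obtain x where x: "X = ?B +>\<^bsub>deg C n\<^esub> x" "x \<in> cocycles C n" by (auto simp: surj)
      have "c \<odot>\<^bsub>cohomology C n\<^esub> X = ?B +>\<^bsub>deg C n\<^esub> (c \<odot>\<^bsub>deg C n\<^esub> x)" using q(3)[of c x] x c by (simp add: cohomology_def)
      moreover have "c \<odot>\<^bsub>deg C n\<^esub> x \<in> cocycles C n" using Z.smult_closed[of c x] x c by simp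
      moreover have "f n (c \<odot>\<^bsub>deg C n\<^esub> x) = c \<odot>\<^bsub>deg C' n\<^esub> f n x" using mod_homE(3)[OF fh(1) c] x by (simp add: cocycles_def)
      ultimately show "cohomology_map C C' f n (c \<odot>\<^bsub>cohomology C n\<^esub> X) = c \<odot>\<^bsub>cohomology C' n\<^esub> cohomology_map C C' f n X"
        using x cm fZ q'(3)[of c "f n x"] c by (simp add: cohomology_def)
    qed
    show "bij_betw (cohomology_map C C' f n) (carrier (cohomology C n)) (carrier (cohomology C' n))"
      unfolding bij_betw_def
    proof
      show "inj_on (cohomology_map C C' f n) (carrier (cohomology C n))"
      proof (rule inj_onI)
        fix X Y assume X: "X \<in> carrier (cohomology C n)" "Y \<in> carrier (cohomology C n)"
          and e: "cohomology_map C C' f n X = cohomology_map C C' f n Y"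
        obtain x y where xy: "X = ?B +>\<^bsub>deg C n\<^esub> x" "x \<in> cocycles C n" "Y = ?B +>\<^bsub>deg C n\<^esub> y" "y \<in> cocycles C n"
          using X by (auto simp: surj)
        define w where "w = x \<oplus>\<^bsub>deg C n\<^esub> (\<ominus>\<^bsub>R\<^esub> \<one>\<^bsub>R\<^esub>) \<odot>\<^bsub>deg C n\<^esub> y"
        have ny: "(\<ominus>\<^bsub>R\<^esub> \<one>\<^bsub>R\<^esub>) \<odot>\<^bsub>deg C n\<^esub> y \<in> cocycles C n" using Z.smult_closed[of "\<ominus>\<^bsub>R\<^esub> \<one>\<^bsub>R\<^esub>" y] xy by simp
        have w: "w \<in> cocycles C n" using Z.M.a_closed[of x] ny xy by (simp add: w_def)
        have "w \<oplus>\<^bsub>deg C n\<^esub> y = x"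
        proof -
          interpret N: module R "deg C n" using Mod(1) .
          have "x \<in> carrier (deg C n)" "y \<in> carrier (deg C n)" using xy by (auto simp: cocycles_def)
          then show ?thesis unfolding w_def by (simp add: N.neg_one_smult N.M.a_assoc N.M.l_neg)
        qed
        then have fx: "f n x = f n w \<oplus>\<^bsub>deg C' n\<^esub> f n y" using fa[OF w xy(4)] by simp
        have "f n x \<in> ?B' +>\<^bsub>deg C' n\<^esub> f n x"
          using q'(8)[of "f n x"] fZ[OF xy(2)] by simp
        then have "f n x \<in> ?B' +>\<^bsub>deg C' n\<^esub> f n y" using e xy cm by simp
        then obtain b where b: "b \<in> ?B'" "f n x = b \<oplus>\<^bsub>deg C' n\<^esub> f n y" using q'(6)[of "f n y" "f n x"] fZ xy by auto
        have "b \<in> cocycles C' n" using b(1) Z'.submoduleE(1)[OF Q'(2)] by auto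
        then have "f n w = b" using fx b(2) fZ[OF w] fZ[OF xy(4)] Z'.M.add.right_cancel[of "f n y" "f n w" b] by simp
        then have "w \<in> ?B" using inj[OF w] b(1) by simp
        then have "x \<in> ?B +>\<^bsub>deg C n\<^esub> y" using q(6)[of y x] xy \<open>w \<oplus>\<^bsub>deg C n\<^esub> y = x\<close> by auto
        then show "X = Y" using q(7)[of y x] xy by simp
      qed
      show "cohomology_map C C' f n ` carrier (cohomology C n) = carrier (cohomology C' n)"
      proof
        show "cohomology_map C C' f n ` carrier (cohomology C n) \<subseteq> carrier (cohomology C' n)" using cm fZ by (auto simp: surj)
        show "carrier (cohomology C' n) \<subseteq> cohomology_map C C' f n ` carrier (cohomology C n)"
        proof
          fix X assume "X \<in> carrier (cohomology C' n)"
          then obtain z' where z': "X = ?B' +>\<^bsub>deg C' n\<^esub> z'" "z' \<in> cocycles C' n" by (auto simp: surj)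
          obtain z b where z: "z \<in> cocycles C n" "b \<in> ?B'" "f n z = b \<oplus>\<^bsub>deg C' n\<^esub> z'" using sur[OF z'(2)] by blast
          then have "f n z \<in> ?B' +>\<^bsub>deg C' n\<^esub> z'" using q'(6)[of z' "f n z"] z'(2) by auto
          then have "?B' +>\<^bsub>deg C' n\<^esub> f n z = X" using q'(7)[of z' "f n z"] z' by simp
          then have "cohomology_map C C' f n (?B +>\<^bsub>deg C n\<^esub> z) = X" using cm[OF z(1)] by simp
          then show "X \<in> cohomology_map C C' f n ` carrier (cohomology C n)" using z(1) by (auto simp: surj)
        qed
      qed
    qed
  qed
qed

section \<open>Higher de Rham complexes\<close>

lemma compose_mod_hom:
  assumes "module R L" "h \<in> mod_hom R L M" "g \<in> mod_hom R M N"
  shows "compose (carrier L) g h \<in> mod_hom R L N"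
proof -
  interpret L: module R L by fact
  show ?thesis
    using mod_homE[OF assms(2)] mod_homE[OF assms(3)] by (simp add: mod_hom_def lin_maps_def compose_def PiE_def)
qed

context diffcalc
begin

lemma carrier_scalars [simp]: "carrier (scalars K A) = K"
  by (simp add: scalars_def)

lemma module_scalars:
  assumes "module A M"
  shows "module (scalars K A) M"
proof -
  interpret M: module A M by fact
  have "cring (scalars K A)"
    unfolding scalars_def using R.subcring_iff[of K] R.subcringI'[OF subring_K] K_carrier by auto
  then show ?thesis
    by (rule moduleI[OF _ M.abelian_group_axioms])
      (auto simp: scalars_def K_carrier M.smult_l_distr M.smult_r_distr M.smult_assoc1)
qed

lemma mod_hom_scalars: "h \<in> mod_hom A M N \<Longrightarrow> h \<in> mod_hom (scalars K A) M N"
  by (auto simp: mod_hom_def lin_maps_def K_carrier)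

end

section \<open>Words as elements of the modules of forms\<close>

locale forms = diff_cat A K xs dd \<DD>
  for A :: "('u, 'z) ring_scheme" (structure) and K xs dd \<DD> +
  fixes \<Lambda> :: "nat list \<Rightarrow> ('u, 'u) module"
    and \<eta> :: "nat list \<Rightarrow> ('u, 'u) module \<Rightarrow> ('u \<Rightarrow> 'u) \<Rightarrow> ('u, 'u) iter"
  assumes forms: "form_system K A \<DD> \<Lambda> \<eta>"
begin

abbreviation "uelem \<equiv> universal_element \<Lambda> \<eta>"

definition E :: "nat list \<Rightarrow> 'u list list \<Rightarrow> 'u" where
  "E s f = evs (\<Lambda> s) (uelem s) f"

lemma univ_represents:
  assumes "pos_seq s"
  shows "represents (\<Lambda> s) s (uelem s)"
    "Q \<in> \<DD> \<Longrightarrow> h \<in> mod_hom A (\<Lambda> s) Q \<Longrightarrow> \<eta> s Q h = iter_map A h (uelem s)"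
proof -
  have "represents (\<Lambda> s) s (uelem s) \<and> (\<forall>Q\<in>\<DD>. \<forall>h\<in>mod_hom A (\<Lambda> s) Q. \<eta> s Q h = iter_map A h (uelem s))"
  proof (cases "s = []")
    case True
    then have "\<Lambda> s = regular_module A" "\<And>Q h. \<eta> s Q h = Base (h \<one>)" using forms by (auto simp: form_system_def)
    then show ?thesis using represents_Nil True by (simp add: universal_element_def regular_module_def)
  next
    case False
    then have "strict_representation A \<DD> (DD K A s) (iter_map A) (\<Lambda> s) (\<eta> s)"
      using forms assms by (simp add: form_system_def)
    from represents_strict[OF this] show ?thesis by (simp add: universal_element_def)
  qed
  then show "represents (\<Lambda> s) s (uelem s)"
    "Q \<in> \<DD> \<Longrightarrow> h \<in> mod_hom A (\<Lambda> s) Q \<Longrightarrow> \<eta> s Q h = iter_map A h (uelem s)" by blast+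
qed

lemma univ_facts:
  assumes "pos_seq s"
  shows "\<Lambda> s \<in> \<DD>" "module A (\<Lambda> s)" "uelem s \<in> DR 0 s (\<Lambda> s)" "uelem s \<in> carrier (Wm s (\<Lambda> s))"
    "Q \<in> \<DD> \<Longrightarrow> X \<in> DR 0 s Q \<Longrightarrow> \<exists>h\<in>mod_hom A (\<Lambda> s) Q. iter_map A h (uelem s) = X"
proof -
  show a: "\<Lambda> s \<in> \<DD>" "uelem s \<in> DR 0 s (\<Lambda> s)"
    "Q \<in> \<DD> \<Longrightarrow> X \<in> DR 0 s Q \<Longrightarrow> \<exists>h\<in>mod_hom A (\<Lambda> s) Q. iter_map A h (uelem s) = X"
    using univ_represents(1)[OF assms] by (auto simp: represents_def)
  show "module A (\<Lambda> s)" by (rule cat_module[OF a(1)])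
  show "uelem s \<in> carrier (Wm s (\<Lambda> s))" by (rule DR_carrier[OF a(1,2)])
qed

lemma E_onto: "pos_seq s \<Longrightarrow> E s ` FS (length s) = carrier (\<Lambda> s)"
  using represents_span[OF univ_represents(1)] by (simp add: E_def[abs_def])

lemma E_closed: "pos_seq s \<Longrightarrow> f \<in> FS (length s) \<Longrightarrow> E s f \<in> carrier (\<Lambda> s)"
  using E_onto by blast

lemma E_obtain:
  assumes "pos_seq s" "x \<in> carrier (\<Lambda> s)"
  obtains f where "f \<in> FS (length s)" "x = E s f"
  using assms E_onto[OF assms(1)] by blast

lemma E_append: "\<lbrakk>pos_seq s; f \<in> FS (length s); g \<in> FS (length s)\<rbrakk> \<Longrightarrow> E s (f @ g) = E s f \<oplus>\<^bsub>\<Lambda> s\<^esub> E s g"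
  unfolding E_def by (rule evs_append[OF univ_facts(2,4)])

lemma E_Nil [simp]: "E s [] = \<zero>\<^bsub>\<Lambda> s\<^esub>"
  by (simp add: E_def)

lemma hom_E:
  "\<lbrakk>pos_seq s; module A Q; h \<in> mod_hom A (\<Lambda> s) Q; f \<in> FS (length s)\<rbrakk> \<Longrightarrow> h (E s f) = evs Q (iter_map A h (uelem s)) f"
  unfolding E_def by (rule iter_map_hom(2)[OF univ_facts(2) _ _ univ_facts(3), symmetric])

text \<open>Uniqueness holds for all target modules and not just for objects, because the values of
  the universal element generate.\<close>

lemma hom_eqI:
  assumes "pos_seq s" "module A Q" "h \<in> mod_hom A (\<Lambda> s) Q" "h' \<in> mod_hom A (\<Lambda> s) Q"
    "iter_map A h (uelem s) = iter_map A h' (uelem s)"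
  shows "h = h'"
proof (rule extensionalityI[OF mod_homD(3)[OF assms(3)] mod_homD(3)[OF assms(4)]])
  fix x assume "x \<in> carrier (\<Lambda> s)"
  then obtain f where "f \<in> FS (length s)" "x = E s f" by (rule E_obtain[OF assms(1)])
  then show "h x = h' x" using hom_E[OF assms(1,2,3)] hom_E[OF assms(1,2,4)] assms(5) by simp
qed

text \<open>Tests of type \<open>s\<close> are the homomorphisms out of \<open>\<Lambda> s\<close>,
  so agreement under all tests is equality of elements. This translates the results on words into
  results on the complexes.\<close>

lemma E_eq_iff:
  assumes "pos_seq s" "f \<in> FS (length s)" "g \<in> FS (length s)"
  shows "E s f = E s g \<longleftrightarrow> eqv 0 s f g"
proof
  assume e: "E s f = E s g"
  show "eqv 0 s f g"
    unfolding eqv_def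
  proof (intro ballI)
    fix Q X assume Q: "Q \<in> \<DD>" "X \<in> DR 0 s Q"
    obtain h where h: "h \<in> mod_hom A (\<Lambda> s) Q" "iter_map A h (uelem s) = X" using univ_facts(5)[OF assms(1) Q] by blast
    show "evs Q X f = evs Q X g"
      using hom_E[OF assms(1) cat_module[OF Q(1)] h(1) assms(2)] hom_E[OF assms(1) cat_module[OF Q(1)] h(1) assms(3)]
        e h(2) by simp
  qed
next
  assume "eqv 0 s f g"
  then show "E s f = E s g" unfolding E_def by (rule eqvD[OF _ univ_facts(1,3)[OF assms(1)]])
qed

text \<open>The module of operators is only isomorphic to an object \<open>Y\<close>.
  Representability is applied to \<open>Y\<close> and the homomorphism carried back along the
  isomorphism; uniqueness comes from \<open>hom_eqI\<close>.\<close>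

lemma differential_exists:
  assumes "pos_seq (s @ [k])"
  defines "P \<equiv> Diffp K A k (regular_module A) (\<Lambda> (s @ [k]))"
  shows "module A P" "\<exists>!f. f \<in> mod_hom A (\<Lambda> s) P \<and> hom_to_D A \<Lambda> \<eta> s f = iter_split A (length s) (uelem (s @ [k]))"
proof -
  have s: "pos_seq s" using assms(1) by simp
  note L = univ_facts[OF s] and L' = univ_facts[OF assms(1)]
  obtain Y j where Y: "Y \<in> \<DD>" "module A P" "module A Y" "linear_on P Y (carrier P) j" "bij_betw j (carrier P) (carrier Y)"
    using in_cat_Diffp[OF L'(1), of k] unfolding P_def[symmetric] by (rule in_catE)
  show mP: "module A P" by fact
  let ?X = "iter_split A (length s) (uelem (s @ [k]))"
  have X: "?X \<in> DR 0 s P" unfolding P_def by (rule iter_split_DR(2)[OF L'(2) mP[unfolded P_def] L'(3)])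
  have Xc: "?X \<in> carrier (Wm s P)" using X DR_subset[OF mP] by blast
  have j: "restrict j (carrier P) \<in> mod_hom A P Y" using Y by (intro linear_mod_hom) (auto simp: bij_betw_def)
  note g = bij_inv_linear[OF Y(2-5)]
  let ?g = "restrict (inv_into (carrier P) j) (carrier Y)"
  have gh: "?g \<in> mod_hom A Y P" using g Y(3) by (intro linear_mod_hom) (auto simp: bij_betw_def)
  obtain h where h: "h \<in> mod_hom A (\<Lambda> s) Y" "iter_map A h (uelem s) = iter_map A (restrict j (carrier P)) ?X"
    using L(5)[OF Y(1) iter_map_hom(1)[OF mP Y(3) j X]] by blast
  interpret L: module A "\<Lambda> s" by (rule L(2))
  have f: "compose (carrier (\<Lambda> s)) ?g h \<in> mod_hom A (\<Lambda> s) P"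
    by (rule compose_mod_hom[OF L(2) h(1) gh])
  have "iter_map A (compose (carrier (\<Lambda> s)) ?g h) (uelem s) = ?X"
  proof (rule ev_ext[OF mP _ Xc])
    show "iter_map A (compose (carrier (\<Lambda> s)) ?g h) (uelem s) \<in> carrier (Wm s P)"
      using iter_map_hom(1)[OF L(2) mP f L(3)] DR_subset[OF mP] by blast
    fix as assume as: "as \<in> tuples (length s)"
    have c: "ev as (uelem s) \<in> carrier (\<Lambda> s)" "ev as ?X \<in> carrier P"
      using ev_carrier[OF L(2,4) as] ev_carrier[OF mP Xc as] by auto
    have "h (ev as (uelem s)) = j (ev as ?X)"
      using iter_map_hom(3)[OF L(2) Y(3) h(1) L(3) as] iter_map_hom(3)[OF mP Y(3) j X as] h(2) c by simp
    then have "compose (carrier (\<Lambda> s)) ?g h (ev as (uelem s)) = ev as ?X"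
      using c Y(5) by (auto simp: compose_def bij_betw_def)
    then show "ev as (iter_map A (compose (carrier (\<Lambda> s)) ?g h) (uelem s)) = ev as ?X"
      using iter_map_hom(3)[OF L(2) mP f L(3) as] by simp
  qed
  then show "\<exists>!f. f \<in> mod_hom A (\<Lambda> s) P \<and> hom_to_D A \<Lambda> \<eta> s f = ?X"
    unfolding hom_to_D_def using f hom_eqI[OF s mP] by (intro ex1I[of _ "compose (carrier (\<Lambda> s)) ?g h"]) auto
qed

text \<open>After re-bracketing, the coefficient of a word acts on the argument of the last
  operator. Evaluation at one therefore turns the coefficient into the last argument and leaves the
  coefficient one.\<close>

lemma differential_E:
  assumes "pos_seq (s @ [k])"
  shows "f \<in> FS (length s) \<Longrightarrow> deRham_differential K A \<Lambda> \<eta> s k (E s f) = E (s @ [k]) (dw f)"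
    "deRham_differential K A \<Lambda> \<eta> s k \<in> mod_hom (scalars K A) (\<Lambda> s) (\<Lambda> (s @ [k]))"
proof -
  let ?Q = "\<Lambda> (s @ [k])"
  let ?P = "Diffp K A k (regular_module A) ?Q"
  let ?d = "deRham_differential K A \<Lambda> \<eta> s k"
  have s: "pos_seq s" using assms(1) by simp
  note L = univ_facts[OF s] and L' = univ_facts[OF assms(1)]
  obtain g where g: "g \<in> mod_hom A (\<Lambda> s) ?P" "hom_to_D A \<Lambda> \<eta> s g = iter_split A (length s) (uelem (s @ [k]))"
    and d: "?d = (\<lambda>\<omega>\<in>carrier (\<Lambda> s). g \<omega> \<one>)"
    using theI'[OF differential_exists(2)[OF assms]] unfolding deRham_differential_def Let_def by blast
  note mP = differential_exists(1)[OF assms]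
  have e: "?d (E s f) = E (s @ [k]) (dw f)" if f: "f \<in> FS (length s)" for f
  proof -
    have "g (E s f) = evs ?P (iter_split A (length s) (uelem (s @ [k]))) f"
      using hom_E[OF s mP g(1) f] g(2) by (simp add: hom_to_D_def)
    then have "?d (E s f) = lsum ?Q (\<lambda>w. ev (butlast w @ [last w \<otimes> \<one>]) (uelem (s @ [k]))) f"
      using evs_iter_split[OF L'(2) mP L'(3) f R.one_closed] E_closed[OF s f] by (simp add: d)
    also have "\<dots> = lsum ?Q (\<lambda>w. ev w (uelem (s @ [k]))) f"
    proof (intro lsum_cong refl)
      fix w assume "w \<in> set f"
      then have "w \<in> tuples (Suc (length s))" using FS_mem f by blast
      then show "ev (butlast w @ [last w \<otimes> \<one>]) (uelem (s @ [k])) = ev w (uelem (s @ [k]))"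
        by (rule tuples_Suc_snoc) simp
    qed
    also have "\<dots> = E (s @ [k]) (dw f)" unfolding E_def by (rule evs_dw[OF L'(2,4) f, symmetric])
    finally show ?thesis .
  qed
  then show "f \<in> FS (length s) \<Longrightarrow> ?d (E s f) = E (s @ [k]) (dw f)" .
  interpret L: module A "\<Lambda> s" by (rule L(2))
  interpret Q: diffmod A K ?Q using L'(2) diffcalc_axioms by (intro diffmod.intro)
  show "?d \<in> mod_hom (scalars K A) (\<Lambda> s) ?Q"
    unfolding mod_hom_def lin_maps_def
  proof (intro CollectI conjI ballI)
    show "?d \<in> carrier (\<Lambda> s) \<rightarrow>\<^sub>E carrier ?Q"
    proof
      fix x assume "x \<in> carrier (\<Lambda> s)"
      then obtain f where "f \<in> FS (length s)" "x = E s f" by (rule E_obtain[OF s])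
      then show "?d x \<in> carrier ?Q" using e E_closed[OF assms, of "dw f"] by simp
    qed (simp add: d)
    fix x y assume xy: "x \<in> carrier (\<Lambda> s)" "y \<in> carrier (\<Lambda> s)"
    obtain f where f: "f \<in> FS (length s)" "x = E s f" using E_obtain[OF s xy(1)] .
    obtain h where h: "h \<in> FS (length s)" "y = E s h" using E_obtain[OF s xy(2)] .
    show "?d (x \<oplus>\<^bsub>\<Lambda> s\<^esub> y) = ?d x \<oplus>\<^bsub>?Q\<^esub> ?d y"
      using e[of "f @ h"] e[OF f(1)] e[OF h(1)] f h E_append[OF s] E_append[OF assms, of "dw f" "dw h"] by simp
  next
    fix c x assume c: "c \<in> carrier (scalars K A)" and x: "x \<in> carrier (\<Lambda> s)"
    have cK: "c \<in> K" "c \<in> carrier A" using c K_carrier by auto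
    have "g x \<in> carrier ?P" using mod_homD(4)[OF g(1) x] .
    then have "g x \<in> lin_maps K (regular_module A) ?Q"
      by (simp add: Diff_plus_def map_module_def diff_ops_def)
    then have "\<forall>c\<in>K. \<forall>a\<in>carrier A. g x (c \<otimes> a) = c \<odot>\<^bsub>?Q\<^esub> g x a"
      by (simp add: lin_maps_def regular_module_def)
    then have "g x (c \<otimes> \<one>) = c \<odot>\<^bsub>?Q\<^esub> g x \<one>" using cK(1) R.one_closed by blast
    moreover have "g (c \<odot>\<^bsub>\<Lambda> s\<^esub> x) = c \<odot>\<^bsub>?P\<^esub> g x" using mod_homE(3)[OF g(1) cK(2) x] .
    then have "g (c \<odot>\<^bsub>\<Lambda> s\<^esub> x) \<one> = g x (c \<otimes> \<one>)"
      by (simp del: R.r_one add: Diff_plus_def map_module_def regular_module_def)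
    ultimately show "?d (c \<odot>\<^bsub>\<Lambda> s\<^esub> x) = c \<odot>\<^bsub>?Q\<^esub> ?d x" using x cK by (simp add: d)
  qed
qed

text \<open>The universal element of type \<open>s\<close> is also a test of type \<open>t\<close>,
  and the canonical map is the homomorphism belonging to it. On words it changes nothing.\<close>

lemma canonical_E:
  assumes "pos_seq s" "list_all2 (\<le>) s t"
  defines "c \<equiv> THE c. c \<in> mod_hom A (\<Lambda> t) (\<Lambda> s) \<and> \<eta> t (\<Lambda> s) c = uelem s"
  shows "c \<in> mod_hom A (\<Lambda> t) (\<Lambda> s)" "f \<in> FS (length s) \<Longrightarrow> c (E t f) = E s f"
proof -
  have t: "pos_seq t" "length t = length s"
    using assms(1,2) by (fastforce simp: list_all2_conv_all_nth in_set_conv_nth, simp add: list_all2_lengthD)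
  note S = univ_facts[OF assms(1)]
  have "uelem s \<in> DR 0 t (\<Lambda> s)" using DR_mono[OF S(2) assms(2), of 0] S(3) by blast
  then obtain h where h: "h \<in> mod_hom A (\<Lambda> t) (\<Lambda> s)" "iter_map A h (uelem t) = uelem s"
    using univ_facts(5)[OF t(1) S(1)] by blast
  have "\<exists>!c. c \<in> mod_hom A (\<Lambda> t) (\<Lambda> s) \<and> \<eta> t (\<Lambda> s) c = uelem s"
    using h univ_represents(2)[OF t(1) S(1)] hom_eqI[OF t(1) S(2)] by (intro ex1I[of _ h]) auto
  from theI'[OF this] have c: "c \<in> mod_hom A (\<Lambda> t) (\<Lambda> s)" "\<eta> t (\<Lambda> s) c = uelem s" unfolding c_def by auto
  then show "c \<in> mod_hom A (\<Lambda> t) (\<Lambda> s)" by simp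
  show "c (E t f) = E s f" if "f \<in> FS (length s)"
    using hom_E[OF t(1) S(2) c(1)] that t(2) c(2) univ_represents(2)[OF t(1) S(1) c(1)] by (simp add: E_def)
qed

lemma initial_seq_Suc: "initial_seq \<sigma> (Suc n) = initial_seq \<sigma> n @ [\<sigma> n]"
  by (simp add: initial_seq_def)

lemma length_initial_seq [simp]: "length (initial_seq \<sigma> n) = n"
  by (simp add: initial_seq_def)

lemma pos_initial_seq: "\<forall>i. 0 < \<sigma> i \<Longrightarrow> pos_seq (initial_seq \<sigma> n)"
  by (auto simp: initial_seq_def)

lemma dR_simps [simp]:
  "deg (dR K A \<Lambda> \<eta> \<sigma>) n = \<Lambda> (initial_seq \<sigma> n)"
  "differential (dR K A \<Lambda> \<eta> \<sigma>) n = deRham_differential K A \<Lambda> \<eta> (initial_seq \<sigma> n) (\<sigma> n)"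
  by (simp_all add: dR_def)

lemma dR_differential:
  assumes "\<forall>i. 0 < \<sigma> i" "f \<in> FS n"
  shows "differential (dR K A \<Lambda> \<eta> \<sigma>) n (E (initial_seq \<sigma> n) f) = E (initial_seq \<sigma> (Suc n)) (dw f)"
  using differential_E(1)[of "initial_seq \<sigma> n" "\<sigma> n" f] assms pos_initial_seq[OF assms(1), of "Suc n"]
  by (simp add: initial_seq_Suc)

lemma dR_complex:
  assumes pos: "\<forall>i. 0 < \<sigma> i"
  shows "cochain_complex (scalars K A) (dR K A \<Lambda> \<eta> \<sigma>)"
  unfolding cochain_complex_def
proof (intro allI conjI ballI)
  fix n
  note p = pos_initial_seq[OF pos]
  show "module (scalars K A) (deg (dR K A \<Lambda> \<eta> \<sigma>) n)"
    using module_scalars[OF univ_facts(2)[OF p]] by simp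
  show "differential (dR K A \<Lambda> \<eta> \<sigma>) n \<in> mod_hom (scalars K A) (deg (dR K A \<Lambda> \<eta> \<sigma>) n) (deg (dR K A \<Lambda> \<eta> \<sigma>) (Suc n))"
    using differential_E(2)[of "initial_seq \<sigma> n" "\<sigma> n"] p[of "Suc n"] by (simp add: initial_seq_Suc)
  fix x assume "x \<in> carrier (deg (dR K A \<Lambda> \<eta> \<sigma>) n)"
  then obtain f where f: "f \<in> FS n" "x = E (initial_seq \<sigma> n) f" using E_obtain[OF p[of n], of x] by auto
  have "E (initial_seq \<sigma> (Suc (Suc n))) (dw (dw f)) = E (initial_seq \<sigma> (Suc (Suc n))) []"
    using f(1) by (subst E_eq_iff[OF p]) (simp_all add: dw_zero[of _ n])
  then show "differential (dR K A \<Lambda> \<eta> \<sigma>) (Suc n) (differential (dR K A \<Lambda> \<eta> \<sigma>) n x) = \<zero>\<^bsub>deg (dR K A \<Lambda> \<eta> \<sigma>) (Suc (Suc n))\<^esub>"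
    using f dR_differential[OF pos, of f n] dR_differential[OF pos, of "dw f" "Suc n"] by (simp del: dR_simps(2))
qed

lemma dR_cocycle_iff:
  assumes "\<forall>i. 0 < \<sigma> i" "f \<in> FS n"
  shows "E (initial_seq \<sigma> n) f \<in> cocycles (dR K A \<Lambda> \<eta> \<sigma>) n \<longleftrightarrow> eqv 0 (initial_seq \<sigma> (Suc n)) (dw f) []"
  using dR_differential[OF assms] E_closed[OF pos_initial_seq[OF assms(1), of n], of f] assms(2)
    E_eq_iff[OF pos_initial_seq[OF assms(1), of "Suc n"], of "dw f" "[]"]
  by (simp add: cocycles_def del: dR_simps(2))

lemma dR_coboundary_iff:
  assumes pos: "\<forall>i. 0 < \<sigma> i" and f: "f \<in> FS n"
  shows "E (initial_seq \<sigma> n) f \<in> coboundaries (dR K A \<Lambda> \<eta> \<sigma>) n \<longleftrightarrow> (\<exists>h\<in>bnd 0 n. eqv 0 (initial_seq \<sigma> n) f h)"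
proof -
  have e: "eqv 0 (initial_seq \<sigma> n) f h \<longleftrightarrow> E (initial_seq \<sigma> n) f = E (initial_seq \<sigma> n) h" if "h \<in> FS n" for h
    using E_eq_iff[OF pos_initial_seq[OF pos, of n], of f h] f that by simp
  show ?thesis
  proof (cases n)
    case 0
    then show ?thesis using e[of "[]"] by (simp add: coboundaries_def bnd_def)
  next
    case (Suc m)
    have "coboundaries (dR K A \<Lambda> \<eta> \<sigma>) n = (\<lambda>h. E (initial_seq \<sigma> n) (dw h)) ` FS m"
    proof -
      have "carrier (deg (dR K A \<Lambda> \<eta> \<sigma>) m) = E (initial_seq \<sigma> m) ` FS m"
        using E_onto[OF pos_initial_seq[OF pos], of m] by simp
      then show ?thesis
        using dR_differential[OF pos] Suc by (auto simp: coboundaries_def image_image simp del: dR_simps intro!: image_cong)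
    qed
    then show ?thesis using e[OF bnd_FS] e FS_dw[of _ m] Suc by (auto simp: bnd_def)
  qed
qed

theorem dR_quasi_isomorphism:
  assumes \<sigma>: "\<forall>i. 0 < \<sigma> i" and \<tau>: "\<forall>i. 0 < \<tau> i" and le: "\<forall>i. \<sigma> i \<le> \<tau> i"
  shows "cochain_epi (scalars K A) (dR K A \<Lambda> \<eta> \<tau>) (dR K A \<Lambda> \<eta> \<sigma>) (dR_canonical A \<Lambda> \<eta> \<tau> \<sigma>)"
    "quasi_isomorphism (scalars K A) (dR K A \<Lambda> \<eta> \<tau>) (dR K A \<Lambda> \<eta> \<sigma>) (dR_canonical A \<Lambda> \<eta> \<tau> \<sigma>)"
proof -
  let ?c = "dR_canonical A \<Lambda> \<eta> \<tau> \<sigma>" and ?T = "dR K A \<Lambda> \<eta> \<tau>" and ?S = "dR K A \<Lambda> \<eta> \<sigma>"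
  note p\<sigma> = pos_initial_seq[OF \<sigma>] and p\<tau> = pos_initial_seq[OF \<tau>]
  have le': "list_all2 (\<le>) (initial_seq \<sigma> n) (initial_seq \<tau> n)" for n
    using le by (simp add: initial_seq_def list_all2_conv_all_nth)
  have c: "?c n \<in> mod_hom A (\<Lambda> (initial_seq \<tau> n)) (\<Lambda> (initial_seq \<sigma> n))"
    "f \<in> FS n \<Longrightarrow> ?c n (E (initial_seq \<tau> n) f) = E (initial_seq \<sigma> n) f" for n f
    using canonical_E[OF p\<sigma>[of n] le'] by (simp_all add: dR_canonical_def)
  have map: "cochain_map (scalars K A) ?T ?S ?c"
    unfolding cochain_map_def
  proof (intro conjI allI ballI dR_complex[OF \<sigma>] dR_complex[OF \<tau>])
    fix n
    show "?c n \<in> mod_hom (scalars K A) (deg ?T n) (deg ?S n)" using mod_hom_scalars[OF c(1)] by simp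
    fix x assume "x \<in> carrier (deg ?T n)"
    then obtain f where f: "f \<in> FS n" "x = E (initial_seq \<tau> n) f" using E_obtain[OF p\<tau>[of n], of x] by auto
    then show "?c (Suc n) (differential ?T n x) = differential ?S n (?c n x)"
      using c(2) dR_differential[OF \<sigma>] dR_differential[OF \<tau>] by (simp del: dR_simps)
  qed
  have onto: "?c n ` carrier (deg ?T n) = carrier (deg ?S n)" for n
  proof -
    have "?c n ` (E (initial_seq \<tau> n) ` FS n) = E (initial_seq \<sigma> n) ` FS n" using c(2) by (auto simp: image_image intro!: image_cong)
    then show ?thesis using E_onto[OF p\<tau>[of n]] E_onto[OF p\<sigma>[of n]] by simp
  qed
  show "cochain_epi (scalars K A) ?T ?S ?c" unfolding cochain_epi_def using map onto by blast
  have cmp: "comparison n (initial_seq \<sigma> (Suc n)) (initial_seq \<tau> (Suc n))" for n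
    by (rule comparison[OF le' p\<sigma>]) simp
  have bl: "butlast (initial_seq \<sigma> (Suc n)) = initial_seq \<sigma> n" for n \<sigma> by (simp add: initial_seq_Suc)
  show "quasi_isomorphism (scalars K A) ?T ?S ?c"
  proof (rule quasi_isomorphismI[OF map])
    fix n z assume z: "z \<in> cocycles ?S n"
    then obtain g where g: "g \<in> FS n" "z = E (initial_seq \<sigma> n) g"
      using E_obtain[OF p\<sigma>[of n], of z] by (auto simp: cocycles_def)
    have "eqv 0 (initial_seq \<sigma> (Suc n)) (dw g) []" using z dR_cocycle_iff[OF \<sigma> g(1)] g(2) by simp
    then obtain f h where f: "f \<in> FS n" "eqv 0 (initial_seq \<tau> (Suc n)) (dw f) []" "h \<in> bnd 0 n" "eqv 0 (initial_seq \<sigma> n) f (h @ g)"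
      using cmp[of n] g(1) unfolding comparison_def bl by blast
    have "E (initial_seq \<tau> n) f \<in> cocycles ?T n" using dR_cocycle_iff[OF \<tau> f(1)] f(2) by simp
    moreover have "E (initial_seq \<sigma> n) h \<in> coboundaries ?S n"
      unfolding dR_coboundary_iff[OF \<sigma> bnd_FS[OF f(3)]] by (rule bexI[of _ h]) (simp_all add: f(3))
    moreover have "?c n (E (initial_seq \<tau> n) f) = E (initial_seq \<sigma> n) h \<oplus>\<^bsub>deg ?S n\<^esub> z"
      using c(2)[OF f(1)] E_eq_iff[OF p\<sigma>[of n], of f "h @ g"] f(1,4) g bnd_FS[OF f(3)] E_append[OF p\<sigma>[of n], of h g] by simp
    ultimately show "\<exists>y\<in>cocycles ?T n. \<exists>b\<in>coboundaries ?S n. ?c n y = b \<oplus>\<^bsub>deg ?S n\<^esub> z" by blast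
  next
    fix n z assume z: "z \<in> cocycles ?T n" "?c n z \<in> coboundaries ?S n"
    then obtain f where f: "f \<in> FS n" "z = E (initial_seq \<tau> n) f"
      using E_obtain[OF p\<tau>[of n], of z] by (auto simp: cocycles_def)
    have "eqv 0 (initial_seq \<tau> (Suc n)) (dw f) []" using z(1) dR_cocycle_iff[OF \<tau> f(1)] f(2) by simp
    moreover have "\<exists>h\<in>bnd 0 n. eqv 0 (initial_seq \<sigma> n) f h"
      using z(2) c(2)[OF f(1)] f dR_coboundary_iff[OF \<sigma> f(1)] by simp
    ultimately have "\<exists>h\<in>bnd 0 n. eqv 0 (initial_seq \<tau> n) f h"
      using cmp[of n] f(1) unfolding comparison_def bl by blast
    then show "z \<in> coboundaries ?T n" using dR_coboundary_iff[OF \<tau> f(1)] f(2) by simp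
  qed
qed

end

theorem theorem4p7:
  fixes A :: "('u, 'z) ring_scheme"
    and K :: "'u set"
    and \<DD> :: "('u, 'u) module set"
    and \<Lambda> :: "nat list \<Rightarrow> ('u, 'u) module"
    and \<eta> :: "nat list \<Rightarrow> ('u, 'u) module \<Rightarrow> ('u \<Rightarrow> 'u) \<Rightarrow> ('u, 'u) iter"
    and \<sigma> \<tau> :: "nat \<Rightarrow> nat"
  assumes "cring A"
    and "subring K A"
    and "zero_characteristic A"
    and "smooth_subcategory K A \<DD>"
    and "form_system K A \<DD> \<Lambda> \<eta>"
    and "\<forall>i. 0 < \<sigma> i"
    and "\<forall>i. 0 < \<tau> i"
    and "\<forall>i. \<sigma> i \<le> \<tau> i"
  shows "cochain_epi (scalars K A) (dR K A \<Lambda> \<eta> \<tau>) (dR K A \<Lambda> \<eta> \<sigma>) (dR_canonical A \<Lambda> \<eta> \<tau> \<sigma>) \<and>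
    quasi_isomorphism (scalars K A) (dR K A \<Lambda> \<eta> \<tau>) (dR K A \<Lambda> \<eta> \<sigma>) (dR_canonical A \<Lambda> \<eta> \<tau> \<sigma>) \<and>
    (\<forall>n. isomorphic_modules (scalars K A)
       (cohomology (dR K A \<Lambda> \<eta> \<sigma>) n) (cohomology (dR K A \<Lambda> \<eta> \<tau>) n))"
proof -
  interpret diff_closed A K \<DD>
    using assms by (intro diff_closed.intro diffcalc.intro diffcalc_axioms.intro diff_closed_axioms.intro)
      (simp_all add: smooth_subcategory_def)
  obtain L e where "strict_representation A \<DD> (DD K A [1]) (iter_map A) L e" "projective_module A L" "finite_type A L"
    using assms(4) by (auto simp: smooth_subcategory_def)
  from frame_exists[OF assms(3) represents_strict(1)[OF this(1)] this(2,3)]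
  obtain xs dd where "diff_cat A K xs dd \<DD>" by blast
  then interpret forms A K xs dd \<DD> \<Lambda> \<eta>
    using assms(5) by (intro forms.intro forms_axioms.intro)
  note q = dR_quasi_isomorphism[OF assms(6-8)]
  \<comment> \<open>The canonical morphism runs from \<tau> to \<sigma>; the asserted isomorphism is
    its inverse on cohomology.\<close>
  have "isomorphic_modules (scalars K A) (cohomology (dR K A \<Lambda> \<eta> \<tau>) n) (cohomology (dR K A \<Lambda> \<eta> \<sigma>) n)" for n
    using q(2) by (auto simp: quasi_isomorphism_def isomorphic_modules_def)
  then show ?thesis using q mod_iso_sym by blast
qed

end
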